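(* Let $\mathcal{A}$ be the operator on the energy space $\mathcal{H}$ defined in the context (associated with the transmission system of two coupled wave systems), and let $(e^{t\mathcal{A}})_{t\ge 0}$ be the $C_0$-semigroup of contractions that it generates. Then this semigroup is strongly stable in $\mathcal{H}$, in the sense that $$\lim_{t\to+\infty}\|e^{t\mathcal{A}}U_0\|_{\mathcal{H}}=0\qquad\text{for all } U_0\in\mathcal{H}.$$
   Context: Constants: $0<\alpha_1<\alpha_2<\alpha_3<\alpha_4<L_0<\beta_1<\beta_2<\beta_3<\beta_4<L$; $a_1,a_2,d_2>0$; $c_1,c_2\in\mathbb{R}\setminus\{0\}$ with $|c_1|<1/C_0$, where $C_0$ is the smallest positive constant such that $\int_0^{L_0}|f|^2dx\le C_0\int_0^{L_0}|f_x|^2dx$ for all $f\in H^1_0(0,L_0)$. Coefficients: $c_1(x)=c_1$ for $x\in(\alpha_1,\alpha_3)$ and $0$ otherwise; $c_2(x)=c_2$ for $x\in(\beta_1,\beta_3)$ and $0$ otherwise; $d_2(x)=d_2$ for $x\in(\beta_2,\beta_4)$ and $0$ otherwise. The system (with no damping in the first wave system, i.e. $d_1(x)=0$ in $(0,L_0)$) is, for $t>0$: $u_{tt}-a_1u_{xx}+c_1(x)y=0$ and $y_{tt}-y_{xx}+c_1(x)u=0$ on $(0,L_0)$; $\varphi_{tt}-a_2\varphi_{xx}+d_2(x)\varphi_t+c_2(x)\psi_t=0$ and $\psi_{tt}-\psi_{xx}-c_2(x)\varphi_t=0$ on $(L_0,L)$; with $u(0,t)=y(0,t)=\varphi(L,t)=\psi(L,t)=0$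 and transmission conditions $u(L_0,t)=\varphi(L_0,t)$, $y(L_0,t)=\psi(L_0,t)$, $a_1u_x(L_0,t)=a_2\varphi_x(L_0,t)$, $y_x(L_0,t)=\psi_x(L_0,t)$. All functions are complex-valued. For $a<b$, $H^1_L(a,b)=\{f\in H^1(a,b): f(a)=0\}$ and $H^1_R(a,b)=\{f\in H^1(a,b): f(b)=0\}$. The energy space $\mathcal{H}$ is the set of $U=(u,v,y,z,\varphi,\eta,\psi,\xi)\in[H^1_L(0,L_0)\times L^2(0,L_0)]^2\times[H^1_R(L_0,L)\times L^2(L_0,L)]^2$ with $u(L_0)=\varphi(L_0)$ and $y(L_0)=\psi(L_0)$, equipped with the norm $$\|U\|_{\mathcal{H}}^2=\int_0^{L_0}\big(a_1|u_x|^2+|v|^2+|y_x|^2+|z|^2\big)dx+2\Re\int_0^{L_0}c_1(x)u\overline{y}\,dx+\int_{L_0}^{L}\big(a_2|\varphi_x|^2+|\eta|^2+|\psi_x|^2+|\xi|^2\big)dx.$$ The operator $\mathcal{A}$ is $$\mathcal{A}U=\big(v,\ a_1u_{xx}-c_1(x)y,\ z,\ y_{xx}-c_1(x)u,\ \eta,\ a_2\varphi_{xx}-c_2(x)\xi-d_2(x)\eta,\ \xi,\ \psi_{xx}+c_2(x)\eta\big),$$ with domain $D(\mathcal{A})$ the set of $U\in\mathcal{H}$ such that $v,z\in H^1_L(0,L_0)$; $u,y\in H^2(0,L_0)\cap H^1_L(0,L_0)$; $\eta,\xi\in H^1_R(L_0,L)$; $\varphi,\psi\in H^2(L_0,L)\cap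 H^1_R(L_0,L)$; $u(L_0)=\varphi(L_0)$, $y(L_0)=\psi(L_0)$, $v(L_0)=\eta(L_0)$, $z(L_0)=\xi(L_0)$, $a_1u_x(L_0)=a_2\varphi_x(L_0)$, $y_x(L_0)=\psi_x(L_0)$.
   Formalization: The formal statement assumes explicitly that the given expression is a norm on the energy space; the condition |c_1|<1/C_0 alone does not guarantee this (for small a_1 the form can be negative), and then the normed space and contraction semigroup are undefined. *)

theory Defs
  imports
    "HOL-Analysis.Analysis"
    "HOL-Library.Function_Algebras"
begin

section \<open>Sobolev spaces on a bounded interval\<close>

text \<open>
  Elements of \<open>L\<^sup>2(a,b)\<close> are represented by functions on the whole line; only their values on
  \<open>(a,b)\<close> matter, up to null sets.  Every notion below is invariant under changing a function on
  a null set or outside the interval.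
\<close>

definition L2 :: "real \<Rightarrow> real \<Rightarrow> (real \<Rightarrow> complex) set" where
  "L2 a b = {f. set_borel_measurable lborel {a<..<b} f \<and>
                set_integrable lborel {a<..<b} (\<lambda>x. (cmod (f x))\<^sup>2)}"

definition ae_eq :: "real \<Rightarrow> real \<Rightarrow> (real \<Rightarrow> complex) \<Rightarrow> (real \<Rightarrow> complex) \<Rightarrow> bool" where
  "ae_eq a b f g \<longleftrightarrow> (AE x in lborel. x \<in> {a<..<b} \<longrightarrow> f x = g x)"

text \<open>\<open>p \<in> C\<^sub>c\<^sup>1(a,b)\<close> with derivative \<open>p'\<close>, extended by zero to the line.\<close>

definition test_function :: "real \<Rightarrow> real \<Rightarrow> (real \<Rightarrow> real) \<Rightarrow> (real \<Rightarrow> real) \<Rightarrow> bool" where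
  "test_function a b p p' \<longleftrightarrow>
     (\<forall>x. (p has_real_derivative p' x) (at x)) \<and> continuous_on UNIV p' \<and>
     (\<exists>c d. a < c \<and> d < b \<and> (\<forall>x. x \<notin> {c..d} \<longrightarrow> p x = 0))"

definition weak_derivative ::
  "real \<Rightarrow> real \<Rightarrow> (real \<Rightarrow> complex) \<Rightarrow> (real \<Rightarrow> complex) \<Rightarrow> bool" where
  "weak_derivative a b f g \<longleftrightarrow>
     (\<forall>p p'. test_function a b p p' \<longrightarrow>
        (LINT x:{a<..<b}|lborel. p' x *\<^sub>R f x) = - (LINT x:{a<..<b}|lborel. p x *\<^sub>R g x))"

definition H1 :: "real \<Rightarrow> real \<Rightarrow> (real \<Rightarrow> complex) set" where
  "H1 a b = {f \<in> L2 a b. \<exists>g \<in> L2 a b. weak_derivative a b f g}"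

text \<open>The weak derivative of \<open>f \<in> H\<^sup>1(a,b)\<close>: a choice within its a.e. class.\<close>

definition Dx :: "real \<Rightarrow> real \<Rightarrow> (real \<Rightarrow> complex) \<Rightarrow> (real \<Rightarrow> complex)" where
  "Dx a b f = (SOME g. g \<in> L2 a b \<and> weak_derivative a b f g)"

definition H2 :: "real \<Rightarrow> real \<Rightarrow> (real \<Rightarrow> complex) set" where
  "H2 a b = {f \<in> H1 a b. Dx a b f \<in> H1 a b}"

text \<open>Point value at \<open>x \<in> [a,b]\<close>, for \<open>f \<in> H\<^sup>1(a,b)\<close>: that of the continuous representative.\<close>

definition val :: "real \<Rightarrow> real \<Rightarrow> (real \<Rightarrow> complex) \<Rightarrow> real \<Rightarrow> complex" where
  "val a b f x = (THE w. \<exists>g. continuous_on {a..b} g \<and> ae_eq a b f g \<and> w = g x)"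

definition H1L :: "real \<Rightarrow> real \<Rightarrow> (real \<Rightarrow> complex) set" where
  "H1L a b = {f \<in> H1 a b. val a b f a = 0}"

definition H1R :: "real \<Rightarrow> real \<Rightarrow> (real \<Rightarrow> complex) set" where
  "H1R a b = {f \<in> H1 a b. val a b f b = 0}"

definition H10 :: "real \<Rightarrow> real \<Rightarrow> (real \<Rightarrow> complex) set" where
  "H10 a b = {f \<in> H1 a b. val a b f a = 0 \<and> val a b f b = 0}"

definition poincare_bound :: "real \<Rightarrow> real \<Rightarrow> bool" where
  "poincare_bound L0 C \<longleftrightarrow>
     (\<forall>f \<in> H10 0 L0. (LINT x:{0<..<L0}|lborel. (cmod (f x))\<^sup>2)
                      \<le> C * (LINT x:{0<..<L0}|lborel. (cmod (Dx 0 L0 f x))\<^sup>2))"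

definition is_poincare_constant :: "real \<Rightarrow> real \<Rightarrow> bool" where
  "is_poincare_constant L0 C \<longleftrightarrow>
     0 < C \<and> poincare_bound L0 C \<and> (\<forall>C'>0. poincare_bound L0 C' \<longrightarrow> C \<le> C')"


section \<open>Contraction semigroups\<close>

text \<open>
  \<open>X\<close> is a complex linear space of representatives, \<open>Z\<close> the set of representatives of the zero
  element, and \<open>N\<close> induces a norm on the quotient \<open>X / Z\<close>.
\<close>

definition norm_on ::
  "(complex \<Rightarrow> 'a::ab_group_add \<Rightarrow> 'a) \<Rightarrow> 'a set \<Rightarrow> 'a set \<Rightarrow> ('a \<Rightarrow> real) \<Rightarrow> bool" where
  "norm_on sc X Z N \<longleftrightarrow>
     (\<forall>U\<in>X. 0 \<le> N U) \<and>
     (\<forall>U\<in>X. N U = 0 \<longleftrightarrow> U \<in> Z) \<and>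
     (\<forall>c. \<forall>U\<in>X. N (sc c U) = cmod c * N U) \<and>
     (\<forall>U\<in>X. \<forall>V\<in>X. N (U + V) \<le> N U + N V)"

text \<open>\<open>N (U - V) = 0\<close> expresses equality in the quotient.\<close>

definition C0_contraction_semigroup ::
  "(complex \<Rightarrow> 'a::ab_group_add \<Rightarrow> 'a) \<Rightarrow> 'a set \<Rightarrow> ('a \<Rightarrow> real) \<Rightarrow> (real \<Rightarrow> 'a \<Rightarrow> 'a) \<Rightarrow> bool" where
  "C0_contraction_semigroup sc X N S \<longleftrightarrow>
     (\<forall>t\<ge>0. \<forall>U\<in>X. S t U \<in> X) \<and>
     (\<forall>t\<ge>0. \<forall>U\<in>X. \<forall>V\<in>X. N (S t (U + V) - (S t U + S t V)) = 0) \<and>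
     (\<forall>t\<ge>0. \<forall>c. \<forall>U\<in>X. N (S t (sc c U) - sc c (S t U)) = 0) \<and>
     (\<forall>U\<in>X. N (S 0 U - U) = 0) \<and>
     (\<forall>s\<ge>0. \<forall>t\<ge>0. \<forall>U\<in>X. N (S (s + t) U - S s (S t U)) = 0) \<and>
     (\<forall>U\<in>X. ((\<lambda>t. N (S t U - U)) \<longlongrightarrow> 0) (at_right 0)) \<and>
     (\<forall>t\<ge>0. \<forall>U\<in>X. N (S t U) \<le> N U)"

text \<open>
  The operator \<open>A\<close> with domain \<open>D\<close> is the generator of \<open>S\<close>: \<open>U \<in> D\<close> iff \<open>(S h U - U) / h\<close>
  converges in \<open>X\<close> as \<open>h \<rightarrow> 0+\<close>, and the limit is then \<open>A U\<close>.
\<close>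

definition is_generator ::
  "(complex \<Rightarrow> 'a::ab_group_add \<Rightarrow> 'a) \<Rightarrow> 'a set \<Rightarrow> ('a \<Rightarrow> real) \<Rightarrow> (real \<Rightarrow> 'a \<Rightarrow> 'a)
     \<Rightarrow> 'a set \<Rightarrow> ('a \<Rightarrow> 'a) \<Rightarrow> bool" where
  "is_generator sc X N S D A \<longleftrightarrow>
     D \<subseteq> X \<and> A ` D \<subseteq> X \<and>
     (\<forall>U\<in>X. \<forall>W\<in>X.
        ((\<lambda>h. N (sc (complex_of_real (1 / h)) (S h U - U) - W)) \<longlongrightarrow> 0) (at_right 0)
          \<longleftrightarrow> U \<in> D \<and> N (A U - W) = 0)"


section \<open>The transmission problem\<close>

type_synonym cfun = "real \<Rightarrow> complex"

text \<open>\<open>(u, v, y, z, \<phi>, \<eta>, \<psi>, \<xi>)\<close>, the first four on \<open>(0,L0)\<close>, the others on \<open>(L0,L)\<close>.\<close>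

type_synonym state = "cfun \<times> cfun \<times> cfun \<times> cfun \<times> cfun \<times> cfun \<times> cfun \<times> cfun"

fun state_scale :: "complex \<Rightarrow> state \<Rightarrow> state" where
  "state_scale k (u, v, y, z, \<phi>, \<eta>, \<psi>, \<xi>) =
     ((\<lambda>x. k * u x), (\<lambda>x. k * v x), (\<lambda>x. k * y x), (\<lambda>x. k * z x),
      (\<lambda>x. k * \<phi> x), (\<lambda>x. k * \<eta> x), (\<lambda>x. k * \<psi> x), (\<lambda>x. k * \<xi> x))"

definition coef :: "real \<Rightarrow> real \<Rightarrow> real \<Rightarrow> real \<Rightarrow> real" where
  "coef k l r x = (if x \<in> {l<..<r} then k else 0)"

definition energy_space :: "real \<Rightarrow> real \<Rightarrow> state set" where
  "energy_space L0 L =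
     {(u, v, y, z, \<phi>, \<eta>, \<psi>, \<xi>).
        u \<in> H1L 0 L0 \<and> v \<in> L2 0 L0 \<and> y \<in> H1L 0 L0 \<and> z \<in> L2 0 L0 \<and>
        \<phi> \<in> H1R L0 L \<and> \<eta> \<in> L2 L0 L \<and> \<psi> \<in> H1R L0 L \<and> \<xi> \<in> L2 L0 L \<and>
        val 0 L0 u L0 = val L0 L \<phi> L0 \<and> val 0 L0 y L0 = val L0 L \<psi> L0}"

definition null_states :: "real \<Rightarrow> real \<Rightarrow> state set" where
  "null_states L0 L =
     {(u, v, y, z, \<phi>, \<eta>, \<psi>, \<xi>).
        ae_eq 0 L0 u (\<lambda>x. 0) \<and> ae_eq 0 L0 v (\<lambda>x. 0) \<and>
        ae_eq 0 L0 y (\<lambda>x. 0) \<and> ae_eq 0 L0 z (\<lambda>x. 0) \<and>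
        ae_eq L0 L \<phi> (\<lambda>x. 0) \<and> ae_eq L0 L \<eta> (\<lambda>x. 0) \<and>
        ae_eq L0 L \<psi> (\<lambda>x. 0) \<and> ae_eq L0 L \<xi> (\<lambda>x. 0)}"

fun energy_sq :: "real \<Rightarrow> real \<Rightarrow> (real \<Rightarrow> real) \<Rightarrow> real \<Rightarrow> real \<Rightarrow> state \<Rightarrow> real" where
  "energy_sq a1 a2 c1 L0 L (u, v, y, z, \<phi>, \<eta>, \<psi>, \<xi>) =
     (LINT x:{0<..<L0}|lborel.
        a1 * (cmod (Dx 0 L0 u x))\<^sup>2 + (cmod (v x))\<^sup>2 + (cmod (Dx 0 L0 y x))\<^sup>2 + (cmod (z x))\<^sup>2)
     + 2 * Re (LINT x:{0<..<L0}|lborel. complex_of_real (c1 x) * u x * cnj (y x))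
     + (LINT x:{L0<..<L}|lborel.
        a2 * (cmod (Dx L0 L \<phi> x))\<^sup>2 + (cmod (\<eta> x))\<^sup>2 + (cmod (Dx L0 L \<psi> x))\<^sup>2 + (cmod (\<xi> x))\<^sup>2)"

text \<open>
  The library's \<open>sqrt\<close> is odd, so this is negative wherever \<open>energy_sq\<close> is negative; that
  \<open>energy_norm\<close> is a norm is therefore a genuine condition on the constants.
\<close>

definition energy_norm :: "real \<Rightarrow> real \<Rightarrow> (real \<Rightarrow> real) \<Rightarrow> real \<Rightarrow> real \<Rightarrow> state \<Rightarrow> real" where
  "energy_norm a1 a2 c1 L0 L U = sqrt (energy_sq a1 a2 c1 L0 L U)"

fun wave_op :: "real \<Rightarrow> real \<Rightarrow> (real \<Rightarrow> real) \<Rightarrow> (real \<Rightarrow> real) \<Rightarrow> (real \<Rightarrow> real)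
                  \<Rightarrow> real \<Rightarrow> real \<Rightarrow> state \<Rightarrow> state" where
  "wave_op a1 a2 c1 c2 d2 L0 L (u, v, y, z, \<phi>, \<eta>, \<psi>, \<xi>) =
     (v,
      (\<lambda>x. complex_of_real a1 * Dx 0 L0 (Dx 0 L0 u) x - complex_of_real (c1 x) * y x),
      z,
      (\<lambda>x. Dx 0 L0 (Dx 0 L0 y) x - complex_of_real (c1 x) * u x),
      \<eta>,
      (\<lambda>x. complex_of_real a2 * Dx L0 L (Dx L0 L \<phi>) x
             - complex_of_real (c2 x) * \<xi> x - complex_of_real (d2 x) * \<eta> x),
      \<xi>,
      (\<lambda>x. Dx L0 L (Dx L0 L \<psi>) x + complex_of_real (c2 x) * \<eta> x))"

definition wave_dom :: "real \<Rightarrow> real \<Rightarrow> real \<Rightarrow> real \<Rightarrow> state set" where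
  "wave_dom a1 a2 L0 L =
     {(u, v, y, z, \<phi>, \<eta>, \<psi>, \<xi>).
        (u, v, y, z, \<phi>, \<eta>, \<psi>, \<xi>) \<in> energy_space L0 L \<and>
        v \<in> H1L 0 L0 \<and> z \<in> H1L 0 L0 \<and>
        u \<in> H2 0 L0 \<inter> H1L 0 L0 \<and> y \<in> H2 0 L0 \<inter> H1L 0 L0 \<and>
        \<eta> \<in> H1R L0 L \<and> \<xi> \<in> H1R L0 L \<and>
        \<phi> \<in> H2 L0 L \<inter> H1R L0 L \<and> \<psi> \<in> H2 L0 L \<inter> H1R L0 L \<and>
        val 0 L0 u L0 = val L0 L \<phi> L0 \<and> val 0 L0 y L0 = val L0 L \<psi> L0 \<and>
        val 0 L0 v L0 = val L0 L \<eta> L0 \<and> val 0 L0 z L0 = val L0 L \<xi> L0 \<and>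
        complex_of_real a1 * val 0 L0 (Dx 0 L0 u) L0 = complex_of_real a2 * val L0 L (Dx L0 L \<phi>) L0 \<and>
        val 0 L0 (Dx 0 L0 y) L0 = val L0 L (Dx L0 L \<psi>) L0}"

end

theory Submission
  imports Defs "HOL-Complex_Analysis.Great_Picard"
begin

text \<open>A state is first approximated by states of the domain of the eighth power of the generator
(\<open>chain_dense\<close>).  Since the semigroup contracts the energy norm, it is enough to treat these, and
their orbits are classical solutions: the four displacements \<open>u\<close>, \<open>y\<close>, \<open>\<phi>\<close>, \<open>\<psi>\<close> have several time
derivatives, and these and their space derivatives are bounded and Lipschitz, uniformly in time.
This uses that the energy dominates the squares of all gradients and velocities (\<open>coercive\<close>): it is
positive definite, and the coupling term in it is compact relative to the rest.

The energy of every time derivative of the solution decreases at the rate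
\<open>2 d\<^sub>2 \<integral> \<bar>\<phi>\<^sub>t\<bar>\<^sup>2\<close>, taken over the damped interval \<open>(\<beta>2, \<beta>4)\<close> and for that derivative
(\<open>energy_derivative\<close>).  The rate is Lipschitz in time and has a finite integral, so it tends to zero, and
with it the time derivatives of \<open>\<phi>\<close> on the damped interval.  On \<open>(\<beta>2, \<beta>3)\<close> the coupling acts as well,
and there the equation of \<open>\<phi>\<close> expresses \<open>\<psi>\<^sub>t\<close> by \<open>\<phi>\<^sub>t\<^sub>t\<close>, \<open>\<phi>\<^sub>x\<^sub>x\<close> and \<open>\<phi>\<^sub>t\<close>, so that the time
derivatives of \<open>\<psi>\<close> decay too.

In one space dimension a wave equation can also be solved sideways, with space in the role of time.
The Riemann invariants of a wave of speed \<open>c\<close> are transported along the lines of slope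
\<open>\<plusminus> 1/c\<close> in the \<open>(x, t)\<close> plane up to lower-order terms, which turns decay at one point, of the field
and of its first derivatives, into decay at every point of the interval (\<open>decay_spreads\<close>).  Applied to
\<open>\<phi>\<^sub>t\<^sub>t\<close> and \<open>\<psi>\<^sub>t\<^sub>t\<close> this reaches the interface \<open>L0\<close>; the transmission conditions hand the
decay over to \<open>u\<^sub>t\<^sub>t\<close> and \<open>y\<^sub>t\<^sub>t\<close>, and a second application covers \<open>(0, L0)\<close> (\<open>all_fade\<close>).

Thus the second time derivative of every component tends to zero pointwise, hence so does the first one, by
interpolation.  Green's formula tested with the displacement itself writes the energy as a sum of
integrals of bounded functions, each with a factor that is a first or second time derivative, and these integrals tend to
zero by dominated convergence (\<open>orbit_decay\<close>).\<close>

section \<open>Contraction semigroups on a pseudo-normed space\<close>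

text \<open>States of zero norm need not be zero, and the semigroup is linear only up to them.  The relation
\<open>eqv\<close> records equality in the quotient, without passing to a quotient type.\<close>

locale contraction_generator = vector_space sc
  for sc :: "complex \<Rightarrow> 'a::ab_group_add \<Rightarrow> 'a" +
  fixes X Z :: "'a set" and N :: "'a \<Rightarrow> real" and S :: "real \<Rightarrow> 'a \<Rightarrow> 'a"
    and D :: "'a set" and A :: "'a \<Rightarrow> 'a"
  assumes subspace_X: "subspace X"
    and norm: "norm_on sc X Z N"
    and semigroup: "C0_contraction_semigroup sc X N S"
    and generator: "is_generator sc X N S D A"
begin

definition eqv :: "'a \<Rightarrow> 'a \<Rightarrow> bool" where "eqv U V \<longleftrightarrow> N (U - V) = 0"

abbreviation rsc :: "real \<Rightarrow> 'a \<Rightarrow> 'a" where "rsc r \<equiv> sc (complex_of_real r)"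

lemmas X_add [simp, intro] = subspace_add[OF subspace_X]
lemmas X_diff [simp, intro] = subspace_diff[OF subspace_X]
lemmas X_sc [simp, intro] = subspace_scale[OF subspace_X]
lemmas X_0 [simp, intro] = subspace_0[OF subspace_X]
lemmas X_uminus [simp, intro] = subspace_neg[OF subspace_X]
lemmas X_sum = subspace_sum[OF subspace_X]

lemma N_ge_0 [simp]: "U \<in> X \<Longrightarrow> 0 \<le> N U"
  and N_sc [simp]: "U \<in> X \<Longrightarrow> N (sc c U) = cmod c * N U"
  and N_add: "U \<in> X \<Longrightarrow> V \<in> X \<Longrightarrow> N (U + V) \<le> N U + N V"
  using norm by (auto simp: norm_on_def)

lemma N_0 [simp]: "N 0 = 0" using N_sc[of 0 0] by simp

lemma N_commute: "U \<in> X \<Longrightarrow> V \<in> X \<Longrightarrow> N (U - V) = N (V - U)"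
  using N_sc[of "U - V" "-1"] by simp

lemma N_diff: "U \<in> X \<Longrightarrow> V \<in> X \<Longrightarrow> N (U - V) \<le> N U + N V"
  using N_add[of U "sc (-1) V"] X_sc[of V "-1"] N_sc[of V "-1"] by simp

lemma N_tri: "U \<in> X \<Longrightarrow> V \<in> X \<Longrightarrow> W \<in> X \<Longrightarrow> N (U - W) \<le> N (U - V) + N (V - W)"
  using N_add[of "U - V" "V - W"] by simp

lemma N_le_add_diff: "U \<in> X \<Longrightarrow> V \<in> X \<Longrightarrow> N U \<le> N V + N (U - V)"
  using N_add[of V "U - V"] by simp

lemma eqv_N: "U \<in> X \<Longrightarrow> V \<in> X \<Longrightarrow> eqv U V \<Longrightarrow> N U = N V"
  using N_le_add_diff[of U V] N_le_add_diff[of V U] N_commute[of U V] by (simp add: eqv_def)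

lemma eqv_refl [simp]: "eqv U U" by (simp add: eqv_def)

lemma eqv_sym: "U \<in> X \<Longrightarrow> V \<in> X \<Longrightarrow> eqv U V \<Longrightarrow> eqv V U"
  using N_commute by (simp add: eqv_def)

lemma eqvI: "U \<in> X \<Longrightarrow> V \<in> X \<Longrightarrow> N (U - V) \<le> 0 \<Longrightarrow> eqv U V"
  unfolding eqv_def by (rule antisym) auto

lemma eqv_trans: "U \<in> X \<Longrightarrow> V \<in> X \<Longrightarrow> W \<in> X \<Longrightarrow> eqv U V \<Longrightarrow> eqv V W \<Longrightarrow> eqv U W"
  using N_tri[of U V W] by (intro eqvI) (auto simp: eqv_def)

lemma eqv_diff: "U \<in> X \<Longrightarrow> V \<in> X \<Longrightarrow> U' \<in> X \<Longrightarrow> V' \<in> X \<Longrightarrow> eqv U U' \<Longrightarrow> eqv V V' \<Longrightarrow> eqv (U - V) (U' - V')"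
  using N_diff[of "U - U'" "V - V'"] by (intro eqvI) (auto simp: eqv_def algebra_simps)

lemma eqv_add: "U \<in> X \<Longrightarrow> V \<in> X \<Longrightarrow> U' \<in> X \<Longrightarrow> V' \<in> X \<Longrightarrow> eqv U U' \<Longrightarrow> eqv V V' \<Longrightarrow> eqv (U + V) (U' + V')"
  using N_add[of "U - U'" "V - V'"] by (intro eqvI) (auto simp: eqv_def algebra_simps)

lemma eqv_sc: "U \<in> X \<Longrightarrow> V \<in> X \<Longrightarrow> eqv U V \<Longrightarrow> eqv (sc c U) (sc c V)"
  using N_sc[of "U - V" c] by (simp add: eqv_def scale_right_diff_distrib)

lemma S_X [simp, intro]: "0 \<le> t \<Longrightarrow> U \<in> X \<Longrightarrow> S t U \<in> X"
  and S_add: "0 \<le> t \<Longrightarrow> U \<in> X \<Longrightarrow> V \<in> X \<Longrightarrow> eqv (S t (U + V)) (S t U + S t V)"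
  and S_sc: "0 \<le> t \<Longrightarrow> U \<in> X \<Longrightarrow> eqv (S t (sc c U)) (sc c (S t U))"
  and S_0: "U \<in> X \<Longrightarrow> eqv (S 0 U) U"
  and S_S: "0 \<le> s \<Longrightarrow> 0 \<le> t \<Longrightarrow> U \<in> X \<Longrightarrow> eqv (S (s + t) U) (S s (S t U))"
  and S_cont: "U \<in> X \<Longrightarrow> ((\<lambda>t. N (S t U - U)) \<longlongrightarrow> 0) (at_right 0)"
  and S_le: "0 \<le> t \<Longrightarrow> U \<in> X \<Longrightarrow> N (S t U) \<le> N U"
  using semigroup by (auto simp: C0_contraction_semigroup_def eqv_def)

lemma S_diff:
  assumes "0 \<le> t" "U \<in> X" "V \<in> X"
  shows "eqv (S t (U - V)) (S t U - S t V)"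
proof -
  have "eqv (S t (U + sc (-1) V)) (S t U + S t (sc (-1) V))" using assms by (intro S_add) auto
  moreover have "eqv (S t U + S t (sc (-1) V)) (S t U + sc (-1) (S t V))"
    using assms by (intro eqv_add S_sc) auto
  ultimately have "eqv (S t (U + sc (-1) V)) (S t U + sc (-1) (S t V))"
    by (rule eqv_trans[rotated 3]) (use assms in auto)
  then show ?thesis by simp
qed

lemma S_diff_le:
  assumes "0 \<le> t" "U \<in> X" "V \<in> X" shows "N (S t U - S t V) \<le> N (U - V)"
  using eqv_N[OF _ _ S_diff[OF assms]] S_le[of t "U - V"] assms by auto

lemma S_shift:
  assumes "0 \<le> s" "0 \<le> r" "U \<in> X" shows "N (S (s + r) U - S s U) \<le> N (S r U - U)"
proof -
  have "eqv (S (s + r) U - S s U) (S s (S r U) - S s U)"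
    using assms by (intro eqv_diff S_S) auto
  then have "N (S (s + r) U - S s U) = N (S s (S r U) - S s U)"
    using assms by (intro eqv_N) auto
  also have "\<dots> \<le> N (S r U - U)" using assms by (intro S_diff_le) auto
  finally show ?thesis .
qed

lemma S_comb:
  assumes "0 \<le> t" "U \<in> X" "V \<in> X" "W \<in> X"
  shows "eqv (S t (U - V - sc c W)) (S t U - S t V - sc c (S t W))"
proof -
  have "eqv (S t (U - V - sc c W)) (S t (U - V) - S t (sc c W))" using assms by (intro S_diff) auto
  moreover have "eqv (S t (U - V) - S t (sc c W)) (S t U - S t V - sc c (S t W))"
    using assms by (intro eqv_diff S_diff S_sc) auto
  ultimately show ?thesis by (rule eqv_trans[rotated 3]) (use assms in auto)
qed

lemma D_X [simp, intro]: "U \<in> D \<Longrightarrow> U \<in> X"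
  and A_X [simp, intro]: "U \<in> D \<Longrightarrow> A U \<in> X"
  using generator by (auto simp: is_generator_def)

definition quot :: "'a \<Rightarrow> real \<Rightarrow> 'a" where "quot U h = rsc (1 / h) (S h U - U)"

lemma quot_X [simp, intro]: "0 \<le> h \<Longrightarrow> U \<in> X \<Longrightarrow> quot U h \<in> X"
  by (simp add: quot_def)

lemma generator_iff:
  assumes "U \<in> X" "V \<in> X"
  shows "((\<lambda>h. N (quot U h - V)) \<longlongrightarrow> 0) (at_right 0) \<longleftrightarrow> U \<in> D \<and> eqv (A U) V"
  using generator assms by (auto simp: is_generator_def eqv_def quot_def)

lemma generatorI:
  assumes "U \<in> X" "V \<in> X" "(g \<longlongrightarrow> 0) (at_right 0)" "\<And>h. 0 < h \<Longrightarrow> N (quot U h - V) \<le> g h"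
  shows "U \<in> D \<and> eqv (A U) V"
proof -
  have "((\<lambda>h. N (quot U h - V)) \<longlongrightarrow> 0) (at_right 0)"
  proof (rule tendsto_sandwich[OF _ _ tendsto_const assms(3)])
    show "eventually (\<lambda>h. 0 \<le> N (quot U h - V)) (at_right 0)"
      using assms by (auto simp: eventually_at_right_field intro!: exI[of _ 1])
    show "eventually (\<lambda>h. N (quot U h - V) \<le> g h) (at_right 0)"
      using assms by (auto simp: eventually_at_right_field intro!: exI[of _ 1])
  qed
  then show ?thesis using generator_iff assms by blast
qed

lemma D_diff:
  assumes U: "U \<in> D" and V: "V \<in> D"
  shows "U - V \<in> D" "eqv (A (U - V)) (A U - A V)"
proof -
  have "U - V \<in> D \<and> eqv (A (U - V)) (A U - A V)"
  proof (rule generatorI)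
    have "((\<lambda>h. N (quot U h - A U)) \<longlongrightarrow> 0) (at_right 0)" "((\<lambda>h. N (quot V h - A V)) \<longlongrightarrow> 0) (at_right 0)"
      using generator_iff[of U "A U"] generator_iff[of V "A V"] U V by auto
    from tendsto_add[OF this]
    show "((\<lambda>h. N (quot U h - A U) + N (quot V h - A V)) \<longlongrightarrow> 0) (at_right 0)" by simp
    fix h :: real assume h: "0 < h"
    have "eqv (quot (U - V) h) (quot U h - quot V h)"
    proof -
      have "eqv (S h (U - V) - (U - V)) (S h U - S h V - (U - V))"
        using U V h by (intro eqv_diff S_diff) auto
      then have "eqv (rsc (1 / h) (S h (U - V) - (U - V))) (rsc (1 / h) (S h U - S h V - (U - V)))"
        using U V h by (intro eqv_sc) auto
      then show ?thesis by (simp add: quot_def scale_right_diff_distrib algebra_simps)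
    qed
    then have "N (quot (U - V) h - (A U - A V)) = N ((quot U h - quot V h) - (A U - A V))"
      using U V h by (intro eqv_N eqv_diff) (auto intro!: X_diff)
    also have "\<dots> = N ((quot U h - A U) - (quot V h - A V))" by (simp add: algebra_simps)
    also have "\<dots> \<le> N (quot U h - A U) + N (quot V h - A V)"
      using U V h by (intro N_diff) (auto intro!: X_diff)
    finally show "N (quot (U - V) h - (A U - A V)) \<le> N (quot U h - A U) + N (quot V h - A V)" .
  qed (use U V in auto)
  then show "U - V \<in> D" "eqv (A (U - V)) (A U - A V)" by auto
qed

lemma D_sc:
  assumes U: "U \<in> D"
  shows "sc c U \<in> D" "eqv (A (sc c U)) (sc c (A U))"
proof -
  have "sc c U \<in> D \<and> eqv (A (sc c U)) (sc c (A U))"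
  proof (rule generatorI)
    have "((\<lambda>h. N (quot U h - A U)) \<longlongrightarrow> 0) (at_right 0)"
      using generator_iff[of U "A U"] U by auto
    from tendsto_mult_left[OF this, of "cmod c"]
    show "((\<lambda>h. cmod c * N (quot U h - A U)) \<longlongrightarrow> 0) (at_right 0)" by simp
    fix h :: real assume h: "0 < h"
    have "eqv (quot (sc c U) h) (sc c (quot U h))"
    proof -
      have "eqv (S h (sc c U) - sc c U) (sc c (S h U) - sc c U)"
        using U h by (intro eqv_diff S_sc) auto
      then have "eqv (rsc (1 / h) (S h (sc c U) - sc c U)) (rsc (1 / h) (sc c (S h U) - sc c U))"
        using U h by (intro eqv_sc) auto
      then show ?thesis by (simp add: quot_def scale_right_diff_distrib mult.commute)
    qed
    then have "N (quot (sc c U) h - sc c (A U)) = N (sc c (quot U h) - sc c (A U))"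
      using U h by (intro eqv_N eqv_diff) auto
    also have "\<dots> = cmod c * N (quot U h - A U)"
      using U h N_sc[of "quot U h - A U" c] by (simp add: scale_right_diff_distrib)
    finally show "N (quot (sc c U) h - sc c (A U)) \<le> cmod c * N (quot U h - A U)" by simp
  qed (use U in auto)
  then show "sc c U \<in> D" "eqv (A (sc c U)) (sc c (A U))" by auto
qed

text \<open>Up to null states the operator \<open>S t\<close> maps the difference quotient of \<open>U\<close> to that of \<open>S t U\<close>, and it
does not increase the norm; so the quotients along the orbit converge as well.\<close>

lemma orbit_D:
  assumes U: "U \<in> D" and V: "V \<in> X" and AU: "eqv (A U) V" and t: "0 \<le> t"
  shows "S t U \<in> D" "eqv (A (S t U)) (S t V)"
proof -
  have "S t U \<in> D \<and> eqv (A (S t U)) (S t V)"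
  proof (rule generatorI)
    show "((\<lambda>h. N (quot U h - V)) \<longlongrightarrow> 0) (at_right 0)"
      using generator_iff[of U V] U V AU by auto
    fix h :: real assume h: "0 < h"
    have 1: "eqv (S h (S t U)) (S t (S h U))"
    proof (rule eqv_trans[rotated 3])
      show "eqv (S h (S t U)) (S (h + t) U)" using S_S[of h t U] U t h by (intro eqv_sym[of "S (h + t) U"]) auto
      show "eqv (S (h + t) U) (S t (S h U))" using S_S[of t h U] U t h by (simp add: add.commute)
    qed (use U t h in auto)
    have "N (S h (S t U) - S t U - rsc h (S t V)) = N (S t (S h U) - S t U - rsc h (S t V))"
      using 1 U V t h by (intro eqv_N eqv_diff) auto
    also have "\<dots> = N (S t (S h U - U - rsc h V))"
      using S_comb[of t "S h U" U V] U V t h by (intro eqv_N[symmetric]) auto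
    also have "\<dots> \<le> N (S h U - U - rsc h V)" using U V t h by (intro S_le) auto
    finally have le: "N (S h (S t U) - S t U - rsc h (S t V)) \<le> N (S h U - U - rsc h V)" .
    have e: "N (quot W h - W') = (1 / h) * N (S h W - W - rsc h W')" if "W \<in> X" "W' \<in> X" for W W'
    proof -
      have "quot W h - W' = rsc (1 / h) (S h W - W - rsc h W')"
        using h by (simp add: quot_def scale_right_diff_distrib)
      then show ?thesis using that h N_sc[of "S h W - W - rsc h W'" "complex_of_real (1 / h)"]
        by (simp add: norm_divide)
    qed
    show "N (quot (S t U) h - S t V) \<le> N (quot U h - V)"
      using le e[of "S t U" "S t V"] e[of U V] U V t h by (auto intro!: divide_right_mono)
  qed (use U V t in auto)
  then show "S t U \<in> D" "eqv (A (S t U)) (S t V)" by auto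
qed

subsection \<open>Differentiating along orbits\<close>

text \<open>The error of the difference quotient at time zero, with a second term that also covers steps
backwards in time.\<close>

definition defect :: "'a \<Rightarrow> 'a \<Rightarrow> real \<Rightarrow> real" where
  "defect U V h = N (quot U h - V) + N (S h V - V)"

lemma defect_tendsto:
  assumes "U \<in> D" "V \<in> X" "eqv (A U) V"
  shows "(defect U V \<longlongrightarrow> 0) (at_right 0)"
  using tendsto_add[of "\<lambda>h. N (quot U h - V)" 0 _ "\<lambda>h. N (S h V - V)" 0]
    generator_iff[of U V] assms S_cont[of V] unfolding defect_def by auto

lemma defect_abs_tendsto:
  assumes "U \<in> D" "V \<in> X" "eqv (A U) V"
  shows "((\<lambda>h. defect U V \<bar>h\<bar>) \<longlongrightarrow> 0) (at 0)"
proof -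
  have "filterlim (\<lambda>h::real. \<bar>h\<bar>) (at_right 0) (at 0)"
    unfolding filterlim_at by (auto simp: eventually_at_filter intro!: tendsto_eq_intros)
  then show ?thesis using defect_tendsto[OF assms] by (rule filterlim_compose[rotated])
qed

lemma increment_forward:
  assumes U: "U \<in> X" and V: "V \<in> X" and s: "0 \<le> s" and h: "0 < h"
  shows "N (S (s + h) U - S s U - rsc h (S s V)) \<le> h * N (quot U h - V)"
proof -
  have "N (S (s + h) U - S s U - rsc h (S s V)) = N (S s (S h U) - S s U - rsc h (S s V))"
    using S_S[of s h U] U V s h by (intro eqv_N eqv_diff) auto
  also have "\<dots> = N (S s (S h U - U - rsc h V))"
    using S_comb[of s "S h U" U V] U V s h by (intro eqv_N[symmetric]) auto
  also have "\<dots> \<le> N (S h U - U - rsc h V)" using U V s h by (intro S_le) auto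
  also have "S h U - U - rsc h V = rsc h (quot U h - V)"
    using h by (simp add: quot_def scale_right_diff_distrib)
  also have "N (rsc h (quot U h - V)) = h * N (quot U h - V)"
    using U V h by simp
  finally show ?thesis .
qed

text \<open>A backward step from \<open>t\<close> is a forward step from \<open>t - h\<close>, whose derivative \<open>S (t - h) V\<close> has
to be replaced by \<open>S t V\<close>; by contractivity both errors are bounded by their values at time zero.\<close>

lemma increment:
  assumes U: "U \<in> X" and V: "V \<in> X" and t: "0 < t" and h: "h \<noteq> 0" "\<bar>h\<bar> < t"
  shows "N (S (t + h) U - S t U - rsc h (S t V)) \<le> \<bar>h\<bar> * defect U V \<bar>h\<bar>"
proof (cases "h > 0")
  case True
  have "N (S (t + h) U - S t U - rsc h (S t V)) \<le> h * N (quot U h - V)"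
    using increment_forward[OF U V] t True by auto
  also have "\<dots> \<le> h * defect U V h"
    using True V by (intro mult_left_mono) (auto simp: defect_def intro!: N_ge_0)
  finally show ?thesis using True by simp
next
  case False
  define k s where "k = - h" and "s = t + h"
  have k: "0 < k" "0 \<le> s" "t = s + k" using False h t by (auto simp: k_def s_def)
  have "S (t + h) U - S t U - rsc h (S t V) = (S s U - S (s + k) U + rsc k (S s V)) + rsc k (S (s + k) V - S s V)"
    using k by (simp add: s_def[symmetric] k_def scale_right_diff_distrib)
  also have "N \<dots> \<le> N (S s U - S (s + k) U + rsc k (S s V)) + N (rsc k (S (s + k) V - S s V))"
    using U V k by (intro N_add) (auto intro!: S_X X_diff X_sc X_add)
  also have "N (S s U - S (s + k) U + rsc k (S s V)) = N (S (s + k) U - S s U - rsc k (S s V))"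
    using N_commute[of 0 "S (s + k) U - S s U - rsc k (S s V)"] U V k by (simp add: algebra_simps)
  also have "\<dots> \<le> k * N (quot U k - V)" by (rule increment_forward[OF U V k(2,1)])
  also have "N (rsc k (S (s + k) V - S s V)) \<le> k * N (S k V - V)"
    using S_shift[of s k V] V k by (simp add: mult_left_mono)
  finally show ?thesis using False by (simp add: defect_def k_def algebra_simps)
qed

lemma has_vector_derivative_by_error:
  fixes f :: "real \<Rightarrow> 'b::real_normed_vector"
  assumes "0 < t" "(g \<longlongrightarrow> 0) (at 0)"
    and "\<And>h. h \<noteq> 0 \<Longrightarrow> \<bar>h\<bar> < t \<Longrightarrow> norm (f (t + h) - f t - h *\<^sub>R d) \<le> \<bar>h\<bar> * g h"
  shows "(f has_vector_derivative d) (at t)"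
  unfolding has_vector_derivative_def has_derivative_at
proof (intro conjI bounded_linear_scaleR_left)
  show "((\<lambda>h. norm (f (t + h) - f t - h *\<^sub>R d) / norm h) \<longlongrightarrow> 0) (at 0)"
  proof (rule tendsto_sandwich[OF _ _ tendsto_const assms(2)])
    show "\<forall>\<^sub>F h in at 0. norm (f (t + h) - f t - h *\<^sub>R d) / norm h \<le> g h"
      unfolding eventually_at using assms(1,3)
      by (intro exI[of _ t]) (auto simp: dist_real_def divide_le_eq mult.commute)
  qed auto
qed

text \<open>The remainder of the first-order expansion of the orbit is small in the graph norm, since the
expansion can be made for \<open>U\<close> and for its image \<open>V\<close> alike.  This makes point evaluations of the gradient differentiable in
time, although they are not continuous in the norm itself.\<close>

lemma functional_derivative:
  fixes l :: "'a \<Rightarrow> complex"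
  assumes diff: "\<And>U V. U \<in> D \<Longrightarrow> V \<in> D \<Longrightarrow> l (U - V) = l U - l V"
    and sc: "\<And>c U. U \<in> D \<Longrightarrow> l (sc c U) = c * l U"
    and bound: "\<And>U. U \<in> D \<Longrightarrow> cmod (l U) \<le> C * (N U + N (A U))"
    and U: "U \<in> D" "eqv (A U) V" and V: "V \<in> D" "eqv (A V) W" and W: "W \<in> X" and t: "0 < t"
  shows "((\<lambda>t. l (S t U)) has_vector_derivative l (S t V)) (at t)"
proof (rule has_vector_derivative_by_error[OF t])
  show "((\<lambda>h. \<bar>C\<bar> * (defect U V \<bar>h\<bar> + defect V W \<bar>h\<bar>)) \<longlongrightarrow> 0) (at 0)"
    using defect_abs_tendsto[OF U(1) _ U(2)] defect_abs_tendsto[OF V(1) W V(2)] V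
    by (auto intro!: tendsto_eq_intros)
  fix h assume h: "h \<noteq> 0" "\<bar>h\<bar> < t"
  let ?R = "S (t + h) U - S t U - rsc h (S t V)"
  have th: "0 \<le> t + h" "0 \<le> t" using h by auto
  have D: "S (t + h) U \<in> D" "S t U \<in> D" "S t V \<in> D" "eqv (A (S (t + h) U)) (S (t + h) V)"
    "eqv (A (S t U)) (S t V)" "eqv (A (S t V)) (S t W)"
    using orbit_D[OF U(1) _ U(2)] orbit_D[OF V(1) W V(2)] V th by auto
  have R: "?R \<in> D" using D by (intro D_diff D_sc)
  have "eqv (A ?R) (S (t + h) V - S t V - rsc h (S t W))"
  proof -
    have "eqv (A ?R) (A (S (t + h) U - S t U) - A (rsc h (S t V)))"
      by (rule D_diff(2)[OF D_diff(1)[OF D(1,2)] D_sc(1)[OF D(3)]])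
    moreover have "eqv (A (S (t + h) U - S t U)) (S (t + h) V - S t V)"
      using D V th eqv_trans[OF _ _ _ D_diff(2)[OF D(1,2)] eqv_diff[OF _ _ _ _ D(4,5)]] D_diff(1)[OF D(1,2)]
      by auto
    moreover have "eqv (A (rsc h (S t V))) (rsc h (S t W))"
      using D W th eqv_trans[OF _ _ _ D_sc(2)[OF D(3)] eqv_sc[OF _ _ D(6)]] D_sc(1)[OF D(3)] by auto
    ultimately have "eqv (A (S (t + h) U - S t U) - A (rsc h (S t V))) (S (t + h) V - S t V - rsc h (S t W))"
      using V W th D_diff(1)[OF D(1,2)] D_sc(1)[OF D(3)] by (intro eqv_diff) auto
    with \<open>eqv (A ?R) _\<close> show ?thesis
      by (rule eqv_trans[rotated 3]) (use V W th D_diff(1)[OF D(1,2)] D_sc(1)[OF D(3)] R in auto)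
  qed
  then have "N (A ?R) = N (S (t + h) V - S t V - rsc h (S t W))"
    using R V W th by (intro eqv_N) auto
  also have "\<dots> \<le> \<bar>h\<bar> * defect V W \<bar>h\<bar>" using increment[OF _ W t h, of V] V by auto
  finally have NA: "N (A ?R) \<le> \<bar>h\<bar> * defect V W \<bar>h\<bar>" .
  have NR: "N ?R \<le> \<bar>h\<bar> * defect U V \<bar>h\<bar>" using increment[OF _ _ t h, of U V] U V by auto
  have C0: "0 \<le> C \<or> (\<forall>U\<in>D. N U + N (A U) = 0)"
  proof (rule ccontr)
    assume "\<not> ?thesis"
    then obtain U where "U \<in> D" "N U + N (A U) \<noteq> 0" "C < 0" by auto
    moreover have "0 \<le> N U" "0 \<le> N (A U)" using \<open>U \<in> D\<close> by auto
    ultimately have "C * (N U + N (A U)) < 0" by (intro mult_neg_pos) linarith+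
    then show False using bound[OF \<open>U \<in> D\<close>] norm_ge_zero[of "l U"] by linarith
  qed
  have "l (S (t + h) U) - l (S t U) - h *\<^sub>R l (S t V) = l ?R"
    using D diff[OF D_diff(1)[OF D(1,2)] D_sc(1)[OF D(3)]] diff[OF D(1,2)] sc[OF D(3)]
    by (simp add: scaleR_conv_of_real)
  also have "cmod (l ?R) \<le> \<bar>C\<bar> * (N ?R + N (A ?R))"
    using bound[OF R] C0 R by auto
  also have "\<dots> \<le> \<bar>C\<bar> * (\<bar>h\<bar> * defect U V \<bar>h\<bar> + \<bar>h\<bar> * defect V W \<bar>h\<bar>)"
    using NR NA by (intro mult_left_mono) auto
  finally show "norm (l (S (t + h) U) - l (S t U) - h *\<^sub>R l (S t V)) \<le> \<bar>h\<bar> * (\<bar>C\<bar> * (defect U V \<bar>h\<bar> + defect V W \<bar>h\<bar>))"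
    by (simp add: algebra_simps)
qed

text \<open>For a quadratic norm the expansion of \<open>N\<^sup>2\<close> in the direction of the derivative has a linear term
\<open>2 h b\<close>, and the step along the tangent differs from the step along the orbit by \<open>o(h)\<close>.\<close>

lemma norm_sq_derivative:
  assumes U: "U \<in> D" "eqv (A U) V" and V: "V \<in> X" and t: "0 < t"
    and expand: "\<And>h. (N (S t U + rsc h (S t V)))\<^sup>2 = (N (S t U))\<^sup>2 + 2 * h * b + h\<^sup>2 * q"
  shows "((\<lambda>t. (N (S t U))\<^sup>2) has_real_derivative 2 * b) (at t)"
  unfolding has_real_derivative_iff_has_vector_derivative
proof (rule has_vector_derivative_by_error[OF t])
  let ?g = "\<lambda>h. defect U V \<bar>h\<bar> * (2 * N U + \<bar>h\<bar> * N V) + \<bar>h\<bar> * \<bar>q\<bar>"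
  have "((\<lambda>h::real. \<bar>h\<bar>) \<longlongrightarrow> 0) (at 0)" by (auto intro!: tendsto_eq_intros)
  then have "(?g \<longlongrightarrow> 0 * (2 * N U + 0 * N V) + 0 * \<bar>q\<bar>) (at 0)"
    by (intro tendsto_add tendsto_mult tendsto_const defect_abs_tendsto[OF U(1) V U(2)])
  then show "(?g \<longlongrightarrow> 0) (at 0)" by simp
  fix h assume h: "h \<noteq> 0" "\<bar>h\<bar> < t"
  let ?P = "S (t + h) U" and ?Q = "S t U + rsc h (S t V)"
  have th: "0 \<le> t + h" "0 \<le> t" using h by auto
  have PQ: "?P \<in> X" "?Q \<in> X" using U V th by auto
  have "N (?P - ?Q) \<le> \<bar>h\<bar> * defect U V \<bar>h\<bar>"
    using increment[OF _ V t h, of U] U by (auto simp: algebra_simps)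
  then have d: "\<bar>N ?P - N ?Q\<bar> \<le> \<bar>h\<bar> * defect U V \<bar>h\<bar>"
    using N_le_add_diff[OF PQ] N_le_add_diff[OF PQ(2,1)] N_commute[OF PQ] by linarith
  have P: "N ?P \<le> N U" using U th by (intro S_le) auto
  have "N ?Q \<le> N (S t U) + N (rsc h (S t V))" using U V th by (intro N_add) auto
  also have "\<dots> \<le> N U + \<bar>h\<bar> * N V"
    using S_le[OF th(2), of U] S_le[OF th(2) V] U(1) V th by (intro add_mono) (simp_all add: mult_left_mono)
  finally have Q: "N ?Q \<le> N U + \<bar>h\<bar> * N V" .
  have sq: "\<bar>p\<^sup>2 - r\<^sup>2\<bar> = \<bar>p - r\<bar> * (p + r)" if "0 \<le> p" "0 \<le> r" for p r :: real
  proof -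
    have "p\<^sup>2 - r\<^sup>2 = (p - r) * (p + r)" by (simp add: power2_eq_square algebra_simps)
    then show ?thesis using that by (simp add: abs_mult)
  qed
  define p r s \<delta> where "p = N ?P" and "r = N ?Q" and "s = N (S t U)" and "\<delta> = defect U V \<bar>h\<bar>"
  have pr: "0 \<le> p" "0 \<le> r" "\<bar>p - r\<bar> \<le> \<bar>h\<bar> * \<delta>" "p + r \<le> 2 * N U + \<bar>h\<bar> * N V"
    using PQ d P Q by (auto simp: p_def r_def \<delta>_def)
  have rs: "r\<^sup>2 = s\<^sup>2 + 2 * h * b + h\<^sup>2 * q" unfolding r_def s_def by (rule expand)
  have "\<bar>p\<^sup>2 - r\<^sup>2\<bar> \<le> (\<bar>h\<bar> * \<delta>) * (2 * N U + \<bar>h\<bar> * N V)"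
    unfolding sq[OF pr(1,2)] using pr by (intro mult_mono) (auto intro: order.trans[OF abs_ge_zero])
  moreover have "p\<^sup>2 - s\<^sup>2 - h * (2 * b) = (p\<^sup>2 - r\<^sup>2) + h\<^sup>2 * q"
    using rs by simp
  moreover have "\<bar>h\<^sup>2 * q\<bar> = \<bar>h\<bar> * (\<bar>h\<bar> * \<bar>q\<bar>)" by (simp add: abs_mult power2_eq_square)
  ultimately have "\<bar>p\<^sup>2 - s\<^sup>2 - h * (2 * b)\<bar> \<le> (\<bar>h\<bar> * \<delta>) * (2 * N U + \<bar>h\<bar> * N V) + \<bar>h\<bar> * (\<bar>h\<bar> * \<bar>q\<bar>)"
    by linarith
  also have "\<dots> = \<bar>h\<bar> * (\<delta> * (2 * N U + \<bar>h\<bar> * N V) + \<bar>h\<bar> * \<bar>q\<bar>)" by (simp only: distrib_left mult.assoc)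
  finally show "norm ((N ?P)\<^sup>2 - (N (S t U))\<^sup>2 - h *\<^sub>R (2 * b)) \<le> \<bar>h\<bar> * ?g h"
    unfolding p_def s_def \<delta>_def by simp
qed

subsection \<open>Density of the iterated domains\<close>

lemma N_sum_le: "(\<And>j. j \<in> J \<Longrightarrow> f j \<in> X) \<Longrightarrow> N (sum f J) \<le> (\<Sum>j\<in>J. N (f j))"
proof (induction J rule: infinite_finite_induct)
  case (insert x F)
  have "N (f x + sum f F) \<le> N (f x) + N (sum f F)"
    using insert by (intro N_add X_sum) auto
  then show ?case using insert by fastforce
qed auto

lemma N_mean_le:
  assumes "0 < m" "\<And>j. j < m \<Longrightarrow> f j \<in> X" "\<And>j. j < k \<Longrightarrow> N (f j) \<le> e" "k \<le> m"
  shows "N (rsc (1 / real m) (\<Sum>j<k. f j)) \<le> real k / real m * e"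
proof -
  have "N (rsc (1 / real m) (\<Sum>j<k. f j)) = (1 / real m) * N (\<Sum>j<k. f j)"
    using assms by (subst N_sc) (auto intro!: X_sum simp: norm_divide)
  also have "N (\<Sum>j<k. f j) \<le> (\<Sum>j<k. N (f j))" using assms by (intro N_sum_le) auto
  also have "\<dots> \<le> real k * e" using sum_bounded_above[of "{..<k}" "\<lambda>j. N (f j)" e] assms by auto
  finally show ?thesis by (simp add: divide_right_mono)
qed

lemma S_sum:
  assumes "0 \<le> t" "\<And>j. j \<in> J \<Longrightarrow> f j \<in> X"
  shows "eqv (S t (sum f J)) (\<Sum>j\<in>J. S t (f j))"
  using assms(2)
proof (induction J rule: infinite_finite_induct)
  case (insert x F)
  have "eqv (S t (f x + sum f F)) (S t (f x) + S t (sum f F))"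
    using assms(1) insert by (intro S_add X_sum) auto
  moreover have "eqv (S t (f x) + S t (sum f F)) (S t (f x) + (\<Sum>j\<in>F. S t (f j)))"
    using assms(1) insert by (intro eqv_add) (auto intro!: X_sum)
  ultimately have "eqv (S t (f x + sum f F)) (S t (f x) + (\<Sum>j\<in>F. S t (f j)))"
    by (rule eqv_trans[rotated 3]) (use assms(1) insert in \<open>auto intro!: X_sum X_add S_X\<close>)
  then show ?case using insert by simp
qed (use S_sc[of t 0 0] assms(1) in auto)

text \<open>Riemann sums of the time mean of the orbit over \<open>[0, h]\<close>.\<close>

definition riemann :: "'a \<Rightarrow> real \<Rightarrow> nat \<Rightarrow> 'a" where
  "riemann U h m = rsc (1 / real m) (\<Sum>j<m. S (real j * h / real m) U)"

lemma riemann_X [simp, intro]: "U \<in> X \<Longrightarrow> 0 \<le> h \<Longrightarrow> riemann U h m \<in> X"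
  unfolding riemann_def by (auto intro!: X_sum)

lemma sum_lessThan_split: "(\<Sum>j<m + k. f j) = (\<Sum>j<m. f j) + (\<Sum>j<k. f (m + j) :: 'b::comm_monoid_add)" for m k :: nat
  by (induction k) (auto simp: add.assoc)

lemma sum_grouped: "(\<Sum>j<m * k. f j) = (\<Sum>i<m. \<Sum>r<k. f (i * k + r) :: 'b::comm_monoid_add)" for m k :: nat
proof (induction m)
  case (Suc m)
  have "(\<Sum>j<Suc m * k. f j) = (\<Sum>j<m * k + k. f j)" by (simp add: add.commute)
  then show ?case using Suc by (simp add: sum_lessThan_split)
qed auto

text \<open>Every node of the refined partition lies within \<open>h / m\<close> to the right of a node of the coarse one.\<close>

lemma riemann_refine:
  assumes U: "U \<in> X" and h: "0 \<le> h" and m: "0 < m" and k: "0 < k"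
    and e: "\<And>\<sigma>. 0 \<le> \<sigma> \<Longrightarrow> \<sigma> \<le> h / real m \<Longrightarrow> N (S \<sigma> U - U) \<le> e"
  shows "N (riemann U h (m * k) - riemann U h m) \<le> e"
proof -
  let ?f = "\<lambda>j. S (real j * h / real (m * k)) U"
  have 1: "riemann U h m = rsc (1 / real (m * k)) (\<Sum>i<m. \<Sum>r<k. S (real i * h / real m) U)"
  proof -
    have "(\<Sum>i<m. \<Sum>r<k. S (real i * h / real m) U) = (\<Sum>i<m. rsc (real k) (S (real i * h / real m) U))"
      by (simp add: sum_constant_scale)
    also have "\<dots> = rsc (real k) (\<Sum>i<m. S (real i * h / real m) U)" by (simp add: scale_sum_right)
    finally show ?thesis using m k by (simp add: riemann_def)
  qed
  have "riemann U h (m * k) - riemann U h m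
      = rsc (1 / real (m * k)) (\<Sum>i<m. \<Sum>r<k. ?f (i * k + r) - S (real i * h / real m) U)"
    unfolding 1 unfolding riemann_def sum_grouped by (simp add: scale_right_diff_distrib sum_subtractf)
  also have "(\<Sum>i<m. \<Sum>r<k. ?f (i * k + r) - S (real i * h / real m) U)
      = (\<Sum>j<m * k. ?f j - S (real (j div k) * h / real m) U)"
    unfolding sum_grouped using k by (intro sum.cong refl) auto
  also have "N (rsc (1 / real (m * k)) \<dots>) \<le> real (m * k) / real (m * k) * e"
  proof (rule N_mean_le)
    fix j assume "j < m * k"
    define i r where "i = j div k" and "r = j mod k"
    have jr: "j = i * k + r" "r < k" using k by (auto simp: i_def r_def)
    have "real j * h / real (m * k) = real i * h / real m + real r * h / real (m * k)"
      using m k by (simp add: jr field_simps)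
    then have "N (?f j - S (real i * h / real m) U) \<le> N (S (real r * h / real (m * k)) U - U)"
      using S_shift[of "real i * h / real m" "real r * h / real (m * k)" U] U h by simp
    also have "\<dots> \<le> e"
    proof (rule e)
      have "real r * h \<le> real k * h" using jr h by (intro mult_right_mono) auto
      then have "real r * h / real (m * k) \<le> real k * h / real (m * k)" by (intro divide_right_mono) auto
      then show "real r * h / real (m * k) \<le> h / real m" using k by simp
    qed (use h in auto)
    finally show "N (?f j - S (real (j div k) * h / real m) U) \<le> e" by (simp add: i_def)
  qed (use U h m k in auto)
  finally show ?thesis using m k by simp
qed

text \<open>Shifting the sum by \<open>s\<close>, rounded to a multiple of the mesh, drops the first terms and appends terms
shifted by \<open>h\<close>; each pair contributes \<open>S h U - U\<close> up to the modulus of continuity of the orbit.\<close>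

lemma riemann_quotient:
  assumes U: "U \<in> X" and h: "0 < h" and m: "0 < m" and s: "0 < s" "s \<le> h"
    and e: "\<And>\<sigma>. 0 \<le> \<sigma> \<Longrightarrow> \<sigma> \<le> h / real m \<Longrightarrow> N (S \<sigma> U - U) \<le> e"
    and \<eta>: "\<And>\<sigma>. 0 \<le> \<sigma> \<Longrightarrow> \<sigma> \<le> s \<Longrightarrow> N (S \<sigma> U - U) \<le> \<eta>"
  shows "N (S s (riemann U h m) - riemann U h m - rsc (s / h) (S h U - U)) \<le> e + 2 * \<eta> * (s / h) + N (S h U - U) / real m"
proof -
  let ?V = "S h U - U" and ?R = "riemann U h m"
  define \<delta> where "\<delta> = h / real m"
  define k where "k = nat \<lfloor>s / \<delta>\<rfloor>"
  \<comment> \<open>The rounding error of the shift.\<close>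
  define r where "r = s - real k * \<delta>"
  define f where "f = (\<lambda>j. S (real j * \<delta>) U)"
  have \<delta>: "0 < \<delta>" "real m * \<delta> = h" using h m by (auto simp: \<delta>_def)
  have fl: "real k \<le> s / \<delta>" "s / \<delta> < real k + 1"
    using s \<delta> by (auto simp: k_def)
  have r: "0 \<le> r" "r < \<delta>" using fl \<delta> by (auto simp: r_def field_simps)
  have km: "k \<le> m"
  proof -
    have "s / \<delta> \<le> real m" using s \<delta> by (simp add: field_simps)
    then have "real k \<le> real m" using fl by linarith
    then show ?thesis by simp
  qed
  have \<eta>0: "0 \<le> \<eta>"
  proof (rule order.trans)
    show "0 \<le> N (S 0 U - U)" using U by auto
    show "N (S 0 U - U) \<le> \<eta>" using \<eta>[of 0] s by auto
  qed
  have fX: "f j \<in> X" for j using U \<delta> by (auto simp: f_def)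
  have R: "?R = rsc (1 / real m) (\<Sum>j<m. f j)" by (simp add: riemann_def f_def \<delta>_def)
  define B where "B = (\<Sum>j<m. f (k + j))"
  have "eqv (S s ?R) (rsc (1 / real m) (\<Sum>j<m. S s (f j)))"
  proof -
    have "eqv (S s ?R) (rsc (1 / real m) (S s (\<Sum>j<m. f j)))"
      unfolding R using s fX by (intro S_sc X_sum) auto
    moreover have "eqv (rsc (1 / real m) (S s (\<Sum>j<m. f j))) (rsc (1 / real m) (\<Sum>j<m. S s (f j)))"
      using s fX by (intro eqv_sc S_sum) (auto intro!: X_sum)
    ultimately show ?thesis by (rule eqv_trans[rotated 3]) (use s fX in \<open>auto intro!: X_sum X_sc S_X simp: R\<close>)
  qed
  then have "N (S s ?R - rsc (1 / real m) B) = N (rsc (1 / real m) (\<Sum>j<m. S s (f j)) - rsc (1 / real m) B)"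
    using s fX by (intro eqv_N eqv_diff) (auto intro!: X_sum X_sc S_X X_diff simp: R B_def)
  also have "rsc (1 / real m) (\<Sum>j<m. S s (f j)) - rsc (1 / real m) B = rsc (1 / real m) (\<Sum>j<m. S s (f j) - f (k + j))"
    by (simp add: B_def scale_right_diff_distrib[symmetric] sum_subtractf)
  also have "N \<dots> \<le> real m / real m * e"
  proof (rule N_mean_le)
    fix j
    have "eqv (S (s + real j * \<delta>) U) (S s (f j))" using S_S[of s "real j * \<delta>" U] s \<delta> U by (simp add: f_def)
    then have "N (S s (f j) - f (k + j)) = N (S (s + real j * \<delta>) U - f (k + j))"
      using s \<delta> U fX by (intro eqv_N[symmetric] eqv_diff) auto
    also have "s + real j * \<delta> = real (k + j) * \<delta> + r" by (simp add: r_def algebra_simps)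
    also have "N (S (real (k + j) * \<delta> + r) U - f (k + j)) \<le> N (S r U - U)"
      unfolding f_def using S_shift[of "real (k + j) * \<delta>" r U] r \<delta> U by simp
    also have "\<dots> \<le> e" using e[of r] r by (simp add: \<delta>_def)
    finally show "N (S s (f j) - f (k + j)) \<le> e" .
  qed (use m s fX in auto)
  finally have 1: "N (S s ?R - rsc (1 / real m) B) \<le> e" using m by simp
  have BR: "rsc (1 / real m) B - ?R = rsc (1 / real m) (\<Sum>j<k. f (m + j) - f j)"
  proof -
    have "(\<Sum>j<m. f j) + (\<Sum>j<k. f (m + j)) = (\<Sum>j<k. f j) + B"
      unfolding B_def sum_lessThan_split[symmetric] by (simp add: add.commute)
    then have "B - (\<Sum>j<m. f j) = (\<Sum>j<k. f (m + j) - f j)"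
      by (simp add: sum_subtractf algebra_simps)
    then show ?thesis by (simp add: R scale_right_diff_distrib[symmetric])
  qed
  have "rsc (1 / real m) B - ?R - rsc (real k / real m) ?V = rsc (1 / real m) (\<Sum>j<k. (f (m + j) - f j) - ?V)"
    unfolding BR using m by (simp add: sum_subtractf scale_right_diff_distrib sum_constant_scale del: of_real_divide)
      (simp add: of_real_divide)
  also have "N \<dots> \<le> real k / real m * (2 * \<eta>)"
  proof (rule N_mean_le[OF m _ _ km])
    fix j assume j: "j < k"
    have js: "0 \<le> real j * \<delta>" "real j * \<delta> \<le> s"
    proof -
      have "real j * \<delta> \<le> real k * \<delta>" using j \<delta> by (intro mult_right_mono) auto
      then show "real j * \<delta> \<le> s" using r(1) unfolding r_def by linarith
    qed (use \<delta> in auto)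
    have "real (m + j) * \<delta> = h + real j * \<delta>" using \<delta> by (simp add: distrib_right)
    then have "(f (m + j) - f j) - ?V = (S (h + real j * \<delta>) U - S h U) - (S (real j * \<delta>) U - U)"
      by (simp add: f_def)
    also have "N \<dots> \<le> N (S (h + real j * \<delta>) U - S h U) + N (S (real j * \<delta>) U - U)"
      using U h js by (intro N_diff) (auto intro!: S_X)
    also have "\<dots> \<le> 2 * \<eta>"
      using S_shift[of h "real j * \<delta>" U] \<eta>[OF js] U h js by simp
    finally show "N (f (m + j) - f j - ?V) \<le> 2 * \<eta>" .
  qed (use fX U h in auto)
  also have "\<dots> \<le> s / h * (2 * \<eta>)"
  proof (rule mult_right_mono)
    have "real k * \<delta> \<le> s" using r by (simp add: r_def)
    then have "real k * \<delta> / h \<le> s / h" using h by (intro divide_right_mono) auto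
    then show "real k / real m \<le> s / h" using \<delta> h m by (simp add: \<delta>_def)
  qed (use \<eta>0 in auto)
  finally have 2: "N (rsc (1 / real m) B - ?R - rsc (real k / real m) ?V) \<le> s / h * (2 * \<eta>)" .
  have 3: "N (rsc (real k / real m) ?V - rsc (s / h) ?V) \<le> N ?V / real m"
  proof -
    have "rsc (real k / real m) ?V - rsc (s / h) ?V = rsc (real k / real m - s / h) ?V"
      by (simp only: scale_left_diff_distrib of_real_diff)
    then have "N (rsc (real k / real m) ?V - rsc (s / h) ?V) = \<bar>real k / real m - s / h\<bar> * N ?V"
      using U h N_sc[of ?V "complex_of_real (real k / real m - s / h)"] by (simp only: norm_of_real) auto
    also have "real k / real m - s / h = - r / h"
      using h m by (simp add: r_def \<delta>_def field_simps)
    also have "\<bar>- r / h\<bar> * N ?V \<le> (\<delta> / h) * N ?V"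
      using r h U by (intro mult_right_mono) (auto simp: divide_right_mono)
    also have "\<dots> = N ?V / real m" using h by (simp add: \<delta>_def)
    finally show ?thesis .
  qed
  have BX: "B \<in> X" using fX by (auto simp: B_def intro!: X_sum)
  have "S s ?R - ?R - rsc (s / h) ?V = (S s ?R - rsc (1 / real m) B) + ((rsc (1 / real m) B - ?R - rsc (real k / real m) ?V)
      + (rsc (real k / real m) ?V - rsc (s / h) ?V))" by simp
  also have "N \<dots> \<le> N (S s ?R - rsc (1 / real m) B) + N ((rsc (1 / real m) B - ?R - rsc (real k / real m) ?V)
      + (rsc (real k / real m) ?V - rsc (s / h) ?V))"
    using BX U h s by (intro N_add) (auto intro!: X_diff X_sc S_X riemann_X X_add)
  also have "N ((rsc (1 / real m) B - ?R - rsc (real k / real m) ?V) + (rsc (real k / real m) ?V - rsc (s / h) ?V))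
      \<le> N (rsc (1 / real m) B - ?R - rsc (real k / real m) ?V) + N (rsc (real k / real m) ?V - rsc (s / h) ?V)"
    using BX U h s by (intro N_add) (auto intro!: X_diff X_sc S_X riemann_X)
  finally show ?thesis using 1 2 3 by (simp add: algebra_simps)
qed

lemma S_cont_uniform:
  assumes "U \<in> X" "0 < e"
  obtains d where "0 < d" "\<And>\<sigma>. 0 \<le> \<sigma> \<Longrightarrow> \<sigma> \<le> d \<Longrightarrow> N (S \<sigma> U - U) \<le> e"
proof -
  have "eventually (\<lambda>t. N (S t U - U) < e) (at_right 0)"
    using S_cont[OF assms(1)] assms(2) by (rule order_tendstoD)
  then obtain d where d: "0 < d" "\<And>t. 0 < t \<Longrightarrow> t < d \<Longrightarrow> N (S t U - U) < e"
    unfolding eventually_at_right_field by auto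
  have "N (S \<sigma> U - U) \<le> e" if "0 \<le> \<sigma>" "\<sigma> \<le> d / 2" for \<sigma>
    using d that S_0[OF assms(1)] assms(2) by (cases "\<sigma> = 0") (auto simp: eqv_def less_imp_le)
  then show ?thesis using d(1) that[of "d / 2"] by auto
qed

end

locale complete_contraction_generator = contraction_generator +
  assumes complete: "\<And>f :: nat \<Rightarrow> 'a. (\<And>n. f n \<in> X) \<Longrightarrow>
      (\<And>e. 0 < e \<Longrightarrow> \<exists>M. \<forall>m\<ge>M. \<forall>n\<ge>M. N (f m - f n) < e) \<Longrightarrow> \<exists>U\<in>X. (\<lambda>n. N (f n - U)) \<longlonglongrightarrow> 0"
begin

text \<open>The mean of an orbit over a time interval lies in the domain: its difference quotients
  telescope.  Completeness turns the Riemann sums into the mean.\<close>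

lemma mean_in_domain:
  assumes U: "U \<in> X" and h: "0 < h"
  obtains W where "W \<in> D" "eqv (A W) (quot U h)"
    "\<And>\<eta>. (\<And>\<sigma>. 0 \<le> \<sigma> \<Longrightarrow> \<sigma> \<le> h \<Longrightarrow> N (S \<sigma> U - U) \<le> \<eta>) \<Longrightarrow> N (W - U) \<le> \<eta>"
proof -
  define f where "f = (\<lambda>n. riemann U h (Suc n))"
  have fX: "f n \<in> X" for n using U h by (auto simp: f_def)
  have cauchy: "\<exists>M. \<forall>m\<ge>M. \<forall>n\<ge>M. N (f m - f n) < e" if e: "0 < e" for e
  proof -
    obtain d where d: "0 < d" "\<And>\<sigma>. 0 \<le> \<sigma> \<Longrightarrow> \<sigma> \<le> d \<Longrightarrow> N (S \<sigma> U - U) \<le> e / 3"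
      using S_cont_uniform[OF U, of "e / 3"] e by (metis divide_pos_pos zero_less_numeral)
    obtain M where M: "h / d < real M" using reals_Archimedean2 by blast
    have close: "N (riemann U h (Suc m * k) - f m) \<le> e / 3" if "m \<ge> M" "0 < k" for m k
      unfolding f_def
    proof (rule riemann_refine[OF U])
      fix \<sigma> assume \<sigma>: "0 \<le> \<sigma>" "\<sigma> \<le> h / real (Suc m)"
      have "h / d \<le> real (Suc m)" using M that by linarith
      then have "h \<le> d * real (Suc m)" using d(1) by (simp add: field_simps)
      then have "h / real (Suc m) \<le> d" by (simp add: field_simps)
      then show "N (S \<sigma> U - U) \<le> e / 3" using d(2) \<sigma> by auto
    qed (use h that in auto)
    have "N (f m - f n) < e" if "m \<ge> M" "n \<ge> M" for m n
    proof -
      \<comment> \<open>A common refinement of both partitions.\<close>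
      let ?R = "riemann U h (Suc m * Suc n)"
      have "N (f m - f n) \<le> N (f m - ?R) + N (?R - f n)" using fX U h by (intro N_tri) auto
      also have "N (f m - ?R) = N (?R - f m)" using fX U h by (intro N_commute) auto
      finally show ?thesis
        using close[OF that(1), of "Suc n"] close[OF that(2), of "Suc m"] \<open>0 < e\<close> by (simp add: mult.commute)
    qed
    then show ?thesis by blast
  qed
  obtain W where W: "W \<in> X" and lim: "(\<lambda>n. N (f n - W)) \<longlonglongrightarrow> 0"
    using complete[OF fX cauchy] by auto
  have est: "N (quot W s - quot U h) \<le> 2 * \<eta> / h"
    if s: "0 < s" "s \<le> h" and \<eta>: "\<And>\<sigma>. 0 \<le> \<sigma> \<Longrightarrow> \<sigma> \<le> s \<Longrightarrow> N (S \<sigma> U - U) \<le> \<eta>" for s \<eta>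
  proof -
    let ?V = "S h U - U"
    have X: "?V \<in> X" using U h by auto
    have main: "N (S s W - W - rsc (s / h) ?V) \<le> 2 * \<eta> * (s / h)"
    proof (rule field_le_epsilon)
      fix \<epsilon> :: real assume \<epsilon>: "0 < \<epsilon>"
      obtain d where d: "0 < d" "\<And>\<sigma>. 0 \<le> \<sigma> \<Longrightarrow> \<sigma> \<le> d \<Longrightarrow> N (S \<sigma> U - U) \<le> \<epsilon> / 4"
        using S_cont_uniform[OF U, of "\<epsilon> / 4"] \<epsilon> by auto
      obtain M1 where M1: "\<And>n. n \<ge> M1 \<Longrightarrow> N (f n - W) < \<epsilon> / 4"
        using order_tendstoD(2)[OF lim, of "\<epsilon> / 4"] \<epsilon> by (auto simp: eventually_sequentially)
      obtain M2 where M2: "max (h / d) (4 * N ?V / \<epsilon>) < real M2" using reals_Archimedean2 by blast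
      define n where "n = max M1 M2"
      have n: "h / d \<le> real (Suc n)" "4 * N ?V / \<epsilon> \<le> real (Suc n)" "n \<ge> M1"
        using M2 by (auto simp: n_def)
      have n1: "h / real (Suc n) \<le> d" using n(1) d(1) by (simp add: field_simps)
      have n2: "N ?V / real (Suc n) \<le> \<epsilon> / 4" using n(2) \<epsilon> by (simp add: field_simps)
      have "N (S s (f n) - f n - rsc (s / h) ?V) \<le> \<epsilon> / 4 + 2 * \<eta> * (s / h) + N ?V / real (Suc n)"
        unfolding f_def
      proof (rule riemann_quotient[OF U h _ s _ \<eta>])
        show "N (S \<sigma> U - U) \<le> \<epsilon> / 4" if "0 \<le> \<sigma>" "\<sigma> \<le> h / real (Suc n)" for \<sigma>
          using d(2) that n1 by auto
      qed auto
      moreover have "N (S s W - S s (f n)) \<le> N (f n - W)"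
        using S_diff_le[of s W "f n"] N_commute[of W "f n"] s W fX by auto
      moreover have "N (S s W - W - rsc (s / h) ?V) \<le> N (S s (f n) - f n - rsc (s / h) ?V) + (N (S s W - S s (f n)) + N (f n - W))"
      proof -
        have "S s W - W - rsc (s / h) ?V = (S s (f n) - f n - rsc (s / h) ?V) + ((S s W - S s (f n)) + (f n - W))"
          by simp
        also have "N \<dots> \<le> N (S s (f n) - f n - rsc (s / h) ?V) + N ((S s W - S s (f n)) + (f n - W))"
          using s W fX X by (intro N_add) (auto intro!: X_add X_diff S_X X_sc)
        also have "N ((S s W - S s (f n)) + (f n - W)) \<le> N (S s W - S s (f n)) + N (f n - W)"
          using s W fX X by (intro N_add) (auto intro!: X_add X_diff S_X X_sc)
        finally show ?thesis by simp
      qed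
      ultimately show "N (S s W - W - rsc (s / h) ?V) \<le> 2 * \<eta> * (s / h) + \<epsilon>"
        using M1[OF n(3)] n2 by linarith
    qed
    have "quot W s - quot U h = rsc (1 / s) (S s W - W - rsc (s / h) ?V)"
      using s by (simp add: quot_def scale_right_diff_distrib)
    then have "N (quot W s - quot U h) = (1 / s) * N (S s W - W - rsc (s / h) ?V)"
      using N_sc[of "S s W - W - rsc (s / h) ?V" "complex_of_real (1 / s)"] s W X by (simp add: norm_divide)
    also have "\<dots> \<le> (1 / s) * (2 * \<eta> * (s / h))" using main s by (intro mult_left_mono) auto
    finally show ?thesis using s by simp
  qed
  have "((\<lambda>s. N (quot W s - quot U h)) \<longlongrightarrow> 0) (at_right 0)"
  proof (rule tendstoI)
    fix e :: real assume e: "0 < e"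
    obtain d where d: "0 < d" "\<And>\<sigma>. 0 \<le> \<sigma> \<Longrightarrow> \<sigma> \<le> d \<Longrightarrow> N (S \<sigma> U - U) \<le> e * h / 4"
      using S_cont_uniform[OF U, of "e * h / 4"] e h by auto
    have "dist (N (quot W s - quot U h)) 0 < e" if "0 < s" "s < min d h" for s
    proof -
      have "N (quot W s - quot U h) \<le> 2 * (e * h / 4) / h" using est[of s "e * h / 4"] d that by auto
      also have "\<dots> < e" using e h by simp
      finally show ?thesis using U W h that by (auto simp: dist_real_def)
    qed
    then show "\<forall>\<^sub>F s in at_right 0. dist (N (quot W s - quot U h)) 0 < e"
      unfolding eventually_at_right_field using d(1) h by (intro exI[of _ "min d h"]) auto
  qed
  then have WD: "W \<in> D" "eqv (A W) (quot U h)"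
    using generator_iff[of W "quot U h"] W U h by auto
  show ?thesis
  proof (rule that[OF WD])
    fix \<eta> assume \<eta>: "\<And>\<sigma>. 0 \<le> \<sigma> \<Longrightarrow> \<sigma> \<le> h \<Longrightarrow> N (S \<sigma> U - U) \<le> \<eta>"
    have close: "N (f n - U) \<le> \<eta>" for n
    proof -
      have "f n - U = rsc (1 / real (Suc n)) (\<Sum>j<Suc n. S (real j * h / real (Suc n)) U - U)"
        unfolding f_def riemann_def
        by (simp add: sum_subtractf scale_right_diff_distrib sum_constant_scale del: sum.lessThan_Suc of_nat_Suc)
      also have "N \<dots> \<le> real (Suc n) / real (Suc n) * \<eta>"
      proof (rule N_mean_le)
        fix j assume "j < Suc n"
        then have "real j * h \<le> real (Suc n) * h" using h by (intro mult_right_mono) auto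
        then show "N (S (real j * h / real (Suc n)) U - U) \<le> \<eta>"
          using h by (intro \<eta>) (auto simp: field_simps)
      qed (use U h in auto)
      finally show ?thesis by simp
    qed
    have "N (W - U) \<le> N (f n - W) + \<eta>" for n
      using N_tri[of W "f n" U] N_commute[of W "f n"] close[of n] W fX U by auto
    moreover have "(\<lambda>n. N (f n - W) + \<eta>) \<longlonglongrightarrow> 0 + \<eta>" by (intro tendsto_intros lim)
    ultimately show "N (W - U) \<le> \<eta>" by (auto intro: LIMSEQ_le_const)
  qed
qed

end

context contraction_generator begin

text \<open>A chain of length \<open>k\<close> starting at \<open>f 0\<close> exhibits \<open>f 0\<close> as an element of the domain of the
  \<open>k\<close>-th power of the generator, with \<open>f j\<close> representing its image under the \<open>j\<close>-th power.\<close>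

definition chain :: "nat \<Rightarrow> (nat \<Rightarrow> 'a) \<Rightarrow> bool" where
  "chain k f \<longleftrightarrow> (\<forall>j<k. f j \<in> D \<and> eqv (A (f j)) (f (Suc j))) \<and> f k \<in> X"

lemma chain_X: "chain k f \<Longrightarrow> j \<le> k \<Longrightarrow> f j \<in> X"
  by (cases "j < k") (auto simp: chain_def)

lemma chain_orbit:
  assumes "chain k f" "0 \<le> t" shows "chain k (\<lambda>j. S t (f j))"
proof -
  have "f (Suc j) \<in> X" if "j < k" for j using chain_X[OF assms(1), of "Suc j"] that by auto
  then show ?thesis using assms unfolding chain_def by (auto intro: orbit_D)
qed

end

context complete_contraction_generator begin

text \<open>The difference quotients with a fixed step of a chain form a chain again, and the time mean of its
first element extends it by one at the front.\<close>

lemma chain_dense: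
  assumes "U \<in> X" "0 < e"
  shows "\<exists>f. chain k f \<and> N (f 0 - U) < e"
  using assms
proof (induction k arbitrary: U e)
  case 0
  then show ?case by (intro exI[of _ "\<lambda>_. U"]) (auto simp: chain_def)
next
  case (Suc k)
  then obtain f where f: "chain k f" "N (f 0 - U) < e / 2" by (metis half_gt_zero)
  have fX: "f j \<in> X" if "j \<le> k" for j using chain_X[OF f(1) that] .
  obtain h where h: "0 < h" "\<And>\<sigma>. 0 \<le> \<sigma> \<Longrightarrow> \<sigma> \<le> h \<Longrightarrow> N (S \<sigma> (f 0) - f 0) \<le> e / 2"
    using S_cont_uniform[of "f 0" "e / 2"] fX Suc.prems by auto
  obtain W where W: "W \<in> D" "eqv (A W) (quot (f 0) h)" "N (W - f 0) \<le> e / 2"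
    using mean_in_domain[of "f 0" h] fX h by (metis le0)
  \<comment> \<open>The mean precedes the difference quotients of the old chain.\<close>
  define g where "g = case_nat W (\<lambda>j. quot (f j) h)"
  have quot: "quot (f j) h \<in> D" "eqv (A (quot (f j) h)) (quot (f (Suc j)) h)" if j: "j < k" for j
  proof -
    have fj: "f j \<in> D" "eqv (A (f j)) (f (Suc j))" "f (Suc j) \<in> X"
      using f(1) fX[of "Suc j"] j by (auto simp: chain_def)
    note o = orbit_D[OF fj(1,3,2), of h]
    have d: "S h (f j) - f j \<in> D" using o(1) fj h by (intro D_diff) auto
    then show D: "quot (f j) h \<in> D" unfolding quot_def by (rule D_sc)
    have "eqv (A (S h (f j) - f j)) (A (S h (f j)) - A (f j))"
      using o(1) fj h by (intro D_diff) auto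
    moreover have "eqv (A (S h (f j)) - A (f j)) (S h (f (Suc j)) - f (Suc j))"
      using o fj h by (intro eqv_diff) auto
    ultimately have 1: "eqv (A (S h (f j) - f j)) (S h (f (Suc j)) - f (Suc j))"
      by (rule eqv_trans[rotated 3]) (use o(1) fj h d in auto)
    have "eqv (A (quot (f j) h)) (rsc (1 / h) (A (S h (f j) - f j)))"
      unfolding quot_def using d by (rule D_sc)
    moreover have "eqv (rsc (1 / h) (A (S h (f j) - f j))) (quot (f (Suc j)) h)"
      unfolding quot_def using 1 d fj h by (intro eqv_sc) auto
    ultimately show "eqv (A (quot (f j) h)) (quot (f (Suc j)) h)"
      by (rule eqv_trans[rotated 3]) (use D d fj h in auto)
  qed
  have "chain (Suc k) g"
    unfolding chain_def
  proof (intro conjI allI impI)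
    fix j assume j: "j < Suc k"
    show "g j \<in> D" using j W quot by (cases j) (auto simp: g_def)
    show "eqv (A (g j)) (g (Suc j))" using j W quot by (cases j) (auto simp: g_def)
  qed (use fX[of k] h in \<open>auto simp: g_def\<close>)
  moreover have "N (g 0 - U) < e"
    using N_tri[of W "f 0" U] W f fX[of 0] Suc.prems by (auto simp: g_def)
  ultimately show ?case by blast
qed

end

section \<open>Asymptotics\<close>

lemma increment_bound:
  fixes P :: "real \<Rightarrow> complex"
  assumes K: "finite K" and uv: "u \<le> v" and cont: "continuous_on {u..v} P"
    and der: "\<And>s. s \<in> {u<..<v} - K \<Longrightarrow> (P has_vector_derivative P' s) (at s)"
    and bd: "\<And>s. s \<in> {u<..<v} - K \<Longrightarrow> cmod (P' s) \<le> B" and B: "0 \<le> B"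
  shows "cmod (P v - P u) \<le> B * (v - u)"
proof -
  define Q where "Q = (\<lambda>s. if s \<in> {u<..<v} - K then P' s else 0)"
  have "(Q has_integral (P v - P u)) {u..v}"
    by (rule fundamental_theorem_of_calculus_interior_strong[OF K uv _ cont]) (use der in \<open>auto simp: Q_def\<close>)
  then have "(Q has_integral (P v - P u)) (cbox u v)" by simp
  from has_integral_bound[OF B this] have "cmod (P v - P u) \<le> B * measure lborel (cbox u v)"
    using bd B by (auto simp: Q_def)
  then show ?thesis using uv by simp
qed

lemma taylor_bound:
  fixes f g :: "real \<Rightarrow> complex"
  assumes der: "\<And>s. s \<in> closed_segment x y \<Longrightarrow> (f has_vector_derivative g s) (at s)"
    and bd: "\<And>s. s \<in> closed_segment x y \<Longrightarrow> cmod (g s - g x) \<le> B" and B: "0 \<le> B"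
  shows "cmod (f y - f x - (y - x) *\<^sub>R g x) \<le> B * \<bar>y - x\<bar>"
proof -
  let ?P = "\<lambda>s. f s - s *\<^sub>R g x"
  have d: "(?P has_vector_derivative g s - g x) (at s)" if "s \<in> closed_segment x y" for s
    by (rule derivative_eq_intros der[OF that] | simp)+
  have c: "continuous_on (closed_segment x y) ?P"
    using d by (meson continuous_at_imp_continuous_on has_vector_derivative_continuous)
  have "cmod (?P (max x y) - ?P (min x y)) \<le> B * (max x y - min x y)"
  proof (rule increment_bound[of "{}" _ _ _ "\<lambda>s. g s - g x"])
    show "continuous_on {min x y..max x y} ?P"
      using c by (auto simp: closed_segment_eq_real_ivl min_def max_def split: if_splits)
  qed (use d bd B in \<open>auto simp: closed_segment_eq_real_ivl min_def max_def split: if_splits\<close>)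
  then have "cmod (?P y - ?P x) \<le> B * \<bar>y - x\<bar>"
    by (cases "x \<le> y") (auto simp: max_def min_def norm_minus_commute)
  then show ?thesis by (simp add: algebra_simps)
qed

lemma mult_half_divide: "0 < k \<Longrightarrow> k * (e / (2 * k)) = e / (2::real)"
  by simp

lemma tendsto_zero_cmodI:
  assumes "\<And>e. 0 < e \<Longrightarrow> \<forall>\<^sub>F t in F. cmod (f t) \<le> e"
  shows "(f \<longlongrightarrow> 0) F"
proof (rule tendstoI)
  fix e :: real assume "0 < e"
  then have "\<forall>\<^sub>F t in F. cmod (f t) \<le> e / 2" using assms[of "e / 2"] by simp
  then show "\<forall>\<^sub>F t in F. dist (f t) 0 < e"
    by (rule eventually_mono) (use \<open>0 < e\<close> in auto)
qed

lemma tendsto_zero_cmodD: "(f \<longlongrightarrow> 0) F \<Longrightarrow> 0 < e \<Longrightarrow> \<forall>\<^sub>F t in F. cmod (f t) \<le> e"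
  by (drule tendstoD[of _ _ _ e]) (auto elim!: eventually_mono)

text \<open>A difference quotient over a short step approximates the derivative uniformly in time, and the
difference quotient tends to zero.\<close>

lemma space_derivative_tendsto_zero:
  fixes f g :: "real \<Rightarrow> real \<Rightarrow> complex"
  assumes der: "\<And>x t. x \<in> {a<..<b} \<Longrightarrow> 0 < t \<Longrightarrow> ((\<lambda>x. f x t) has_vector_derivative g x t) (at x)"
    and lip: "\<And>x y t. x \<in> {a<..<b} \<Longrightarrow> y \<in> {a<..<b} \<Longrightarrow> 0 < t \<Longrightarrow> cmod (g x t - g y t) \<le> K * \<bar>x - y\<bar>"
    and lim: "\<And>x. x \<in> {a<..<b} \<Longrightarrow> ((\<lambda>t. f x t) \<longlongrightarrow> 0) at_top"
    and x: "x \<in> {a<..<b}"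
  shows "((\<lambda>t. g x t) \<longlongrightarrow> 0) at_top"
proof (rule tendsto_zero_cmodI)
  fix e :: real assume e: "0 < e"
  define h where "h = min ((b - x) / 2) (e / (2 * (\<bar>K\<bar> + 1)))"
  have hb: "h \<le> (b - x) / 2" unfolding h_def by (rule min.cobounded1)
  have h0: "0 < h" using x e by (auto simp: h_def intro!: divide_pos_pos add_nonneg_pos)
  have h: "0 < h" "x + h \<in> {a<..<b}" using x hb h0 by auto
  have Kh: "\<bar>K\<bar> * h \<le> e / 2"
  proof -
    have "\<bar>K\<bar> * h \<le> (\<bar>K\<bar> + 1) * (e / (2 * (\<bar>K\<bar> + 1)))" using h by (intro mult_mono) (auto simp: h_def)
    also have "\<dots> = e / 2" by (rule mult_half_divide) linarith
    finally show ?thesis .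
  qed
  have "\<forall>\<^sub>F t in at_top. cmod (f (x + h) t) \<le> e * h / 4" "\<forall>\<^sub>F t in at_top. cmod (f x t) \<le> e * h / 4"
    using h e x by (intro tendsto_zero_cmodD[OF lim]; simp)+
  then show "\<forall>\<^sub>F t in at_top. cmod (g x t) \<le> e"
    using eventually_gt_at_top[of 0]
  proof eventually_elim
    case (elim t)
    have seg: "closed_segment x (x + h) = {x..x + h}" using h by (simp add: closed_segment_eq_real_ivl)
    have "cmod (f (x + h) t - f x t - (x + h - x) *\<^sub>R g x t) \<le> (\<bar>K\<bar> * h) * \<bar>x + h - x\<bar>"
    proof (rule taylor_bound)
      show "((\<lambda>x. f x t) has_vector_derivative g s t) (at s)" if "s \<in> closed_segment x (x + h)" for s
        using that h x elim unfolding seg by (intro der) auto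
      show "cmod (g s t - g x t) \<le> \<bar>K\<bar> * h" if "s \<in> closed_segment x (x + h)" for s
      proof -
        have "cmod (g s t - g x t) \<le> K * \<bar>s - x\<bar>"
          using that h x elim unfolding seg by (intro lip) auto
        also have "\<dots> \<le> \<bar>K\<bar> * h" using that unfolding seg by (intro mult_mono) auto
        finally show ?thesis .
      qed
    qed (use h in auto)
    then have "cmod (f (x + h) t - f x t - h *\<^sub>R g x t) \<le> (\<bar>K\<bar> * h) * h" using h by simp
    also have "\<dots> \<le> (e / 2) * h" by (rule mult_right_mono[OF Kh]) (use h in simp)
    finally have "cmod (f (x + h) t - f x t - h *\<^sub>R g x t) \<le> (e / 2) * h" .
    moreover have "h * cmod (g x t) \<le> cmod (f (x + h) t) + cmod (f x t) + cmod (f (x + h) t - f x t - h *\<^sub>R g x t)"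
    proof -
      have "h *\<^sub>R g x t = f (x + h) t - f x t - (f (x + h) t - f x t - h *\<^sub>R g x t)" by simp
      then have "cmod (h *\<^sub>R g x t) \<le> cmod (f (x + h) t - f x t) + cmod (f (x + h) t - f x t - h *\<^sub>R g x t)"
        using norm_triangle_ineq4 by metis
      also have "cmod (f (x + h) t - f x t) \<le> cmod (f (x + h) t) + cmod (f x t)" by (rule norm_triangle_ineq4)
      finally show ?thesis using h by simp
    qed
    ultimately have "h * cmod (g x t) \<le> h * e" using elim by (simp add: algebra_simps)
    then show ?case using h by simp
  qed
qed

text \<open>Landau's interpolation: over a long time step the bounded function \<open>u\<close> has a small difference quotient,
and the second derivative \<open>w\<close> is eventually small enough for the quotient to be close to the derivative.\<close>

lemma time_derivative_tendsto_zero: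
  fixes u v w :: "real \<Rightarrow> complex"
  assumes u: "\<And>t. 0 < t \<Longrightarrow> (u has_vector_derivative v t) (at t)"
    and v: "\<And>t. 0 < t \<Longrightarrow> (v has_vector_derivative w t) (at t)"
    and bd: "\<And>t. 0 < t \<Longrightarrow> cmod (u t) \<le> M" and w: "(w \<longlongrightarrow> 0) at_top"
  shows "(v \<longlongrightarrow> 0) at_top"
proof (rule tendsto_zero_cmodI)
  fix e :: real assume e: "0 < e"
  have M: "0 \<le> M" using bd[of 1] norm_ge_zero[of "u 1"] by linarith
  \<comment> \<open>The step is long, so that the oscillation of the bounded function over it contributes at most half of the tolerance.\<close>
  define h where "h = 4 * (M + 1) / e"
  have h: "0 < h" using e M by (simp add: h_def)
  obtain T where T: "\<And>t. t \<ge> T \<Longrightarrow> cmod (w t) \<le> e / (2 * h)"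
    using tendsto_zero_cmodD[OF w, of "e / (2 * h)"] e h by (auto simp: eventually_at_top_linorder)
  show "\<forall>\<^sub>F t in at_top. cmod (v t) \<le> e"
    unfolding eventually_at_top_linorder
  proof (intro exI[of _ "max T 1"] allI impI)
    fix t assume t: "max T 1 \<le> t"
    have vt: "cmod (v s - v t) \<le> e / (2 * h) * (s - t)" if "t \<le> s" for s
    proof (rule increment_bound[of "{}" _ _ _ w])
      show "continuous_on {t..s} v"
        using t by (intro continuous_at_imp_continuous_on ballI has_vector_derivative_continuous[OF v]) auto
    qed (use that t v T e h in auto)
    have "cmod (u (t + h) - u t - (t + h - t) *\<^sub>R v t) \<le> (e / 2) * \<bar>t + h - t\<bar>"
    proof (rule taylor_bound)
      fix s assume "s \<in> closed_segment t (t + h)"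
      then have s: "t \<le> s" "s \<le> t + h" using h by (auto simp: closed_segment_eq_real_ivl)
      show "(u has_vector_derivative v s) (at s)" using s t by (intro u) auto
      have "cmod (v s - v t) \<le> e / (2 * h) * (s - t)" using vt s by auto
      also have "\<dots> \<le> e / (2 * h) * h" using s e h by (intro mult_left_mono) auto
      also have "\<dots> = e / 2" using h by simp
      finally show "cmod (v s - v t) \<le> e / 2" .
    qed (use e in auto)
    then have 1: "cmod (u (t + h) - u t - h *\<^sub>R v t) \<le> (e / 2) * h" using h by simp
    have "h *\<^sub>R v t = u (t + h) - u t - (u (t + h) - u t - h *\<^sub>R v t)" by simp
    then have "cmod (h *\<^sub>R v t) \<le> cmod (u (t + h) - u t) + cmod (u (t + h) - u t - h *\<^sub>R v t)"
      using norm_triangle_ineq4 by metis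
    moreover have "cmod (u (t + h) - u t) \<le> 2 * M"
      using norm_triangle_ineq4[of "u (t + h)" "u t"] bd[of t] bd[of "t + h"] t h by auto
    ultimately have "h * cmod (v t) \<le> 2 * M + (e / 2) * h" using 1 h by simp
    also have "2 * M \<le> (e / 2) * h" using e by (simp add: h_def)
    finally have "h * cmod (v t) \<le> h * e" by (simp add: algebra_simps)
    then show "cmod (v t) \<le> e" using h by simp
  qed
qed

text \<open>Barbalat's argument: the energy \<open>E\<close> converges, so its mean rate over a short time interval tends to
zero, and the Lipschitz bound compares the mean with the value at the left end.\<close>

lemma dissipation_rate_tendsto_zero:
  fixes E G :: "real \<Rightarrow> real"
  assumes der: "\<And>t. 0 < t \<Longrightarrow> (E has_real_derivative - G t) (at t)"
    and G: "\<And>t. 0 < t \<Longrightarrow> 0 \<le> G t" and E: "\<And>t. 0 < t \<Longrightarrow> 0 \<le> E t"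
    and lip: "\<And>s t. 0 < s \<Longrightarrow> 0 < t \<Longrightarrow> \<bar>G s - G t\<bar> \<le> K * \<bar>s - t\<bar>"
  shows "(G \<longlongrightarrow> 0) at_top"
proof (rule tendstoI)
  fix e :: real assume e: "0 < e"
  define h where "h = e / (2 * (\<bar>K\<bar> + 1))"
  have h: "0 < h" using e by (simp add: h_def)
  have Kh: "\<bar>K\<bar> * h \<le> e / 2"
  proof -
    have "\<bar>K\<bar> * h \<le> (\<bar>K\<bar> + 1) * h" using h by (intro mult_right_mono) auto
    also have "\<dots> = e / 2" unfolding h_def by (rule mult_half_divide) linarith
    finally show ?thesis .
  qed
  have mvt: "\<exists>z. s < z \<and> z < t \<and> E t - E s = (t - s) * (- G z)" if "0 < s" "s < t" for s t
    using that by (intro MVT2 der) auto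
  have dec: "E t \<le> E s" if "0 < s" "s \<le> t" for s t
  proof (cases "s = t")
    case False
    then have st: "0 < s" "s < t" using that by simp_all
    obtain z where "s < z" "E t - E s = (t - s) * (- G z)" using mvt[OF st] by blast
    moreover have "(t - s) * (- G z) \<le> 0" using G[of z] that \<open>s < z\<close> by (intro mult_nonneg_nonpos) auto
    ultimately show ?thesis by simp
  qed simp
  define m where "m = Inf (E ` {0<..})"
  have bdd: "bdd_below (E ` {0<..})" using E by (auto simp: bdd_below_def intro!: exI[of _ 0])
  have "m < m + e * h / 4" using e h by simp
  \<comment> \<open>From here on the energy cannot drop by more than this amount.\<close>
  then obtain T where T: "0 < T" "E T < m + e * h / 4"
    unfolding m_def using cInf_lessD[of "E ` {0<..}" "Inf (E ` {0<..}) + e * h / 4"] by auto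
  have "dist (G t) 0 < e" if t: "T \<le> t" for t
  proof -
    have "m \<le> E (t + h)" unfolding m_def using bdd h t T by (intro cInf_lower) auto
    moreover have "E t \<le> E T" using dec t T by auto
    ultimately have d: "E t - E (t + h) < e * h / 4" using T by linarith
    obtain z where z: "t < z" "z < t + h" "E (t + h) - E t = h * (- G z)"
      using mvt[of t "t + h"] h t T by auto
    then have "h * G z = E t - E (t + h)" by simp
    also have "\<dots> < e * h / 4" by (rule d)
    also have "\<dots> = h * (e / 4)" by simp
    finally have "h * G z < h * (e / 4)" .
    then have "G z < e / 4" using h by simp
    moreover have "G t \<le> G z + \<bar>K\<bar> * h"
    proof -
      have "\<bar>G t - G z\<bar> \<le> K * \<bar>t - z\<bar>" using z t T by (intro lip) auto
      also have "\<dots> \<le> \<bar>K\<bar> * h" using z by (intro mult_mono) auto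
      finally show ?thesis by simp
    qed
    ultimately show ?thesis using Kh G[of t] t T e by (simp add: dist_real_def)
  qed
  then show "\<forall>\<^sub>F t in at_top. dist (G t) 0 < e" by (auto simp: eventually_at_top_linorder)
qed

text \<open>A value above \<open>e\<close> at one point forces values above \<open>e / 2\<close> on an interval whose length does not
depend on time.\<close>

lemma mean_square_tendsto_pointwise:
  fixes f :: "real \<Rightarrow> real \<Rightarrow> complex"
  assumes ab: "a < b"
    and lip: "\<And>x y t. x \<in> {a..b} \<Longrightarrow> y \<in> {a..b} \<Longrightarrow> 0 < t \<Longrightarrow> cmod (f x t - f y t) \<le> K * \<bar>x - y\<bar>"
    and lim: "((\<lambda>t. integral {a..b} (\<lambda>x. (cmod (f x t))\<^sup>2)) \<longlongrightarrow> 0) at_top"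
    and x: "x \<in> {a..b}"
  shows "((\<lambda>t. f x t) \<longlongrightarrow> 0) at_top"
proof (rule tendsto_zero_cmodI)
  fix e :: real assume e: "0 < e"
  define l where "l = min ((b - a) / 2) (e / (2 * (\<bar>K\<bar> + 1)))"
  have "0 < l" using ab e by (auto simp: l_def intro!: divide_pos_pos add_nonneg_pos)
  moreover have "l \<le> (b - a) / 2" unfolding l_def by (rule min.cobounded1)
  ultimately have l: "0 < l" "l \<le> (b - a) / 2" by auto
  have Kl: "\<bar>K\<bar> * l \<le> e / 2"
  proof -
    have "\<bar>K\<bar> * l \<le> (\<bar>K\<bar> + 1) * (e / (2 * (\<bar>K\<bar> + 1)))" using l by (intro mult_mono) (auto simp: l_def)
    also have "\<dots> = e / 2" by (rule mult_half_divide) linarith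
    finally show ?thesis .
  qed
  \<comment> \<open>An interval of length l in [a, b] that contains x, on either side of it.\<close>
  obtain c where c: "a \<le> c" "c + l \<le> b" "c \<le> x" "x \<le> c + l"
  proof (cases "x \<le> (a + b) / 2")
    case True
    have "x + l \<le> b" using True l by (simp add: field_simps)
    then show ?thesis using that[of x] l x by auto
  next
    case False
    have "a \<le> x - l" using False l by (simp add: field_simps)
    then show ?thesis using that[of "x - l"] l x by auto
  qed
  have "\<forall>\<^sub>F t in at_top. dist (integral {a..b} (\<lambda>x. (cmod (f x t))\<^sup>2)) 0 < l * (e / 2)\<^sup>2"
    using lim by (rule tendstoD) (use l e in auto)
  then show "\<forall>\<^sub>F t in at_top. cmod (f x t) \<le> e"
    using eventually_gt_at_top[of 0]
  proof eventually_elim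
    case (elim t)
    show ?case
    proof (rule ccontr)
      assume n: "\<not> cmod (f x t) \<le> e"
      have big: "e / 2 \<le> cmod (f y t)" if "y \<in> {c..c + l}" for y
      proof -
        have "cmod (f x t - f y t) \<le> K * \<bar>x - y\<bar>" using that c x elim by (intro lip) auto
        also have "\<dots> \<le> \<bar>K\<bar> * l" using that c by (intro mult_mono) auto
        finally show ?thesis using n Kl norm_triangle_ineq2[of "f x t" "f y t"] by linarith
      qed
      have ct: "continuous_on {a..b} (\<lambda>x. f x t)"
        unfolding continuous_on_iff
      proof (intro ballI allI impI)
        fix y d :: real assume y: "y \<in> {a..b}" and d: "0 < d"
        have "dist (f z t) (f y t) < d" if "z \<in> {a..b}" "dist z y < d / (\<bar>K\<bar> + 1)" for z
        proof -
          have "cmod (f z t - f y t) \<le> K * \<bar>z - y\<bar>" using that y elim by (intro lip) auto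
          also have "\<dots> \<le> (\<bar>K\<bar> + 1) * \<bar>z - y\<bar>" by (intro mult_right_mono) auto
          also have "\<dots> < (\<bar>K\<bar> + 1) * (d / (\<bar>K\<bar> + 1))" using that by (intro mult_strict_left_mono) (auto simp: dist_real_def)
          finally show ?thesis by (simp add: dist_norm)
        qed
        then show "\<exists>d'>0. \<forall>z\<in>{a..b}. dist z y < d' \<longrightarrow> dist (f z t) (f y t) < d"
          using d by (intro exI[of _ "d / (\<bar>K\<bar> + 1)"]) auto
      qed
      have i1: "(\<lambda>x. (cmod (f x t))\<^sup>2) integrable_on {a..b}"
        using ct by (intro integrable_continuous_interval continuous_intros)
      have i2: "(\<lambda>x. (cmod (f x t))\<^sup>2) integrable_on {c..c + l}"
        by (rule integrable_on_subinterval[OF i1]) (use c in auto)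
      have "integral {c..c + l} (\<lambda>x. (e / 2)\<^sup>2) \<le> integral {c..c + l} (\<lambda>x. (cmod (f x t))\<^sup>2)"
        using big e by (intro integral_le i2) (auto intro!: power_mono)
      also have "\<dots> \<le> integral {a..b} (\<lambda>x. (cmod (f x t))\<^sup>2)"
        using c by (intro integral_subset_le i1 i2) auto
      finally show False using elim l by (simp add: dist_real_def)
    qed
  qed
qed

subsection \<open>Sideways propagation of decay\<close>

text \<open>A finite family of waves \<open>w i\<close> of speeds \<open>c i\<close> on \<open>[a, b]\<close>, coupled through the lower-order terms
\<open>F i\<close>.  The letters \<open>wt\<close>, \<open>wtt\<close> are the time derivatives, \<open>r\<close> is the space derivative with time
derivative \<open>rt\<close>, and \<open>g\<close> is the second space derivative, which is required outside the finite set \<open>K\<close> where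
the coefficients jump.\<close>

locale wave_family =
  fixes I :: "'i set" and a b :: real and K :: "real set" and c :: "'i \<Rightarrow> real" and C \<kappa> M :: real
    and w wt wtt r rt g F :: "'i \<Rightarrow> real \<Rightarrow> real \<Rightarrow> complex"
  assumes fin: "finite I" "finite K"
    and speed: "\<And>i. i \<in> I \<Longrightarrow> 0 < c i" "\<And>i. i \<in> I \<Longrightarrow> 1 / c i \<le> \<kappa>"
    and C: "0 \<le> C"
    and wt_t: "\<And>i x t. i \<in> I \<Longrightarrow> x \<in> {a..b} \<Longrightarrow> 0 < t \<Longrightarrow> (wt i x has_vector_derivative wtt i x t) (at t)"
    and r_t: "\<And>i x t. i \<in> I \<Longrightarrow> x \<in> {a..b} \<Longrightarrow> 0 < t \<Longrightarrow> (r i x has_vector_derivative rt i x t) (at t)"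
    and w_x: "\<And>i x t. i \<in> I \<Longrightarrow> x \<in> {a<..<b} \<Longrightarrow> 0 < t \<Longrightarrow> ((\<lambda>x. w i x t) has_vector_derivative r i x t) (at x)"
    and wt_x: "\<And>i x t. i \<in> I \<Longrightarrow> x \<in> {a<..<b} \<Longrightarrow> 0 < t \<Longrightarrow> ((\<lambda>x. wt i x t) has_vector_derivative rt i x t) (at x)"
    and r_x: "\<And>i x t. i \<in> I \<Longrightarrow> x \<in> {a<..<b} - K \<Longrightarrow> 0 < t \<Longrightarrow> ((\<lambda>x. r i x t) has_vector_derivative g i x t) (at x)"
    and wave: "\<And>i x t. i \<in> I \<Longrightarrow> x \<in> {a<..<b} - K \<Longrightarrow> 0 < t \<Longrightarrow> (c i)\<^sup>2 *\<^sub>R g i x t = wtt i x t + F i x t"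
    and F: "\<And>i x t B. i \<in> I \<Longrightarrow> x \<in> {a<..<b} - K \<Longrightarrow> 0 < t \<Longrightarrow>
        (\<And>j. j \<in> I \<Longrightarrow> cmod (w j x t) \<le> B \<and> cmod (wt j x t) \<le> B) \<Longrightarrow> cmod (F i x t) \<le> C * B"
    and cont: "\<And>i h. i \<in> I \<Longrightarrow> h \<in> {w i, wt i, r i, wtt i, rt i} \<Longrightarrow> continuous_on ({a..b} \<times> {0<..}) (\<lambda>(x, t). h x t)"
    and bounded: "\<And>i x t. i \<in> I \<Longrightarrow> x \<in> {a..b} \<Longrightarrow> 0 < t \<Longrightarrow> cmod (w i x t) \<le> M \<and> cmod (wt i x t) \<le> M \<and> cmod (c i *\<^sub>R r i x t) \<le> M"
begin

text \<open>The space derivative is scaled by the speed, so that sums and differences of the last two entries are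
the Riemann invariants below.\<close>

definition small :: "real \<Rightarrow> real \<Rightarrow> real \<Rightarrow> bool" where
  "small B x t \<longleftrightarrow> (\<forall>i\<in>I. cmod (w i x t) \<le> B \<and> cmod (wt i x t) \<le> B \<and> cmod (c i *\<^sub>R r i x t) \<le> B)"

definition decays :: "real \<Rightarrow> bool" where
  "decays x \<longleftrightarrow> (\<forall>e>0. \<forall>\<^sub>F t in at_top. small e x t)"

text \<open>The two Riemann invariants, for \<open>\<sigma> = 1\<close> and \<open>\<sigma> = -1\<close>.\<close>

definition riem :: "real \<Rightarrow> 'i \<Rightarrow> real \<Rightarrow> real \<Rightarrow> complex" where
  "riem \<sigma> i x t = wt i x t + (\<sigma> * c i) *\<^sub>R r i x t"

text \<open>Along a characteristic the Riemann invariant changes only through the coupling.\<close>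

lemma riem_derivative:
  assumes i: "i \<in> I" and x: "x \<in> {a<..<b} - K" and \<sigma>: "\<bar>\<sigma>\<bar> = 1" and \<tau>: "0 < q - \<sigma> * x / c i"
  shows "((\<lambda>s. riem \<sigma> i s (q - \<sigma> * s / c i)) has_vector_derivative (\<sigma> / c i) *\<^sub>R F i x (q - \<sigma> * x / c i)) (at x)"
proof -
  let ?t = "q - \<sigma> * x / c i"
  let ?D = "\<lambda>x t. wtt i x t + (\<sigma> * c i) *\<^sub>R rt i x t"
  have ci: "c i \<noteq> 0" using speed(1)[OF i] by simp
  have \<sigma>2: "\<sigma> * \<sigma> = 1" using \<sigma> by (metis abs_mult_self_eq mult_1)
  have fx: "((\<lambda>x. riem \<sigma> i x ?t) has_derivative (\<lambda>h. h *\<^sub>R (rt i x ?t + (\<sigma> * c i) *\<^sub>R g i x ?t))) (at x within {a<..<b})"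
  proof -
    have "((\<lambda>x. riem \<sigma> i x ?t) has_vector_derivative (rt i x ?t + (\<sigma> * c i) *\<^sub>R g i x ?t)) (at x)"
      unfolding riem_def by (intro derivative_intros wt_x[OF i] r_x[OF i] bounded_linear.has_vector_derivative[OF bounded_linear_scaleR_right]) (use x \<tau> in auto)
    then show ?thesis unfolding has_vector_derivative_def by (rule has_derivative_at_withinI)
  qed
  have fy: "(riem \<sigma> i x' has_derivative blinfun_apply (blinfun_scaleR_left (?D x' t))) (at t within {0<..})"
    if "x' \<in> {a<..<b}" "t \<in> {0<..}" for x' t
  proof -
    have "(riem \<sigma> i x' has_vector_derivative ?D x' t) (at t)"
      unfolding riem_def by (intro derivative_intros wt_t[OF i] r_t[OF i] bounded_linear.has_vector_derivative[OF bounded_linear_scaleR_right]) (use that in auto)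
    then show ?thesis unfolding has_vector_derivative_def by (simp add: has_derivative_at_withinI)
  qed
  have D: "continuous_on ({a<..<b} \<times> {0<..}) (\<lambda>p. wtt i (fst p) (snd p) + (\<sigma> * c i) *\<^sub>R rt i (fst p) (snd p))"
  proof -
    have "continuous_on ({a..b} \<times> {0<..}) (\<lambda>p. wtt i (fst p) (snd p) + (\<sigma> * c i) *\<^sub>R rt i (fst p) (snd p))"
      using cont[OF i, of "wtt i"] cont[OF i, of "rt i"]
      by (intro continuous_intros) (auto simp: case_prod_beta')
    then show ?thesis by (rule continuous_on_subset) auto
  qed
  have fyc: "continuous (at (x, ?t) within {a<..<b} \<times> {0<..}) (\<lambda>(x, t). blinfun_scaleR_left (?D x t))"
  proof -
    have "continuous_on ({a<..<b} \<times> {0<..}) (\<lambda>p. blinfun_scaleR_left (wtt i (fst p) (snd p) + (\<sigma> * c i) *\<^sub>R rt i (fst p) (snd p)))"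
      by (intro bounded_linear.continuous_on[OF bounded_linear_blinfun_scaleR_left] D)
    then show ?thesis using x \<tau> by (auto simp: continuous_on_eq_continuous_within case_prod_beta')
  qed
  have "((\<lambda>(x, t). riem \<sigma> i x t) has_derivative (\<lambda>(tx, ty). tx *\<^sub>R (rt i x ?t + (\<sigma> * c i) *\<^sub>R g i x ?t)
        + blinfun_apply (blinfun_scaleR_left (?D x ?t)) ty)) (at (x, ?t) within {a<..<b} \<times> {0<..})"
    by (rule has_derivative_partialsI[OF fx fy fyc]) (use \<tau> in auto)
  moreover have "at (x, ?t) within {a<..<b} \<times> {0<..} = at (x, ?t)"
    using x \<tau> by (intro at_within_open) (auto intro!: open_Times)
  ultimately have d: "((\<lambda>(x, t). riem \<sigma> i x t) has_derivative (\<lambda>(tx, ty). tx *\<^sub>R (rt i x ?t + (\<sigma> * c i) *\<^sub>R g i x ?t)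
        + ty *\<^sub>R ?D x ?t)) (at (x, ?t))" by simp
  have path: "((\<lambda>s. (s, q - \<sigma> * s / c i)) has_derivative (\<lambda>h. (h, - \<sigma> * h / c i))) (at x)"
    by (rule derivative_eq_intros refl | simp add: ci)+
  have "((\<lambda>s. (\<lambda>(x, t). riem \<sigma> i x t) (s, q - \<sigma> * s / c i)) has_derivative
      (\<lambda>h. h *\<^sub>R (rt i x ?t + (\<sigma> * c i) *\<^sub>R g i x ?t) + (- \<sigma> * h / c i) *\<^sub>R ?D x ?t)) (at x)"
    using has_derivative_compose[OF path d] by simp
  moreover have "h *\<^sub>R (rt i x ?t + (\<sigma> * c i) *\<^sub>R g i x ?t) + (- \<sigma> * h / c i) *\<^sub>R ?D x ?t = h *\<^sub>R ((\<sigma> / c i) *\<^sub>R F i x ?t)" for h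
  proof -
    have "(\<sigma> * c i) *\<^sub>R g i x ?t = (\<sigma> / c i) *\<^sub>R ((c i)\<^sup>2 *\<^sub>R g i x ?t)"
      using ci by (simp add: power2_eq_square)
    also have "(c i)\<^sup>2 *\<^sub>R g i x ?t = wtt i x ?t + F i x ?t" by (rule wave[OF i x \<tau>])
    finally have gg: "(\<sigma> * c i) *\<^sub>R g i x ?t = (\<sigma> / c i) *\<^sub>R (wtt i x ?t + F i x ?t)" .
    have "(- \<sigma> * h / c i) *\<^sub>R ((\<sigma> * c i) *\<^sub>R rt i x ?t) = (- h) *\<^sub>R rt i x ?t"
    proof -
      have "(- \<sigma> * h / c i) * (\<sigma> * c i) = - h * (\<sigma> * \<sigma>)" using ci by (simp add: field_simps)
      then have "(- \<sigma> * h / c i) * (\<sigma> * c i) = - h" unfolding \<sigma>2 by simp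
      then show ?thesis by (simp only: scaleR_scaleR)
    qed
    then have 1: "(- \<sigma> * h / c i) *\<^sub>R ((\<sigma> * c i) *\<^sub>R rt i x ?t) = - (h *\<^sub>R rt i x ?t)" by (simp only: scaleR_minus_left)
    have 2: "(- \<sigma> * h / c i) *\<^sub>R wtt i x ?t = - (h *\<^sub>R (\<sigma> / c i) *\<^sub>R wtt i x ?t)" by (simp add: mult.commute)
    show ?thesis unfolding gg scaleR_add_right 1 2 by (simp only: algebra_simps) simp
  qed
  ultimately show ?thesis unfolding has_vector_derivative_def by simp
qed

lemma riem_increment:
  assumes i: "i \<in> I" and \<sigma>: "\<bar>\<sigma>\<bar> = 1" and uv: "a \<le> u" "u \<le> v" "v \<le> b"
    and pos: "\<And>s. s \<in> {u..v} \<Longrightarrow> 0 < q - \<sigma> * s / c i"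
    and sm: "\<And>s. s \<in> {u..v} \<Longrightarrow> small B s (q - \<sigma> * s / c i)" and B: "0 \<le> B"
  shows "cmod (riem \<sigma> i v (q - \<sigma> * v / c i) - riem \<sigma> i u (q - \<sigma> * u / c i)) \<le> (\<kappa> * (C * B)) * (v - u)"
proof (rule increment_bound[OF fin(2) uv(2), of _ "\<lambda>x. (\<sigma> / c i) *\<^sub>R F i x (q - \<sigma> * x / c i)"])
  have \<kappa>: "0 \<le> \<kappa>" using speed[OF i] by (meson divide_pos_pos less_imp_le order.trans zero_less_one)
  show "0 \<le> \<kappa> * (C * B)" using \<kappa> C B by auto
  have ci: "c i \<noteq> 0" using speed(1)[OF i] by simp
  have path: "continuous_on {u..v} (\<lambda>s. (s, q - \<sigma> * s / c i))"
    by (intro continuous_on_Pair continuous_on_id continuous_on_diff continuous_on_const continuous_on_divide continuous_on_mult)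
      (simp add: ci)
  have cc: "continuous_on {u..v} (\<lambda>s. h s (q - \<sigma> * s / c i))" if "h \<in> {w i, wt i, r i, wtt i, rt i}" for h
  proof -
    have "continuous_on {u..v} ((\<lambda>(x, t). h x t) \<circ> (\<lambda>s. (s, q - \<sigma> * s / c i)))"
      using cont[OF i that] uv pos by (intro continuous_on_compose path) (auto elim!: continuous_on_subset)
    then show ?thesis by (simp add: o_def)
  qed
  show "continuous_on {u..v} (\<lambda>s. riem \<sigma> i s (q - \<sigma> * s / c i))"
    unfolding riem_def by (intro continuous_intros cc) auto
  fix s assume s: "s \<in> {u<..<v} - K"
  then have s': "s \<in> {a<..<b} - K" "s \<in> {u..v}" using uv by auto
  show "((\<lambda>s. riem \<sigma> i s (q - \<sigma> * s / c i)) has_vector_derivative (\<sigma> / c i) *\<^sub>R F i s (q - \<sigma> * s / c i)) (at s)"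
    by (rule riem_derivative[OF i s'(1) \<sigma> pos[OF s'(2)]])
  have "cmod (F i s (q - \<sigma> * s / c i)) \<le> C * B"
    by (rule F[OF i s'(1) pos[OF s'(2)]]) (use sm[OF s'(2)] in \<open>auto simp: small_def\<close>)
  moreover have "\<bar>\<sigma> / c i\<bar> \<le> \<kappa>" using speed[OF i] \<sigma> by simp
  ultimately show "cmod ((\<sigma> / c i) *\<^sub>R F i s (q - \<sigma> * s / c i)) \<le> \<kappa> * (C * B)"
    unfolding norm_scaleR by (intro mult_mono) (use \<kappa> in auto)
qed

text \<open>On a short space interval around \<open>x0\<close> the Riemann invariants at a point are those at
\<open>x0\<close>, taken at a time shifted by at most \<open>\<rho> \<kappa>\<close>, plus an integral of the lower-order terms.  The former tend to
zero, and the latter is at most half of any bound \<open>B\<close> that holds already.  So an eventual bound improves by a fixed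
factor, in a space-time region that begins a little later.\<close>

lemma contraction_step:
  assumes x0: "x0 \<in> {a..b}" and dec: "decays x0" and \<rho>: "0 \<le> \<rho>" "\<rho> * \<kappa> * (C + 1) \<le> 1 / 2" and \<kappa>: "0 \<le> \<kappa>"
    and B: "0 < B" and T: "\<And>x t. x \<in> {a..b} \<Longrightarrow> \<bar>x - x0\<bar> \<le> \<rho> \<Longrightarrow> t \<ge> T \<Longrightarrow> small B x t"
  shows "\<exists>T'. \<forall>x t. x \<in> {a..b} \<longrightarrow> \<bar>x - x0\<bar> \<le> \<rho> \<longrightarrow> t \<ge> T' \<longrightarrow> small (3/4 * B) x t"
proof -
  \<comment> \<open>With this constant a Riemann invariant is at most a quarter of the bound, and the coupling adds at most one half.\<close>
  obtain T0 where T0: "\<And>t. t \<ge> T0 \<Longrightarrow> small (B / 8) x0 t"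
    using dec B unfolding decays_def eventually_at_top_linorder by (metis divide_pos_pos zero_less_numeral)
  \<comment> \<open>Characteristics leaving after this time meet the base line, and all points between, after T and T0.\<close>
  define T' where "T' = max (max T T0) 1 + \<rho> * \<kappa> + 1"
  have \<rho>\<kappa>: "0 \<le> \<rho> * \<kappa>" using \<rho> \<kappa> by auto
  have \<rho>\<kappa>C: "\<rho> * \<kappa> * C \<le> 1 / 2" "\<rho> * \<kappa> \<le> 1 / 2"
    using \<rho>(2) mult_nonneg_nonneg[OF \<rho>\<kappa> C] \<rho>\<kappa> by (auto simp: distrib_left)
  have "small (3/4 * B) x t" if x: "x \<in> {a..b}" "\<bar>x - x0\<bar> \<le> \<rho>" and t: "t \<ge> T'" for x t
    unfolding small_def
  proof
    fix i assume i: "i \<in> I"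
    define u v where "u = min x x0" and "v = max x x0"
    have uv: "a \<le> u" "u \<le> v" "v \<le> b" "v - u = \<bar>x - x0\<bar>" using x x0 by (auto simp: u_def v_def)
    have near: "s \<in> {a..b}" "\<bar>s - x0\<bar> \<le> \<rho>" "\<bar>s - x\<bar> \<le> \<rho>" if "s \<in> {u..v}" for s
      using that x x0 by (auto simp: u_def v_def min_def max_def split: if_splits)
    have ci: "0 < c i" "1 / c i \<le> \<kappa>" using speed[OF i] by auto
    have p: "cmod (riem \<sigma> i x t) \<le> 3/4 * B" if \<sigma>: "\<bar>\<sigma>\<bar> = 1" for \<sigma>
    proof -
      \<comment> \<open>The characteristic through the point, in the form time = q - sigma * place / speed.\<close>
      define q where "q = t + \<sigma> * x / c i"
      have path: "q - \<sigma> * s / c i \<ge> max (max T T0) 1" if "s \<in> {u..v}" for s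
      proof -
        have "\<bar>\<sigma> * (x - s) / c i\<bar> = \<bar>s - x\<bar> * (1 / c i)" using \<sigma> ci by (simp add: abs_mult)
        also have "\<dots> \<le> \<rho> * \<kappa>" using near(3)[OF that] ci \<rho> by (intro mult_mono) auto
        finally have "- (\<rho> * \<kappa>) \<le> \<sigma> * (x - s) / c i" by linarith
        moreover have "q - \<sigma> * s / c i = t + \<sigma> * (x - s) / c i"
          by (simp add: q_def right_diff_distrib diff_divide_distrib)
        ultimately show ?thesis using t unfolding T'_def by linarith
      qed
      have "cmod (riem \<sigma> i v (q - \<sigma> * v / c i) - riem \<sigma> i u (q - \<sigma> * u / c i)) \<le> (\<kappa> * (C * B)) * (v - u)"
      proof (rule riem_increment[OF i \<sigma> uv(1-3)])
        fix s assume s: "s \<in> {u..v}"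
        show "0 < q - \<sigma> * s / c i" using path[OF s] by simp
        show "small B s (q - \<sigma> * s / c i)" using path[OF s] near[OF s] by (intro T) auto
      qed (use B in auto)
      also have "\<dots> \<le> (\<kappa> * (C * B)) * \<rho>" using uv(4) x \<kappa> C B by (intro mult_left_mono) auto
      also have "\<dots> = (\<rho> * \<kappa> * C) * B" by simp
      also have "\<dots> \<le> 1 / 2 * B" using \<rho>\<kappa>C B by (intro mult_right_mono) auto
      finally have "cmod (riem \<sigma> i v (q - \<sigma> * v / c i) - riem \<sigma> i u (q - \<sigma> * u / c i)) \<le> 1 / 2 * B" .
      then have "cmod (riem \<sigma> i x (q - \<sigma> * x / c i) - riem \<sigma> i x0 (q - \<sigma> * x0 / c i)) \<le> 1 / 2 * B"
        by (cases "x \<le> x0") (auto simp: u_def v_def norm_minus_commute)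
      then have 1: "cmod (riem \<sigma> i x t - riem \<sigma> i x0 (q - \<sigma> * x0 / c i)) \<le> 1 / 2 * B" by (simp add: q_def)
      have "x0 \<in> {u..v}" by (auto simp: u_def v_def)
      then have "small (B / 8) x0 (q - \<sigma> * x0 / c i)" using path T0 by auto
      then have "cmod (wt i x0 (q - \<sigma> * x0 / c i)) \<le> B / 8" "cmod (c i *\<^sub>R r i x0 (q - \<sigma> * x0 / c i)) \<le> B / 8"
        using i by (auto simp: small_def)
      moreover have "cmod (riem \<sigma> i x0 (q - \<sigma> * x0 / c i))
          \<le> cmod (wt i x0 (q - \<sigma> * x0 / c i)) + cmod (c i *\<^sub>R r i x0 (q - \<sigma> * x0 / c i))"
        unfolding riem_def using \<sigma> by (intro order.trans[OF norm_triangle_ineq]) (simp add: abs_mult)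
      ultimately have 2: "cmod (riem \<sigma> i x0 (q - \<sigma> * x0 / c i)) \<le> B / 4" by linarith
      have "cmod (riem \<sigma> i x t) \<le> cmod (riem \<sigma> i x t - riem \<sigma> i x0 (q - \<sigma> * x0 / c i)) + cmod (riem \<sigma> i x0 (q - \<sigma> * x0 / c i))"
        using norm_triangle_sub[of "riem \<sigma> i x t" "riem \<sigma> i x0 (q - \<sigma> * x0 / c i)"] by simp
      then show ?thesis using 1 2 by simp
    qed
    have p1: "cmod (riem 1 i x t) \<le> 3/4 * B" and p2: "cmod (riem (-1) i x t) \<le> 3/4 * B" using p by auto
    \<comment> \<open>The two invariants determine both derivatives.\<close>
    have "2 *\<^sub>R wt i x t = riem 1 i x t + riem (-1) i x t" by (simp add: riem_def scaleR_2)
    then have "cmod (2 *\<^sub>R wt i x t) \<le> 2 * (3/4 * B)" using norm_triangle_mono[OF p1 p2] by simp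
    then have A1: "cmod (wt i x t) \<le> 3/4 * B" by simp
    have "2 *\<^sub>R (c i *\<^sub>R r i x t) = riem 1 i x t - riem (-1) i x t" by (simp add: riem_def scaleR_conv_of_real)
    then have "cmod (2 *\<^sub>R (c i *\<^sub>R r i x t)) \<le> 2 * (3/4 * B)" using norm_triangle_ineq4[of "riem 1 i x t" "riem (-1) i x t"] p1 p2 by simp
    then have A2: "cmod (c i *\<^sub>R r i x t) \<le> 3/4 * B" by simp
    have tt: "t > 0" "t \<ge> T" "t \<ge> T0" using t \<rho>\<kappa> by (auto simp: T'_def)
    have "cmod (w i v t - w i u t) \<le> (\<kappa> * B) * (v - u)"
    proof (rule increment_bound[of "{}" _ _ _ "\<lambda>x. r i x t"])
      show "continuous_on {u..v} (\<lambda>x. w i x t)"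
      proof -
        have "continuous_on {u..v} ((\<lambda>(x, t). w i x t) \<circ> (\<lambda>s. (s, t)))"
          using cont[OF i, of "w i"] uv tt by (intro continuous_on_compose continuous_intros) (auto elim!: continuous_on_subset)
        then show ?thesis by (simp add: o_def)
      qed
      fix s assume s: "s \<in> {u<..<v} - {}"
      show "((\<lambda>x. w i x t) has_vector_derivative r i s t) (at s)" using s uv tt by (intro w_x[OF i]) auto
      have "small B s t" using near[of s] s tt by (intro T) auto
      then have "c i * cmod (r i s t) \<le> B" using i ci by (auto simp: small_def)
      then have "cmod (r i s t) \<le> (1 / c i) * B" using ci by (simp add: field_simps)
      also have "\<dots> \<le> \<kappa> * B" using ci B by (intro mult_right_mono) auto
      finally show "cmod (r i s t) \<le> \<kappa> * B" .
    qed (use uv \<kappa> B in auto)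
    also have "\<dots> \<le> (\<kappa> * B) * \<rho>" using uv(4) x \<kappa> B by (intro mult_left_mono) auto
    also have "\<dots> = (\<rho> * \<kappa>) * B" by simp
    also have "\<dots> \<le> 1 / 2 * B" using \<rho>\<kappa>C B by (intro mult_right_mono) auto
    finally have "cmod (w i v t - w i u t) \<le> 1 / 2 * B" .
    then have "cmod (w i x t - w i x0 t) \<le> 1 / 2 * B"
      by (cases "x \<le> x0") (auto simp: u_def v_def norm_minus_commute)
    moreover have "cmod (w i x0 t) \<le> B / 8" using T0[OF tt(3)] i by (auto simp: small_def)
    ultimately have A3: "cmod (w i x t) \<le> 3/4 * B" using norm_triangle_sub[of "w i x t" "w i x0 t"] B by simp
    show "cmod (w i x t) \<le> 3 / 4 * B \<and> cmod (wt i x t) \<le> 3 / 4 * B \<and> cmod (c i *\<^sub>R r i x t) \<le> 3 / 4 * B"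
      using A1 A2 A3 by blast
  qed
  then show ?thesis by blast
qed

text \<open>Iterating the improvement of the bound starts from the global bound on the family.\<close>

lemma decays_nearby:
  assumes x0: "x0 \<in> {a..b}" and dec: "decays x0" and \<rho>: "0 \<le> \<rho>" "\<rho> * \<kappa> * (C + 1) \<le> 1 / 2" and \<kappa>: "0 \<le> \<kappa>"
    and x: "x \<in> {a..b}" "\<bar>x - x0\<bar> \<le> \<rho>"
  shows "decays x"
proof -
  define M' where "M' = \<bar>M\<bar> + 1"
  have it: "\<exists>T. \<forall>x t. x \<in> {a..b} \<longrightarrow> \<bar>x - x0\<bar> \<le> \<rho> \<longrightarrow> t \<ge> T \<longrightarrow> small ((3/4) ^ n * M') x t" for n
  proof (induction n)
    case 0
    have "small M' x t" if "x \<in> {a..b}" "t \<ge> 1" for x t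
      unfolding small_def
    proof
      fix i assume "i \<in> I"
      then show "cmod (w i x t) \<le> M' \<and> cmod (wt i x t) \<le> M' \<and> cmod (c i *\<^sub>R r i x t) \<le> M'"
        using bounded[of i x t] that unfolding M'_def by linarith
    qed
    then show ?case by auto
  next
    case (Suc n)
    then obtain T where T: "\<And>x t. x \<in> {a..b} \<Longrightarrow> \<bar>x - x0\<bar> \<le> \<rho> \<Longrightarrow> t \<ge> T \<Longrightarrow> small ((3/4) ^ n * M') x t" by blast
    from contraction_step[OF x0 dec \<rho> \<kappa> _ T] show ?case by (simp add: M'_def mult.assoc)
  qed
  show ?thesis unfolding decays_def
  proof (intro allI impI)
    fix e :: real assume e: "0 < e"
    have "(\<lambda>n. (3/4::real) ^ n * M') \<longlonglongrightarrow> 0 * M'" by (intro tendsto_intros LIMSEQ_power_zero) auto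
    then obtain n where "(3/4::real) ^ n * M' < e"
      using order_tendstoD(2)[of _ "0 * M'" sequentially e] e by (auto simp: eventually_sequentially)
    moreover obtain T where "\<And>t. t \<ge> T \<Longrightarrow> small ((3/4) ^ n * M') x t" using it[of n] x by blast
    ultimately have "small e x t" if "t \<ge> T" for t
      using that unfolding small_def by (meson less_imp_le order.trans)
    then show "\<forall>\<^sub>F t in at_top. small e x t" by (auto simp: eventually_at_top_linorder)
  qed
qed

text \<open>The length of the step does not depend on the base point, so finitely many steps reach every point of the interval.\<close>

theorem decay_spreads:
  assumes x0: "x0 \<in> {a..b}" and dec: "decays x0" and x: "x \<in> {a..b}" and \<kappa>: "0 \<le> \<kappa>"
  shows "decays x"
proof -
  define \<rho> where "\<rho> = 1 / (2 * (\<kappa> + 1) * (C + 1))"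
  have \<rho>: "0 < \<rho>" using \<kappa> C by (simp add: \<rho>_def)
  have \<rho>2: "\<rho> * \<kappa> * (C + 1) \<le> 1 / 2"
  proof -
    have "\<rho> * \<kappa> * (C + 1) \<le> \<rho> * (\<kappa> + 1) * (C + 1)" using \<rho> \<kappa> C by (intro mult_right_mono mult_left_mono) auto
    also have "\<dots> = 1 / 2" using \<kappa> C by (simp add: \<rho>_def)
    finally show ?thesis .
  qed
  have "\<forall>x\<in>{a..b}. \<bar>x - x0\<bar> \<le> real n * \<rho> \<longrightarrow> decays x" for n
  proof (induction n)
    case 0 then show ?case using dec by auto
  next
    case (Suc n)
    show ?case
    proof (intro ballI impI)
      fix x assume x: "x \<in> {a..b}" "\<bar>x - x0\<bar> \<le> real (Suc n) * \<rho>"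
      \<comment> \<open>One step back towards the base point, without passing it.\<close>
      define y where "y = (if x \<ge> x0 then max x0 (x - \<rho>) else min x0 (x + \<rho>))"
      have y: "y \<in> {a..b}" "\<bar>x - y\<bar> \<le> \<rho>" using x x0 \<rho> by (auto simp: y_def)
      have "\<bar>y - x0\<bar> \<le> real n * \<rho>"
        using x \<rho> by (auto simp: y_def abs_if algebra_simps max_def min_def)
      then have "decays y" using Suc y by blast
      then show "decays x" using decays_nearby[OF y(1) _ _ \<rho>2 \<kappa> x(1) y(2)] \<rho> by auto
    qed
  qed
  moreover obtain n where "\<bar>x - x0\<bar> / \<rho> \<le> real n" using real_arch_simple by blast
  ultimately show ?thesis using x \<rho> by (auto simp: field_simps)
qed

end

section \<open>Square-integrable functions and Sobolev functions on an interval\<close>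

abbreviation sqint :: "real \<Rightarrow> real \<Rightarrow> (real \<Rightarrow> complex) \<Rightarrow> real" where
  "sqint a b f \<equiv> (LINT x:{a<..<b}|lborel. (cmod (f x))\<^sup>2)"

lemma set_integrable_const: "set_integrable lborel {c<..<d::real} (\<lambda>x. k::'b::{banach,second_countable_topology})"
  unfolding set_integrable_def
proof (intro integrable_scaleR_left integrable_real_indicator)
  show "emeasure lborel {c<..<d} < \<infinity>"
    using emeasure_lborel_box_finite[of c d] by (simp only: box_real)
qed simp

lemma set_integral_constant: "(c::real) \<le> d \<Longrightarrow> (LINT x:{c<..<d}|lborel. k::'b::{banach,second_countable_topology}) = (d - c) *\<^sub>R k"
  unfolding set_lebesgue_integral_def by simp

lemma set_integral_ge_0:
  fixes f :: "real \<Rightarrow> real"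
  assumes "\<And>x. x \<in> A \<Longrightarrow> 0 \<le> f x"
  shows "0 \<le> (LINT x:A|lborel. f x)"
  unfolding set_lebesgue_integral_def
  by (rule integral_nonneg_AE) (use assms in \<open>auto simp: indicator_def\<close>)

lemma set_integral_cong_AE':
  fixes f g :: "real \<Rightarrow> 'b::{banach,second_countable_topology}"
  assumes "AE x in lborel. x \<in> A \<longrightarrow> f x = g x" "set_borel_measurable lborel A f" "set_borel_measurable lborel A g"
  shows "(LINT x:A|lborel. f x) = (LINT x:A|lborel. g x)"
  unfolding set_lebesgue_integral_def
proof (rule integral_cong_AE)
  show "AE x in lborel. indicator A x *\<^sub>R f x = indicator A x *\<^sub>R g x"
    using assms(1) by eventually_elim (auto simp: indicator_def)
qed (use assms in \<open>auto simp: set_borel_measurable_def\<close>)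

lemma set_integral_mono_subset:
  fixes f :: "real \<Rightarrow> real"
  assumes "set_integrable lborel B f" "A \<subseteq> B" "A \<in> sets lborel" "\<And>x. x \<in> B \<Longrightarrow> 0 \<le> f x"
  shows "(LINT x:A|lborel. f x) \<le> (LINT x:B|lborel. f x)"
proof -
  have "set_integrable lborel A f" using set_integrable_subset[OF assms(1,3,2)] .
  then show ?thesis using assms(1) unfolding set_lebesgue_integral_def set_integrable_def
    by (rule integral_mono) (use assms(2,4) in \<open>auto simp: indicator_def\<close>)
qed

lemma L2_integrable_sq: "f \<in> L2 a b \<Longrightarrow> set_integrable lborel {a<..<b} (\<lambda>x. (cmod (f x))\<^sup>2)"
  by (simp add: L2_def)

lemma L2_measurable: "f \<in> L2 a b \<Longrightarrow> set_borel_measurable lborel {a<..<b} f"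
  by (simp add: L2_def)

lemma L2_integrable:
  assumes "f \<in> L2 a b"
  shows "set_integrable lborel {a<..<b} f"
proof -
  have m: "set_borel_measurable lborel {a<..<b} f" using assms by (rule L2_measurable)
  have c: "set_integrable lborel {a<..<b} (\<lambda>x. 1::real)"
    by (rule set_integrable_const)
  have "set_integrable lborel {a<..<b} (\<lambda>x. 1 + (cmod (f x))\<^sup>2)"
    using c L2_integrable_sq[OF assms] by (rule set_integral_add)
  moreover have "cmod z \<le> 1 + (cmod z)\<^sup>2" for z
    using sum_power2_ge_zero[of "cmod z - 1/2" 0] by (simp add: power2_eq_square algebra_simps)
  ultimately show ?thesis
    using set_integrable_bound[OF _ m] by fastforce
qed

lemma L2_integrable_sub:
  assumes "f \<in> L2 a b" "a \<le> c" "d \<le> b"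
  shows "set_integrable lborel {c<..<d} f"
  by (rule set_integrable_subset[OF L2_integrable[OF assms(1)]]) (use assms in auto)

lemma L2_scale: "f \<in> L2 a b \<Longrightarrow> (\<lambda>x. k * f x) \<in> L2 a b"
  unfolding L2_def set_borel_measurable_def
  by (auto simp: norm_mult power_mult_distrib simp flip: mult_scaleR_right)

lemma sq_norm_add_le: "(cmod (z + w))\<^sup>2 \<le> 2 * (cmod z)\<^sup>2 + 2 * (cmod w)\<^sup>2"
proof -
  have "(cmod (z + w))\<^sup>2 \<le> (cmod z + cmod w)\<^sup>2" by (simp add: norm_triangle_ineq power_mono)
  also have "\<dots> \<le> 2 * (cmod z)\<^sup>2 + 2 * (cmod w)\<^sup>2"
    using zero_le_power2[of "cmod z - cmod w"] by (simp add: power2_eq_square algebra_simps)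
  finally show ?thesis .
qed

lemma L2_add:
  assumes "f \<in> L2 a b" "g \<in> L2 a b"
  shows "(\<lambda>x. f x + g x) \<in> L2 a b"
proof -
  have m: "set_borel_measurable lborel {a<..<b} (\<lambda>x. f x + g x)"
    using L2_measurable[OF assms(1)] L2_measurable[OF assms(2)]
    by (simp add: set_borel_measurable_def scaleR_add_right)
  have m2: "set_borel_measurable lborel {a<..<b} (\<lambda>x. (cmod (f x + g x))\<^sup>2)"
  proof -
    have "(\<lambda>x. (cmod (indicator {a<..<b} x *\<^sub>R (f x + g x)))\<^sup>2) \<in> borel_measurable lborel"
      using m unfolding set_borel_measurable_def by measurable
    moreover have "(\<lambda>x. (cmod (indicator {a<..<b} x *\<^sub>R (f x + g x)))\<^sup>2)
        = (\<lambda>x. indicat_real {a<..<b} x *\<^sub>R (cmod (f x + g x))\<^sup>2)"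
      by (auto simp: indicator_def)
    ultimately show ?thesis unfolding set_borel_measurable_def by metis
  qed
  have "set_integrable lborel {a<..<b} (\<lambda>x. 2 * (cmod (f x))\<^sup>2 + 2 * (cmod (g x))\<^sup>2)"
    using assms by (intro set_integral_add set_integrable_mult_right L2_integrable_sq)
  then have "set_integrable lborel {a<..<b} (\<lambda>x. (cmod (f x + g x))\<^sup>2)"
    using m2 by (rule set_integrable_bound) (use sq_norm_add_le in auto)
  with m show ?thesis by (simp add: L2_def)
qed

lemma L2_diff:
  assumes "f \<in> L2 a b" "g \<in> L2 a b"
  shows "(\<lambda>x. f x - g x) \<in> L2 a b"
  using L2_add[OF assms(1) L2_scale[OF assms(2), of "-1"]] by simp

lemma L2_zero: "(\<lambda>x. 0) \<in> L2 a b"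
  by (simp add: L2_def set_borel_measurable_def set_integrable_def)

lemma sqint_nonneg: "sqint a b f \<ge> 0"
  by (rule set_integral_ge_0) auto

lemma ae_eq_refl: "ae_eq a b f f" by (simp add: ae_eq_def)
lemma ae_eq_sym: "ae_eq a b f g \<Longrightarrow> ae_eq a b g f"
  unfolding ae_eq_def by (elim AE_mp) auto
lemma ae_eq_trans: "ae_eq a b f g \<Longrightarrow> ae_eq a b g h \<Longrightarrow> ae_eq a b f h"
  unfolding ae_eq_def by (elim AE_mp[OF AE_conjI]) auto

lemma ae_eq_binop:
  assumes "ae_eq a b f f'" "ae_eq a b g g'"
  shows "ae_eq a b (\<lambda>x. F x (f x) (g x)) (\<lambda>x. F x (f' x) (g' x))"
  using assms unfolding ae_eq_def by (elim AE_mp[OF AE_conjI]) auto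

lemma ae_eq_unop:
  assumes "ae_eq a b f f'"
  shows "ae_eq a b (\<lambda>x. F x (f x)) (\<lambda>x. F x (f' x))"
  using assms unfolding ae_eq_def by (elim AE_mp) auto

lemma ae_eq_subinterval: "ae_eq a b f g \<Longrightarrow> a \<le> c \<Longrightarrow> d \<le> b \<Longrightarrow> ae_eq c d f g"
  unfolding ae_eq_def by (elim AE_mp) auto

text \<open>The Lebesgue integral of a non-measurable function is zero by convention, so equality of
  integrals of a.e. equal functions needs measurability.\<close>

lemma set_integral_ae_eq:
  fixes f g :: "real \<Rightarrow> complex"
  assumes "ae_eq a b f g" "set_borel_measurable lborel {a<..<b} f" "set_borel_measurable lborel {a<..<b} g"
  shows "(LINT x:{a<..<b}|lborel. f x) = (LINT x:{a<..<b}|lborel. g x)"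
  using assms unfolding ae_eq_def by (intro set_integral_cong_AE') auto

lemma sqint_cong:
  assumes "ae_eq a b f g" "f \<in> L2 a b" "g \<in> L2 a b"
  shows "sqint a b f = sqint a b g"
proof -
  have *: "set_borel_measurable lborel {a<..<b} (\<lambda>x. (cmod (f x))\<^sup>2)" if "f \<in> L2 a b" for f
    using L2_integrable_sq[OF that] unfolding set_integrable_def set_borel_measurable_def by auto
  show ?thesis
    using assms(1) *[OF assms(2)] *[OF assms(3)] unfolding ae_eq_def
    by (intro set_integral_cong_AE') (auto elim: AE_mp)
qed

lemma sqint_add_le:
  assumes "f \<in> L2 a b" "g \<in> L2 a b"
  shows "sqint a b (\<lambda>x. f x + g x) \<le> 2 * sqint a b f + 2 * sqint a b g"
proof -
  have "sqint a b (\<lambda>x. f x + g x) \<le> (LINT x:{a<..<b}|lborel. 2 * (cmod (f x))\<^sup>2 + 2 * (cmod (g x))\<^sup>2)"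
    using assms L2_add[OF assms] sq_norm_add_le
    by (intro set_integral_mono set_integral_add set_integrable_mult_right L2_integrable_sq) auto
  also have "\<dots> = 2 * sqint a b f + 2 * sqint a b g"
    using assms by (subst set_integral_add) (auto intro!: set_integrable_mult_right L2_integrable_sq)
  finally show ?thesis .
qed

lemma sqint_scale: "sqint a b (\<lambda>x. k * f x) = (cmod k)\<^sup>2 * sqint a b f"
  by (simp add: norm_mult power_mult_distrib)

lemma sqint_subinterval:
  assumes "f \<in> L2 a b" "a \<le> c" "d \<le> b"
  shows "sqint c d f \<le> sqint a b f"
  by (rule set_integral_mono_subset[OF L2_integrable_sq[OF assms(1)]]) (use assms in auto)

text \<open>Cauchy--Schwarz against the constant 1, in the form of the variance inequality.\<close>

lemma L2_holder:
  assumes "f \<in> L2 a b" "a \<le> c" "c \<le> d" "d \<le> b"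
  shows "(cmod (LINT s:{c<..<d}|lborel. f s))\<^sup>2 \<le> (d - c) * sqint a b f"
proof (cases "c = d")
  case True
  then show ?thesis by (simp add: set_lebesgue_integral_def)
next
  case False
  then have cd: "c < d" using assms by simp
  have fi: "set_integrable lborel {c<..<d} f" using L2_integrable_sub assms by blast
  have fn: "set_integrable lborel {c<..<d} (\<lambda>s. cmod (f s))"
    using set_integrable_norm[OF fi] .
  have fs: "set_integrable lborel {c<..<d} (\<lambda>s. (cmod (f s))\<^sup>2)"
    by (rule set_integrable_subset[OF L2_integrable_sq[OF assms(1)]]) (use assms in auto)
  define I where "I = (LINT s:{c<..<d}|lborel. cmod (f s))"
  define m where "m = I / (d - c)"
  have c1: "set_integrable lborel {c<..<d} (\<lambda>s. m\<^sup>2)" by (rule set_integrable_const)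
  have "0 \<le> (LINT s:{c<..<d}|lborel. (cmod (f s) - m)\<^sup>2)"
    by (rule set_integral_ge_0) auto
  also have "\<dots> = (LINT s:{c<..<d}|lborel. ((cmod (f s))\<^sup>2 - (2 * m) * cmod (f s)) + m\<^sup>2)"
    by (simp add: power2_eq_square algebra_simps)
  also have "\<dots> = (sqint c d f - 2 * m * I) + (LINT s:{c<..<d}|lborel. m\<^sup>2)"
    unfolding I_def using fn fs c1
    by (subst set_integral_add set_integral_diff; (intro set_integral_diff set_integrable_mult_right | simp))+
  also have "(LINT s:{c<..<d}|lborel. m\<^sup>2) = m\<^sup>2 * (d - c)"
    using cd by (simp add: set_integral_constant)
  also have "m\<^sup>2 * (d - c) = m * I"
    using cd by (simp add: m_def power2_eq_square)
  finally have "m * I \<le> sqint c d f" by (simp add: algebra_simps)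
  then have "I\<^sup>2 \<le> (d - c) * sqint c d f"
    using cd by (simp add: m_def power2_eq_square field_simps)
  also have "\<dots> \<le> (d - c) * sqint a b f"
    using sqint_subinterval[OF assms(1,2,4)] cd by (intro mult_left_mono) auto
  finally have I: "I\<^sup>2 \<le> (d - c) * sqint a b f" .
  have "cmod (LINT s:{c<..<d}|lborel. f s) \<le> I"
    unfolding I_def using set_integral_norm_bound[OF fi] .
  then have "(cmod (LINT s:{c<..<d}|lborel. f s))\<^sup>2 \<le> I\<^sup>2" by (simp add: power_mono)
  with I show ?thesis by linarith
qed


subsection \<open>Primitives of square-integrable functions\<close>

definition prim :: "real \<Rightarrow> (real \<Rightarrow> complex) \<Rightarrow> real \<Rightarrow> complex" where
  "prim a g x = (LINT s:{a<..<x}|lborel. g s)"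

lemma set_integral_open_closed:
  "(LINT x:{c<..<d::real}|lborel. (f x :: 'b::{banach,second_countable_topology})) = (LINT x:{c..d}|lborel. f x)"
  by (rule set_integral_discrete_difference[where X="{c, d}"]) auto

lemma prim_diff:
  assumes "g \<in> L2 a b" "a \<le> x" "x \<le> y" "y \<le> b"
  shows "prim a g y - prim a g x = (LINT s:{x<..<y}|lborel. g s)"
proof -
  have i1: "set_integrable lborel {a<..<x} g" and i2: "set_integrable lborel {x<..<y} g"
    using L2_integrable_sub assms by auto
  have "prim a g y = (LINT s:{a<..<x} \<union> {x<..<y}|lborel. g s)"
    unfolding prim_def
    by (rule set_integral_discrete_difference[where X="{x}"]) (use assms in auto)
  also have "\<dots> = prim a g x + (LINT s:{x<..<y}|lborel. g s)"
    unfolding prim_def by (rule set_integral_Un) (use i1 i2 in auto)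
  finally show ?thesis by simp
qed

lemma prim_left [simp]: "prim a g a = 0"
  by (simp add: prim_def set_lebesgue_integral_def)

lemma prim_holder:
  assumes "g \<in> L2 a b" "x \<in> {a..b}" "y \<in> {a..b}"
  shows "(cmod (prim a g y - prim a g x))\<^sup>2 \<le> \<bar>y - x\<bar> * sqint a b g"
proof (cases "x \<le> y")
  case True
  then show ?thesis using L2_holder[OF assms(1), of x y] prim_diff[OF assms(1), of x y] assms by auto
next
  case False
  then have "(cmod (prim a g x - prim a g y))\<^sup>2 \<le> \<bar>y - x\<bar> * sqint a b g"
    using L2_holder[OF assms(1), of y x] prim_diff[OF assms(1), of y x] assms by auto
  then show ?thesis by (simp add: norm_minus_commute)
qed

lemma continuous_on_holder_half:
  fixes f :: "real \<Rightarrow> complex"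
  assumes "\<And>x y. x \<in> A \<Longrightarrow> y \<in> A \<Longrightarrow> (cmod (f y - f x))\<^sup>2 \<le> \<bar>y - x\<bar> * C" "C \<ge> 0"
  shows "continuous_on A f"
  unfolding continuous_on_iff
proof (intro ballI allI impI)
  fix x e :: real assume x: "x \<in> A" and e: "0 < e"
  define d where "d = e\<^sup>2 / (C + 1)"
  have d: "d > 0" using e assms(2) by (simp add: d_def)
  have "dist (f y) (f x) < e" if "y \<in> A" "dist y x < d" for y
  proof -
    have "(cmod (f y - f x))\<^sup>2 \<le> \<bar>y - x\<bar> * C" using assms(1) x that by auto
    also have "\<dots> \<le> d * C" using that assms(2) by (intro mult_right_mono) (auto simp: dist_real_def)
    also have "\<dots> < e\<^sup>2" using e assms(2) by (simp add: d_def field_simps)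
    finally show ?thesis using e by (simp add: dist_norm power2_less_imp_less)
  qed
  with d show "\<exists>d>0. \<forall>x'\<in>A. dist x' x < d \<longrightarrow> dist (f x') (f x) < e" by blast
qed

lemma continuous_on_prim: "g \<in> L2 a b \<Longrightarrow> continuous_on {a..b} (prim a g)"
  by (rule continuous_on_holder_half[where C="sqint a b g"]) (auto intro: prim_holder sqint_nonneg)

lemma continuous_L2:
  fixes f :: "real \<Rightarrow> complex"
  assumes "continuous_on {a..b} f"
  shows "f \<in> L2 a b"
proof -
  have c2: "continuous_on {a..b} (\<lambda>x. (cmod (f x))\<^sup>2)" using assms by (intro continuous_intros)
  have "set_integrable lborel {a..b} f" "set_integrable lborel {a..b} (\<lambda>x. (cmod (f x))\<^sup>2)"
    unfolding set_integrable_def using borel_integrable_compact[OF compact_Icc assms]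
      borel_integrable_compact[OF compact_Icc c2] by auto
  then have "set_integrable lborel {a<..<b} f" "set_integrable lborel {a<..<b} (\<lambda>x. (cmod (f x))\<^sup>2)"
    by (auto elim!: set_integrable_subset)
  then show ?thesis unfolding L2_def set_integrable_def set_borel_measurable_def by auto
qed

lemma L2_const: "(\<lambda>x. c) \<in> L2 a b"
  by (rule continuous_L2) auto

lemma prim_add:
  assumes "f \<in> L2 a b" "g \<in> L2 a b" "x \<le> b"
  shows "prim a (\<lambda>x. f x + g x) x = prim a f x + prim a g x"
  unfolding prim_def using assms by (intro set_integral_add) (auto intro: L2_integrable_sub)

lemma prim_scale: "prim a (\<lambda>x. k * f x) x = k * prim a f x"
  unfolding prim_def by simp

lemma prim_minus:
  assumes "f \<in> L2 a b" "g \<in> L2 a b" "x \<le> b"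
  shows "prim a (\<lambda>x. f x - g x) x = prim a f x - prim a g x"
  unfolding prim_def using assms by (intro set_integral_diff) (auto intro: L2_integrable_sub)

lemma test_function_integral:
  assumes "test_function a b p p'" "a \<le> s" "s \<le> b"
  shows "(LINT x:{s<..<b}|lborel. p' x) = - p s"
proof -
  from assms(1) obtain c d where p: "\<And>x. (p has_real_derivative p' x) (at x)" "continuous_on UNIV p'"
    "a < c" "d < b" "\<And>x. x \<notin> {c..d} \<Longrightarrow> p x = 0"
    unfolding test_function_def by blast
  have "(\<integral>x. p' x * indicator {s..b} x \<partial>lborel) = p b - p s"
    using assms(3) p(1,2) by (intro integral_FTC_Icc_real) (auto simp: continuous_on_eq_continuous_at)
  moreover have "p b = 0" using p by auto
  ultimately show ?thesis
    unfolding set_integral_open_closed by (simp add: set_lebesgue_integral_def mult.commute)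
qed

text \<open>Fubini's theorem on the triangle \<open>s < x\<close>.\<close>

lemma integration_by_parts_prim:
  assumes g: "g \<in> L2 a b" and p: "test_function a b p p'"
  shows "(LINT x:{a<..<b}|lborel. p' x *\<^sub>R prim a g x) = - (LINT x:{a<..<b}|lborel. p x *\<^sub>R g x)"
proof -
  have p'c: "continuous_on UNIV p'" using p by (simp add: test_function_def)
  define G where "G = (\<lambda>s. indicator {a<..<b} s *\<^sub>R g s)"
  define P where "P = (\<lambda>x. indicator {a<..<b} x * p' x)"
  define F where "F = (\<lambda>x s. if s < x then P x *\<^sub>R G s else 0)"
  have Gi: "integrable lborel G" using L2_integrable[OF g] by (simp add: G_def set_integrable_def)
  have Pi: "integrable lborel P"
  proof -
    have "set_integrable lborel {a..b} p'"
      unfolding set_integrable_def using p'c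
      by (intro borel_integrable_compact) (auto intro: continuous_on_subset)
    then have "set_integrable lborel {a<..<b} p'" by (rule set_integrable_subset) auto
    then show ?thesis by (simp add: P_def set_integrable_def)
  qed
  have [measurable]: "G \<in> borel_measurable borel" "P \<in> borel_measurable borel" using Gi Pi by auto
  have H: "integrable (lborel \<Otimes>\<^sub>M lborel) (\<lambda>(x, s). P x *\<^sub>R G s)"
  proof (rule lborel_pair.Fubini_integrable)
    have "integrable lborel (\<lambda>x. \<bar>P x\<bar> * (\<integral>s. cmod (G s) \<partial>lborel))"
      using Pi by auto
    then show "integrable lborel (\<lambda>x. \<integral>y. norm (case (x, y) of (x, s) \<Rightarrow> P x *\<^sub>R G s) \<partial>lborel)"
      by simp
  qed (use Gi in auto)
  have Fi: "integrable (lborel \<Otimes>\<^sub>M lborel) (case_prod F)"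
    by (rule Bochner_Integration.integrable_bound[OF H]) (auto simp: F_def)
  have "(\<integral>s. (\<integral>x. F x s \<partial>lborel) \<partial>lborel) = (\<integral>x. (\<integral>s. F x s \<partial>lborel) \<partial>lborel)"
    by (rule lborel_pair.Fubini_integral[OF Fi])
  moreover have "(\<integral>s. F x s \<partial>lborel) = indicator {a<..<b} x *\<^sub>R (p' x *\<^sub>R prim a g x)" for x
  proof (cases "x \<in> {a<..<b}")
    case True
    then have "(\<integral>s. F x s \<partial>lborel) = (\<integral>s. p' x *\<^sub>R (indicator {a<..<x} s *\<^sub>R g s) \<partial>lborel)"
      by (intro Bochner_Integration.integral_cong) (auto simp: F_def P_def G_def indicator_def)
    also have "\<dots> = p' x *\<^sub>R prim a g x"
      unfolding prim_def set_lebesgue_integral_def by (rule integral_scaleR_right)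
    finally show ?thesis using True by simp
  next
    case False
    then have "F x s = 0" for s by (simp add: F_def P_def)
    then show ?thesis using False by simp
  qed
  moreover have "(\<integral>x. F x s \<partial>lborel) = - (indicator {a<..<b} s *\<^sub>R (p s *\<^sub>R g s))" for s
  proof (cases "s \<in> {a<..<b}")
    case True
    then have "(\<integral>x. F x s \<partial>lborel) = (\<integral>x. (indicator {s<..<b} x * p' x) *\<^sub>R g s \<partial>lborel)"
      by (intro Bochner_Integration.integral_cong) (auto simp: F_def P_def G_def indicator_def)
    also have "\<dots> = (LINT x:{s<..<b}|lborel. p' x) *\<^sub>R g s"
    proof -
      have "integrable lborel (\<lambda>x. indicator {s<..<b} x * p' x)"
      proof -
        have "set_integrable lborel {s..b} p'"
          unfolding set_integrable_def using p'c
          by (intro borel_integrable_compact) (auto intro: continuous_on_subset)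
        then have "set_integrable lborel {s<..<b} p'" by (rule set_integrable_subset) auto
        then show ?thesis by (simp add: set_integrable_def)
      qed
      then show ?thesis by (simp add: set_lebesgue_integral_def)
    qed
    finally show ?thesis using True test_function_integral[OF p, of s] by simp
  next
    case False
    then have "F x s = 0" for x by (simp add: F_def G_def)
    then show ?thesis using False by simp
  qed
  ultimately show ?thesis by (simp add: set_lebesgue_integral_def)
qed

text \<open>Half-lines generate the Borel sets and are closed under intersection.\<close>

lemma AE_zero_if_half_line_integrals_zero:
  fixes k :: "real \<Rightarrow> complex"
  assumes k: "integrable lborel k" and z: "\<And>x. (LINT s:{..x}|lborel. k s) = 0"
  shows "AE x in lborel. k x = 0"
proof (rule sigma_finite_measure.density_zero[OF lborel.sigma_finite_measure_axioms k])
  have si: "set_integrable lborel A k" if "A \<in> sets borel" for A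
    using k that by (simp add: set_integrable_def integrable_mult_indicator)
  have U0: "(LINT s:UNIV|lborel. k s) = 0"
  proof -
    have "((\<lambda>i::nat. LINT s:{..real i}|lborel. k s) \<longlonglongrightarrow> (LINT s:(\<Union>i. {..real i})|lborel. k s))"
      by (rule set_integral_cont_up) (auto simp: incseq_def intro: si)
    moreover have "(\<Union>i. {..real i}) = UNIV" using real_arch_simple by auto
    ultimately have "(\<lambda>i::nat. 0 :: complex) \<longlonglongrightarrow> (LINT s:UNIV|lborel. k s)" by (simp only: z)
    then show ?thesis by (simp add: LIMSEQ_const_iff)
  qed
  fix A :: "real set" assume "A \<in> sets lborel"
  then have A: "A \<in> sigma_sets UNIV (range (\<lambda>x::real. {..x}))"
    unfolding sets_lborel borel_eq_atMost by simp
  have sub: "sigma_sets UNIV (range (\<lambda>x::real. {..x})) = sets borel"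
    unfolding borel_eq_atMost by simp
  have st: "Int_stable (range (\<lambda>x::real. {..x}))"
    unfolding Int_stable_def by auto
  have cl: "range (\<lambda>x::real. {..x}) \<subseteq> Pow UNIV" by simp
  show "(LINT s:A|lborel. k s) = 0"
  proof (rule sigma_sets_induct_disjoint[OF st cl A])
    show "(LINT s:A|lborel. k s) = 0" if "A \<in> range (\<lambda>x::real. {..x})" for A using that z by auto
    show "(LINT s:{}|lborel. k s) = 0" by (simp add: set_lebesgue_integral_def)
    show "(LINT s:UNIV - A|lborel. k s) = 0"
      if "A \<in> sigma_sets UNIV (range (\<lambda>x::real. {..x}))" "(LINT s:A|lborel. k s) = 0" for A
    proof -
      have Ab: "A \<in> sets borel" using that sub by simp
      have "(LINT s:UNIV|lborel. k s) = (LINT s:A \<union> (UNIV - A)|lborel. k s)" by simp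
      also have "\<dots> = (LINT s:A|lborel. k s) + (LINT s:UNIV - A|lborel. k s)"
        by (rule set_integral_Un) (use Ab in \<open>auto intro!: si\<close>)
      finally show ?thesis using U0 that by simp
    qed
    show "(LINT s:(\<Union>i. A i)|lborel. k s) = 0"
      if "disjoint_family A" "range A \<subseteq> sigma_sets UNIV (range (\<lambda>x::real. {..x}))"
        "\<And>i. (LINT s:A i|lborel. k s) = 0" for A :: "nat \<Rightarrow> real set"
    proof -
      have Ab: "A i \<in> sets borel" for i using that(2) sub by auto
      have "(LINT s:(\<Union>i. A i)|lborel. k s) = (\<Sum>i. (LINT s:A i|lborel. k s))"
        by (rule lebesgue_integral_countable_add)
          (use Ab that(1) in \<open>auto intro!: si simp: disjoint_family_on_def\<close>)
      then show ?thesis using that(3) by simp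
    qed
  qed
qed

lemma L2_ae_zero_if_prim_zero:
  assumes "h \<in> L2 a b" "a < b" "\<And>x. x \<in> {a<..<b} \<Longrightarrow> prim a h x = 0"
  shows "ae_eq a b h (\<lambda>x. 0)"
proof -
  define k where "k = (\<lambda>x. indicator {a<..<b} x *\<^sub>R h x)"
  have p0: "prim a h x = 0" if "x \<in> {a..b}" for x
  proof -
    have "closed {x \<in> {a..b}. prim a h x = 0}"
      using continuous_on_prim[OF assms(1)] by (intro continuous_closed_preimage_constant) auto
    then have "closure {a<..<b} \<subseteq> {x \<in> {a..b}. prim a h x = 0}"
      using assms(3) by (intro closure_minimal) auto
    then show ?thesis using that assms(2) by auto
  qed
  have "integrable lborel k" using L2_integrable[OF assms(1)] by (simp add: k_def set_integrable_def)
  moreover have "(LINT s:{..x}|lborel. k s) = 0" for x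
  proof -
    have "(LINT s:{..x}|lborel. k s) = prim a h (min x b)" if "x > a"
    proof -
      have "(LINT s:{..x}|lborel. k s) = (LINT s:{a<..<min x b} \<union> ({x} \<inter> {a<..<b})|lborel. h s)"
        unfolding set_lebesgue_integral_def k_def
        by (rule Bochner_Integration.integral_cong) (auto simp: indicator_def)
      also have "\<dots> = prim a h (min x b)" unfolding prim_def
        by (rule set_integral_discrete_difference[where X="{x}"]) auto
      finally show ?thesis .
    qed
    moreover have "(LINT s:{..x}|lborel. k s) = 0" if "x \<le> a"
    proof -
      have "indicat_real {..x} s *\<^sub>R k s = 0" for s using that by (auto simp: k_def indicator_def)
      then show ?thesis unfolding set_lebesgue_integral_def by (simp only: Bochner_Integration.integral_zero)
    qed
    ultimately show ?thesis using p0[of "min x b"] assms(2) by (cases "x > a") auto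
  qed
  ultimately have "AE x in lborel. k x = 0" by (rule AE_zero_if_half_line_integrals_zero)
  then show ?thesis unfolding ae_eq_def by eventually_elim (auto simp: k_def indicator_def)
qed

subsection \<open>The fundamental lemma and Sobolev functions on an interval\<close>

text \<open>Trapezoids which increase to the indicator of \<open>(c, d)\<close> as the slope \<open>n\<close> grows.\<close>

definition trap :: "real \<Rightarrow> real \<Rightarrow> nat \<Rightarrow> real \<Rightarrow> real" where
  "trap c d n x = max 0 (min 1 (min (real n * (x - c)) (real n * (d - x))))"

lemma trap_continuous: "continuous_on A (trap c d n)"
  unfolding trap_def by (intro continuous_intros)

lemma trap_range: "0 \<le> trap c d n x" "trap c d n x \<le> 1"
  by (auto simp: trap_def)

lemma trap_outside: "x \<notin> {c<..<d} \<Longrightarrow> trap c d n x = 0"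
proof -
  assume "x \<notin> {c<..<d}"
  then have "real n * (x - c) \<le> 0 \<or> real n * (d - x) \<le> 0" by (auto simp: mult_le_0_iff)
  then show ?thesis by (auto simp: trap_def)
qed

lemma trap_limit: "(\<lambda>n. trap c d n x) \<longlonglongrightarrow> indicator {c<..<d} x"
proof (cases "x \<in> {c<..<d}")
  case True
  obtain N where N: "real N \<ge> 1 / (x - c)" "real N \<ge> 1 / (d - x)"
    using real_arch_simple[of "max (1 / (x - c)) (1 / (d - x))"] by auto
  have "trap c d n x = 1" if "n \<ge> N" for n
  proof -
    have "real n \<ge> 1 / (x - c)" "real n \<ge> 1 / (d - x)" using that N of_nat_mono[OF that, where 'a=real] by linarith+
    then have "real n * (x - c) \<ge> 1" "real n * (d - x) \<ge> 1" using True by (auto simp: field_simps)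
    then show ?thesis by (simp add: trap_def)
  qed
  then show ?thesis using True by (intro tendsto_eventually) (auto simp: eventually_sequentially)
next
  case False
  then show ?thesis by (simp add: trap_outside)
qed

lemma trap_integral_limit:
  fixes h :: "real \<Rightarrow> 'b::{banach,second_countable_topology}"
  assumes h: "set_integrable lborel {a<..<b} h" and "a \<le> c" "d \<le> b"
  shows "(\<lambda>n. LINT x:{a<..<b}|lborel. trap c d n x *\<^sub>R h x) \<longlonglongrightarrow> (LINT x:{c<..<d}|lborel. h x)"
proof -
  define H where "H = (\<lambda>x. indicator {a<..<b} x *\<^sub>R h x)"
  have Hi: "integrable lborel H" using h by (simp add: H_def set_integrable_def)
  have [measurable]: "trap c d n \<in> borel_measurable borel" for n
    using trap_continuous by (rule borel_measurable_continuous_onI)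
  have [measurable]: "H \<in> borel_measurable borel" using Hi by auto
  have "(\<lambda>n. \<integral>x. trap c d n x *\<^sub>R H x \<partial>lborel) \<longlonglongrightarrow> (\<integral>x. indicator {c<..<d} x *\<^sub>R H x \<partial>lborel)"
  proof (rule integral_dominated_convergence[where w="\<lambda>x. norm (H x)"])
    show "AE x in lborel. (\<lambda>n. trap c d n x *\<^sub>R H x) \<longlonglongrightarrow> indicat_real {c<..<d} x *\<^sub>R H x"
      by (intro AE_I2 tendsto_intros trap_limit)
    show "AE x in lborel. norm (trap c d n x *\<^sub>R H x) \<le> norm (H x)" for n
      using trap_range[of c d n] by (intro AE_I2) (auto intro!: mult_left_le_one_le)
  qed (use Hi in auto)
  moreover have "indicator {c<..<d} x *\<^sub>R H x = indicator {c<..<d} x *\<^sub>R h x" for x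
    using assms by (auto simp: H_def indicator_def)
  ultimately have "(\<lambda>n. \<integral>x. trap c d n x *\<^sub>R H x \<partial>lborel) \<longlonglongrightarrow> (\<integral>x. indicator {c<..<d} x *\<^sub>R h x \<partial>lborel)"
    by simp
  then show ?thesis unfolding set_lebesgue_integral_def H_def by (simp add: mult.commute)
qed

text \<open>The primitive of \<open>q\<close> vanishes again to the right of \<open>d\<close>, because \<open>q\<close> has mean zero.\<close>

lemma test_function_of_mean_zero:
  assumes q: "continuous_on UNIV q" and "a < c" "c < d" "d < b"
    and sup: "\<And>x. x \<notin> {c<..<d} \<Longrightarrow> q x = 0" and z: "(LINT x:{c<..<d}|lborel. q x) = 0"
  shows "test_function a b (\<lambda>x. integral {c..x} q) q"
proof -
  have qi: "q integrable_on {x..y}" for x y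
    using q by (intro integrable_continuous_interval) (auto intro: continuous_on_subset)
  have zero_left: "integral {c..x} q = 0" if "x \<le> c" for x
    using that by (cases "x = c") auto
  have der: "((\<lambda>x. integral {c..x} q) has_real_derivative q x) (at x)" for x
  proof -
    let ?l = "min c x - 1" and ?r = "max d x + 1"
    have "((\<lambda>u. integral {?l..u} q) has_real_derivative q x) (at x within {?l..?r})"
      using q by (intro integral_has_real_derivative) (auto intro: continuous_on_subset)
    then have 1: "((\<lambda>u. integral {?l..u} q) has_real_derivative q x) (at x)"
      by (subst (asm) at_within_interior) auto
    have 2: "integral {?l..u} q = integral {c..u} q" if "u \<in> {?l<..<?r}" for u
    proof (cases "c \<le> u")
      case True
      have "integral {?l..c} q = integral {?l..c} (\<lambda>_. 0)"
        by (rule integral_cong) (use sup in auto)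
      moreover have "integral {?l..u} q = integral {?l..c} q + integral {c..u} q"
        using True by (intro Henstock_Kurzweil_Integration.integral_combine[symmetric] qi) auto
      ultimately show ?thesis by simp
    next
      case False
      have "integral {?l..u} q = integral {?l..u} (\<lambda>_. 0)"
        by (rule integral_cong) (use False sup in auto)
      then show ?thesis using False zero_left by simp
    qed
    show ?thesis
      by (rule DERIV_cong_ev[THEN iffD1, OF refl _ refl 1])
        (rule eventually_nhds[THEN iffD2], rule exI[of _ "{?l<..<?r}"], use 2 in auto)
  qed
  have "integral {c..x} q = 0" if "x \<notin> {c..d}" for x
  proof (cases "x < c")
    case True then show ?thesis using zero_left by simp
  next
    case False
    then have "d < x" using that by auto
    have "set_integrable lborel {c..d} q"
      unfolding set_integrable_def using q
      by (intro borel_integrable_compact) (auto intro: continuous_on_subset)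
    then have "integral {c..d} q = (LINT x:{c..d}|lborel. q x)"
      by (rule set_borel_integral_eq_integral(2)[symmetric])
    then have "integral {c..d} q = 0" using z by (simp add: set_integral_open_closed)
    moreover have "integral {d..x} q = integral {d..x} (\<lambda>_. 0)"
      by (rule integral_cong) (use sup in auto)
    moreover have "integral {c..x} q = integral {c..d} q + integral {d..x} q"
      using \<open>d < x\<close> assms by (intro Henstock_Kurzweil_Integration.integral_combine[symmetric] qi) auto
    ultimately show ?thesis by simp
  qed
  then show ?thesis using der q assms unfolding test_function_def by blast
qed

text \<open>The fundamental lemma of du Bois-Reymond.  A combination of two trapezoids which has mean zero is the
derivative of a test function; steepening the trapezoids shows that \<open>h\<close> has the same mean over every subinterval.\<close>

lemma weak_derivative_zero_const:
  assumes h: "h \<in> L2 a b" and ab: "a < b"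
    and z: "\<And>p p'. test_function a b p p' \<Longrightarrow> (LINT x:{a<..<b}|lborel. p' x *\<^sub>R h x) = 0"
  shows "\<exists>K. ae_eq a b h (\<lambda>x. K)"
proof -
  have hi: "set_integrable lborel {a<..<b} h" by (rule L2_integrable[OF h])
  have key: "(d' - c') *\<^sub>R (LINT x:{c<..<d}|lborel. h x) = (d - c) *\<^sub>R (LINT x:{c'<..<d'}|lborel. h x)"
    if I: "a < c" "c < d" "d < b" "a < c'" "c' < d'" "d' < b" for c d c' d'
  proof -
    define e f where "e = min c c'" and "f = max d d'"
    have ef: "a < e" "e < f" "f < b" "e \<le> c" "e \<le> c'" "d \<le> f" "d' \<le> f" using I by (auto simp: e_def f_def)
    define T where "T = (\<lambda>c d n. LINT x:{e<..<f}|lborel. trap c d n x)"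
    define J where "J = (\<lambda>c d n. LINT x:{a<..<b}|lborel. trap c d n x *\<^sub>R h x)"
    have ti: "set_integrable lborel {u<..<v} (trap c d n)" for c d n u v
    proof -
      have "set_integrable lborel {u..v} (trap c d n)"
        unfolding set_integrable_def by (intro borel_integrable_compact) (auto intro: trap_continuous)
      then show ?thesis by (rule set_integrable_subset) auto
    qed
    have thi: "set_integrable lborel {a<..<b} (\<lambda>x. trap c d n x *\<^sub>R h x)" for c d n
    proof (rule set_integrable_bound[OF hi])
      have [measurable]: "trap c d n \<in> borel_measurable borel"
        using trap_continuous by (rule borel_measurable_continuous_onI)
      have "(\<lambda>x. trap c d n x *\<^sub>R (indicat_real {a<..<b} x *\<^sub>R h x)) \<in> borel_measurable lborel"
        using hi unfolding set_integrable_def by measurable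
      then show "set_borel_measurable lborel {a<..<b} (\<lambda>x. trap c d n x *\<^sub>R h x)"
        by (simp add: set_borel_measurable_def mult.commute)
      show "AE x\<in>{a<..<b} in lborel. norm (trap c d n x *\<^sub>R h x) \<le> norm (h x)"
        using trap_range[of c d n] by (intro AE_I2) (auto intro!: mult_left_le_one_le)
    qed
    have eq: "T c' d' n *\<^sub>R J c d n = T c d n *\<^sub>R J c' d' n" for n
    proof -
      \<comment> \<open>Each trapezoid is weighted by the integral of the other, which makes the mean zero.\<close>
      define q where "q = (\<lambda>x. T c' d' n * trap c d n x - T c d n * trap c' d' n x)"
      have "test_function a b (\<lambda>x. integral {e..x} q) q"
      proof (rule test_function_of_mean_zero[OF _ ef(1,2,3)])
        show "continuous_on UNIV q" unfolding q_def by (intro continuous_intros trap_continuous)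
        show "q x = 0" if "x \<notin> {e<..<f}" for x
          using that ef by (auto simp: q_def trap_outside)
        show "(LINT x:{e<..<f}|lborel. q x) = 0"
          unfolding q_def
          by (subst set_integral_diff) (auto simp: T_def intro!: ti set_integrable_mult_right)
      qed
      then have "(LINT x:{a<..<b}|lborel. q x *\<^sub>R h x) = 0" by (rule z)
      moreover have "(LINT x:{a<..<b}|lborel. q x *\<^sub>R h x) = (LINT x:{a<..<b}|lborel. T c' d' n *\<^sub>R (trap c d n x *\<^sub>R h x) - T c d n *\<^sub>R (trap c' d' n x *\<^sub>R h x))"
        by (simp add: q_def scaleR_diff_left)
      moreover have "\<dots> = T c' d' n *\<^sub>R J c d n - T c d n *\<^sub>R J c' d' n"
        unfolding J_def set_integral_scaleR_right[symmetric]
        by (rule set_integral_diff(2)) (intro thi set_integrable_scaleR_right)+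
      ultimately show ?thesis by simp
    qed
    have T1: "(\<lambda>n. T c d n) \<longlonglongrightarrow> d - c" if "c < d" "e \<le> c" "d \<le> f" for c d
    proof -
      have "(\<lambda>n. LINT x:{e<..<f}|lborel. trap c d n x *\<^sub>R (1::real)) \<longlonglongrightarrow> (LINT x:{c<..<d}|lborel. 1)"
        by (rule trap_integral_limit) (use that set_integrable_const in auto)
      then show ?thesis using that by (simp add: T_def set_integral_constant)
    qed
    have J1: "(\<lambda>n. J c d n) \<longlonglongrightarrow> (LINT x:{c<..<d}|lborel. h x)" if "a \<le> c" "d \<le> b" for c d
      unfolding J_def by (rule trap_integral_limit[OF hi that])
    have "(\<lambda>n. T c' d' n *\<^sub>R J c d n) \<longlonglongrightarrow> (d' - c') *\<^sub>R (LINT x:{c<..<d}|lborel. h x)"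
      using I ef by (intro tendsto_scaleR T1 J1) auto
    moreover have "(\<lambda>n. T c d n *\<^sub>R J c' d' n) \<longlonglongrightarrow> (d - c) *\<^sub>R (LINT x:{c'<..<d'}|lborel. h x)"
      using I ef by (intro tendsto_scaleR T1 J1) auto
    ultimately show ?thesis unfolding eq by (rule LIMSEQ_unique)
  qed
  define c0 d0 where "c0 = (2 * a + b) / 3" and "d0 = (a + 2 * b) / 3"
  have cd0: "a < c0" "c0 < d0" "d0 < b" using ab by (auto simp: c0_def d0_def)
  define K where "K = (1 / (d0 - c0)) *\<^sub>R (LINT x:{c0<..<d0}|lborel. h x)"
  have avg: "(LINT x:{c<..<d}|lborel. h x) = (d - c) *\<^sub>R K" if "a < c" "c < d" "d < b" for c d
  proof -
    have "(d0 - c0) *\<^sub>R (LINT x:{c<..<d}|lborel. h x) = (d - c) *\<^sub>R (LINT x:{c0<..<d0}|lborel. h x)"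
      using key[OF that cd0] .
    also have "\<dots> = (d0 - c0) *\<^sub>R ((d - c) *\<^sub>R K)" using cd0 by (simp add: K_def)
    finally show ?thesis using cd0 by (metis less_irrefl real_vector.scale_left_imp_eq right_minus_eq)
  qed
  have hK: "(\<lambda>x. h x - K) \<in> L2 a b" using h L2_const by (rule L2_diff)
  have const: "prim a (\<lambda>x. h x - K) x = prim a (\<lambda>x. h x - K) y" if "a < x" "x < y" "y < b" for x y
  proof -
    have "prim a (\<lambda>x. h x - K) y - prim a (\<lambda>x. h x - K) x = (LINT s:{x<..<y}|lborel. h s - K)"
      by (rule prim_diff[OF hK]) (use that in auto)
    also have "\<dots> = (LINT s:{x<..<y}|lborel. h s) - (LINT s:{x<..<y}|lborel. K)"
      using that by (intro set_integral_diff L2_integrable_sub[OF h] set_integrable_const) auto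
    also have "\<dots> = 0" using avg that by (simp add: set_integral_constant)
    finally show ?thesis by simp
  qed
  have "ae_eq a b (\<lambda>x. h x - K) (\<lambda>x. 0)"
  proof (rule L2_ae_zero_if_prim_zero[OF hK ab])
    fix x assume x: "x \<in> {a<..<b}"
    have lim: "((\<lambda>y. prim a (\<lambda>x. h x - K) y) \<longlongrightarrow> prim a (\<lambda>x. h x - K) a) (at_right a)"
      using continuous_on_prim[OF hK] ab by (intro continuous_on_Icc_at_rightD)
    have "eventually (\<lambda>y. prim a (\<lambda>x. h x - K) y = prim a (\<lambda>x. h x - K) x) (at_right a)"
      unfolding eventually_at_right_field using x const by (intro exI[of _ x]) auto
    from tendsto_cong[OF this] lim show "prim a (\<lambda>x. h x - K) x = 0"
      by (simp add: tendsto_const_iff)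
  qed
  then show ?thesis unfolding ae_eq_def by auto
qed

lemma weak_derivative_prim:
  assumes f: "f \<in> L2 a b" and g: "g \<in> L2 a b" and ab: "a < b"
    and e: "ae_eq a b f (\<lambda>x. c + prim a g x)"
  shows "weak_derivative a b f g"
  unfolding weak_derivative_def
proof (intro allI impI)
  fix p p' assume p: "test_function a b p p'"
  then have p'c: "continuous_on UNIV p'" by (simp add: test_function_def)
  have [measurable]: "p' \<in> borel_measurable borel"
    using p'c by (rule borel_measurable_continuous_onI)
  have m: "set_borel_measurable lborel {a<..<b} (\<lambda>x. p' x *\<^sub>R u x)" if "u \<in> L2 a b" for u :: "real \<Rightarrow> complex"
  proof -
    have "(\<lambda>x. p' x *\<^sub>R (indicat_real {a<..<b} x *\<^sub>R u x)) \<in> borel_measurable lborel"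
      using L2_measurable[OF that] unfolding set_borel_measurable_def by measurable
    then show ?thesis by (simp add: set_borel_measurable_def mult.commute)
  qed
  have p'i: "set_integrable lborel {a<..<b} p'"
  proof -
    have "set_integrable lborel {a..b} p'"
      unfolding set_integrable_def using p'c
      by (intro borel_integrable_compact) (auto intro: continuous_on_subset)
    then show ?thesis by (rule set_integrable_subset) auto
  qed
  have cp: "continuous_on {a..b} (\<lambda>x. p' x *\<^sub>R prim a g x)"
    using p'c continuous_on_prim[OF g] by (intro continuous_intros) (auto intro: continuous_on_subset)
  have L: "(\<lambda>x. c + prim a g x) \<in> L2 a b"
    using continuous_on_prim[OF g] by (intro continuous_L2 continuous_intros)
  have "(LINT x:{a<..<b}|lborel. p' x *\<^sub>R f x) = (LINT x:{a<..<b}|lborel. p' x *\<^sub>R (c + prim a g x))"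
    using ae_eq_unop[OF e, of "\<lambda>x y. p' x *\<^sub>R y"] m[OF f] m[OF L] by (rule set_integral_ae_eq)
  also have "\<dots> = (LINT x:{a<..<b}|lborel. p' x *\<^sub>R c) + (LINT x:{a<..<b}|lborel. p' x *\<^sub>R prim a g x)"
    unfolding scaleR_add_right
    by (rule set_integral_add) (use p'i L2_integrable[OF continuous_L2[OF cp]] in auto)
  also have "(LINT x:{a<..<b}|lborel. p' x *\<^sub>R c) = (LINT x:{a<..<b}|lborel. p' x) *\<^sub>R c"
  proof -
    have "(LINT x:{a<..<b}|lborel. p' x *\<^sub>R c) = (\<integral>x. (indicator {a<..<b} x *\<^sub>R p' x) *\<^sub>R c \<partial>lborel)"
      by (simp add: set_lebesgue_integral_def)
    also have "\<dots> = (LINT x:{a<..<b}|lborel. p' x) *\<^sub>R c"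
      unfolding set_lebesgue_integral_def
      by (rule integral_scaleR_left) (use p'i in \<open>simp add: set_integrable_def\<close>)
    finally show ?thesis .
  qed
  also have "(LINT x:{a<..<b}|lborel. p' x) = - p a"
    by (rule test_function_integral[OF p]) (use ab in auto)
  also have "p a = 0" using p by (auto simp: test_function_def)
  finally show "(LINT x:{a<..<b}|lborel. p' x *\<^sub>R f x) = - (LINT x:{a<..<b}|lborel. p x *\<^sub>R g x)"
    using integration_by_parts_prim[OF g p] by simp
qed

lemma continuous_ae_eq_unique:
  fixes f g :: "real \<Rightarrow> complex"
  assumes "continuous_on {a..b} f" "continuous_on {a..b} g" "ae_eq a b f g" "a < b" "x \<in> {a..b}"
  shows "f x = g x"
proof -
  let ?C = "{x \<in> {a..b}. f x - g x = 0}"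
  have C: "closed ?C"
    using assms(1,2) by (intro continuous_closed_preimage_constant continuous_intros) auto
  have "y \<in> ?C" if "y \<in> {a<..<b}" for y
  proof (rule mem_closed_if_AE_lebesgue_open[OF _ C])
    show "AE x\<in>{a<..<b} in lebesgue. x \<in> ?C"
      using assms(3) unfolding ae_eq_def by (intro AE_completion) (auto elim!: AE_mp)
  qed (use that in auto)
  then have "closure {a<..<b} \<subseteq> ?C" by (intro closure_minimal C) auto
  then show ?thesis using assms(4,5) by auto
qed

lemma H1_L2: "f \<in> H1 a b \<Longrightarrow> f \<in> L2 a b" by (simp add: H1_def)

lemma Dx_spec:
  assumes "f \<in> H1 a b"
  shows "Dx a b f \<in> L2 a b" "weak_derivative a b f (Dx a b f)"
proof -
  have "\<exists>g. g \<in> L2 a b \<and> weak_derivative a b f g" using assms by (auto simp: H1_def)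
  from someI_ex[OF this] show "Dx a b f \<in> L2 a b" "weak_derivative a b f (Dx a b f)"
    by (auto simp: Dx_def)
qed

text \<open>The difference between \<open>f\<close> and a primitive of its weak derivative has weak derivative zero.\<close>

lemma weak_derivative_rep:
  assumes f: "f \<in> L2 a b" and g: "g \<in> L2 a b" and ab: "a < b" and w: "weak_derivative a b f g"
  shows "\<exists>c. ae_eq a b f (\<lambda>x. c + prim a g x)"
proof -
  have pL: "prim a g \<in> L2 a b" by (rule continuous_L2[OF continuous_on_prim[OF g]])
  have "\<exists>K. ae_eq a b (\<lambda>x. f x - prim a g x) (\<lambda>x. K)"
  proof (rule weak_derivative_zero_const[OF L2_diff[OF f pL] ab])
    fix p p' assume p: "test_function a b p p'"
    have [measurable]: "p' \<in> borel_measurable borel"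
      using p by (intro borel_measurable_continuous_onI) (simp add: test_function_def)
    have i: "set_integrable lborel {a<..<b} (\<lambda>x. p' x *\<^sub>R u x)" if "u \<in> L2 a b" for u :: "real \<Rightarrow> complex"
    proof -
      have "bounded (p' ` {a..b})"
        using p by (intro compact_imp_bounded compact_continuous_image)
          (auto simp: test_function_def intro: continuous_on_subset)
      then have "\<exists>B. \<forall>x\<in>{a..b}. \<bar>p' x\<bar> \<le> B" by (auto simp: bounded_iff)
      then obtain B where B: "\<And>x. x \<in> {a..b} \<Longrightarrow> \<bar>p' x\<bar> \<le> B" by blast
      have "(\<lambda>x. p' x *\<^sub>R (indicat_real {a<..<b} x *\<^sub>R u x)) \<in> borel_measurable lborel"
        using L2_measurable[OF that] unfolding set_borel_measurable_def by measurable
      then have m: "set_borel_measurable lborel {a<..<b} (\<lambda>x. p' x *\<^sub>R u x)"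
        by (simp add: set_borel_measurable_def mult.commute)
      show ?thesis
        by (rule set_integrable_bound[OF set_integrable_scaleR_right[of B, OF L2_integrable[OF that]] m])
          (use B in \<open>auto intro!: AE_I2 mult_right_mono order.trans[OF _ abs_ge_self]\<close>)
    qed
    have "(LINT x:{a<..<b}|lborel. p' x *\<^sub>R (f x - prim a g x))
        = (LINT x:{a<..<b}|lborel. p' x *\<^sub>R f x) - (LINT x:{a<..<b}|lborel. p' x *\<^sub>R prim a g x)"
      unfolding scaleR_diff_right by (rule set_integral_diff(2)[OF i[OF f] i[OF pL]])
    also have "\<dots> = 0"
      using w p integration_by_parts_prim[OF g p] by (simp add: weak_derivative_def)
    finally show "(LINT x:{a<..<b}|lborel. p' x *\<^sub>R (f x - prim a g x)) = 0" .
  qed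
  then obtain K where "ae_eq a b (\<lambda>x. f x - prim a g x) (\<lambda>x. K)" by blast
  then have "ae_eq a b f (\<lambda>x. K + prim a g x)" unfolding ae_eq_def by (elim AE_mp) (auto simp: algebra_simps)
  then show ?thesis by blast
qed

lemma prim_rep_unique:
  assumes g: "g \<in> L2 a b" and g': "g' \<in> L2 a b" and ab: "a < b"
    and e: "ae_eq a b (\<lambda>x. c + prim a g x) (\<lambda>x. c' + prim a g' x)"
  shows "c = c'" "ae_eq a b g g'"
proof -
  have eq: "c + prim a g x = c' + prim a g' x" if "x \<in> {a..b}" for x
    by (rule continuous_ae_eq_unique[OF _ _ e ab that])
      (intro continuous_intros continuous_on_prim g g')+
  from eq[of a] ab show c: "c = c'" by simp
  have "ae_eq a b (\<lambda>x. g x - g' x) (\<lambda>x. 0)"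
  proof (rule L2_ae_zero_if_prim_zero[OF L2_diff[OF g g'] ab])
    fix x assume "x \<in> {a<..<b}"
    then show "prim a (\<lambda>x. g x - g' x) x = 0"
      using eq[of x] c prim_minus[OF g g', of x] by auto
  qed
  then show "ae_eq a b g g'" unfolding ae_eq_def by auto
qed

lemma val_eqI:
  assumes "continuous_on {a..b} F" "ae_eq a b f F" "a < b" "x \<in> {a..b}"
  shows "val a b f x = F x"
  unfolding val_def
proof (rule the_equality)
  show "\<exists>g. continuous_on {a..b} g \<and> ae_eq a b f g \<and> F x = g x" using assms by blast
next
  fix w assume "\<exists>g. continuous_on {a..b} g \<and> ae_eq a b f g \<and> w = g x"
  then obtain g where g: "continuous_on {a..b} g" "ae_eq a b f g" "w = g x" by blast
  have "ae_eq a b g F" using ae_eq_trans[OF ae_eq_sym[OF g(2)] assms(2)] .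
  then show "w = F x" using continuous_ae_eq_unique[OF g(1) assms(1) _ assms(3,4)] g(3) by simp
qed

text \<open>Membership, derivative and continuous representative are read off from a representation as a primitive,
because that representation is unique.\<close>

lemma H1I:
  assumes f: "f \<in> L2 a b" and g: "g \<in> L2 a b" and ab: "a < b" and e: "ae_eq a b f (\<lambda>x. c + prim a g x)"
  shows "f \<in> H1 a b" "ae_eq a b (Dx a b f) g" "\<And>x. x \<in> {a..b} \<Longrightarrow> val a b f x = c + prim a g x"
proof -
  show H: "f \<in> H1 a b"
    using weak_derivative_prim[OF f g ab e] f g by (auto simp: H1_def)
  obtain c' where "ae_eq a b f (\<lambda>x. c' + prim a (Dx a b f) x)"
    using weak_derivative_rep[OF f Dx_spec(1)[OF H] ab Dx_spec(2)[OF H]] by blast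
  then have "ae_eq a b (\<lambda>x. c' + prim a (Dx a b f) x) (\<lambda>x. c + prim a g x)"
    using e ae_eq_sym ae_eq_trans by blast
  then show "ae_eq a b (Dx a b f) g" by (rule prim_rep_unique[OF Dx_spec(1)[OF H] g ab])
  show "val a b f x = c + prim a g x" if "x \<in> {a..b}" for x
    by (rule val_eqI[OF _ e ab that]) (intro continuous_intros continuous_on_prim g)
qed

lemma H1D:
  assumes f: "f \<in> H1 a b" and ab: "a < b"
  shows "ae_eq a b f (\<lambda>x. val a b f a + prim a (Dx a b f) x)"
    "\<And>x. x \<in> {a..b} \<Longrightarrow> val a b f x = val a b f a + prim a (Dx a b f) x"
    "continuous_on {a..b} (val a b f)" "ae_eq a b f (val a b f)"
proof -
  note D = Dx_spec[OF f]
  obtain c where e: "ae_eq a b f (\<lambda>x. c + prim a (Dx a b f) x)"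
    using weak_derivative_rep[OF H1_L2[OF f] D(1) ab D(2)] by blast
  note v = H1I(3)[OF H1_L2[OF f] D(1) ab e]
  from v[of a] ab have c: "val a b f a = c" by simp
  show 1: "ae_eq a b f (\<lambda>x. val a b f a + prim a (Dx a b f) x)" unfolding c by (rule e)
  show 2: "\<And>x. x \<in> {a..b} \<Longrightarrow> val a b f x = val a b f a + prim a (Dx a b f) x" unfolding c by (rule v)
  have "continuous_on {a..b} (\<lambda>x. val a b f a + prim a (Dx a b f) x)"
    by (intro continuous_intros continuous_on_prim D)
  then show "continuous_on {a..b} (val a b f)" by (simp only: continuous_on_cong[OF refl 2])
  show "ae_eq a b f (val a b f)"
    using 1 unfolding ae_eq_def
  proof eventually_elim
    case (elim x)
    then show ?case using 2[of x] by simp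
  qed
qed

lemma H1_add:
  assumes f: "f \<in> H1 a b" and g: "g \<in> H1 a b" and ab: "a < b"
  shows "(\<lambda>x. f x + g x) \<in> H1 a b"
    "ae_eq a b (Dx a b (\<lambda>x. f x + g x)) (\<lambda>x. Dx a b f x + Dx a b g x)"
    "\<And>x. x \<in> {a..b} \<Longrightarrow> val a b (\<lambda>x. f x + g x) x = val a b f x + val a b g x"
proof -
  let ?c = "val a b f a + val a b g a" and ?g = "\<lambda>x. Dx a b f x + Dx a b g x"
  note D = L2_add[OF Dx_spec(1)[OF f] Dx_spec(1)[OF g]]
  have p: "prim a ?g x = prim a (Dx a b f) x + prim a (Dx a b g) x" if "x \<le> b" for x
    using prim_add[OF Dx_spec(1)[OF f] Dx_spec(1)[OF g] that] .
  have e: "ae_eq a b (\<lambda>x. f x + g x) (\<lambda>x. ?c + prim a ?g x)"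
    using H1D(1)[OF f ab] H1D(1)[OF g ab] p unfolding ae_eq_def by (elim AE_mp[OF AE_conjI]) auto
  note I = H1I[OF L2_add[OF H1_L2[OF f] H1_L2[OF g]] D ab e]
  from I(1,2) show "(\<lambda>x. f x + g x) \<in> H1 a b" "ae_eq a b (Dx a b (\<lambda>x. f x + g x)) ?g" by auto
  show "val a b (\<lambda>x. f x + g x) x = val a b f x + val a b g x" if "x \<in> {a..b}" for x
    using I(3)[OF that] H1D(2)[OF f ab that] H1D(2)[OF g ab that] p[of x] that by auto
qed

lemma H1_scale:
  assumes f: "f \<in> H1 a b" and ab: "a < b"
  shows "(\<lambda>x. k * f x) \<in> H1 a b"
    "ae_eq a b (Dx a b (\<lambda>x. k * f x)) (\<lambda>x. k * Dx a b f x)"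
    "\<And>x. x \<in> {a..b} \<Longrightarrow> val a b (\<lambda>x. k * f x) x = k * val a b f x"
proof -
  have e: "ae_eq a b (\<lambda>x. k * f x) (\<lambda>x. k * val a b f a + prim a (\<lambda>x. k * Dx a b f x) x)"
    using H1D(1)[OF f ab] unfolding ae_eq_def prim_scale by (elim AE_mp) (auto simp: algebra_simps)
  note I = H1I[OF L2_scale[OF H1_L2[OF f]] L2_scale[OF Dx_spec(1)[OF f]] ab e]
  from I(1,2) show "(\<lambda>x. k * f x) \<in> H1 a b" "ae_eq a b (Dx a b (\<lambda>x. k * f x)) (\<lambda>x. k * Dx a b f x)" by auto
  show "val a b (\<lambda>x. k * f x) x = k * val a b f x" if "x \<in> {a..b}" for x
    using I(3)[OF that] H1D(2)[OF f ab that] by (simp add: prim_scale algebra_simps)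
qed

lemma H1_cong:
  assumes f: "f \<in> H1 a b" and ab: "a < b" and g: "g \<in> L2 a b" and e: "ae_eq a b f g"
  shows "g \<in> H1 a b" "ae_eq a b (Dx a b g) (Dx a b f)" "\<And>x. x \<in> {a..b} \<Longrightarrow> val a b g x = val a b f x"
proof -
  note I = H1I[OF g Dx_spec(1)[OF f] ab ae_eq_trans[OF ae_eq_sym[OF e] H1D(1)[OF f ab]]]
  from I(1,2) show "g \<in> H1 a b" "ae_eq a b (Dx a b g) (Dx a b f)" by auto
  show "val a b g x = val a b f x" if "x \<in> {a..b}" for x
    using I(3)[OF that] H1D(2)[OF f ab that] by simp
qed

subsection \<open>Completeness\<close>

text \<open>The argument of Riesz and Fischer: on a bounded interval the sequence is Cauchy in the mean, hence
converges a.e. along a subsequence, and Fatou's lemma gives mean square convergence to that limit.\<close>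

lemma sqint_limit_complete:
  fixes f :: "nat \<Rightarrow> real \<Rightarrow> complex"
  assumes ab: "a < b" and f: "\<And>n. f n \<in> L2 a b"
    and C: "\<And>e. e > 0 \<Longrightarrow> \<exists>M. \<forall>m\<ge>M. \<forall>n\<ge>M. sqint a b (\<lambda>x. f m x - f n x) < e"
  shows "\<exists>g \<in> L2 a b. (\<lambda>n. sqint a b (\<lambda>x. f n x - g x)) \<longlonglongrightarrow> 0"
proof -
  define s where "s = (\<lambda>n x. indicat_real {a<..<b} x *\<^sub>R f n x)"
  have si: "integrable lborel (s n)" for n
    using L2_integrable[OF f] by (simp add: s_def set_integrable_def)
  then have [measurable]: "s n \<in> borel_measurable lborel" for n by auto
  have L1: "(LINT x|lborel. norm (s i x - s j x))\<^sup>2 \<le> (b - a) * sqint a b (\<lambda>x. f i x - f j x)" for i j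
  proof -
    let ?h = "\<lambda>x. complex_of_real (cmod (f i x - f j x))"
    have d: "(\<lambda>x. f i x - f j x) \<in> L2 a b" using f by (intro L2_diff)
    have m: "(\<lambda>x. complex_of_real (cmod (indicat_real {a<..<b} x *\<^sub>R (f i x - f j x)))) \<in> borel_measurable lborel"
      using L2_measurable[OF d] unfolding set_borel_measurable_def by measurable
    have "(\<lambda>x. complex_of_real (cmod (indicat_real {a<..<b} x *\<^sub>R (f i x - f j x)))) = (\<lambda>x. indicat_real {a<..<b} x *\<^sub>R ?h x)"
      by (auto simp: indicator_def)
    with m have "?h \<in> L2 a b" using L2_integrable_sq[OF d] unfolding L2_def set_borel_measurable_def by simp
    from L2_holder[OF this, of a b] ab
    have "(cmod (LINT x:{a<..<b}|lborel. ?h x))\<^sup>2 \<le> (b - a) * sqint a b (\<lambda>x. f i x - f j x)" by simp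
    moreover have "(LINT x:{a<..<b}|lborel. ?h x) = complex_of_real (LINT x|lborel. norm (s i x - s j x))"
      unfolding set_lebesgue_integral_def integral_complex_of_real[symmetric]
      by (rule Bochner_Integration.integral_cong) (auto simp: s_def indicator_def)
    ultimately show ?thesis by simp
  qed
  have L1C: "\<exists>N. \<forall>i\<ge>N. \<forall>j\<ge>N. LINT x|lborel. norm (s i x - s j x) < e" if e: "e > 0" for e
  proof -
    obtain M where M: "\<And>m n. m \<ge> M \<Longrightarrow> n \<ge> M \<Longrightarrow> sqint a b (\<lambda>x. f m x - f n x) < e\<^sup>2 / (b - a)"
      using C[of "e\<^sup>2 / (b - a)"] ab e by auto
    have "LINT x|lborel. norm (s i x - s j x) < e" if "i \<ge> M" "j \<ge> M" for i j
    proof -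
      have "(LINT x|lborel. norm (s i x - s j x))\<^sup>2 < e\<^sup>2"
        using L1[of i j] M[OF that] ab by (simp add: field_simps)
      then show ?thesis using \<open>e > 0\<close> by (simp add: power2_less_imp_less)
    qed
    then show ?thesis by blast
  qed
  obtain r where r: "strict_mono r" and ae: "AE x in lborel. Cauchy (\<lambda>i. s (r i) x)"
    using cauchy_L1_AE_cauchy_subseq[OF si L1C] by blast
  define g where "g = (\<lambda>x. lim (\<lambda>i. s (r i) x))"
  have [measurable]: "g \<in> borel_measurable lborel" unfolding g_def by measurable
  have conv: "AE x in lborel. (\<lambda>i. s (r i) x) \<longlonglongrightarrow> g x"
    using ae by eventually_elim (auto simp: g_def Cauchy_convergent_iff convergent_LIMSEQ_iff)
  have nn: "(\<integral>\<^sup>+x. ennreal (indicator {a<..<b} x * (cmod (f n x - u x))\<^sup>2) \<partial>lborel) = ennreal (sqint a b (\<lambda>x. f n x - u x))"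
    if "u \<in> L2 a b" for u n
    using L2_integrable_sq[OF L2_diff[OF f that]] unfolding set_lebesgue_integral_def set_integrable_def real_scaleR_def
    by (intro nn_integral_eq_integral) auto
  have fatou: "(\<integral>\<^sup>+x. ennreal (indicator {a<..<b} x * (cmod (f n x - g x))\<^sup>2) \<partial>lborel) \<le> ennreal e"
    if M: "\<And>m. m \<ge> M \<Longrightarrow> sqint a b (\<lambda>x. f n x - f m x) \<le> e" for n M e
  proof -
    have meas: "(\<lambda>x. ennreal (indicator {a<..<b} x * (cmod (f n x - f (r i) x))\<^sup>2)) \<in> borel_measurable lborel" for i
      using L2_integrable_sq[OF L2_diff[OF f[of n] f[of "r i"]]] unfolding set_integrable_def by simp
    have "(\<integral>\<^sup>+x. ennreal (indicator {a<..<b} x * (cmod (f n x - g x))\<^sup>2) \<partial>lborel)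
        = (\<integral>\<^sup>+x. liminf (\<lambda>i. ennreal (indicator {a<..<b} x * (cmod (f n x - f (r i) x))\<^sup>2)) \<partial>lborel)"
    proof (rule nn_integral_cong_AE)
      show "AE x in lborel. ennreal (indicator {a<..<b} x * (cmod (f n x - g x))\<^sup>2)
          = liminf (\<lambda>i. ennreal (indicator {a<..<b} x * (cmod (f n x - f (r i) x))\<^sup>2))"
        using conv
      proof eventually_elim
        case (elim x)
        have "(\<lambda>i. ennreal (indicator {a<..<b} x * (cmod (f n x - s (r i) x))\<^sup>2)) \<longlonglongrightarrow> ennreal (indicator {a<..<b} x * (cmod (f n x - g x))\<^sup>2)"
          by (intro tendsto_intros elim)
        moreover have "indicator {a<..<b} x * (cmod (f n x - s (r i) x))\<^sup>2 = indicator {a<..<b} x * (cmod (f n x - f (r i) x))\<^sup>2" for i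
          by (auto simp: s_def indicator_def)
        ultimately have "(\<lambda>i. ennreal (indicator {a<..<b} x * (cmod (f n x - f (r i) x))\<^sup>2)) \<longlonglongrightarrow> ennreal (indicator {a<..<b} x * (cmod (f n x - g x))\<^sup>2)"
          by (simp only:)
        then show ?case by (intro lim_imp_Liminf[symmetric]) auto
      qed
    qed
    also have "\<dots> \<le> liminf (\<lambda>i. \<integral>\<^sup>+x. ennreal (indicator {a<..<b} x * (cmod (f n x - f (r i) x))\<^sup>2) \<partial>lborel)"
      by (rule nn_integral_liminf) (rule meas)
    also have "\<dots> = liminf (\<lambda>i. ennreal (sqint a b (\<lambda>x. f n x - f (r i) x)))"
      using nn[OF f] by simp
    also have "\<dots> \<le> ennreal e"
    proof (rule Liminf_le)
      have "r i \<ge> M" if "i \<ge> M" for i using seq_suble[OF r, of i] that by linarith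
      then show "\<forall>\<^sub>F i in sequentially. ennreal (sqint a b (\<lambda>x. f n x - f (r i) x)) \<le> ennreal e"
        unfolding eventually_sequentially by (intro exI[of _ M] allI impI ennreal_leI M) auto
    qed auto
    finally show ?thesis .
  qed
  have dL: "(\<lambda>x. f n x - g x) \<in> L2 a b \<and> sqint a b (\<lambda>x. f n x - g x) \<le> e"
    if M: "\<And>m. m \<ge> M \<Longrightarrow> sqint a b (\<lambda>x. f n x - f m x) \<le> e" and e: "e \<ge> 0" for n M e
  proof -
    have mm: "(\<lambda>x. indicat_real {a<..<b} x *\<^sub>R (f n x - g x)) \<in> borel_measurable lborel"
    proof -
      have "(\<lambda>x. s n x - indicat_real {a<..<b} x *\<^sub>R g x) \<in> borel_measurable lborel" by measurable
      then show ?thesis by (simp add: s_def scaleR_diff_right)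
    qed
    then have "(\<lambda>x. (cmod (indicat_real {a<..<b} x *\<^sub>R (f n x - g x)))\<^sup>2) \<in> borel_measurable lborel" by measurable
    moreover have "(\<lambda>x. (cmod (indicat_real {a<..<b} x *\<^sub>R (f n x - g x)))\<^sup>2) = (\<lambda>x. indicator {a<..<b} x * (cmod (f n x - g x))\<^sup>2)"
      by (auto simp: indicator_def)
    ultimately have m2: "(\<lambda>x. indicator {a<..<b} x * (cmod (f n x - g x))\<^sup>2) \<in> borel_measurable lborel" by simp
    have F: "(\<integral>\<^sup>+x. ennreal (indicator {a<..<b} x * (cmod (f n x - g x))\<^sup>2) \<partial>lborel) \<le> ennreal e"
      by (rule fatou[OF M])
    have i2: "integrable lborel (\<lambda>x. indicator {a<..<b} x * (cmod (f n x - g x))\<^sup>2)"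
      using m2 le_less_trans[OF F ennreal_less_top] by (intro integrableI_nonneg) auto
    have "ennreal (sqint a b (\<lambda>x. f n x - g x)) \<le> ennreal e"
      using F nn_integral_eq_integral[OF i2] by (simp add: set_lebesgue_integral_def)
    then show ?thesis using mm i2 e by (simp add: L2_def set_borel_measurable_def set_integrable_def)
  qed
  obtain M0 where M0: "\<And>m n. m \<ge> M0 \<Longrightarrow> n \<ge> M0 \<Longrightarrow> sqint a b (\<lambda>x. f m x - f n x) < 1"
    using C[of 1] by auto
  have "(\<lambda>x. f M0 x - g x) \<in> L2 a b" using dL[of M0 M0 1] M0 by (auto intro: less_imp_le)
  from L2_diff[OF f[of M0] this] have g: "g \<in> L2 a b" by simp
  have "(\<lambda>n. sqint a b (\<lambda>x. f n x - g x)) \<longlonglongrightarrow> 0"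
  proof (rule LIMSEQ_I)
    fix e :: real assume e: "0 < e"
    obtain M where M: "\<And>m n. m \<ge> M \<Longrightarrow> n \<ge> M \<Longrightarrow> sqint a b (\<lambda>x. f m x - f n x) < e / 2"
      using C[of "e / 2"] e by auto
    have "sqint a b (\<lambda>x. f n x - g x) \<le> e / 2" if "n \<ge> M" for n
      using dL[of M n "e / 2"] M that e by (auto intro: less_imp_le)
    then have "norm (sqint a b (\<lambda>x. f n x - g x) - 0) < e" if "n \<ge> M" for n
      using that e sqint_nonneg[of a b "\<lambda>x. f n x - g x"] by fastforce
    then show "\<exists>no. \<forall>n\<ge>no. norm (sqint a b (\<lambda>x. f n x - g x) - 0) < e" by blast
  qed
  with g show ?thesis by blast
qed

section \<open>The energy space\<close>

text \<open>The displacements \<open>u\<close>, \<open>y\<close>, \<open>\<phi>\<close>, \<open>\<psi>\<close> are numbered from 0 to 3, and likewise their velocities.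
Components 0 and 1 live on \<open>(0, L0)\<close>, components 2 and 3 on \<open>(L0, L)\<close>; with the numbering, what holds for all
four is stated once.\<close>

fun disp :: "nat \<Rightarrow> state \<Rightarrow> cfun" where
  "disp k (u, v, y, z, \<phi>, \<eta>, \<psi>, \<xi>) = (if k = 0 then u else if k = 1 then y else if k = 2 then \<phi> else \<psi>)"

fun vel :: "nat \<Rightarrow> state \<Rightarrow> cfun" where
  "vel k (u, v, y, z, \<phi>, \<eta>, \<psi>, \<xi>) = (if k = 0 then v else if k = 1 then z else if k = 2 then \<eta> else \<xi>)"

lemma state_exhaust:
  obtains u v y z \<phi> \<eta> \<psi> \<xi> where "(U :: state) = (u, v, y, z, \<phi>, \<eta>, \<psi>, \<xi>)"
  by (rule vel.cases[of "(0, U)"]) auto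

definition mk_state :: "(nat \<Rightarrow> cfun) \<Rightarrow> (nat \<Rightarrow> cfun) \<Rightarrow> state" where
  "mk_state d v = (d 0, v 0, d 1, v 1, d 2, v 2, d 3, v 3)"

lemma less_4_cases: "k < 4 \<Longrightarrow> k = 0 \<or> k = 1 \<or> k = 2 \<or> k = (3::nat)" by auto

lemma all_less_4: "(\<forall>k<4::nat. P k) \<longleftrightarrow> P 0 \<and> P 1 \<and> P 2 \<and> P 3"
proof
  assume "P 0 \<and> P 1 \<and> P 2 \<and> P 3"
  then show "\<forall>k<4. P k" using less_4_cases by blast
qed simp

lemma sum_less_4: "(\<Sum>k<4::nat. f k) = f 0 + f 1 + f 2 + (f 3 :: 'a::comm_monoid_add)"
  by (simp add: numeral_eq_Suc add.assoc)

lemma disp_mk_state: "k < 4 \<Longrightarrow> disp k (mk_state d v) = d k"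
  and vel_mk_state: "k < 4 \<Longrightarrow> vel k (mk_state d v) = v k"
  by (auto simp: mk_state_def dest: less_4_cases)

lemma disp_add: "disp k (U + V) = (\<lambda>x. disp k U x + disp k V x)"
  and vel_add: "vel k (U + V) = (\<lambda>x. vel k U x + vel k V x)"
  and disp_diff: "disp k (U - V) = (\<lambda>x. disp k U x - disp k V x)"
  and vel_diff: "vel k (U - V) = (\<lambda>x. vel k U x - vel k V x)"
  and disp_scale: "disp k (state_scale c U) = (\<lambda>x. c * disp k U x)"
  and vel_scale: "vel k (state_scale c U) = (\<lambda>x. c * vel k U x)"
  and disp_0: "disp k 0 = (\<lambda>x. 0)" and vel_0: "vel k 0 = (\<lambda>x. 0)"
  by (cases U, cases V, auto simp: fun_eq_iff zero_prod_def)+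

lemma vector_space_state_scale: "vector_space state_scale"
proof
  show "state_scale a (x + y) = state_scale a x + state_scale a y" for a x y
    by (cases x, cases y) (auto simp: fun_eq_iff algebra_simps)
  show "state_scale (a + b) x = state_scale a x + state_scale b x" for a b x
    by (cases x) (auto simp: fun_eq_iff algebra_simps)
  show "state_scale a (state_scale b x) = state_scale (a * b) x" for a b x
    by (cases x) (auto simp: fun_eq_iff)
  show "state_scale 1 x = x" for x
    by (cases x) auto
qed

interpretation state: vector_space state_scale by (rule vector_space_state_scale)

text \<open>The coupling of \<open>u\<close> and \<open>y\<close> acts on \<open>(p, q)\<close>.\<close>

locale transmission =
  fixes L0 L a1 a2 c1 p q :: real
  assumes L0: "0 < L0" "L0 < L" and a: "0 < a1" "0 < a2" and pq: "0 \<le> p" "p < q" "q \<le> L0"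
begin

definition lft :: "nat \<Rightarrow> real" where "lft k = (if k < 2 then 0 else L0)"
definition rgt :: "nat \<Rightarrow> real" where "rgt k = (if k < 2 then L0 else L)"
definition stiff :: "nat \<Rightarrow> real" where "stiff k = (if k = 0 then a1 else if k = 2 then a2 else 1)"

abbreviation H :: "state set" where "H \<equiv> energy_space L0 L"
abbreviation E :: "state \<Rightarrow> real" where "E \<equiv> energy_sq a1 a2 (coef c1 p q) L0 L"

definition grad :: "nat \<Rightarrow> state \<Rightarrow> cfun" where "grad k U = Dx (lft k) (rgt k) (disp k U)"

text \<open>The continuous representative of the displacement.\<close>

definition pt :: "nat \<Rightarrow> state \<Rightarrow> cfun" where "pt k U = val (lft k) (rgt k) (disp k U)"

abbreviation sq :: "nat \<Rightarrow> cfun \<Rightarrow> real" where "sq k f \<equiv> sqint (lft k) (rgt k) f"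

text \<open>The square of the \<open>H\<^sup>1 \<times> L\<^sup>2\<close> seminorm, which controls \<open>H\<^sup>1\<close> norms because every component
vanishes at an end of its interval.\<close>

definition Ksq :: "state \<Rightarrow> real" where
  "Ksq U = (\<Sum>k<4. sq k (grad k U) + sq k (vel k U))"

lemma lr: "lft k < rgt k" "0 \<le> lft k" "rgt k \<le> L" "rgt k - lft k \<le> L"
  using L0 by (auto simp: lft_def rgt_def)

lemma stiff_pos: "0 < stiff k" using a by (simp add: stiff_def)

lemma H_iff: "U \<in> H \<longleftrightarrow> (\<forall>k<4. disp k U \<in> H1 (lft k) (rgt k) \<and> vel k U \<in> L2 (lft k) (rgt k)) \<and>
    pt 0 U 0 = 0 \<and> pt 1 U 0 = 0 \<and> pt 2 U L = 0 \<and> pt 3 U L = 0 \<and> pt 0 U L0 = pt 2 U L0 \<and> pt 1 U L0 = pt 3 U L0"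
proof -
  obtain u v y z \<phi> \<eta> \<psi> \<xi> where U: "U = (u, v, y, z, \<phi>, \<eta>, \<psi>, \<xi>)" by (rule state_exhaust)
  show ?thesis unfolding U all_less_4 by (auto simp: energy_space_def pt_def lft_def rgt_def H1L_def H1R_def)
qed

lemma H_D:
  assumes "U \<in> H" "k < 4"
  shows "disp k U \<in> H1 (lft k) (rgt k)" "vel k U \<in> L2 (lft k) (rgt k)" "grad k U \<in> L2 (lft k) (rgt k)"
  using assms Dx_spec(1) by (auto simp: H_iff grad_def)

lemma pt_rep:
  assumes "U \<in> H" "k < 4" "x \<in> {lft k..rgt k}"
  shows "pt k U x = pt k U (lft k) + prim (lft k) (grad k U) x"
  unfolding pt_def grad_def using H1D(2)[OF H_D(1)[OF assms(1,2)] lr(1) assms(3)] .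

lemma pt_add: "U \<in> H \<Longrightarrow> V \<in> H \<Longrightarrow> k < 4 \<Longrightarrow> x \<in> {lft k..rgt k} \<Longrightarrow> pt k (U + V) x = pt k U x + pt k V x"
  unfolding pt_def disp_add by (rule H1_add(3)) (auto intro: H_D lr)

lemma pt_scale: "U \<in> H \<Longrightarrow> k < 4 \<Longrightarrow> x \<in> {lft k..rgt k} \<Longrightarrow> pt k (state_scale c U) x = c * pt k U x"
  unfolding pt_def disp_scale by (rule H1_scale(3)) (auto intro: H_D lr)

lemma grad_add: "U \<in> H \<Longrightarrow> V \<in> H \<Longrightarrow> k < 4 \<Longrightarrow> ae_eq (lft k) (rgt k) (grad k (U + V)) (\<lambda>x. grad k U x + grad k V x)"
  unfolding grad_def disp_add by (rule H1_add(2)) (auto intro: H_D lr)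

lemma grad_scale: "U \<in> H \<Longrightarrow> k < 4 \<Longrightarrow> ae_eq (lft k) (rgt k) (grad k (state_scale c U)) (\<lambda>x. c * grad k U x)"
  unfolding grad_def disp_scale by (rule H1_scale(2)) (auto intro: H_D lr)

lemma L2_ae_zero: "ae_eq a b f (\<lambda>x. 0) \<Longrightarrow> f \<in> L2 a b \<Longrightarrow> sqint a b f = 0"
  using sqint_cong[of a b f "\<lambda>x. 0"] L2_zero by simp

lemma pt_points: "0 \<in> {lft 0..rgt 0}" "0 \<in> {lft 1..rgt 1}" "L \<in> {lft 2..rgt 2}" "L \<in> {lft 3..rgt 3}"
  "L0 \<in> {lft 0..rgt 0}" "L0 \<in> {lft 1..rgt 1}" "L0 \<in> {lft 2..rgt 2}" "L0 \<in> {lft 3..rgt 3}"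
  using L0 by (auto simp: lft_def rgt_def)

lemma subspace_H: "state.subspace H"
proof (rule state.subspaceI)
  have "val a b (\<lambda>x. 0) x = 0" "(\<lambda>x. 0) \<in> H1 a b" if "a < b" "x \<in> {a..b}" for a b x
    using H1I[OF L2_zero L2_zero that(1), of 0] that ae_eq_refl by (auto simp: prim_def)
  then show "0 \<in> H"
    using pt_points lr unfolding H_iff pt_def disp_0 vel_0 by (auto intro!: L2_zero) (metis atLeastAtMost_iff lr(1) less_imp_le order_refl)
  fix U V assume U: "U \<in> H" and V: "V \<in> H"
  show "U + V \<in> H"
    unfolding H_iff
  proof (intro conjI allI impI)
    fix k :: nat assume "k < 4"
    then show "disp k (U + V) \<in> H1 (lft k) (rgt k)" "vel k (U + V) \<in> L2 (lft k) (rgt k)"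
      using H_D[OF U] H_D[OF V] lr by (auto simp: disp_add vel_add intro: H1_add L2_add)
  qed (use U V pt_points in \<open>simp_all add: pt_add\<close>, simp_all add: H_iff)
  fix c
  show "state_scale c U \<in> H"
    unfolding H_iff
  proof (intro conjI allI impI)
    fix k :: nat assume "k < 4"
    then show "disp k (state_scale c U) \<in> H1 (lft k) (rgt k)" "vel k (state_scale c U) \<in> L2 (lft k) (rgt k)"
      using H_D[OF U] lr by (auto simp: disp_scale vel_scale intro: H1_scale L2_scale)
  qed (use U pt_points in \<open>simp_all add: pt_scale\<close>, simp_all add: H_iff)
qed

lemmas H_add = state.subspace_add[OF subspace_H]
lemmas H_diff = state.subspace_diff[OF subspace_H]
lemmas H_scale = state.subspace_scale[OF subspace_H]

lemma grad_diff: "U \<in> H \<Longrightarrow> V \<in> H \<Longrightarrow> k < 4 \<Longrightarrow> ae_eq (lft k) (rgt k) (grad k (U - V)) (\<lambda>x. grad k U x - grad k V x)"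
proof -
  assume A: "U \<in> H" "V \<in> H" "k < 4"
  have "ae_eq (lft k) (rgt k) (grad k (U + state_scale (-1) V)) (\<lambda>x. grad k U x + grad k (state_scale (-1) V) x)"
    using A by (intro grad_add H_scale)
  moreover have "ae_eq (lft k) (rgt k) (\<lambda>x. grad k U x + grad k (state_scale (-1) V) x) (\<lambda>x. grad k U x + (-1) * grad k V x)"
    using A by (intro ae_eq_unop[of _ _ _ _ "\<lambda>x y. grad k U x + y"] grad_scale)
  ultimately have "ae_eq (lft k) (rgt k) (grad k (U + state_scale (-1) V)) (\<lambda>x. grad k U x + (-1) * grad k V x)"
    by (rule ae_eq_trans)
  then show ?thesis by simp
qed

lemma pt_diff: "U \<in> H \<Longrightarrow> V \<in> H \<Longrightarrow> k < 4 \<Longrightarrow> x \<in> {lft k..rgt k} \<Longrightarrow> pt k (U - V) x = pt k U x - pt k V x"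
  using pt_add[of U "state_scale (-1) V" k x] pt_scale[of V k x "-1"] H_scale[of V "-1"] by simp

lemma sq_grad_diff:
  assumes "U \<in> H" "V \<in> H" "k < 4"
  shows "sq k (grad k (U - V)) = sq k (\<lambda>x. grad k U x - grad k V x)"
  using grad_diff[OF assms] H_D[OF H_diff[OF assms(1,2)] assms(3)] H_D[OF assms(1,3)] H_D[OF assms(2,3)]
  by (intro sqint_cong L2_diff) auto

lemma Ksq_nonneg: "0 \<le> Ksq U"
  unfolding Ksq_def by (intro sum_nonneg add_nonneg_nonneg sqint_nonneg)

lemma Ksq_part:
  assumes "k < 4"
  shows "sq k (grad k U) \<le> Ksq U" "sq k (vel k U) \<le> Ksq U"
proof -
  have "sq k (grad k U) + sq k (vel k U) \<le> Ksq U"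
    unfolding Ksq_def using assms by (intro member_le_sum) (auto intro!: add_nonneg_nonneg sqint_nonneg)
  then show "sq k (grad k U) \<le> Ksq U" "sq k (vel k U) \<le> Ksq U"
    using sqint_nonneg[of "lft k" "rgt k" "grad k U"] sqint_nonneg[of "lft k" "rgt k" "vel k U"] by linarith+
qed

lemma Ksq_add:
  assumes "U \<in> H" "V \<in> H"
  shows "Ksq (U + V) \<le> 2 * Ksq U + 2 * Ksq V"
proof -
  have "Ksq (U + V) \<le> (\<Sum>k<4. (2 * sq k (grad k U) + 2 * sq k (grad k V)) + (2 * sq k (vel k U) + 2 * sq k (vel k V)))"
    unfolding Ksq_def
  proof (intro sum_mono add_mono)
    fix k :: nat assume "k \<in> {..<4}"
    then have k: "k < 4" by simp
    note D = H_D[OF assms(1) k] H_D[OF assms(2) k]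
    have "sq k (grad k (U + V)) = sq k (\<lambda>x. grad k U x + grad k V x)"
      using grad_add[OF assms k] H_D[OF H_add[OF assms] k] D by (intro sqint_cong L2_add) auto
    also have "\<dots> \<le> 2 * sq k (grad k U) + 2 * sq k (grad k V)" using D by (intro sqint_add_le)
    finally show "sq k (grad k (U + V)) \<le> 2 * sq k (grad k U) + 2 * sq k (grad k V)" .
    show "sq k (vel k (U + V)) \<le> 2 * sq k (vel k U) + 2 * sq k (vel k V)"
      unfolding vel_add using D by (intro sqint_add_le)
  qed
  also have "\<dots> = 2 * Ksq U + 2 * Ksq V" by (simp add: Ksq_def sum_distrib_left sum.distrib)
  finally show ?thesis .
qed

lemma Ksq_scale:
  assumes "U \<in> H"
  shows "Ksq (state_scale c U) = (cmod c)\<^sup>2 * Ksq U"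
proof -
  have "sq k (grad k (state_scale c U)) + sq k (vel k (state_scale c U)) = (cmod c)\<^sup>2 * (sq k (grad k U) + sq k (vel k U))"
    if k: "k < 4" for k
  proof -
    have "sq k (grad k (state_scale c U)) = sq k (\<lambda>x. c * grad k U x)"
      using grad_scale[OF assms k] H_D[OF H_scale[OF assms] k] H_D[OF assms k] by (intro sqint_cong L2_scale) auto
    then show ?thesis by (simp only: vel_scale sqint_scale distrib_left)
  qed
  then show ?thesis unfolding Ksq_def sum_distrib_left by (intro sum.cong) auto
qed

text \<open>Each component vanishes at one end of its interval, and the gradient is integrated from there.\<close>

lemma pt_bound:
  assumes U: "U \<in> H" and k: "k < 4" and x: "x \<in> {lft k..rgt k}"
  shows "(cmod (pt k U x))\<^sup>2 \<le> L * Ksq U"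
proof -
  define e where "e = (if k < 2 then 0 else L)"
  have e: "e \<in> {lft k..rgt k}" "pt k U e = 0"
    using U L0 less_4_cases[OF k] by (auto simp: e_def lft_def rgt_def H_iff)
  have "pt k U x = prim (lft k) (grad k U) x - prim (lft k) (grad k U) e"
    using pt_rep[OF U k x] pt_rep[OF U k e(1)] e(2) by (simp add: eq_neg_iff_add_eq_0)
  then have "(cmod (pt k U x))\<^sup>2 \<le> \<bar>x - e\<bar> * sq k (grad k U)"
    using prim_holder[OF H_D(3)[OF U k] e(1) x] by simp
  also have "\<dots> \<le> L * Ksq U"
    using e x lr[of k] Ksq_part(1)[OF k] sqint_nonneg by (intro mult_mono) auto
  finally show ?thesis .
qed

text \<open>The indefinite part of the energy.\<close>

definition cross :: "state \<Rightarrow> real" where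
  "cross U = 2 * Re (LINT x:{0<..<L0}|lborel. complex_of_real (coef c1 p q x) * disp 0 U x * cnj (disp 1 U x))"

lemma E_eq:
  assumes "U \<in> H"
  shows "E U = (\<Sum>k<4. stiff k * sq k (grad k U) + sq k (vel k U)) + cross U"
proof -
  obtain u v y z \<phi> \<eta> \<psi> \<xi> where U: "U = (u, v, y, z, \<phi>, \<eta>, \<psi>, \<xi>)" by (rule state_exhaust)
  have i: "set_integrable lborel {lft k<..<rgt k} (\<lambda>x. (cmod (grad k U x))\<^sup>2)"
    "set_integrable lborel {lft k<..<rgt k} (\<lambda>x. (cmod (vel k U x))\<^sup>2)" if "k < 4" for k
    using H_D[OF assms that] by (auto intro: L2_integrable_sq)
  note ii = i[of 0, unfolded grad_def U, simplified lft_def rgt_def, simplified] i[of 1, unfolded grad_def U, simplified lft_def rgt_def, simplified]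
    i[of 2, unfolded grad_def U, simplified lft_def rgt_def, simplified] i[of 3, unfolded grad_def U, simplified lft_def rgt_def, simplified]
  have "(LINT x:{0<..<L0}|lborel. a1 * (cmod (Dx 0 L0 u x))\<^sup>2 + (cmod (v x))\<^sup>2 + (cmod (Dx 0 L0 y x))\<^sup>2 + (cmod (z x))\<^sup>2)
      = a1 * sqint 0 L0 (Dx 0 L0 u) + sqint 0 L0 v + sqint 0 L0 (Dx 0 L0 y) + sqint 0 L0 z"
    using ii by (simp add: set_integral_add set_integrable_mult_right)
  moreover have "(LINT x:{L0<..<L}|lborel. a2 * (cmod (Dx L0 L \<phi> x))\<^sup>2 + (cmod (\<eta> x))\<^sup>2 + (cmod (Dx L0 L \<psi> x))\<^sup>2 + (cmod (\<xi> x))\<^sup>2)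
      = a2 * sqint L0 L (Dx L0 L \<phi>) + sqint L0 L \<eta> + sqint L0 L (Dx L0 L \<psi>) + sqint L0 L \<xi>"
    using ii by (simp add: set_integral_add set_integrable_mult_right)
  ultimately show ?thesis
    unfolding U sum_less_4 cross_def by (simp add: stiff_def grad_def lft_def rgt_def)
qed

text \<open>A bound by suprema, since uniform convergence is what compactness provides.\<close>

lemma cross_bound:
  assumes U: "U \<in> H" and s: "\<And>x. x \<in> {0..L0} \<Longrightarrow> cmod (pt 0 U x) \<le> s" and t: "\<And>x. x \<in> {0..L0} \<Longrightarrow> cmod (pt 1 U x) \<le> t"
  shows "\<bar>cross U\<bar> \<le> 2 * L0 * \<bar>c1\<bar> * s * t"
proof -
  let ?u = "disp 0 U" and ?y = "disp 1 U"
  have H: "?u \<in> H1 0 L0" "?y \<in> H1 0 L0" using H_D(1)[OF U, of 0] H_D(1)[OF U, of 1] by (auto simp: lft_def rgt_def)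
  have st: "0 \<le> s" "0 \<le> t" using s[of 0] t[of 0] L0 norm_ge_zero order.trans by (metis atLeastAtMost_iff less_imp_le order_refl)+
  define g where "g = (\<lambda>x. indicat_real {0<..<L0} x *\<^sub>R (complex_of_real (coef c1 p q x) * ?u x * cnj (?y x)))"
  have ae: "AE x in lborel. norm (g x) \<le> indicator {0<..<L0} x * (\<bar>c1\<bar> * s * t)"
    using H1D(4)[OF H(1) L0(1)] H1D(4)[OF H(2) L0(1)] unfolding ae_eq_def
  proof eventually_elim
    case (elim x)
    show ?case
    proof (cases "x \<in> {0<..<L0}")
      case True
      then have "cmod (?u x) \<le> s" "cmod (?y x) \<le> t"
        using elim s[of x] t[of x] by (auto simp: pt_def lft_def rgt_def)
      then have "\<bar>coef c1 p q x\<bar> * cmod (?u x) * cmod (?y x) \<le> \<bar>c1\<bar> * s * t"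
        using st by (intro mult_mono) (auto simp: coef_def)
      then show ?thesis using True by (simp add: g_def norm_mult)
    qed (simp add: g_def)
  qed
  have [measurable]: "coef c1 p q \<in> borel_measurable borel" unfolding coef_def by measurable
  define ua ya where "ua = (\<lambda>x. indicat_real {0<..<L0} x *\<^sub>R ?u x)" and "ya = (\<lambda>x. indicat_real {0<..<L0} x *\<^sub>R ?y x)"
  have [measurable]: "ua \<in> borel_measurable lborel" "ya \<in> borel_measurable lborel"
    using L2_measurable[OF H1_L2[OF H(1)]] L2_measurable[OF H1_L2[OF H(2)]] by (auto simp: set_borel_measurable_def ua_def ya_def)
  have [measurable]: "cnj \<in> borel_measurable borel"
    by (intro borel_measurable_continuous_onI continuous_intros)
  have "(\<lambda>x. complex_of_real (coef c1 p q x) * ua x * cnj (ya x)) \<in> borel_measurable lborel"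
    by measurable
  moreover have "(\<lambda>x. complex_of_real (coef c1 p q x) * ua x * cnj (ya x)) = g"
    by (auto simp: g_def ua_def ya_def indicator_def)
  ultimately have gm: "g \<in> borel_measurable lborel" by simp
  have ci: "integrable lborel (\<lambda>x. indicator {0<..<L0} x * (\<bar>c1\<bar> * s * t))"
    using set_integrable_const[of 0 L0 "\<bar>c1\<bar> * s * t"] by (simp add: set_integrable_def)
  have gi: "integrable lborel g"
    by (rule Bochner_Integration.integrable_bound[OF ci gm]) (use ae in \<open>eventually_elim; auto\<close>)
  have "cmod (integral\<^sup>L lborel g) \<le> (\<integral>x. norm (g x) \<partial>lborel)" by (rule integral_norm_bound)
  also have "\<dots> \<le> (\<integral>x. indicator {0<..<L0} x * (\<bar>c1\<bar> * s * t) \<partial>lborel)"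
    using gi ci ae by (intro integral_mono_AE) auto
  also have "\<dots> = L0 * (\<bar>c1\<bar> * s * t)" using L0 by simp
  finally have "cmod (integral\<^sup>L lborel g) \<le> L0 * (\<bar>c1\<bar> * s * t)" .
  moreover have "cross U = 2 * Re (integral\<^sup>L lborel g)" by (simp add: cross_def g_def set_lebesgue_integral_def)
  ultimately show ?thesis using abs_Re_le_cmod[of "integral\<^sup>L lborel g"] by simp
qed

definition kap :: real where "kap = min 1 (min a1 a2)"
definition Kap :: real where "Kap = 1 + a1 + a2"

lemma kap: "0 < kap" "kap \<le> stiff k" "kap \<le> 1" "stiff k \<le> Kap" "1 \<le> Kap"
  using a by (auto simp: kap_def Kap_def stiff_def)

lemma E_ge: "U \<in> H \<Longrightarrow> kap * Ksq U + cross U \<le> E U"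
proof -
  assume U: "U \<in> H"
  have "kap * Ksq U \<le> (\<Sum>k<4. stiff k * sq k (grad k U) + sq k (vel k U))"
    unfolding Ksq_def sum_distrib_left distrib_left
    using kap mult_right_mono[OF kap(3) sqint_nonneg] by (intro sum_mono add_mono mult_right_mono sqint_nonneg) auto
  then show ?thesis using E_eq[OF U] by simp
qed

lemma cross_Ksq: "U \<in> H \<Longrightarrow> \<bar>cross U\<bar> \<le> 2 * L0 * \<bar>c1\<bar> * L * Ksq U"
proof -
  assume U: "U \<in> H"
  let ?s = "sqrt (L * Ksq U)"
  have "cmod (pt k U x) \<le> ?s" if "k < 2" "x \<in> {0..L0}" for k x
    using pt_bound[OF U, of k x] that by (intro real_le_rsqrt) (auto simp: lft_def rgt_def)
  then have "\<bar>cross U\<bar> \<le> 2 * L0 * \<bar>c1\<bar> * ?s * ?s" by (intro cross_bound[OF U]) auto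
  moreover have "?s * ?s = L * Ksq U" using L0 Ksq_nonneg by simp
  ultimately show ?thesis by (simp add: mult.assoc)
qed

lemma E_le: "U \<in> H \<Longrightarrow> E U \<le> (Kap + 2 * L0 * \<bar>c1\<bar> * L) * Ksq U"
proof -
  assume U: "U \<in> H"
  have "(\<Sum>k<4. stiff k * sq k (grad k U) + sq k (vel k U)) \<le> Kap * Ksq U"
    unfolding Ksq_def sum_distrib_left distrib_left
    using kap mult_right_mono[OF kap(5) sqint_nonneg] by (intro sum_mono add_mono mult_right_mono sqint_nonneg) auto
  then show ?thesis using E_eq[OF U] cross_Ksq[OF U] by (simp add: distrib_right)
qed

end

context transmission begin

text \<open>Gradients and velocities converge in the mean square.  The limit displacements are primitives of the
limit gradients, with the constants dictated by the conditions at 0 and at the interface; as primitives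
converge pointwise, the conditions at \<open>L\<close> persist.\<close>

lemma H_complete:
  assumes f: "\<And>n::nat. f n \<in> H" and C: "\<And>e. 0 < e \<Longrightarrow> \<exists>M. \<forall>m\<ge>M. \<forall>n\<ge>M. Ksq (f m - f n) < e"
  shows "\<exists>U\<in>H. (\<lambda>n. Ksq (f n - U)) \<longlonglongrightarrow> 0"
proof -
  have "\<exists>g\<in>L2 (lft k) (rgt k). (\<lambda>n. sq k (\<lambda>x. grad k (f n) x - g x)) \<longlonglongrightarrow> 0" if k: "k < 4" for k
  proof (rule sqint_limit_complete[OF lr(1) H_D(3)[OF f k]])
    fix e :: real assume "0 < e"
    then obtain M where M: "\<And>m n. m \<ge> M \<Longrightarrow> n \<ge> M \<Longrightarrow> Ksq (f m - f n) < e" using C by blast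
    have "sq k (\<lambda>x. grad k (f m) x - grad k (f n) x) < e" if "m \<ge> M" "n \<ge> M" for m n
      using M[OF that] Ksq_part(1)[OF k, of "f m - f n"] sq_grad_diff[OF f f k, of m n] by simp
    then show "\<exists>M. \<forall>m\<ge>M. \<forall>n\<ge>M. sq k (\<lambda>x. grad k (f m) x - grad k (f n) x) < e" by blast
  qed
  then have "\<forall>k\<in>{..<4}. \<exists>g. g \<in> L2 (lft k) (rgt k) \<and> (\<lambda>n. sq k (\<lambda>x. grad k (f n) x - g x)) \<longlonglongrightarrow> 0" by auto
  from bchoice[OF this] obtain g where g: "\<And>k. k < 4 \<Longrightarrow> g k \<in> L2 (lft k) (rgt k)"
    "\<And>k. k < 4 \<Longrightarrow> (\<lambda>n. sq k (\<lambda>x. grad k (f n) x - g k x)) \<longlonglongrightarrow> 0" by blast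
  have "\<exists>g\<in>L2 (lft k) (rgt k). (\<lambda>n. sq k (\<lambda>x. vel k (f n) x - g x)) \<longlonglongrightarrow> 0" if k: "k < 4" for k
  proof (rule sqint_limit_complete[OF lr(1) H_D(2)[OF f k]])
    fix e :: real assume "0 < e"
    then obtain M where M: "\<And>m n. m \<ge> M \<Longrightarrow> n \<ge> M \<Longrightarrow> Ksq (f m - f n) < e" using C by blast
    have "sq k (\<lambda>x. vel k (f m) x - vel k (f n) x) < e" if "m \<ge> M" "n \<ge> M" for m n
      using M[OF that] Ksq_part(2)[OF k, of "f m - f n"] by (simp add: vel_diff)
    then show "\<exists>M. \<forall>m\<ge>M. \<forall>n\<ge>M. sq k (\<lambda>x. vel k (f m) x - vel k (f n) x) < e" by blast
  qed
  then have "\<forall>k\<in>{..<4}. \<exists>v. v \<in> L2 (lft k) (rgt k) \<and> (\<lambda>n. sq k (\<lambda>x. vel k (f n) x - v x)) \<longlonglongrightarrow> 0" by auto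
  from bchoice[OF this] obtain v where v: "\<And>k. k < 4 \<Longrightarrow> v k \<in> L2 (lft k) (rgt k)"
    "\<And>k. k < 4 \<Longrightarrow> (\<lambda>n. sq k (\<lambda>x. vel k (f n) x - v k x)) \<longlonglongrightarrow> 0" by blast
  define cst where "cst = (\<lambda>k::nat. if k = 2 then prim 0 (g 0) L0 else if k = 3 then prim 0 (g 1) L0 else 0)"
  define d where "d = (\<lambda>k x. cst k + prim (lft k) (g k) x)"
  define U where "U = mk_state d v"
  have dk: "disp k U = d k" "vel k U = v k" if "k < 4" for k
    using that by (auto simp: U_def disp_mk_state vel_mk_state)
  have dL2: "d k \<in> L2 (lft k) (rgt k)" if "k < 4" for k
    unfolding d_def using continuous_on_prim[OF g(1)[OF that]] by (intro continuous_L2 continuous_intros)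
  have dH: "d k \<in> H1 (lft k) (rgt k)" "ae_eq (lft k) (rgt k) (Dx (lft k) (rgt k) (d k)) (g k)"
    "\<And>x. x \<in> {lft k..rgt k} \<Longrightarrow> val (lft k) (rgt k) (d k) x = d k x" if "k < 4" for k
    using H1I[OF dL2[OF that] g(1)[OF that] lr(1), of "cst k"] by (auto simp: d_def ae_eq_refl)
  have ptU: "pt k U x = d k x" if "k < 4" "x \<in> {lft k..rgt k}" for k x
    using dH(3)[OF that] dk[OF that(1)] by (simp add: pt_def)
  have plim: "(\<lambda>n. prim (lft k) (grad k (f n)) x) \<longlonglongrightarrow> prim (lft k) (g k) x" if k: "k < 4" and x: "x \<in> {lft k..rgt k}" for k x
  proof -
    have b: "(cmod (prim (lft k) (grad k (f n)) x - prim (lft k) (g k) x))\<^sup>2 \<le> L * sq k (\<lambda>x. grad k (f n) x - g k x)" for n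
    proof -
      have dl: "(\<lambda>x. grad k (f n) x - g k x) \<in> L2 (lft k) (rgt k)" using H_D(3)[OF f k] g(1)[OF k] by (intro L2_diff)
      have "prim (lft k) (grad k (f n)) x - prim (lft k) (g k) x = prim (lft k) (\<lambda>x. grad k (f n) x - g k x) x"
        using x by (intro prim_minus[symmetric, of _ "lft k" "rgt k"] H_D(3)[OF f k] g(1)[OF k]) auto
      moreover have "(cmod (prim (lft k) (\<lambda>x. grad k (f n) x - g k x) x - prim (lft k) (\<lambda>x. grad k (f n) x - g k x) (lft k)))\<^sup>2
          \<le> \<bar>x - lft k\<bar> * sq k (\<lambda>x. grad k (f n) x - g k x)"
        using x by (intro prim_holder[OF dl]) auto
      moreover have "\<bar>x - lft k\<bar> * sq k (\<lambda>x. grad k (f n) x - g k x) \<le> L * sq k (\<lambda>x. grad k (f n) x - g k x)"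
        using x lr[of k] by (intro mult_right_mono sqint_nonneg) auto
      ultimately show ?thesis by simp
    qed
    have "(\<lambda>n. L * sq k (\<lambda>x. grad k (f n) x - g k x)) \<longlonglongrightarrow> L * 0" by (intro tendsto_intros g(2)[OF k])
    then have "(\<lambda>n. L * sq k (\<lambda>x. grad k (f n) x - g k x)) \<longlonglongrightarrow> 0" by simp
    then have "(\<lambda>n. (cmod (prim (lft k) (grad k (f n)) x - prim (lft k) (g k) x))\<^sup>2) \<longlonglongrightarrow> 0"
      by (rule tendsto_sandwich[OF _ _ tendsto_const, rotated 2]) (use b in auto)
    then have "(\<lambda>n. sqrt ((cmod (prim (lft k) (grad k (f n)) x - prim (lft k) (g k) x))\<^sup>2)) \<longlonglongrightarrow> sqrt 0"
      by (rule tendsto_real_sqrt)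
    then have "(\<lambda>n. prim (lft k) (grad k (f n)) x - prim (lft k) (g k) x) \<longlonglongrightarrow> 0"
      by (simp add: tendsto_norm_zero_iff)
    then show ?thesis by (simp add: LIM_zero_iff)
  qed
  have end0: "d k' L = 0" if kk: "k = 0 \<and> k' = 2 \<or> k = 1 \<and> k' = 3" for k k' :: nat
  proof -
    have k4: "k < 4" "k' < 4" and lrk: "lft k = 0" "rgt k = L0" "lft k' = L0" "rgt k' = L"
      using kk by (auto simp: lft_def rgt_def)
    have "prim 0 (grad k (f n)) L0 + prim L0 (grad k' (f n)) L = 0" for n
    proof -
      have "pt k (f n) L0 = pt k (f n) 0 + prim 0 (grad k (f n)) L0"
        using pt_rep[OF f k4(1), of L0 n] L0 by (simp add: lrk)
      moreover have "pt k' (f n) L = pt k' (f n) L0 + prim L0 (grad k' (f n)) L"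
        using pt_rep[OF f k4(2), of L n] L0 by (simp add: lrk)
      moreover have "pt k (f n) 0 = 0" "pt k' (f n) L = 0" "pt k (f n) L0 = pt k' (f n) L0"
        using f[of n] kk by (auto simp: H_iff)
      ultimately show ?thesis by simp
    qed
    moreover have "(\<lambda>n. prim 0 (grad k (f n)) L0 + prim L0 (grad k' (f n)) L) \<longlonglongrightarrow> prim 0 (g k) L0 + prim L0 (g k') L"
      using plim[OF k4(1), of L0] plim[OF k4(2), of L] L0 by (intro tendsto_add) (auto simp: lrk)
    ultimately have "prim 0 (g k) L0 + prim L0 (g k') L = 0" by (simp add: LIMSEQ_const_iff)
    then show ?thesis using kk by (auto simp: d_def cst_def lft_def)
  qed
  have UH: "U \<in> H"
    unfolding H_iff
  proof (intro conjI allI impI)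
    fix k :: nat assume "k < 4"
    then show "disp k U \<in> H1 (lft k) (rgt k)" "vel k U \<in> L2 (lft k) (rgt k)" using dk dH v by auto
  next
    show "pt 0 U 0 = 0" "pt 1 U 0 = 0" using ptU pt_points by (auto simp: d_def cst_def lft_def)
    show "pt 2 U L = 0" "pt 3 U L = 0" using ptU pt_points end0[of 0 2] end0[of 1 3] by auto
    show "pt 0 U L0 = pt 2 U L0" "pt 1 U L0 = pt 3 U L0" using ptU pt_points by (auto simp: d_def cst_def lft_def)
  qed
  have "Ksq (f n - U) = (\<Sum>k<4. sq k (\<lambda>x. grad k (f n) x - g k x) + sq k (\<lambda>x. vel k (f n) x - v k x))" for n
    unfolding Ksq_def
  proof (intro sum.cong refl arg_cong2[of _ _ _ _ "(+)"])
    fix k :: nat assume "k \<in> {..<4}"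
    then have k: "k < 4" by simp
    have "ae_eq (lft k) (rgt k) (\<lambda>x. grad k (f n) x - grad k U x) (\<lambda>x. grad k (f n) x - g k x)"
      using dH(2)[OF k] dk[OF k] by (intro ae_eq_unop[of _ _ _ _ "\<lambda>x y. grad k (f n) x - y"]) (simp add: grad_def)
    then have "ae_eq (lft k) (rgt k) (grad k (f n - U)) (\<lambda>x. grad k (f n) x - g k x)"
      by (rule ae_eq_trans[OF grad_diff[OF f UH k]])
    then show "sq k (grad k (f n - U)) = sq k (\<lambda>x. grad k (f n) x - g k x)"
      using H_D(3)[OF H_diff[OF f UH] k] H_D(3)[OF f k] g(1)[OF k] by (intro sqint_cong L2_diff)
    show "sq k (vel k (f n - U)) = sq k (\<lambda>x. vel k (f n) x - v k x)" using dk[OF k] by (simp add: vel_diff)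
  qed
  moreover have "(\<lambda>n. \<Sum>k<4. sq k (\<lambda>x. grad k (f n) x - g k x) + sq k (\<lambda>x. vel k (f n) x - v k x)) \<longlonglongrightarrow> (\<Sum>k<4::nat. 0 + 0)"
    by (intro tendsto_sum tendsto_add g(2) v(2)) auto
  ultimately show ?thesis using UH by (intro bexI[of _ U]) simp_all
qed

lemma null_Ksq:
  assumes U: "U \<in> H" and Z: "U \<in> null_states L0 L"
  shows "Ksq U = 0"
proof -
  have z: "ae_eq (lft k) (rgt k) (disp k U) (\<lambda>x. 0)" "ae_eq (lft k) (rgt k) (vel k U) (\<lambda>x. 0)" if "k < 4" for k
    using Z less_4_cases[OF that] by (cases U; auto simp: null_states_def lft_def rgt_def)+
  have "sq k (grad k U) = 0 \<and> sq k (vel k U) = 0" if k: "k < 4" for k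
  proof -
    have e: "ae_eq (lft k) (rgt k) (\<lambda>x. pt k U (lft k) + prim (lft k) (grad k U) x) (\<lambda>x. 0 + prim (lft k) (\<lambda>x. 0) x)"
      using ae_eq_trans[OF ae_eq_sym[OF H1D(1)[OF H_D(1)[OF U k] lr(1)]] z(1)[OF k]]
      by (simp add: grad_def pt_def prim_def)
    have "ae_eq (lft k) (rgt k) (grad k U) (\<lambda>x. 0)"
      by (rule prim_rep_unique(2)[OF H_D(3)[OF U k] L2_zero lr(1) e])
    then show ?thesis using L2_ae_zero z(2)[OF k] H_D[OF U k] by blast
  qed
  then show ?thesis by (simp add: Ksq_def)
qed

text \<open>The coupling term is bounded by suprema of \<open>u\<close> and \<open>y\<close>, hence compact relative to the rest of the
energy.  If coercivity failed, normalized states of energy tending to zero would have a convergent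
subsequence, and the limit would be a state of norm one and energy zero, against positive definiteness.\<close>

theorem coercive:
  assumes nrm: "norm_on state_scale H (null_states L0 L) (energy_norm a1 a2 (coef c1 p q) L0 L)"
  shows "\<exists>\<delta>>0. \<forall>U\<in>H. \<delta> * Ksq U \<le> E U"
proof (rule ccontr)
  define N where "N = energy_norm a1 a2 (coef c1 p q) L0 L"
  have N0: "0 \<le> N U" and Nz: "N U = 0 \<longleftrightarrow> U \<in> null_states L0 L"
    and Nt: "V \<in> H \<Longrightarrow> N (U + V) \<le> N U + N V" and Ns: "N (state_scale c U) = cmod c * N U" if "U \<in> H" for U V c
    using nrm that by (auto simp: norm_on_def N_def)
  have E0: "0 \<le> E U" if "U \<in> H" for U
    using N0[OF that] by (simp add: N_def energy_norm_def)
  have NE: "N U = sqrt (E U)" for U by (simp add: N_def energy_norm_def)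
  have NE2: "(N U)\<^sup>2 = E U" if "U \<in> H" for U using E0[OF that] by (simp add: NE)
  assume "\<not> ?thesis"
  then have small: "\<exists>U\<in>H. E U < \<delta> * Ksq U" if "0 < \<delta>" for \<delta> using that by (auto simp: not_le)
  have "\<forall>n. \<exists>U. U \<in> H \<and> E U < (1 / real (Suc n)) * Ksq U"
  proof
    fix n show "\<exists>U. U \<in> H \<and> E U < (1 / real (Suc n)) * Ksq U" using small[of "1 / real (Suc n)"] unfolding Bex_def by (simp del: energy_sq.simps)
  qed
  from choice[OF this] obtain V where V: "\<And>n. V n \<in> H" "\<And>n. E (V n) < (1 / real (Suc n)) * Ksq (V n)" by blast
  have Kpos: "0 < Ksq (V n)" for n
  proof -
    have "0 < (1 / real (Suc n)) * Ksq (V n)" using V(2)[of n] E0[OF V(1)[of n]] by linarith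
    then show ?thesis by (simp add: zero_less_mult_iff zero_less_divide_iff)
  qed
  define U where "U = (\<lambda>n. state_scale (complex_of_real (1 / sqrt (Ksq (V n)))) (V n))"
  have U: "U n \<in> H" for n using V by (auto simp: U_def intro: H_scale)
  have KU: "Ksq (U n) = 1" for n
    unfolding U_def Ksq_scale[OF V(1)] norm_of_real using Kpos[of n] by (simp add: power_divide)
  have EU: "E (U n) < 1 / real (Suc n)" for n
  proof -
    have "N (U n) = \<bar>1 / sqrt (Ksq (V n))\<bar> * N (V n)" unfolding U_def Ns[OF V(1)] norm_of_real ..
    then have "E (U n) = (1 / sqrt (Ksq (V n)))\<^sup>2 * E (V n)"
      unfolding NE2[OF U, symmetric] NE2[OF V(1), symmetric] by (simp only: power_mult_distrib power2_abs)
    also have "\<dots> = E (V n) / Ksq (V n)" using Kpos[of n] by (simp add: power_divide)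
    also have "\<dots> < 1 / real (Suc n)" unfolding pos_divide_less_eq[OF Kpos] by (rule V(2))
    finally show ?thesis .
  qed
  have Nlim: "(\<lambda>n. N (U n)) \<longlonglongrightarrow> 0"
  proof -
    have "(\<lambda>n. E (U n)) \<longlonglongrightarrow> 0"
      by (rule tendsto_sandwich[OF _ _ tendsto_const LIMSEQ_inverse_real_of_nat])
        (use EU E0 U in \<open>auto simp: inverse_eq_divide less_imp_le\<close>)
    from tendsto_real_sqrt[OF this] show ?thesis by (simp add: NE)
  qed
  \<comment> \<open>Both components at once, so that one subsequence serves for both.\<close>
  define F where "F = (\<lambda>n x. (pt 0 (U n) x, pt 1 (U n) x))"
  have ptb: "cmod (pt k (U n) x) \<le> sqrt L" if "k < 2" "x \<in> {0..L0}" for k n x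
    using pt_bound[OF U, of k x n] KU that by (intro real_le_rsqrt) (auto simp: lft_def rgt_def)
  have ptc: "(cmod (pt k (U n) y - pt k (U n) x))\<^sup>2 \<le> \<bar>y - x\<bar>" if "k < 2" "x \<in> {0..L0}" "y \<in> {0..L0}" for k n x y
  proof -
    have k4: "k < 4" and lrk: "lft k = 0" "rgt k = L0" using that by (auto simp: lft_def rgt_def)
    have "pt k (U n) y - pt k (U n) x = prim 0 (grad k (U n)) y - prim 0 (grad k (U n)) x"
      using pt_rep[OF U k4, of y n] pt_rep[OF U k4, of x n] that by (simp add: lrk)
    then have "(cmod (pt k (U n) y - pt k (U n) x))\<^sup>2 \<le> \<bar>y - x\<bar> * sq k (grad k (U n))"
      using prim_holder[OF H_D(3)[OF U k4], of x y n] that by (simp add: lrk)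
    also have "\<dots> \<le> \<bar>y - x\<bar> * 1" using Ksq_part(1)[OF k4, of "U n"] KU by (intro mult_left_mono) auto
    finally show ?thesis by simp
  qed
  have bd: "norm (F n x) \<le> sqrt L + sqrt L" if "x \<in> {0..L0}" for n x
    using norm_Pair_le[of "pt 0 (U n) x" "pt 1 (U n) x"] ptb[of 0 x n] ptb[of 1 x n] that by (simp add: F_def)
  have equi: "\<exists>d>0. \<forall>n y. y \<in> {0..L0} \<and> norm (x - y) < d \<longrightarrow> norm (F n x - F n y) < e"
    if x: "x \<in> {0..L0}" and e: "0 < e" for x e
  proof (intro exI[of _ "e\<^sup>2 / 4"] conjI allI impI)
    show "0 < e\<^sup>2 / 4" using e by simp
    fix n y assume y: "y \<in> {0..L0} \<and> norm (x - y) < e\<^sup>2 / 4"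
    have c: "cmod (pt k (U n) x - pt k (U n) y) < e / 2" if k: "k < 2" for k
    proof -
      have "(cmod (pt k (U n) x - pt k (U n) y))\<^sup>2 \<le> \<bar>x - y\<bar>" using y by (intro ptc k x) auto
      also have "\<dots> < (e / 2)\<^sup>2" using y by (simp add: power_divide)
      finally show ?thesis by (rule power2_less_imp_less) (use e in simp)
    qed
    have "F n x - F n y = (pt 0 (U n) x - pt 0 (U n) y, pt 1 (U n) x - pt 1 (U n) y)" by (simp add: F_def)
    then have "norm (F n x - F n y) \<le> cmod (pt 0 (U n) x - pt 0 (U n) y) + cmod (pt 1 (U n) x - pt 1 (U n) y)"
      by (simp only: norm_Pair_le)
    then show "norm (F n x - F n y) < e" using c[of 0] c[of 1] by simp
  qed
  have "\<exists>G r. strict_mono (r :: nat \<Rightarrow> nat) \<and> (\<forall>e>0. \<exists>N. \<forall>n x. n \<ge> N \<and> x \<in> {0..L0} \<longrightarrow> norm (F (r n) x - G x) < e)"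
    by (rule Arzela_Ascoli[OF compact_Icc bd equi]) blast+
  then obtain G r where "strict_mono (r :: nat \<Rightarrow> nat)"
    and G: "\<And>e. 0 < e \<Longrightarrow> \<exists>N. \<forall>n x. n \<ge> N \<and> x \<in> {0..L0} \<longrightarrow> norm (F (r n) x - G x) < e"
    by blast
  \<comment> \<open>Along this subsequence the coupling term of differences is small, and so is their energy.\<close>
  have cl: "\<exists>M. \<forall>m\<ge>M. \<forall>n\<ge>M. Ksq (U (r m) - U (r n)) < e" if e: "0 < e" for e
  proof -
    define A where "A = 2 * L0 * \<bar>c1\<bar>"
    have A: "0 \<le> A" using L0 by (simp add: A_def)
    define \<theta> where "\<theta> = sqrt (e * kap / (8 * (A + 1)))"
    have \<theta>: "0 < \<theta>" "A * \<theta> * \<theta> \<le> e * kap / 8"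
    proof -
      show "0 < \<theta>" using e kap A by (simp add: \<theta>_def)
      have "\<theta> * \<theta> = e * kap / (8 * (A + 1))" using e kap A by (simp add: \<theta>_def)
      then have "A * \<theta> * \<theta> = A * (e * kap / (8 * (A + 1)))" by (simp add: mult.assoc)
      also have "\<dots> \<le> (A + 1) * (e * kap / (8 * (A + 1)))" using e kap A by (intro mult_right_mono) auto
      also have "\<dots> = e * kap / 8" using A by (simp add: field_simps)
      finally show "A * \<theta> * \<theta> \<le> e * kap / 8" .
    qed
    obtain M1 where M1: "\<And>n x. n \<ge> M1 \<Longrightarrow> x \<in> {0..L0} \<Longrightarrow> norm (F (r n) x - G x) < \<theta> / 2"
      using G[OF half_gt_zero[OF \<theta>(1)]] by blast
    define \<epsilon> where "\<epsilon> = sqrt (e * kap / 8) / 2"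
    have ek: "0 < e * kap / 8" using e kap(1) by simp
    have "2 * \<epsilon> = sqrt (e * kap / 8)" by (simp add: \<epsilon>_def)
    then have \<epsilon>: "0 < \<epsilon>" "(2 * \<epsilon>)\<^sup>2 = e * kap / 8"
      using ek real_sqrt_gt_zero[OF ek] real_sqrt_pow2[OF less_imp_le[OF ek]] by (simp add: \<epsilon>_def, simp only:)
    obtain M2 where M2: "\<And>n. n \<ge> M2 \<Longrightarrow> N (U n) < \<epsilon>"
      using order_tendstoD(2)[OF Nlim \<epsilon>(1)] unfolding eventually_sequentially by blast
    have "Ksq (U (r m) - U (r n)) < e" if mn: "m \<ge> max M1 M2" "n \<ge> max M1 M2" for m n
    proof -
      let ?W = "U (r m) - U (r n)"
      have W: "?W \<in> H" using U by (intro H_diff)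
      have rm: "r m \<ge> M2" "r n \<ge> M2" using mn seq_suble[OF \<open>strict_mono r\<close>, of m] seq_suble[OF \<open>strict_mono r\<close>, of n] by auto
      have "N ?W \<le> N (U (r m)) + N (state_scale (-1) (U (r n)))"
        using Nt[OF U H_scale[OF U], of "r m" "-1" "r n"] by simp
      also have "\<dots> < 2 * \<epsilon>" using M2[OF rm(1)] M2[OF rm(2)] Ns[OF U, of "-1" "r n"] by (simp del: state.scale_minus_left)
      finally have "(N ?W)\<^sup>2 < (2 * \<epsilon>)\<^sup>2" using N0[OF W] by (intro power_strict_mono) auto
      then have EW: "E ?W < e * kap / 8" using NE2[OF W] \<epsilon> by simp
      have FF: "norm (F (r m) x - F (r n) x) \<le> \<theta>" if "x \<in> {0..L0}" for x
        using M1[of m x] M1[of n x] mn that norm_triangle_ineq4[of "F (r m) x - G x" "F (r n) x - G x"] by auto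
      have d: "cmod (pt k ?W x) \<le> \<theta>" if "k < 2" "x \<in> {0..L0}" for k x
      proof -
        have "pt k ?W x = pt k (U (r m)) x - pt k (U (r n)) x"
          using that by (intro pt_diff U) (auto simp: lft_def rgt_def)
        moreover have "F (r m) x - F (r n) x = (pt 0 (U (r m)) x - pt 0 (U (r n)) x, pt 1 (U (r m)) x - pt 1 (U (r n)) x)"
          by (simp add: F_def)
        then have "cmod (pt 0 (U (r m)) x - pt 0 (U (r n)) x) \<le> norm (F (r m) x - F (r n) x)"
          "cmod (pt 1 (U (r m)) x - pt 1 (U (r n)) x) \<le> norm (F (r m) x - F (r n) x)"
          by (simp_all only: norm_fst_le norm_snd_le)
        moreover have "k = 0 \<or> k = 1" using that(1) by auto
        ultimately have "cmod (pt k ?W x) \<le> norm (F (r m) x - F (r n) x)" by metis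
        then show ?thesis using FF[OF that(2)] by simp
      qed
      have "\<bar>cross ?W\<bar> \<le> A * \<theta> * \<theta>"
        unfolding A_def using d by (intro cross_bound[OF W]) auto
      then have "kap * Ksq ?W < e * kap / 8 + e * kap / 8" using E_ge[OF W] EW \<theta>(2) by linarith
      also have "\<dots> < kap * e" using e kap(1) by (simp add: field_simps)
      finally show ?thesis using kap(1) by simp
    qed
    then show ?thesis by blast
  qed
  have UrH: "\<And>n. U (r n) \<in> H" using U by simp
  obtain W where W: "W \<in> H" and WL: "(\<lambda>n. Ksq (U (r n) - W)) \<longlonglongrightarrow> 0"
    using H_complete[OF UrH cl] by blast
  have "(\<lambda>n. N (U (r n) - W)) \<longlonglongrightarrow> 0"
  proof -
    have "(\<lambda>n. (Kap + 2 * L0 * \<bar>c1\<bar> * L) * Ksq (U (r n) - W)) \<longlonglongrightarrow> (Kap + 2 * L0 * \<bar>c1\<bar> * L) * 0"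
      by (intro tendsto_intros WL)
    then have up: "(\<lambda>n. (Kap + 2 * L0 * \<bar>c1\<bar> * L) * Ksq (U (r n) - W)) \<longlonglongrightarrow> 0" by simp
    have "(\<lambda>n. E (U (r n) - W)) \<longlonglongrightarrow> 0"
      by (rule tendsto_sandwich[OF _ _ tendsto_const up])
        (use E_le[OF H_diff[OF U W]] E0[OF H_diff[OF U W]] in \<open>simp_all del: energy_sq.simps\<close>)
    from tendsto_real_sqrt[OF this] show ?thesis by (simp add: NE)
  qed
  moreover have "(\<lambda>n. N (U (r n))) \<longlonglongrightarrow> 0" using LIMSEQ_subseq_LIMSEQ[OF Nlim \<open>strict_mono r\<close>] by (simp add: o_def)
  ultimately have lim0: "(\<lambda>n. N (U (r n)) + N (U (r n) - W)) \<longlonglongrightarrow> 0 + 0" by (intro tendsto_add)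
  have "N W \<le> N (U (r n)) + N (U (r n) - W)" for n
    using Nt[OF U H_scale[OF H_diff[OF U W]], of "r n" "-1" "r n"] Ns[OF H_diff[OF U W], of "-1" "r n"] by simp
  then have "N W \<le> 0 + 0" by (intro LIMSEQ_le_const[OF lim0]) blast
  then have "N W = 0" using N0[OF W] by linarith
  then have KW: "Ksq W = 0" using Nz[OF W] null_Ksq[OF W] by simp
  have "1 \<le> 2 * Ksq (U (r n) - W)" for n
    using Ksq_add[OF H_diff[OF U W] W, of "r n"] KU KW by simp
  moreover have "(\<lambda>n. 2 * Ksq (U (r n) - W)) \<longlonglongrightarrow> 2 * 0" by (intro tendsto_intros WL)
  ultimately have "(1::real) \<le> 2 * 0" by (intro LIMSEQ_le_const[of "\<lambda>n. 2 * Ksq (U (r n) - W)"]) auto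
  then show False by simp
qed

end

section \<open>Orbits as classical solutions\<close>

lemma H1_diff:
  assumes f: "f \<in> H1 a b" and g: "g \<in> H1 a b" and ab: "a < b"
  shows "(\<lambda>x. f x - g x) \<in> H1 a b"
    "\<And>x. x \<in> {a..b} \<Longrightarrow> val a b (\<lambda>x. f x - g x) x = val a b f x - val a b g x"
  using H1_add[OF f H1_scale(1)[OF g ab, of "-1"] ab] H1_scale(3)[OF g ab, of _ "-1"] by auto

lemma H1_sup_bound:
  assumes f: "f \<in> H1 a b" and ab: "a < b" and x: "x \<in> {a..b}"
  shows "(cmod (val a b f x))\<^sup>2 \<le> 2 / (b - a) * sqint a b f + 2 * (b - a) * sqint a b (Dx a b f)"
proof -
  let ?F = "val a b f" and ?B = "2 * (b - a) * sqint a b (Dx a b f)"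
  note D = Dx_spec(1)[OF f]
  have pw: "(cmod (?F x))\<^sup>2 \<le> 2 * (cmod (?F y))\<^sup>2 + ?B" if y: "y \<in> {a..b}" for y
  proof -
    have "?F x - ?F y = prim a (Dx a b f) x - prim a (Dx a b f) y"
      using H1D(2)[OF f ab x] H1D(2)[OF f ab y] by simp
    then have "(cmod (?F x - ?F y))\<^sup>2 \<le> \<bar>x - y\<bar> * sqint a b (Dx a b f)"
      using prim_holder[OF D y x] by simp
    also have "\<dots> \<le> (b - a) * sqint a b (Dx a b f)" using x y by (intro mult_right_mono sqint_nonneg) auto
    finally have d: "(cmod (?F x - ?F y))\<^sup>2 \<le> (b - a) * sqint a b (Dx a b f)" .
    have "(cmod (?F x))\<^sup>2 \<le> 2 * (cmod (?F y))\<^sup>2 + 2 * (cmod (?F x - ?F y))\<^sup>2"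
      using sq_norm_add_le[of "?F y" "?F x - ?F y"] by simp
    moreover have "?B = 2 * ((b - a) * sqint a b (Dx a b f))" by (rule mult.assoc)
    ultimately show ?thesis using d by linarith
  qed
  have L: "?F \<in> L2 a b" by (rule continuous_L2[OF H1D(3)[OF f ab]])
  have "(b - a) * (cmod (?F x))\<^sup>2 = (LINT y:{a<..<b}|lborel. (cmod (?F x))\<^sup>2)"
    using ab by (simp add: set_integral_constant)
  also have "\<dots> \<le> (LINT y:{a<..<b}|lborel. 2 * (cmod (?F y))\<^sup>2 + ?B)"
    using pw by (intro set_integral_mono set_integrable_const set_integral_add set_integrable_mult_right L2_integrable_sq[OF L]) auto
  also have "\<dots> = 2 * sqint a b ?F + (b - a) * ?B"
    using ab by (subst set_integral_add(2)) (auto intro!: set_integrable_const set_integrable_mult_right L2_integrable_sq[OF L] simp: set_integral_constant)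
  also have "sqint a b ?F = sqint a b f"
    using H1D(4)[OF f ab] by (intro sqint_cong L H1_L2[OF f]) (rule ae_eq_sym)
  finally have "(b - a) * (cmod (?F x))\<^sup>2 \<le> 2 * sqint a b f + (b - a) * ?B" .
  then have "(cmod (?F x))\<^sup>2 \<le> (2 * sqint a b f + (b - a) * ?B) / (b - a)" using ab by (simp add: pos_le_divide_eq mult.commute)
  also have "\<dots> = 2 / (b - a) * sqint a b f + ?B" using ab by (simp add: add_divide_distrib)
  finally show ?thesis .
qed

text \<open>Agreement is required on a subinterval only: the coefficients jump, and the integrands of interest have a continuous
representative between the jumps.\<close>

lemma prim_has_derivative:
  assumes g: "g \<in> L2 a b" and cd: "a \<le> c" "d \<le> b" and e: "ae_eq c d g G"
    and G: "continuous_on {c<..<d} G" and x: "x \<in> {c<..<d}"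
  shows "(prim a g has_vector_derivative G x) (at x)"
proof -
  define u v where "u = (c + x) / 2" and "v = (x + d) / 2"
  have uv: "c < u" "u < x" "x < v" "v < d" using x by (auto simp: u_def v_def)
  have Gc: "continuous_on {u..v} G" using uv by (intro continuous_on_subset[OF G]) auto
  have eq: "prim a g y = prim a g u + integral {u..y} G" if y: "y \<in> {u..v}" for y
  proof -
    have Gy: "continuous_on {u..y} G" using y by (intro continuous_on_subset[OF Gc]) auto
    have i: "set_integrable lborel {u..y} G"
      unfolding set_integrable_def using borel_integrable_compact[OF compact_Icc Gy] .
    have "prim a g y - prim a g u = (LINT s:{u<..<y}|lborel. g s)"
      using y uv cd by (intro prim_diff[OF g]) auto
    also have "\<dots> = (LINT s:{u<..<y}|lborel. G s)"
    proof (rule set_integral_ae_eq)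
      show "ae_eq u y g G" by (rule ae_eq_subinterval[OF e]) (use uv y in auto)
      show "set_borel_measurable lborel {u<..<y} g" "set_borel_measurable lborel {u<..<y} G"
        using L2_integrable_sub[OF g, of u y] L2_integrable[OF continuous_L2[OF Gy]] uv y cd
        unfolding set_integrable_def set_borel_measurable_def by auto
    qed
    also have "\<dots> = integral {u..y} G"
      unfolding set_integral_open_closed by (rule set_borel_integral_eq_integral(2)[OF i])
    finally show ?thesis by (simp add: algebra_simps)
  qed
  have "((\<lambda>y. prim a g u + integral {u..y} G) has_vector_derivative 0 + G x) (at x within {u..v})"
    using uv by (intro has_vector_derivative_add has_vector_derivative_const integral_has_vector_derivative Gc) auto
  then have "((\<lambda>y. prim a g u + integral {u..y} G) has_vector_derivative G x) (at x)"
    using at_within_Icc_at[OF uv(2,3)] by (simp only: add_0_left)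
  then show ?thesis
  proof (rule has_vector_derivative_transform_within_open[where S="{u<..<v}"])
    fix y assume "y \<in> {u<..<v}"
    then show "prim a g u + integral {u..y} G = prim a g y" by (intro eq[symmetric]) auto
  qed (use uv in auto)
qed

lemma continuous_on_coef:
  assumes "l \<notin> S" "r \<notin> S" shows "continuous_on S (coef k l r)"
proof -
  have "continuous_on ({l<..<r} \<union> ({..<l} \<union> {r<..})) (coef k l r)"
  proof (rule continuous_on_open_Un)
    have "continuous_on {l<..<r} (\<lambda>x. k)" "continuous_on ({..<l} \<union> {r<..}) (\<lambda>x. 0::real)" by (rule continuous_on_const)+
    moreover have "coef k l r x = k" if "x \<in> {l<..<r}" for x using that by (simp add: coef_def)
    moreover have "coef k l r x = 0" if "x \<in> {..<l} \<union> {r<..}" for x using that by (auto simp: coef_def)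
    ultimately show "continuous_on {l<..<r} (coef k l r)" "continuous_on ({..<l} \<union> {r<..}) (coef k l r)"
      using continuous_on_cong[of "{l<..<r}" "{l<..<r}" "coef k l r" "\<lambda>x. k"]
        continuous_on_cong[of "{..<l} \<union> {r<..}" "{..<l} \<union> {r<..}" "coef k l r" "\<lambda>x. 0"] by simp_all
  qed (intro open_Un open_greaterThanLessThan open_lessThan open_greaterThan)+
  moreover have "S \<subseteq> {l<..<r} \<union> ({..<l} \<union> {r<..})"
  proof
    fix x assume "x \<in> S"
    then have "x \<noteq> l" "x \<noteq> r" using assms by auto
    then show "x \<in> {l<..<r} \<union> ({..<l} \<union> {r<..})" by (simp add: less_le) linarith
  qed
  ultimately show ?thesis by (rule continuous_on_subset)
qed

lemma coef_bound: "\<bar>coef k l r x\<bar> \<le> \<bar>k\<bar>" by (simp add: coef_def)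

lemma coef_measurable [measurable]: "coef k l r \<in> borel_measurable borel"
  unfolding coef_def by measurable

lemma L2_coef:
  assumes "f \<in> L2 a b"
  shows "(\<lambda>x. complex_of_real (coef k l r x) * f x) \<in> L2 a b"
    "sqint a b (\<lambda>x. complex_of_real (coef k l r x) * f x) \<le> k\<^sup>2 * sqint a b f"
proof -
  define fa where "fa = (\<lambda>x. indicat_real {a<..<b} x *\<^sub>R f x)"
  have [measurable]: "fa \<in> borel_measurable lborel"
    using L2_measurable[OF assms] by (simp add: fa_def set_borel_measurable_def)
  have "(\<lambda>x. complex_of_real (coef k l r x) * fa x) \<in> borel_measurable lborel" by measurable
  moreover have "(\<lambda>x. complex_of_real (coef k l r x) * fa x) = (\<lambda>x. indicat_real {a<..<b} x *\<^sub>R (complex_of_real (coef k l r x) * f x))"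
    by (auto simp: fa_def indicator_def)
  ultimately have m: "set_borel_measurable lborel {a<..<b} (\<lambda>x. complex_of_real (coef k l r x) * f x)"
    by (simp add: set_borel_measurable_def)
  have b: "(cmod (complex_of_real (coef k l r x) * f x))\<^sup>2 \<le> k\<^sup>2 * (cmod (f x))\<^sup>2" for x
    by (simp add: coef_def norm_mult power_mult_distrib)
  have i: "set_integrable lborel {a<..<b} (\<lambda>x. k\<^sup>2 * (cmod (f x))\<^sup>2)"
    by (intro set_integrable_mult_right L2_integrable_sq[OF assms])
  have "(\<lambda>x. (cmod (indicat_real {a<..<b} x *\<^sub>R (complex_of_real (coef k l r x) * f x)))\<^sup>2) \<in> borel_measurable lborel"
    using m unfolding set_borel_measurable_def by measurable
  moreover have "(\<lambda>x. (cmod (indicat_real {a<..<b} x *\<^sub>R (complex_of_real (coef k l r x) * f x)))\<^sup>2)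
      = (\<lambda>x. indicat_real {a<..<b} x *\<^sub>R (cmod (complex_of_real (coef k l r x) * f x))\<^sup>2)"
    by (auto simp: indicator_def)
  ultimately have m2: "set_borel_measurable lborel {a<..<b} (\<lambda>x. (cmod (complex_of_real (coef k l r x) * f x))\<^sup>2)"
    by (simp only: set_borel_measurable_def)
  have i2: "set_integrable lborel {a<..<b} (\<lambda>x. (cmod (complex_of_real (coef k l r x) * f x))\<^sup>2)"
  proof (rule set_integrable_bound[OF i m2], rule AE_I2, rule impI)
    fix x show "norm ((cmod (complex_of_real (coef k l r x) * f x))\<^sup>2) \<le> norm (k\<^sup>2 * (cmod (f x))\<^sup>2)"
      using b[of x] by (simp only: real_norm_def abs_of_nonneg[OF zero_le_power2] abs_of_nonneg[OF mult_nonneg_nonneg[OF zero_le_power2 zero_le_power2]])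
  qed
  then show "(\<lambda>x. complex_of_real (coef k l r x) * f x) \<in> L2 a b" using m by (simp add: L2_def)
  have "sqint a b (\<lambda>x. complex_of_real (coef k l r x) * f x) \<le> (LINT x:{a<..<b}|lborel. k\<^sup>2 * (cmod (f x))\<^sup>2)"
    by (rule set_integral_mono[OF i2 i]) (rule b)
  then show "sqint a b (\<lambda>x. complex_of_real (coef k l r x) * f x) \<le> k\<^sup>2 * sqint a b f" by simp
qed

locale damped_transmission = transmission +
  fixes \<beta>1 \<beta>2 \<beta>3 \<beta>4 c2 d2 :: real and S :: "real \<Rightarrow> state \<Rightarrow> state"
  assumes \<beta>: "L0 < \<beta>1" "\<beta>1 < \<beta>2" "\<beta>2 < \<beta>3" "\<beta>3 < \<beta>4" "\<beta>4 < L" and d2: "0 < d2" and c2: "c2 \<noteq> 0"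
    and norm: "norm_on state_scale (energy_space L0 L) (null_states L0 L) (energy_norm a1 a2 (coef c1 p q) L0 L)"
    and semigroup: "C0_contraction_semigroup state_scale (energy_space L0 L) (energy_norm a1 a2 (coef c1 p q) L0 L) S"
    and generator: "is_generator state_scale (energy_space L0 L) (energy_norm a1 a2 (coef c1 p q) L0 L) S
           (wave_dom a1 a2 L0 L) (wave_op a1 a2 (coef c1 p q) (coef c2 \<beta>1 \<beta>3) (coef d2 \<beta>2 \<beta>4) L0 L)"
begin

abbreviation N where "N \<equiv> energy_norm a1 a2 (coef c1 p q) L0 L"
abbreviation Dom where "Dom \<equiv> wave_dom a1 a2 L0 L"
abbreviation Op where "Op \<equiv> wave_op a1 a2 (coef c1 p q) (coef c2 \<beta>1 \<beta>3) (coef d2 \<beta>2 \<beta>4) L0 L"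

sublocale gen: contraction_generator state_scale H "null_states L0 L" N S Dom Op
  using subspace_H norm semigroup generator by unfold_locales

lemma N_sq: "U \<in> H \<Longrightarrow> (N U)\<^sup>2 = E U"
proof -
  assume "U \<in> H"
  then have "0 \<le> E U" using gen.N_ge_0[of U] by (simp add: energy_norm_def)
  then show ?thesis by (simp add: energy_norm_def)
qed

lemma Ksq_le_N: "\<exists>C\<ge>0. \<forall>U\<in>H. Ksq U \<le> C * (N U)\<^sup>2"
proof -
  obtain \<delta> where \<delta>: "0 < \<delta>" "\<And>U. U \<in> H \<Longrightarrow> \<delta> * Ksq U \<le> E U" using coercive[OF norm] by blast
  have "Ksq U \<le> 1 / \<delta> * (N U)\<^sup>2" if "U \<in> H" for U
  proof -
    have "\<delta> * Ksq U \<le> (N U)\<^sup>2" unfolding N_sq[OF that] by (rule \<delta>(2)[OF that])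
    then show ?thesis using \<delta>(1) by (simp add: field_simps)
  qed
  then show ?thesis using \<delta>(1) by (intro exI[of _ "1 / \<delta>"]) auto
qed

definition KC :: real where "KC = (SOME C. C \<ge> 0 \<and> (\<forall>U\<in>H. Ksq U \<le> C * (N U)\<^sup>2))"

lemma KC: "0 \<le> KC" "U \<in> H \<Longrightarrow> Ksq U \<le> KC * (N U)\<^sup>2"
proof -
  have "\<exists>C. C \<ge> 0 \<and> (\<forall>U\<in>H. Ksq U \<le> C * (N U)\<^sup>2)" using Ksq_le_N by blast
  from someI_ex[OF this] have "0 \<le> KC \<and> (\<forall>U\<in>H. Ksq U \<le> KC * (N U)\<^sup>2)" unfolding KC_def .
  then show "0 \<le> KC" "U \<in> H \<Longrightarrow> Ksq U \<le> KC * (N U)\<^sup>2" by auto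
qed

sublocale gen: complete_contraction_generator state_scale H "null_states L0 L" N S Dom Op
proof
  fix f :: "nat \<Rightarrow> state"
  assume f: "\<And>n. f n \<in> H" and C: "\<And>e. 0 < e \<Longrightarrow> \<exists>M. \<forall>m\<ge>M. \<forall>n\<ge>M. N (f m - f n) < e"
  have "\<exists>U\<in>H. (\<lambda>n. Ksq (f n - U)) \<longlonglongrightarrow> 0"
  proof (rule H_complete[OF f])
    fix e :: real assume e: "0 < e"
    define e' where "e' = sqrt (e / (KC + 1))"
    have kc: "0 < KC + 1" using KC(1) by linarith
    then have q: "0 < e / (KC + 1)" using e by simp
    have e': "0 < e'" unfolding e'_def using q by (rule real_sqrt_gt_zero)
    have "e'\<^sup>2 = e / (KC + 1)" unfolding e'_def using q by (intro real_sqrt_pow2) simp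
    then have e'2: "(KC + 1) * e'\<^sup>2 = e" using kc by simp
    obtain M where M: "\<And>m n. m \<ge> M \<Longrightarrow> n \<ge> M \<Longrightarrow> N (f m - f n) < e'" using C[OF e'] by blast
    have "Ksq (f m - f n) < e" if mn: "m \<ge> M" "n \<ge> M" for m n
    proof -
      have d: "f m - f n \<in> H" using f by (intro H_diff)
      have "Ksq (f m - f n) \<le> KC * (N (f m - f n))\<^sup>2" by (rule KC(2)[OF d])
      also have "\<dots> \<le> (KC + 1) * (N (f m - f n))\<^sup>2" by (intro mult_right_mono) auto
      also have "\<dots> < (KC + 1) * e'\<^sup>2"
        by (intro mult_strict_left_mono power_strict_mono M[OF mn] gen.N_ge_0[OF d] kc) simp
      finally show ?thesis unfolding e'2 .
    qed
    then show "\<exists>M. \<forall>m\<ge>M. \<forall>n\<ge>M. Ksq (f m - f n) < e" by blast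
  qed
  then obtain U where U: "U \<in> H" and lim: "(\<lambda>n. Ksq (f n - U)) \<longlonglongrightarrow> 0" by blast
  let ?C = "Kap + 2 * L0 * \<bar>c1\<bar> * L"
  have "(\<lambda>n. ?C * Ksq (f n - U)) \<longlonglongrightarrow> ?C * 0" by (intro tendsto_intros lim)
  then have up: "(\<lambda>n. ?C * Ksq (f n - U)) \<longlonglongrightarrow> 0" by simp
  have "(\<lambda>n. (N (f n - U))\<^sup>2) \<longlonglongrightarrow> 0"
  proof (rule tendsto_sandwich[OF _ _ tendsto_const up])
    show "\<forall>\<^sub>F n in sequentially. (N (f n - U))\<^sup>2 \<le> ?C * Ksq (f n - U)"
      using E_le[OF H_diff[OF f U]] by (simp add: N_sq[OF H_diff[OF f U]] del: energy_sq.simps)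
  qed auto
  from tendsto_real_sqrt[OF this] have "(\<lambda>n. N (f n - U)) \<longlonglongrightarrow> 0"
    by (simp only: real_sqrt_abs abs_of_nonneg[OF gen.N_ge_0[OF H_diff[OF f U]]] real_sqrt_zero)
  then show "\<exists>U\<in>H. (\<lambda>n. N (f n - U)) \<longlonglongrightarrow> 0" using U by blast
qed

text \<open>By coercivity, states at energy distance zero agree almost everywhere.\<close>

lemma eqv_ae:
  assumes "U \<in> H" "V \<in> H" "gen.eqv U V" "k < 4"
  shows "ae_eq (lft k) (rgt k) (disp k U) (disp k V)" "ae_eq (lft k) (rgt k) (vel k U) (vel k V)"
proof -
  have "U - V \<in> null_states L0 L"
    using norm H_diff[OF assms(1,2)] assms(3) by (auto simp: norm_on_def gen.eqv_def)
  then have "ae_eq (lft k) (rgt k) (disp k (U - V)) (\<lambda>x. 0) \<and> ae_eq (lft k) (rgt k) (vel k (U - V)) (\<lambda>x. 0)"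
    using less_4_cases[OF assms(4)] by (cases "U - V") (auto simp: null_states_def lft_def rgt_def)
  then show "ae_eq (lft k) (rgt k) (disp k U) (disp k V)" "ae_eq (lft k) (rgt k) (vel k U) (vel k V)"
    unfolding disp_diff vel_diff ae_eq_def by simp_all
qed

text \<open>The continuous representative of the gradient, for states of the domain.\<close>

definition fl :: "nat \<Rightarrow> state \<Rightarrow> cfun" where "fl k U = val (lft k) (rgt k) (grad k U)"

text \<open>The lower-order terms of the four equations, on displacements \<open>D\<close> and velocities \<open>V\<close>.\<close>

definition lower :: "(nat \<Rightarrow> complex) \<Rightarrow> (nat \<Rightarrow> complex) \<Rightarrow> nat \<Rightarrow> real \<Rightarrow> complex" where
  "lower D V k x =
    (if k = 0 then - complex_of_real (coef c1 p q x) * D 1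
     else if k = 1 then - complex_of_real (coef c1 p q x) * D 0
     else if k = 2 then - complex_of_real (coef c2 \<beta>1 \<beta>3 x) * V 3 - complex_of_real (coef d2 \<beta>2 \<beta>4 x) * V 2
     else complex_of_real (coef c2 \<beta>1 \<beta>3 x) * V 2)"

lemma Dom_D:
  assumes "U \<in> Dom"
  shows "k < 4 \<Longrightarrow> grad k U \<in> H1 (lft k) (rgt k)" "k < 4 \<Longrightarrow> vel k U \<in> H1 (lft k) (rgt k)"
    "complex_of_real a1 * fl 0 U L0 = complex_of_real a2 * fl 2 U L0" "fl 1 U L0 = fl 3 U L0"
proof -
  obtain u v y z \<phi> \<eta> \<psi> \<xi> where U: "U = (u, v, y, z, \<phi>, \<eta>, \<psi>, \<xi>)" by (rule state_exhaust)
  note W = assms[unfolded U wave_dom_def mem_Collect_eq prod.case]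
  have g: "Dx 0 L0 u \<in> H1 0 L0" "Dx 0 L0 y \<in> H1 0 L0" "Dx L0 L \<phi> \<in> H1 L0 L" "Dx L0 L \<psi> \<in> H1 L0 L"
    using W unfolding H2_def by blast+
  have v: "v \<in> H1 0 L0" "z \<in> H1 0 L0" "\<eta> \<in> H1 L0 L" "\<xi> \<in> H1 L0 L"
    using W unfolding H1L_def H1R_def by blast+
  show "k < 4 \<Longrightarrow> grad k U \<in> H1 (lft k) (rgt k)" "k < 4 \<Longrightarrow> vel k U \<in> H1 (lft k) (rgt k)"
    using g v less_4_cases[of k] unfolding U by (auto simp: grad_def lft_def rgt_def)
  have "complex_of_real a1 * val 0 L0 (Dx 0 L0 u) L0 = complex_of_real a2 * val L0 L (Dx L0 L \<phi>) L0"
    "val 0 L0 (Dx 0 L0 y) L0 = val L0 L (Dx L0 L \<psi>) L0"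
    using W by blast+
  then show "complex_of_real a1 * fl 0 U L0 = complex_of_real a2 * fl 2 U L0" "fl 1 U L0 = fl 3 U L0"
    unfolding U by (simp_all only: fl_def grad_def lft_def rgt_def disp.simps) simp_all
qed

lemma disp_Op: "k < 4 \<Longrightarrow> disp k (Op U) = vel k U"
  and vel_Op: "k < 4 \<Longrightarrow> vel k (Op U) = (\<lambda>x. complex_of_real (stiff k) * Dx (lft k) (rgt k) (grad k U) x
      + lower (\<lambda>m. disp m U x) (\<lambda>m. vel m U x) k x)"
proof -
  obtain u v y z \<phi> \<eta> \<psi> \<xi> where U: "U = (u, v, y, z, \<phi>, \<eta>, \<psi>, \<xi>)" by (rule state_exhaust)
  show "k < 4 \<Longrightarrow> disp k (Op U) = vel k U" using less_4_cases[of k] unfolding U by auto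
  show "k < 4 \<Longrightarrow> vel k (Op U) = (\<lambda>x. complex_of_real (stiff k) * Dx (lft k) (rgt k) (grad k U) x
      + lower (\<lambda>m. disp m U x) (\<lambda>m. vel m U x) k x)"
    using less_4_cases[of k] unfolding U by (auto simp: lower_def stiff_def grad_def lft_def rgt_def fun_eq_iff)
qed

lemma disp_L2_bound:
  assumes U: "U \<in> H" and k: "k < 4"
  shows "sq k (disp k U) \<le> L * (L * Ksq U)"
proof -
  have "sq k (disp k U) = sq k (pt k U)"
    using H1D(4)[OF H_D(1)[OF U k] lr(1)] H1_L2[OF H_D(1)[OF U k]] continuous_L2[OF H1D(3)[OF H_D(1)[OF U k] lr(1)]]
    unfolding pt_def by (intro sqint_cong)
  also have "\<dots> \<le> (LINT x:{lft k<..<rgt k}|lborel. L * Ksq U)"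
    using pt_bound[OF U k] continuous_L2[OF H1D(3)[OF H_D(1)[OF U k] lr(1)]]
    by (intro set_integral_mono set_integrable_const L2_integrable_sq) (auto simp: pt_def)
  also have "\<dots> = (rgt k - lft k) * (L * Ksq U)" using lr(1)[of k] by (simp add: set_integral_constant)
  also have "\<dots> \<le> L * (L * Ksq U)" using lr(4)[of k] L0 Ksq_nonneg by (intro mult_right_mono) auto
  finally show ?thesis .
qed

lemma lower_L2:
  assumes U: "U \<in> H" and k: "k < 4"
  shows "(\<lambda>x. lower (\<lambda>m. disp m U x) (\<lambda>m. vel m U x) k x) \<in> L2 (lft k) (rgt k)"
    "sq k (\<lambda>x. lower (\<lambda>m. disp m U x) (\<lambda>m. vel m U x) k x) \<le> (c1\<^sup>2 * L * L + 2 * c2\<^sup>2 + 2 * d2\<^sup>2) * Ksq U"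
proof -
  let ?l = "\<lambda>x. lower (\<lambda>m. disp m U x) (\<lambda>m. vel m U x) k x"
  have K0: "0 \<le> Ksq U" by (rule Ksq_nonneg)
  have c: "0 \<le> c1\<^sup>2 * L * L * Ksq U" "0 \<le> c2\<^sup>2 * Ksq U" "0 \<le> d2\<^sup>2 * Ksq U" using K0 L0 by auto
  have "?l \<in> L2 (lft k) (rgt k) \<and> sq k ?l \<le> (c1\<^sup>2 * L * L + 2 * c2\<^sup>2 + 2 * d2\<^sup>2) * Ksq U"
  proof (cases "k < 2")
    case True
    define m where "m = 1 - k"
    have m: "m < 4" "lft m = lft k" "rgt m = rgt k" using True by (auto simp: m_def lft_def rgt_def)
    have eq: "lower (\<lambda>m. disp m U x) (\<lambda>m. vel m U x) k x = (-1) * (complex_of_real (coef c1 p q x) * disp m U x)" for x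
      using True by (auto simp: lower_def m_def)
    have dL: "disp m U \<in> L2 (lft k) (rgt k)" using H1_L2[OF H_D(1)[OF U m(1)]] m by simp
    have "sq k ?l = sq k (\<lambda>x. complex_of_real (coef c1 p q x) * disp m U x)"
    proof -
      have "sq k (\<lambda>x. (-1) * (complex_of_real (coef c1 p q x) * disp m U x)) = (cmod (-1))\<^sup>2 * sq k (\<lambda>x. complex_of_real (coef c1 p q x) * disp m U x)"
        by (rule sqint_scale)
      then show ?thesis unfolding eq by simp
    qed
    also have "\<dots> \<le> c1\<^sup>2 * sq k (disp m U)" by (rule L2_coef(2)[OF dL])
    also have "\<dots> \<le> c1\<^sup>2 * (L * (L * Ksq U))" using disp_L2_bound[OF U m(1)] m by (intro mult_left_mono) auto
    finally have "sq k ?l \<le> c1\<^sup>2 * L * L * Ksq U" by (simp add: mult.assoc)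
    then show ?thesis using c L2_scale[OF L2_coef(1)[OF dL], of "-1" c1 p q] unfolding eq by (simp add: distrib_right)
  next
    case False
    then have kk: "k = 2 \<or> k = 3" using k by auto
    have lrk: "lft k = L0" "rgt k = L" using False by (auto simp: lft_def rgt_def)
    have v: "vel 2 U \<in> L2 L0 L" "vel 3 U \<in> L2 L0 L" "sqint L0 L (vel 2 U) \<le> Ksq U" "sqint L0 L (vel 3 U) \<le> Ksq U"
      using H_D(2)[OF U, of 2] H_D(2)[OF U, of 3] Ksq_part(2)[of 2 U] Ksq_part(2)[of 3 U] by (auto simp: lft_def rgt_def)
    let ?g = "\<lambda>x. complex_of_real (coef c2 \<beta>1 \<beta>3 x) * vel 3 U x" and ?h = "\<lambda>x. complex_of_real (coef d2 \<beta>2 \<beta>4 x) * vel 2 U x"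
      and ?e = "\<lambda>x. complex_of_real (coef c2 \<beta>1 \<beta>3 x) * vel 2 U x"
    have gh: "sqint L0 L ?g \<le> c2\<^sup>2 * Ksq U" "sqint L0 L ?h \<le> d2\<^sup>2 * Ksq U" "sqint L0 L ?e \<le> c2\<^sup>2 * Ksq U"
      using order.trans[OF L2_coef(2)[OF v(2), of c2 \<beta>1 \<beta>3] mult_left_mono[OF v(4), of "c2\<^sup>2"]]
        order.trans[OF L2_coef(2)[OF v(1), of d2 \<beta>2 \<beta>4] mult_left_mono[OF v(3), of "d2\<^sup>2"]]
        order.trans[OF L2_coef(2)[OF v(1), of c2 \<beta>1 \<beta>3] mult_left_mono[OF v(3), of "c2\<^sup>2"]] by auto
    have ghL: "?g \<in> L2 L0 L" "?h \<in> L2 L0 L" "?e \<in> L2 L0 L" using L2_coef(1)[OF v(2)] L2_coef(1)[OF v(1)] by auto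
    from kk show ?thesis
    proof
      assume k2: "k = 2"
      have eq: "lower (\<lambda>m. disp m U x) (\<lambda>m. vel m U x) k x = (-1) * (?g x + ?h x)" for x unfolding k2 by (simp add: lower_def)
      have "sq k ?l = sqint L0 L (\<lambda>x. ?g x + ?h x)" unfolding eq sqint_scale lrk by simp
      also have "\<dots> \<le> 2 * sqint L0 L ?g + 2 * sqint L0 L ?h" by (rule sqint_add_le[OF ghL(1,2)])
      finally have "sq k ?l \<le> 2 * (c2\<^sup>2 * Ksq U) + 2 * (d2\<^sup>2 * Ksq U)" using gh by linarith
      then show ?thesis using c L2_scale[OF L2_add[OF ghL(1,2)], of "-1"] unfolding eq lrk by (simp add: distrib_right)
    next
      assume k3: "k = 3"
      have eq: "lower (\<lambda>m. disp m U x) (\<lambda>m. vel m U x) k x = ?e x" for x unfolding k3 by (simp add: lower_def)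
      show ?thesis using c gh(3) ghL(3) unfolding eq lrk by (simp add: distrib_right)
    qed
  qed
  then show "?l \<in> L2 (lft k) (rgt k)" "sq k ?l \<le> (c1\<^sup>2 * L * L + 2 * c2\<^sup>2 + 2 * d2\<^sup>2) * Ksq U" by auto
qed

lemma pt_N: "\<exists>C\<ge>0. \<forall>U\<in>H. \<forall>k<4. \<forall>x\<in>{lft k..rgt k}. cmod (pt k U x) \<le> C * N U"
proof (intro exI[of _ "sqrt (L * KC)"] conjI ballI allI impI)
  show "0 \<le> sqrt (L * KC)" using L0 KC(1) by simp
  fix U k x assume U: "U \<in> H" and k: "(k::nat) < 4" and x: "x \<in> {lft k..rgt k}"
  have "(cmod (pt k U x))\<^sup>2 \<le> L * Ksq U" by (rule pt_bound[OF U k x])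
  also have "\<dots> \<le> L * (KC * (N U)\<^sup>2)" using KC(2)[OF U] L0 by (intro mult_left_mono) auto
  finally have "(cmod (pt k U x))\<^sup>2 \<le> (sqrt (L * KC) * N U)\<^sup>2"
    using L0 KC(1) by (simp add: power_mult_distrib mult.assoc)
  then show "cmod (pt k U x) \<le> sqrt (L * KC) * N U"
    by (rule power2_le_imp_le) (use L0 KC(1) gen.N_ge_0[OF U] in auto)
qed

text \<open>The second space derivative is a combination of the velocity component of the image under the operator and of lower-order terms, so
the graph norm bounds the gradient in \<open>H\<^sup>1\<close>, and thereby pointwise.\<close>

lemma fl_N: "\<exists>C\<ge>0. \<forall>U\<in>Dom. \<forall>k<4. \<forall>x\<in>{lft k..rgt k}. cmod (fl k U x) \<le> C * (N U + N (Op U))"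
proof -
  define l where "l = min L0 (L - L0)"
  define B where "B = c1\<^sup>2 * L * L + 2 * c2\<^sup>2 + 2 * d2\<^sup>2"
  define C where "C = 2 / l + 2 * L * ((2 + 2 * B) / kap\<^sup>2)"
  have l: "0 < l" using L0 by (simp add: l_def)
  have B: "0 \<le> B" using L0 by (simp add: B_def)
  have Cp: "0 \<le> 2 * L * ((2 + 2 * B) / kap\<^sup>2)" "0 \<le> 2 / l" using l B L0 by auto
  have C: "0 \<le> C" using Cp by (simp add: C_def)
  show ?thesis
  proof (intro exI[of _ "sqrt (C * KC)"] conjI ballI allI impI)
    show "0 \<le> sqrt (C * KC)" using C KC(1) by simp
    fix U k x assume U: "U \<in> Dom" and k: "(k::nat) < 4" and x: "x \<in> {lft k..rgt k}"
    have UH: "U \<in> H" "Op U \<in> H" using U by auto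
    note g = Dom_D(1)[OF U k]
    let ?DD = "Dx (lft k) (rgt k) (grad k U)" and ?lo = "\<lambda>x. lower (\<lambda>m. disp m U x) (\<lambda>m. vel m U x) k x"
    have st: "kap \<le> stiff k" "0 < stiff k" using kap stiff_pos by auto
    have DD: "?DD = (\<lambda>x. complex_of_real (1 / stiff k) * (vel k (Op U) x + (-1) * ?lo x))"
      using st(2) unfolding vel_Op[OF k] by (simp add: fun_eq_iff)
    have "sq k ?DD = (1 / stiff k)\<^sup>2 * sq k (\<lambda>x. vel k (Op U) x + (-1) * ?lo x)"
      unfolding DD sqint_scale using st(2) by (simp add: norm_divide power_divide)
    also have "\<dots> \<le> (1 / kap\<^sup>2) * (2 * Ksq (Op U) + 2 * (B * Ksq U))"
    proof (intro mult_mono)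
      have "kap\<^sup>2 \<le> (stiff k)\<^sup>2" using st kap(1) by (intro power_mono) auto
      then show "(1 / stiff k)\<^sup>2 \<le> 1 / kap\<^sup>2" using kap(1) by (simp add: power_divide frac_le)
      have "sq k (\<lambda>x. vel k (Op U) x + (-1) * ?lo x) \<le> 2 * sq k (vel k (Op U)) + 2 * sq k (\<lambda>x. (-1) * ?lo x)"
        by (rule sqint_add_le[OF H_D(2)[OF UH(2) k] L2_scale[OF lower_L2(1)[OF UH(1) k]]])
      also have "sq k (\<lambda>x. (-1) * ?lo x) = sq k ?lo" unfolding sqint_scale by simp
      also have "2 * sq k (vel k (Op U)) + 2 * sq k ?lo \<le> 2 * Ksq (Op U) + 2 * (B * Ksq U)"
        using Ksq_part(2)[OF k, of "Op U"] lower_L2(2)[OF UH(1) k] by (simp add: B_def)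
      finally show "sq k (\<lambda>x. vel k (Op U) x + (-1) * ?lo x) \<le> 2 * Ksq (Op U) + 2 * (B * Ksq U)" .
    qed (use kap(1) in \<open>auto intro: sqint_nonneg\<close>)
    also have "\<dots> \<le> (1 / kap\<^sup>2) * ((2 + 2 * B) * (Ksq U + Ksq (Op U)))"
      using Ksq_nonneg[of U] Ksq_nonneg[of "Op U"] B kap(1) by (intro mult_left_mono) (auto simp: algebra_simps)
    finally have dd: "sq k ?DD \<le> (2 + 2 * B) / kap\<^sup>2 * (Ksq U + Ksq (Op U))" by simp
    have "(cmod (fl k U x))\<^sup>2 \<le> 2 / (rgt k - lft k) * sq k (grad k U) + 2 * (rgt k - lft k) * sq k ?DD"
      unfolding fl_def by (rule H1_sup_bound[OF g lr(1) x])
    also have "\<dots> \<le> 2 / l * (Ksq U + Ksq (Op U)) + 2 * L * ((2 + 2 * B) / kap\<^sup>2 * (Ksq U + Ksq (Op U)))"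
    proof (intro add_mono mult_mono)
      have "l \<le> rgt k - lft k" by (auto simp: l_def lft_def rgt_def)
      then show "2 / (rgt k - lft k) \<le> 2 / l" using l by (intro divide_left_mono) auto
      show "sq k (grad k U) \<le> Ksq U + Ksq (Op U)" using Ksq_part(1)[OF k, of U] Ksq_nonneg[of "Op U"] by linarith
    qed (use dd lr(1)[of k] lr(4)[of k] l L0 sqint_nonneg in \<open>auto intro: less_imp_le\<close>)
    also have "\<dots> = C * (Ksq U + Ksq (Op U))" by (simp add: C_def algebra_simps)
    also have "\<dots> \<le> C * (KC * (N U)\<^sup>2 + KC * (N (Op U))\<^sup>2)"
      using KC(2)[OF UH(1)] KC(2)[OF UH(2)] C by (intro mult_left_mono add_mono) auto
    also have "\<dots> \<le> C * KC * (N U + N (Op U))\<^sup>2"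
    proof -
      have "(N U)\<^sup>2 + (N (Op U))\<^sup>2 \<le> (N U + N (Op U))\<^sup>2"
        using gen.N_ge_0[OF UH(1)] gen.N_ge_0[OF UH(2)] by (simp add: power2_sum)
      then have "C * KC * ((N U)\<^sup>2 + (N (Op U))\<^sup>2) \<le> C * KC * (N U + N (Op U))\<^sup>2"
        using C KC(1) by (intro mult_left_mono) auto
      then show ?thesis by (simp add: algebra_simps)
    qed
    also have "\<dots> = (sqrt (C * KC) * (N U + N (Op U)))\<^sup>2"
      using C KC(1) by (simp add: power_mult_distrib)
    finally have "(cmod (fl k U x))\<^sup>2 \<le> (sqrt (C * KC) * (N U + N (Op U)))\<^sup>2" .
    then show "cmod (fl k U x) \<le> sqrt (C * KC) * (N U + N (Op U))"
      by (rule power2_le_imp_le) (use C KC(1) gen.N_ge_0[OF UH(1)] gen.N_ge_0[OF UH(2)] in auto)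
  qed
qed

lemma fl_diff:
  assumes U: "U \<in> Dom" and V: "V \<in> Dom" and k: "k < 4" and x: "x \<in> {lft k..rgt k}"
  shows "fl k (U - V) x = fl k U x - fl k V x"
proof -
  note g = H1_diff[OF Dom_D(1)[OF U k] Dom_D(1)[OF V k] lr(1)]
  have UV: "U \<in> H" "V \<in> H" using U V by auto
  have "val (lft k) (rgt k) (grad k (U - V)) x = val (lft k) (rgt k) (\<lambda>x. grad k U x - grad k V x) x"
    by (rule H1_cong(3)[OF g(1) lr(1) H_D(3)[OF H_diff[OF UV] k] ae_eq_sym[OF grad_diff[OF UV k]] x])
  then show ?thesis using g(2)[OF x] by (simp add: fl_def)
qed

lemma fl_scale:
  assumes U: "U \<in> Dom" and k: "k < 4" and x: "x \<in> {lft k..rgt k}"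
  shows "fl k (state_scale c U) x = c * fl k U x"
proof -
  note g = H1_scale[OF Dom_D(1)[OF U k] lr(1), where k=c]
  have UH: "U \<in> H" using U by auto
  have "val (lft k) (rgt k) (grad k (state_scale c U)) x = val (lft k) (rgt k) (\<lambda>x. c * grad k U x) x"
    by (rule H1_cong(3)[OF g(1) lr(1) H_D(3)[OF H_scale[OF UH] k] ae_eq_sym[OF grad_scale[OF UH k]] x])
  then show ?thesis using g(3)[OF x] by (simp add: fl_def)
qed

lemma pt_derivative:
  assumes U: "U \<in> Dom" and k: "k < 4" and x: "x \<in> {lft k<..<rgt k}"
  shows "(pt k U has_vector_derivative fl k U x) (at x)"
proof -
  have UH: "U \<in> H" using U by auto
  note g = Dom_D(1)[OF U k]
  have "(prim (lft k) (grad k U) has_vector_derivative fl k U x) (at x)"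
  proof (rule prim_has_derivative[OF H_D(3)[OF UH k], of "lft k" "rgt k"])
    show "ae_eq (lft k) (rgt k) (grad k U) (fl k U)" unfolding fl_def by (rule H1D(4)[OF g lr(1)])
    show "continuous_on {lft k<..<rgt k} (fl k U)"
      unfolding fl_def by (rule continuous_on_subset[OF H1D(3)[OF g lr(1)]]) auto
  qed (use x in auto)
  then have "((\<lambda>y. pt k U (lft k) + prim (lft k) (grad k U) y) has_vector_derivative 0 + fl k U x) (at x)"
    by (intro has_vector_derivative_add has_vector_derivative_const)
  then have d: "((\<lambda>y. pt k U (lft k) + prim (lft k) (grad k U) y) has_vector_derivative fl k U x) (at x)" by simp
  show ?thesis
  proof (rule has_vector_derivative_transform_within_open[OF d, where S="{lft k<..<rgt k}"])
    fix y assume "y \<in> {lft k<..<rgt k}"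
    then show "pt k U (lft k) + prim (lft k) (grad k U) y = pt k U y" by (intro pt_rep[symmetric, OF UH k]) auto
  qed (use x in auto)
qed

lemma fl_derivative:
  assumes U: "U \<in> Dom" and k: "k < 4" and cd: "lft k \<le> c" "d \<le> rgt k" and x: "x \<in> {c<..<d}"
    and G: "continuous_on {c<..<d} G" and e: "ae_eq c d (Dx (lft k) (rgt k) (grad k U)) G"
  shows "(fl k U has_vector_derivative G x) (at x)"
proof -
  note g = Dom_D(1)[OF U k]
  have "(prim (lft k) (Dx (lft k) (rgt k) (grad k U)) has_vector_derivative G x) (at x)"
    by (rule prim_has_derivative[OF Dx_spec(1)[OF g] cd e G x])
  then have "((\<lambda>y. fl k U (lft k) + prim (lft k) (Dx (lft k) (rgt k) (grad k U)) y) has_vector_derivative 0 + G x) (at x)"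
    by (intro has_vector_derivative_add has_vector_derivative_const)
  then have d: "((\<lambda>y. fl k U (lft k) + prim (lft k) (Dx (lft k) (rgt k) (grad k U)) y) has_vector_derivative G x) (at x)" by simp
  show ?thesis
  proof (rule has_vector_derivative_transform_within_open[OF d, where S="{c<..<d}"])
    fix y assume "y \<in> {c<..<d}"
    then show "fl k U (lft k) + prim (lft k) (Dx (lft k) (rgt k) (grad k U)) y = fl k U y"
      unfolding fl_def using cd by (intro H1D(2)[symmetric, OF g lr(1)]) auto
  qed (use x in auto)
qed

end

lemma joint_continuous_if_lipschitz:
  fixes h :: "real \<Rightarrow> real \<Rightarrow> complex"
  assumes x: "\<And>x y t. x \<in> A \<Longrightarrow> y \<in> A \<Longrightarrow> t \<in> B \<Longrightarrow> cmod (h x t - h y t) \<le> M * \<bar>x - y\<bar>"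
    and t: "\<And>x s t. x \<in> A \<Longrightarrow> s \<in> B \<Longrightarrow> t \<in> B \<Longrightarrow> cmod (h x s - h x t) \<le> M * \<bar>s - t\<bar>"
  shows "continuous_on (A \<times> B) (\<lambda>(x, t). h x t)"
  unfolding continuous_on_iff
proof (intro ballI allI impI)
  fix P :: "real \<times> real" and e :: real assume P: "P \<in> A \<times> B" and e: "0 < e"
  obtain x0 t0 where P0: "P = (x0, t0)" "x0 \<in> A" "t0 \<in> B" using P by auto
  define d where "d = e / (2 * (\<bar>M\<bar> + 1))"
  have M1: "0 < \<bar>M\<bar> + 1" by linarith
  have d: "0 < d" unfolding d_def using e M1 by simp
  have d2: "(\<bar>M\<bar> + 1) * d = e / 2" unfolding d_def by (rule mult_half_divide[OF M1])
  have "dist (case Q of (x, t) \<Rightarrow> h x t) (case P of (x, t) \<Rightarrow> h x t) < e" if Q: "Q \<in> A \<times> B" "dist Q P < d" for Q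
  proof -
    obtain x1 t1 where Q0: "Q = (x1, t1)" "x1 \<in> A" "t1 \<in> B" using Q by auto
    have "dist x1 x0 \<le> dist Q P" "dist t1 t0 \<le> dist Q P"
      using dist_fst_le[of Q P] dist_snd_le[of Q P] by (auto simp: Q0 P0)
    then have dd: "\<bar>x1 - x0\<bar> < d" "\<bar>t1 - t0\<bar> < d" using Q(2) by (auto simp: dist_real_def)
    have bound: "M * u < e / 2" if "0 \<le> u" "u < d" for u
    proof -
      have "M * u \<le> (\<bar>M\<bar> + 1) * u" using that by (intro mult_right_mono) auto
      also have "\<dots> < (\<bar>M\<bar> + 1) * d" using that M1 by (intro mult_strict_left_mono)
      finally show ?thesis unfolding d2 .
    qed
    have "cmod (h x1 t1 - h x0 t0) \<le> cmod (h x1 t1 - h x0 t1) + cmod (h x0 t1 - h x0 t0)"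
      using norm_triangle_ineq[of "h x1 t1 - h x0 t1" "h x0 t1 - h x0 t0"] by simp
    also have "\<dots> \<le> M * \<bar>x1 - x0\<bar> + M * \<bar>t1 - t0\<bar>"
      using x[OF Q0(2) P0(2) Q0(3)] t[OF P0(2) Q0(3) P0(3)] by linarith
    also have "\<dots> < e" using bound[OF abs_ge_zero dd(1)] bound[OF abs_ge_zero dd(2)] by linarith
    finally show ?thesis by (simp add: Q0 P0 dist_norm)
  qed
  then show "\<exists>d>0. \<forall>Q\<in>A \<times> B. dist Q P < d \<longrightarrow> dist (case Q of (x, t) \<Rightarrow> h x t) (case P of (x, t) \<Rightarrow> h x t) < e"
    using d by blast
qed

text \<open>Eight powers of the generator leave room for the time derivatives that the decay argument consumes:
it works with second time derivatives, uses two more on them through the wave equation, and needs Lipschitz bounds and energy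
identities for these.\<close>

locale orbit = damped_transmission +
  fixes f :: "nat \<Rightarrow> state"
  assumes chain: "gen.chain 8 f"
begin

text \<open>The \<open>j\<close>-th time derivative of the \<open>k\<close>-th displacement.  Following the chain through the semigroup makes every
time derivative the displacement of an orbit in its own right.\<close>

definition w :: "nat \<Rightarrow> nat \<Rightarrow> real \<Rightarrow> real \<Rightarrow> complex" where "w k j x t = pt k (S t (f j)) x"
definition r :: "nat \<Rightarrow> nat \<Rightarrow> real \<Rightarrow> real \<Rightarrow> complex" where "r k j x t = fl k (S t (f j)) x"
definition lo :: "nat \<Rightarrow> nat \<Rightarrow> real \<Rightarrow> real \<Rightarrow> complex" where
  "lo k j x t = lower (\<lambda>m. w m j x t) (\<lambda>m. w m (Suc j) x t) k x"

text \<open>The space derivative of \<open>r\<close>, as the wave equation prescribes it.\<close>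

definition rx :: "nat \<Rightarrow> nat \<Rightarrow> real \<Rightarrow> real \<Rightarrow> complex" where
  "rx k j x t = (1 / stiff k) *\<^sub>R (w k (Suc (Suc j)) x t - lo k j x t)"
definition kinks :: "real set" where "kinks = {p, q, \<beta>1, \<beta>2, \<beta>3, \<beta>4}"

lemma orbit_chain:
  assumes "0 \<le> t" "j < 8"
  shows "S t (f j) \<in> Dom" "gen.eqv (Op (S t (f j))) (S t (f (Suc j)))"
  using gen.chain_orbit[OF chain assms(1)] assms(2) unfolding gen.chain_def by blast+

lemma orbit_H: "0 \<le> t \<Longrightarrow> j \<le> 8 \<Longrightarrow> S t (f j) \<in> H"
  using gen.chain_X[OF gen.chain_orbit[OF chain]] by blast

lemma f_chain: "j < 8 \<Longrightarrow> f j \<in> Dom" "j < 8 \<Longrightarrow> gen.eqv (Op (f j)) (f (Suc j))" "j \<le> 8 \<Longrightarrow> f j \<in> H"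
  using chain gen.chain_X[OF chain, of j] unfolding gen.chain_def by blast+

lemma pt_functional:
  assumes k: "k < 4" and x: "x \<in> {lft k..rgt k}" and j: "j \<le> 6" and t: "0 < t"
  shows "(w k j x has_vector_derivative w k (Suc j) x t) (at t)"
proof -
  obtain C where C: "0 \<le> C" "\<And>U. U \<in> H \<Longrightarrow> cmod (pt k U x) \<le> C * N U" using pt_N k x by blast
  have "((\<lambda>t. pt k (S t (f j)) x) has_vector_derivative pt k (S t (f (Suc j))) x) (at t)"
  proof (rule gen.functional_derivative[where C=C and W="f (Suc (Suc j))"])
    show "pt k (U - V) x = pt k U x - pt k V x" if "U \<in> Dom" "V \<in> Dom" for U V
      by (rule pt_diff[OF gen.D_X[OF that(1)] gen.D_X[OF that(2)] k x])
    show "pt k (state_scale c U) x = c * pt k U x" if "U \<in> Dom" for c U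
      by (rule pt_scale[OF gen.D_X[OF that] k x])
    show "cmod (pt k U x) \<le> C * (N U + N (Op U))" if "U \<in> Dom" for U
    proof -
      have "C * N U \<le> C * (N U + N (Op U))"
        using gen.N_ge_0[OF gen.A_X[OF that]] C(1) by (intro mult_left_mono) auto
      then show ?thesis using C(2)[OF gen.D_X[OF that]] by linarith
    qed
  qed (use f_chain j t in auto)
  then show ?thesis by (simp add: w_def[abs_def])
qed

lemma fl_functional:
  assumes k: "k < 4" and x: "x \<in> {lft k..rgt k}" and j: "j \<le> 6" and t: "0 < t"
  shows "(r k j x has_vector_derivative r k (Suc j) x t) (at t)"
proof -
  obtain C where C: "\<And>U. U \<in> Dom \<Longrightarrow> cmod (fl k U x) \<le> C * (N U + N (Op U))" using fl_N k x by blast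
  have "((\<lambda>t. fl k (S t (f j)) x) has_vector_derivative fl k (S t (f (Suc j))) x) (at t)"
    by (rule gen.functional_derivative[where C=C and W="f (Suc (Suc j))"])
      (use f_chain j t C fl_diff[OF _ _ k x] fl_scale[OF _ k x] in auto)
  then show ?thesis by (simp add: r_def[abs_def])
qed

lemma w_space:
  assumes "k < 4" "x \<in> {lft k<..<rgt k}" "j < 8" "0 \<le> t"
  shows "((\<lambda>x. w k j x t) has_vector_derivative r k j x t) (at x)"
  using pt_derivative[OF orbit_chain(1)[OF assms(4,3)] assms(1,2)] unfolding w_def r_def by simp

lemma w_cont: "k < 4 \<Longrightarrow> j \<le> 8 \<Longrightarrow> 0 \<le> t \<Longrightarrow> continuous_on {lft k..rgt k} (\<lambda>x. w k j x t)"
  unfolding w_def pt_def by (rule H1D(3)[OF H_D(1)[OF orbit_H] lr(1)])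

lemma r_cont: "k < 4 \<Longrightarrow> j < 8 \<Longrightarrow> 0 \<le> t \<Longrightarrow> continuous_on {lft k..rgt k} (\<lambda>x. r k j x t)"
  unfolding r_def fl_def by (rule H1D(3)[OF Dom_D(1)[OF orbit_chain(1)] lr(1)])

lemma disp_ae: "k < 4 \<Longrightarrow> j \<le> 8 \<Longrightarrow> 0 \<le> t \<Longrightarrow> ae_eq (lft k) (rgt k) (disp k (S t (f j))) (\<lambda>x. w k j x t)"
  unfolding w_def pt_def by (rule H1D(4)[OF H_D(1)[OF orbit_H] lr(1)])

lemma grad_ae: "k < 4 \<Longrightarrow> j < 8 \<Longrightarrow> 0 \<le> t \<Longrightarrow> ae_eq (lft k) (rgt k) (grad k (S t (f j))) (\<lambda>x. r k j x t)"
  unfolding r_def fl_def by (rule H1D(4)[OF Dom_D(1)[OF orbit_chain(1)] lr(1)])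

lemma vel_ae:
  assumes "k < 4" "j < 8" "0 \<le> t"
  shows "ae_eq (lft k) (rgt k) (vel k (S t (f j))) (\<lambda>x. w k (Suc j) x t)"
proof -
  note o = orbit_chain[OF assms(3,2)]
  have "ae_eq (lft k) (rgt k) (disp k (Op (S t (f j)))) (disp k (S t (f (Suc j))))"
    by (rule eqv_ae(1)[OF gen.A_X[OF o(1)] orbit_H[OF assms(3)] o(2) assms(1)]) (use assms(2) in simp)
  then show ?thesis unfolding disp_Op[OF assms(1)]
    by (rule ae_eq_trans) (rule disp_ae, use assms in auto)
qed

lemma lower_ae:
  assumes k: "k < 4" and j: "j < 8" and t: "0 \<le> t"
  shows "ae_eq (lft k) (rgt k) (\<lambda>x. lower (\<lambda>m. disp m (S t (f j)) x) (\<lambda>m. vel m (S t (f j)) x) k x) (\<lambda>x. lo k j x t)"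
proof -
  have D: "AE x in lborel. x \<in> {lft k<..<rgt k} \<longrightarrow> disp m (S t (f j)) x = w m j x t"
    "AE x in lborel. x \<in> {lft k<..<rgt k} \<longrightarrow> vel m (S t (f j)) x = w m (Suc j) x t"
    if "m < 4" "m < 2 \<longleftrightarrow> k < 2" for m
  proof -
    have "lft m = lft k" "rgt m = rgt k" using that by (auto simp: lft_def rgt_def)
    then show "AE x in lborel. x \<in> {lft k<..<rgt k} \<longrightarrow> disp m (S t (f j)) x = w m j x t"
      "AE x in lborel. x \<in> {lft k<..<rgt k} \<longrightarrow> vel m (S t (f j)) x = w m (Suc j) x t"
      using disp_ae[OF that(1), of j t] vel_ae[OF that(1) j t] j t unfolding ae_eq_def by auto
  qed
  show ?thesis
  proof (cases "k < 2")
    case True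
    have "AE x in lborel. x \<in> {lft k<..<rgt k} \<longrightarrow> disp 0 (S t (f j)) x = w 0 j x t"
      "AE x in lborel. x \<in> {lft k<..<rgt k} \<longrightarrow> disp 1 (S t (f j)) x = w 1 j x t"
      using D(1)[of 0] D(1)[of 1] True by auto
    then show ?thesis unfolding ae_eq_def
    proof eventually_elim
      case (elim x)
      then show ?case using True by (auto simp: lo_def lower_def)
    qed
  next
    case False
    have "AE x in lborel. x \<in> {lft k<..<rgt k} \<longrightarrow> vel 2 (S t (f j)) x = w 2 (Suc j) x t"
      "AE x in lborel. x \<in> {lft k<..<rgt k} \<longrightarrow> vel 3 (S t (f j)) x = w 3 (Suc j) x t"
      using D(2)[of 2] D(2)[of 3] False by auto
    then show ?thesis unfolding ae_eq_def
    proof eventually_elim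
      case (elim x)
      then show ?case using False by (auto simp: lo_def lower_def)
    qed
  qed
qed

text \<open>The wave equation itself, in the space component: the operator applied to level \<open>j\<close> is level \<open>j + 1\<close> up to null
states.\<close>

lemma rx_ae:
  assumes k: "k < 4" and j: "j < 7" and t: "0 \<le> t"
  shows "ae_eq (lft k) (rgt k) (Dx (lft k) (rgt k) (grad k (S t (f j)))) (\<lambda>x. rx k j x t)"
proof -
  have j8: "j < 8" "Suc j < 8" using j by auto
  note o = orbit_chain[OF t j8(1)]
  have "ae_eq (lft k) (rgt k) (vel k (Op (S t (f j)))) (vel k (S t (f (Suc j))))"
    by (rule eqv_ae(2)[OF gen.A_X[OF o(1)] orbit_H[OF t] o(2) k]) (use j in simp)
  then have "ae_eq (lft k) (rgt k) (vel k (Op (S t (f j)))) (\<lambda>x. w k (Suc (Suc j)) x t)"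
    by (rule ae_eq_trans[OF _ vel_ae[OF k j8(2) t]])
  then show ?thesis
    using lower_ae[OF k j8(1) t] unfolding vel_Op[OF k] ae_eq_def
  proof eventually_elim
    case (elim x)
    show ?case
    proof
      assume "x \<in> {lft k<..<rgt k}"
      then have "complex_of_real (stiff k) * Dx (lft k) (rgt k) (grad k (S t (f j))) x = w k (Suc (Suc j)) x t - lo k j x t"
        using elim by (simp add: algebra_simps)
      then show "Dx (lft k) (rgt k) (grad k (S t (f j))) x = rx k j x t"
        unfolding rx_def scaleR_conv_of_real using stiff_pos[of k] by (simp add: field_simps)
    qed
  qed
qed

lemma finite_kinks: "finite kinks" by (simp add: kinks_def)

lemma lo_cont:
  assumes k: "k < 4" and j: "j < 8" and t: "0 \<le> t" and A: "A \<subseteq> {lft k..rgt k}" "A \<inter> kinks = {}"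
  shows "continuous_on A (\<lambda>x. lo k j x t)"
proof -
  have c: "continuous_on A (coef c1 p q)" "continuous_on A (coef c2 \<beta>1 \<beta>3)" "continuous_on A (coef d2 \<beta>2 \<beta>4)"
    using A(2) unfolding kinks_def by (auto intro!: continuous_on_coef)
  have wc: "continuous_on A (\<lambda>x. w m i x t)" if "m < 4" "m < 2 \<longleftrightarrow> k < 2" "i \<le> 8" for m i
  proof -
    have "lft m = lft k" "rgt m = rgt k" using that by (auto simp: lft_def rgt_def)
    then show ?thesis using w_cont[OF that(1,3) t] A(1) by (metis continuous_on_subset)
  qed
  consider "k = 0" | "k = 1" | "k = 2" | "k = 3" using less_4_cases[OF k] by blast
  then show ?thesis
  proof cases
    case 1
    show ?thesis unfolding lo_def lower_def 1 using j wc[of 1 j] 1 by (simp, intro continuous_intros c) auto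
  next
    case 2
    show ?thesis unfolding lo_def lower_def 2 using j wc[of 0 j] 2 by (simp, intro continuous_intros c) auto
  next
    case 3
    show ?thesis unfolding lo_def lower_def 3 using j wc[of 2 "Suc j"] wc[of 3 "Suc j"] 3 by (simp, intro continuous_intros c) auto
  next
    case 4
    show ?thesis unfolding lo_def lower_def 4 using j wc[of 2 "Suc j"] 4 by (simp, intro continuous_intros c) auto
  qed
qed

lemma r_space:
  assumes k: "k < 4" and x: "x \<in> {lft k<..<rgt k} - kinks" and j: "j < 7" and t: "0 \<le> t"
  shows "((\<lambda>x. r k j x t) has_vector_derivative rx k j x t) (at x)"
proof -
  have "open ({lft k<..<rgt k} - kinks)"
    by (intro open_Diff open_greaterThanLessThan finite_imp_closed finite_kinks)
  then obtain e where e: "0 < e" "ball x e \<subseteq> {lft k<..<rgt k} - kinks"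
    using x open_contains_ball by blast
  define c d where "c = x - e" and "d = x + e"
  have ball: "ball x e = {c<..<d}" by (simp add: c_def d_def ball_eq_greaterThanLessThan)
  have cd: "c < d" using e by (simp add: c_def d_def)
  have sub: "{c<..<d} \<subseteq> {lft k<..<rgt k}" using e(2) ball by blast
  then have cd2: "lft k \<le> c" "d \<le> rgt k"
    using greaterThanLessThan_subseteq_greaterThanLessThan[of c d "lft k" "rgt k"] cd by auto
  have A: "{c<..<d} \<subseteq> {lft k..rgt k}" "{c<..<d} \<inter> kinks = {}" using e(2) ball by auto
  have G: "continuous_on {c<..<d} (\<lambda>x. rx k j x t)"
    unfolding rx_def
    by (intro continuous_intros lo_cont[OF k _ t A] continuous_on_subset[OF w_cont[OF k _ t] A(1)]) (use j in auto)
  have "(fl k (S t (f j)) has_vector_derivative rx k j x t) (at x)"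
    by (rule fl_derivative[OF orbit_chain(1)[OF t] k cd2 _ G ae_eq_subinterval[OF rx_ae[OF k j t] cd2]])
      (use j e in \<open>auto simp: c_def d_def\<close>)
  then show ?thesis by (simp add: r_def)
qed

text \<open>The norm of every element of the chain does not increase along the orbit, and norm and graph norm bound the
fields pointwise.\<close>

lemma orbit_bounds:
  "\<exists>M\<ge>0. \<forall>k<4. \<forall>j<8. \<forall>x\<in>{lft k..rgt k}. \<forall>t\<ge>0. cmod (w k j x t) \<le> M \<and> cmod (r k j x t) \<le> M"
proof -
  obtain C where C: "0 \<le> C" "\<forall>U\<in>H. \<forall>k<4. \<forall>x\<in>{lft k..rgt k}. cmod (pt k U x) \<le> C * N U" using pt_N by blast
  obtain C' where C': "0 \<le> C'" "\<forall>U\<in>Dom. \<forall>k<4. \<forall>x\<in>{lft k..rgt k}. cmod (fl k U x) \<le> C' * (N U + N (Op U))" using fl_N by blast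
  define B where "B = (\<Sum>j\<le>8. N (f j))"
  have NB: "N (f j) \<le> B" if "j \<le> 8" for j
    unfolding B_def using that f_chain(3) by (intro member_le_sum) (auto intro: gen.N_ge_0)
  have B: "0 \<le> B" using NB[of 0] gen.N_ge_0[OF f_chain(3), of 0] by linarith
  have SB: "N (S t (f j)) \<le> B" if "j \<le> 8" "0 \<le> t" for j t
    using gen.S_le[OF that(2) f_chain(3)[OF that(1)]] NB[OF that(1)] by linarith
  show ?thesis
  proof (intro exI[of _ "C * B + C' * (2 * B)"] conjI allI ballI impI)
    show "0 \<le> C * B + C' * (2 * B)" using C C' B by simp
    fix k j x t assume k: "(k::nat) < 4" and j: "(j::nat) < 8" and x: "x \<in> {lft k..rgt k}" and t: "(0::real) \<le> t"
    note o = orbit_chain[OF t j]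
    have "cmod (w k j x t) \<le> C * N (S t (f j))" unfolding w_def using C(2) gen.D_X[OF o(1)] k x by blast
    also have "\<dots> \<le> C * B" using SB[of j t] j t C(1) by (intro mult_left_mono) auto
    also have "\<dots> \<le> C * B + C' * (2 * B)" using C' B by simp
    finally show "cmod (w k j x t) \<le> C * B + C' * (2 * B)" .
    have e: "N (Op (S t (f j))) = N (S t (f (Suc j)))"
      by (rule gen.eqv_N[OF gen.A_X[OF o(1)] orbit_H[OF t] o(2)]) (use j in simp)
    have "cmod (r k j x t) \<le> C' * (N (S t (f j)) + N (Op (S t (f j))))" unfolding r_def using C'(2) o(1) k x by blast
    also have "\<dots> \<le> C' * (2 * B)" using SB[of j t] SB[of "Suc j" t] j t C'(1) unfolding e by (intro mult_left_mono) auto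
    also have "\<dots> \<le> C * B + C' * (2 * B)" using C B by simp
    finally show "cmod (r k j x t) \<le> C * B + C' * (2 * B)" .
  qed
qed

definition M :: real where
  "M = (SOME M. 0 \<le> M \<and> (\<forall>k<4. \<forall>j<8. \<forall>x\<in>{lft k..rgt k}. \<forall>t\<ge>0. cmod (w k j x t) \<le> M \<and> cmod (r k j x t) \<le> M))"

lemma M: "0 \<le> M" "k < 4 \<Longrightarrow> j < 8 \<Longrightarrow> x \<in> {lft k..rgt k} \<Longrightarrow> 0 \<le> t \<Longrightarrow> cmod (w k j x t) \<le> M"
  "k < 4 \<Longrightarrow> j < 8 \<Longrightarrow> x \<in> {lft k..rgt k} \<Longrightarrow> 0 \<le> t \<Longrightarrow> cmod (r k j x t) \<le> M"
proof -
  have "0 \<le> M \<and> (\<forall>k<4. \<forall>j<8. \<forall>x\<in>{lft k..rgt k}. \<forall>t\<ge>0. cmod (w k j x t) \<le> M \<and> cmod (r k j x t) \<le> M)"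
    unfolding M_def by (rule someI_ex) (rule orbit_bounds)
  then show "0 \<le> M" "k < 4 \<Longrightarrow> j < 8 \<Longrightarrow> x \<in> {lft k..rgt k} \<Longrightarrow> 0 \<le> t \<Longrightarrow> cmod (w k j x t) \<le> M"
    "k < 4 \<Longrightarrow> j < 8 \<Longrightarrow> x \<in> {lft k..rgt k} \<Longrightarrow> 0 \<le> t \<Longrightarrow> cmod (r k j x t) \<le> M" by blast+
qed

lemma lower_bound:
  assumes k: "k < 4" and B: "\<And>m. m < 4 \<Longrightarrow> (m < 2 \<longleftrightarrow> k < 2) \<Longrightarrow> cmod (D m) \<le> B \<and> cmod (V m) \<le> B"
  shows "cmod (lower D V k x) \<le> (\<bar>c1\<bar> + \<bar>c2\<bar> + \<bar>d2\<bar>) * B"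
proof -
  have B0: "0 \<le> B" using B[OF k] norm_ge_zero[of "D k"] by linarith
  have m: "cmod (complex_of_real (coef c l u x) * z) \<le> \<bar>c\<bar> * B" if "cmod z \<le> B" for c l u z
    unfolding norm_mult norm_of_real using that coef_bound[of c l u x] by (intro mult_mono) auto
  have nn: "0 \<le> \<bar>c1\<bar> * B" "0 \<le> \<bar>c2\<bar> * B" "0 \<le> \<bar>d2\<bar> * B" using B0 by auto
  consider "k = 0" | "k = 1" | "k = 2" | "k = 3" using less_4_cases[OF k] by blast
  then have "cmod (lower D V k x) \<le> \<bar>c1\<bar> * B + \<bar>c2\<bar> * B + \<bar>d2\<bar> * B"
  proof cases
    case 1
    then show ?thesis using m[of "D 1" c1 p q] B[of 1] nn by (simp add: lower_def)
  next
    case 2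
    then show ?thesis using m[of "D 0" c1 p q] B[of 0] nn by (simp add: lower_def)
  next
    case 3
    have "lower D V k x = - (complex_of_real (coef c2 \<beta>1 \<beta>3 x) * V 3 + complex_of_real (coef d2 \<beta>2 \<beta>4 x) * V 2)"
      using 3 by (simp add: lower_def)
    then have "cmod (lower D V k x) \<le> cmod (complex_of_real (coef c2 \<beta>1 \<beta>3 x) * V 3) + cmod (complex_of_real (coef d2 \<beta>2 \<beta>4 x) * V 2)"
      using norm_triangle_ineq by (simp only: norm_minus_cancel)
    then show ?thesis using m[of "V 3" c2 \<beta>1 \<beta>3] m[of "V 2" d2 \<beta>2 \<beta>4] B[of 3] B[of 2] nn 3 by simp
  next
    case 4
    then show ?thesis using m[of "V 2" c2 \<beta>1 \<beta>3] B[of 2] nn by (simp add: lower_def)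
  qed
  then show ?thesis by (simp add: distrib_right)
qed

definition CC :: real where "CC = \<bar>c1\<bar> + \<bar>c2\<bar> + \<bar>d2\<bar>"
definition M2 :: real where "M2 = M + (1 / kap) * (M + CC * M)"

lemma CC: "0 \<le> CC" by (simp add: CC_def)

lemma M2: "0 \<le> M2" "M \<le> M2"
  using M(1) CC kap(1) by (auto simp: M2_def)

lemma rx_bound:
  assumes k: "k < 4" and j: "j < 6" and x: "x \<in> {lft k..rgt k}" and t: "0 \<le> t"
  shows "cmod (rx k j x t) \<le> M2"
proof -
  have "cmod (lo k j x t) \<le> CC * M"
    unfolding lo_def CC_def
  proof (rule lower_bound[OF k])
    fix m :: nat assume m: "m < 4" "m < 2 \<longleftrightarrow> k < 2"
    then have "x \<in> {lft m..rgt m}" using x by (auto simp: lft_def rgt_def)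
    then show "cmod (w m j x t) \<le> M \<and> cmod (w m (Suc j) x t) \<le> M" using M(2) m j t by auto
  qed
  moreover have "cmod (w k (Suc (Suc j)) x t) \<le> M" using M(2) k j x t by auto
  ultimately have "cmod (w k (Suc (Suc j)) x t - lo k j x t) \<le> M + CC * M"
    using norm_triangle_ineq4[of "w k (Suc (Suc j)) x t" "lo k j x t"] by linarith
  moreover have "1 / stiff k \<le> 1 / kap" using kap stiff_pos by (intro divide_left_mono) auto
  ultimately have "cmod (rx k j x t) \<le> (1 / kap) * (M + CC * M)"
    unfolding rx_def norm_scaleR using stiff_pos[of k] kap(1) by (intro mult_mono) auto
  then show ?thesis using M(1) by (simp add: M2_def)
qed

lemma w_lip_x:
  assumes k: "k < 4" and j: "j < 8" and x: "x \<in> {lft k..rgt k}" "y \<in> {lft k..rgt k}" and t: "0 \<le> t"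
  shows "cmod (w k j x t - w k j y t) \<le> M2 * \<bar>x - y\<bar>"
proof -
  have "cmod (w k j (max x y) t - w k j (min x y) t) \<le> M * (max x y - min x y)"
  proof (rule increment_bound[of "{}" _ _ _ "\<lambda>x. r k j x t"])
    show "continuous_on {min x y..max x y} (\<lambda>x. w k j x t)"
      by (rule continuous_on_subset[OF w_cont[OF k _ t]]) (use x j in auto)
    fix s assume "s \<in> {min x y<..<max x y} - {}"
    then have s: "s \<in> {lft k<..<rgt k}" using x by auto
    show "((\<lambda>x. w k j x t) has_vector_derivative r k j s t) (at s)" by (rule w_space[OF k s j t])
    show "cmod (r k j s t) \<le> M" using M(3)[OF k j _ t] s by auto
  qed (use M(1) in auto)
  then have "cmod (w k j x t - w k j y t) \<le> M * \<bar>x - y\<bar>"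
    by (cases "x \<le> y") (auto simp: max_def min_def norm_minus_commute)
  also have "\<dots> \<le> M2 * \<bar>x - y\<bar>" using M2(2) by (intro mult_right_mono) auto
  finally show ?thesis .
qed

lemma r_lip_x:
  assumes k: "k < 4" and j: "j < 6" and x: "x \<in> {lft k..rgt k}" "y \<in> {lft k..rgt k}" and t: "0 \<le> t"
  shows "cmod (r k j x t - r k j y t) \<le> M2 * \<bar>x - y\<bar>"
proof -
  have "cmod (r k j (max x y) t - r k j (min x y) t) \<le> M2 * (max x y - min x y)"
  proof (rule increment_bound[OF finite_kinks, of _ _ _ "\<lambda>x. rx k j x t"])
    show "continuous_on {min x y..max x y} (\<lambda>x. r k j x t)"
      by (rule continuous_on_subset[OF r_cont[OF k _ t]]) (use x j in auto)
    fix s assume "s \<in> {min x y<..<max x y} - kinks"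
    then have s: "s \<in> {lft k<..<rgt k} - kinks" using x by auto
    show "((\<lambda>x. r k j x t) has_vector_derivative rx k j s t) (at s)" by (rule r_space[OF k s _ t]) (use j in simp)
    show "cmod (rx k j s t) \<le> M2" using rx_bound[OF k j _ t] s by auto
  qed (use M2(1) in auto)
  then show ?thesis
    by (cases "x \<le> y") (auto simp: max_def min_def norm_minus_commute)
qed

lemma lip_t:
  fixes h h' :: "real \<Rightarrow> complex"
  assumes d: "\<And>t. 0 < t \<Longrightarrow> (h has_vector_derivative h' t) (at t)" and b: "\<And>t. 0 < t \<Longrightarrow> cmod (h' t) \<le> B"
    and st: "0 < s" "0 < t"
  shows "cmod (h s - h t) \<le> B * \<bar>s - t\<bar>"
proof -
  have B: "0 \<le> B" using b[OF st(1)] norm_ge_zero[of "h' s"] by linarith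
  have "cmod (h (max s t) - h (min s t)) \<le> B * (max s t - min s t)"
  proof (rule increment_bound[of "{}" _ _ _ h'])
    show "continuous_on {min s t..max s t} h"
      using st by (intro continuous_at_imp_continuous_on ballI has_vector_derivative_continuous[OF d]) auto
  qed (use d b B st in auto)
  then show ?thesis by (cases "s \<le> t") (auto simp: max_def min_def norm_minus_commute)
qed

lemma w_lip_t:
  assumes "k < 4" "j \<le> 6" "x \<in> {lft k..rgt k}" "0 < s" "0 < t"
  shows "cmod (w k j x s - w k j x t) \<le> M2 * \<bar>s - t\<bar>"
  by (rule lip_t[OF pt_functional[OF assms(1,3,2)] order.trans[OF M(2) M2(2)]]) (use assms in auto)

lemma r_lip_t:
  assumes "k < 4" "j \<le> 6" "x \<in> {lft k..rgt k}" "0 < s" "0 < t"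
  shows "cmod (r k j x s - r k j x t) \<le> M2 * \<bar>s - t\<bar>"
  by (rule lip_t[OF fl_functional[OF assms(1,3,2)] order.trans[OF M(3) M2(2)]]) (use assms in auto)

lemma w_joint: "k < 4 \<Longrightarrow> j \<le> 6 \<Longrightarrow> continuous_on ({lft k..rgt k} \<times> {0<..}) (\<lambda>(x, t). w k j x t)"
  by (rule joint_continuous_if_lipschitz[where M=M2]) (auto intro!: w_lip_x w_lip_t)

lemma r_joint: "k < 4 \<Longrightarrow> j < 6 \<Longrightarrow> continuous_on ({lft k..rgt k} \<times> {0<..}) (\<lambda>(x, t). r k j x t)"
  by (rule joint_continuous_if_lipschitz[where M=M2]) (auto intro!: r_lip_x r_lip_t)

lemma boundary:
  assumes "0 \<le> t" "j < 8"
  shows "w 0 j 0 t = 0" "w 1 j 0 t = 0" "w 2 j L t = 0" "w 3 j L t = 0"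
    "w 0 j L0 t = w 2 j L0 t" "w 1 j L0 t = w 3 j L0 t"
    "complex_of_real a1 * r 0 j L0 t = complex_of_real a2 * r 2 j L0 t" "r 1 j L0 t = r 3 j L0 t"
proof -
  have "S t (f j) \<in> H" using orbit_H assms by auto
  then show "w 0 j 0 t = 0" "w 1 j 0 t = 0" "w 2 j L t = 0" "w 3 j L t = 0"
    "w 0 j L0 t = w 2 j L0 t" "w 1 j L0 t = w 3 j L0 t" unfolding w_def H_iff by blast+
  show "complex_of_real a1 * r 0 j L0 t = complex_of_real a2 * r 2 j L0 t" "r 1 j L0 t = r 3 j L0 t"
    unfolding r_def by (rule Dom_D(3,4)[OF orbit_chain(1)[OF assms]])+
qed

end

section \<open>Energy identities\<close>

definition ip :: "real \<Rightarrow> real \<Rightarrow> cfun \<Rightarrow> cfun \<Rightarrow> complex" where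
  "ip a b u v = integral {a..b} (\<lambda>x. u x * cnj (v x))"

lemma ip_integrable:
  fixes u v :: cfun
  assumes "continuous_on {a..b} u" "continuous_on {a..b} v"
  shows "(\<lambda>x. u x * cnj (v x)) integrable_on {a..b}"
  using assms by (intro integrable_continuous_interval continuous_intros)

lemma ip_add_left:
  assumes "continuous_on {a..b} u" "continuous_on {a..b} u'" "continuous_on {a..b} v"
  shows "ip a b (\<lambda>x. u x + u' x) v = ip a b u v + ip a b u' v"
  unfolding ip_def distrib_right by (intro integral_add ip_integrable assms)

lemma ip_scale_left: "ip a b (\<lambda>x. k * u x) v = k * ip a b u v"
  unfolding ip_def by (simp add: mult.assoc)

lemma ip_commute: "ip a b v u = cnj (ip a b u v)"
  unfolding ip_def integral_cnj by (simp add: mult.commute)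

lemma Re_ip_commute: "Re (ip a b v u) = Re (ip a b u v)"
  using ip_commute[of a b v u] by simp

lemma ip_expand:
  assumes u: "continuous_on {a..b} u" "continuous_on {a..b} u'" and v: "continuous_on {a..b} v" "continuous_on {a..b} v'"
  shows "ip a b (\<lambda>x. u x + complex_of_real h * u' x) (\<lambda>x. v x + complex_of_real h * v' x)
    = ip a b u v + complex_of_real h * (ip a b u v' + ip a b u' v) + (complex_of_real h)\<^sup>2 * ip a b u' v'"
proof -
  have R: "ip a b y (\<lambda>x. v x + complex_of_real h * v' x) = ip a b y v + complex_of_real h * ip a b y v'"
    if "continuous_on {a..b} y" for y
  proof -
    have "ip a b y (\<lambda>x. v x + complex_of_real h * v' x) = cnj (ip a b (\<lambda>x. v x + complex_of_real h * v' x) y)"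
      by (rule ip_commute)
    also have "ip a b (\<lambda>x. v x + complex_of_real h * v' x) y = ip a b v y + complex_of_real h * ip a b v' y"
      using v that by (subst ip_add_left) (auto intro!: continuous_intros simp: ip_scale_left)
    finally show ?thesis by (simp add: ip_commute[of a b y v] ip_commute[of a b y v'])
  qed
  have "ip a b (\<lambda>x. u x + complex_of_real h * u' x) (\<lambda>x. v x + complex_of_real h * v' x)
      = ip a b u (\<lambda>x. v x + complex_of_real h * v' x) + complex_of_real h * ip a b u' (\<lambda>x. v x + complex_of_real h * v' x)"
    using u v by (subst ip_add_left) (auto intro!: continuous_intros simp: ip_scale_left)
  then show ?thesis unfolding R[OF u(1)] R[OF u(2)] by (simp add: algebra_simps power2_eq_square)
qed

lemma Re_ip_expand:
  assumes u: "continuous_on {a..b} u" "continuous_on {a..b} u'"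
  shows "Re (ip a b (\<lambda>x. u x + complex_of_real h * u' x) (\<lambda>x. u x + complex_of_real h * u' x))
    = Re (ip a b u u) + 2 * h * Re (ip a b u u') + h\<^sup>2 * Re (ip a b u' u')"
  unfolding ip_expand[OF u u] using Re_ip_commute[of a b u' u]
  by (simp flip: of_real_power)

lemma sqint_ip:
  assumes "continuous_on {a..b} u"
  shows "sqint a b u = Re (ip a b u u)"
proof -
  have c: "continuous_on {a..b} (\<lambda>x. (cmod (u x))\<^sup>2)" using assms by (intro continuous_intros)
  have i: "set_integrable lborel {a..b} (\<lambda>x. (cmod (u x))\<^sup>2)"
    unfolding set_integrable_def using borel_integrable_compact[OF compact_Icc c] .
  have "sqint a b u = integral {a..b} (\<lambda>x. (cmod (u x))\<^sup>2)"
    unfolding set_integral_open_closed by (rule set_borel_integral_eq_integral(2)[OF i])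
  also have "\<dots> = Re (ip a b u u)"
  proof -
    have "ip a b u u = integral {a..b} (\<lambda>x. complex_of_real ((cmod (u x))\<^sup>2))"
      unfolding ip_def by (simp only: complex_norm_square)
    also have "\<dots> = integral {a..b} (complex_of_real \<circ> (\<lambda>x. (cmod (u x))\<^sup>2))" by (simp only: o_def)
    also have "\<dots> = complex_of_real (integral {a..b} (\<lambda>x. (cmod (u x))\<^sup>2))"
      by (rule integral_linear[OF integrable_continuous_interval[OF c] bounded_linear_of_real])
    finally show ?thesis by simp
  qed
  finally show ?thesis .
qed

lemma coef_has_integral:
  fixes g :: cfun
  assumes g: "continuous_on {a..b} g" and lr: "a \<le> l" "l \<le> r" "r \<le> b"
  shows "((\<lambda>x. complex_of_real (coef c l r x) * g x) has_integral complex_of_real c * integral {l..r} g) {a..b}"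
proof -
  have "g integrable_on {l..r}"
    using lr by (intro integrable_continuous_interval continuous_on_subset[OF g]) auto
  then have "(g has_integral integral {l..r} g) {l..r}" by (rule integrable_integral)
  then have "(g has_integral integral {l..r} g) {l<..<r}"
    using has_integral_open_interval[of g _ l r] by (simp add: box_real)
  then have "((\<lambda>x. complex_of_real c * g x) has_integral complex_of_real c * integral {l..r} g) {l<..<r}"
    by (rule has_integral_mult_right)
  then have "((\<lambda>x. if x \<in> {l<..<r} then complex_of_real c * g x else 0) has_integral complex_of_real c * integral {l..r} g) {a..b}"
    using lr by (subst has_integral_restrict) auto
  then show ?thesis by (rule has_integral_eq[rotated]) (auto simp: coef_def)
qed

context transmission begin

text \<open>The energy is a Lebesgue integral of representatives of classes.  For continuous fields it becomes an
integral over closed intervals, in which the quadratic form can be expanded and limits can be taken.\<close>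

lemma E_classical:
  assumes U: "U \<in> H"
    and g: "\<And>k. k < 4 \<Longrightarrow> ae_eq (lft k) (rgt k) (grad k U) (\<rho> k)" "\<And>k. k < 4 \<Longrightarrow> continuous_on {lft k..rgt k} (\<rho> k)"
    and v: "\<And>k. k < 4 \<Longrightarrow> ae_eq (lft k) (rgt k) (vel k U) (\<nu> k)" "\<And>k. k < 4 \<Longrightarrow> continuous_on {lft k..rgt k} (\<nu> k)"
    and d: "\<And>k. k < 4 \<Longrightarrow> ae_eq (lft k) (rgt k) (disp k U) (\<omega> k)" "\<And>k. k < 4 \<Longrightarrow> continuous_on {lft k..rgt k} (\<omega> k)"
  shows "E U = (\<Sum>k<4. stiff k * Re (ip (lft k) (rgt k) (\<rho> k) (\<rho> k)) + Re (ip (lft k) (rgt k) (\<nu> k) (\<nu> k)))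
    + 2 * c1 * Re (ip p q (\<omega> 0) (\<omega> 1))"
proof -
  have "sq k (grad k U) = Re (ip (lft k) (rgt k) (\<rho> k) (\<rho> k))" "sq k (vel k U) = Re (ip (lft k) (rgt k) (\<nu> k) (\<nu> k))"
    if k: "k < 4" for k
    using sqint_cong[OF g(1)[OF k] H_D(3)[OF U k] continuous_L2[OF g(2)[OF k]]] sqint_ip[OF g(2)[OF k]]
      sqint_cong[OF v(1)[OF k] H_D(2)[OF U k] continuous_L2[OF v(2)[OF k]]] sqint_ip[OF v(2)[OF k]] by simp_all
  then have S: "(\<Sum>k<4. stiff k * sq k (grad k U) + sq k (vel k U))
      = (\<Sum>k<4. stiff k * Re (ip (lft k) (rgt k) (\<rho> k) (\<rho> k)) + Re (ip (lft k) (rgt k) (\<nu> k) (\<nu> k)))"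
    by (intro sum.cong) auto
  have lr0: "lft 0 = 0" "rgt 0 = L0" "lft 1 = 0" "rgt 1 = L0" by (auto simp: lft_def rgt_def)
  have \<omega>: "continuous_on {0..L0} (\<omega> 0)" "continuous_on {0..L0} (\<omega> 1)" using d(2)[of 0] d(2)[of 1] lr0 by auto
  have e: "ae_eq 0 L0 (disp 0 U) (\<omega> 0)" "ae_eq 0 L0 (disp 1 U) (\<omega> 1)" using d(1)[of 0] d(1)[of 1] lr0 by auto
  have wc: "continuous_on {0..L0} (\<lambda>x. \<omega> 0 x * cnj (\<omega> 1 x))" by (intro continuous_intros \<omega>)
  have dm: "set_borel_measurable lborel {0<..<L0} (disp 0 U)" "set_borel_measurable lborel {0<..<L0} (disp 1 U)"
    using L2_measurable[OF H1_L2[OF H_D(1)[OF U, of 0]]] L2_measurable[OF H1_L2[OF H_D(1)[OF U, of 1]]] lr0 by auto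
  define ua ya where "ua = (\<lambda>x. indicat_real {0<..<L0} x *\<^sub>R disp 0 U x)" and "ya = (\<lambda>x. indicat_real {0<..<L0} x *\<^sub>R disp 1 U x)"
  have [measurable]: "ua \<in> borel_measurable lborel" "ya \<in> borel_measurable lborel"
    using dm by (auto simp: set_borel_measurable_def ua_def ya_def)
  have [measurable]: "cnj \<in> borel_measurable borel" by (intro borel_measurable_continuous_onI continuous_intros)
  have [measurable]: "coef c1 p q \<in> borel_measurable borel" unfolding coef_def by measurable
  have "(\<lambda>x. complex_of_real (coef c1 p q x) * ua x * cnj (ya x)) \<in> borel_measurable lborel" by measurable
  moreover have "(\<lambda>x. complex_of_real (coef c1 p q x) * ua x * cnj (ya x))
      = (\<lambda>x. indicat_real {0<..<L0} x *\<^sub>R (complex_of_real (coef c1 p q x) * disp 0 U x * cnj (disp 1 U x)))"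
    by (auto simp: ua_def ya_def indicator_def)
  ultimately have m: "set_borel_measurable lborel {0<..<L0} (\<lambda>x. complex_of_real (coef c1 p q x) * disp 0 U x * cnj (disp 1 U x))"
    unfolding set_borel_measurable_def by (simp only:)
  have cl: "(\<lambda>x. complex_of_real (coef c1 p q x) * (\<omega> 0 x * cnj (\<omega> 1 x))) \<in> L2 0 L0"
  proof -
    have wl: "(\<lambda>x. \<omega> 0 x * cnj (\<omega> 1 x)) \<in> L2 0 L0" by (rule continuous_L2[OF wc])
    have sm: "set_borel_measurable lborel {0<..<L0} (\<lambda>x. \<omega> 0 x * cnj (\<omega> 1 x))" by (rule L2_measurable[OF wl])
    define wa where "wa = (\<lambda>x. indicat_real {0<..<L0} x *\<^sub>R (\<omega> 0 x * cnj (\<omega> 1 x)))"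
    have [measurable]: "wa \<in> borel_measurable lborel" using sm by (simp add: set_borel_measurable_def wa_def)
    have "(\<lambda>x. complex_of_real (coef c1 p q x) * wa x) \<in> borel_measurable lborel" by measurable
    moreover have "(\<lambda>x. complex_of_real (coef c1 p q x) * wa x) = (\<lambda>x. indicat_real {0<..<L0} x *\<^sub>R (complex_of_real (coef c1 p q x) * (\<omega> 0 x * cnj (\<omega> 1 x))))"
      by (auto simp: wa_def indicator_def)
    ultimately have m1: "set_borel_measurable lborel {0<..<L0} (\<lambda>x. complex_of_real (coef c1 p q x) * (\<omega> 0 x * cnj (\<omega> 1 x)))"
      unfolding set_borel_measurable_def by (simp only:)
    have "(\<lambda>x. (cmod (complex_of_real (coef c1 p q x) * wa x))\<^sup>2) \<in> borel_measurable lborel" by measurable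
    moreover have "(\<lambda>x. (cmod (complex_of_real (coef c1 p q x) * wa x))\<^sup>2) = (\<lambda>x. indicat_real {0<..<L0} x *\<^sub>R (cmod (complex_of_real (coef c1 p q x) * (\<omega> 0 x * cnj (\<omega> 1 x))))\<^sup>2)"
      by (auto simp: wa_def indicator_def)
    ultimately have m2: "set_borel_measurable lborel {0<..<L0} (\<lambda>x. (cmod (complex_of_real (coef c1 p q x) * (\<omega> 0 x * cnj (\<omega> 1 x))))\<^sup>2)"
      unfolding set_borel_measurable_def by (simp only:)
    have b: "(cmod (complex_of_real (coef c1 p q x) * z))\<^sup>2 \<le> c1\<^sup>2 * (cmod z)\<^sup>2" for x z
      by (simp add: coef_def norm_mult power_mult_distrib)
    have "set_integrable lborel {0<..<L0} (\<lambda>x. (cmod (complex_of_real (coef c1 p q x) * (\<omega> 0 x * cnj (\<omega> 1 x))))\<^sup>2)"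
    proof (rule set_integrable_bound[OF set_integrable_mult_right[of "c1\<^sup>2", OF L2_integrable_sq[OF wl]] m2], rule AE_I2, rule impI)
      fix x
      show "norm ((cmod (complex_of_real (coef c1 p q x) * (\<omega> 0 x * cnj (\<omega> 1 x))))\<^sup>2) \<le> norm (c1\<^sup>2 * (cmod (\<omega> 0 x * cnj (\<omega> 1 x)))\<^sup>2)"
        using b[of x "\<omega> 0 x * cnj (\<omega> 1 x)"]
        by (simp only: real_norm_def abs_of_nonneg[OF zero_le_power2] abs_of_nonneg[OF mult_nonneg_nonneg[OF zero_le_power2 zero_le_power2]])
    qed
    with m1 show ?thesis by (simp only: L2_def mem_Collect_eq simp_thms)
  qed
  have "(LINT x:{0<..<L0}|lborel. complex_of_real (coef c1 p q x) * disp 0 U x * cnj (disp 1 U x))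
      = (LINT x:{0<..<L0}|lborel. complex_of_real (coef c1 p q x) * (\<omega> 0 x * cnj (\<omega> 1 x)))"
  proof (rule set_integral_ae_eq[OF _ m L2_measurable[OF cl]])
    show "ae_eq 0 L0 (\<lambda>x. complex_of_real (coef c1 p q x) * disp 0 U x * cnj (disp 1 U x)) (\<lambda>x. complex_of_real (coef c1 p q x) * (\<omega> 0 x * cnj (\<omega> 1 x)))"
      using ae_eq_binop[OF e, of "\<lambda>x y z. complex_of_real (coef c1 p q x) * y * cnj z"] by (simp only: mult.assoc)
  qed
  also have "\<dots> = integral {0<..<L0} (\<lambda>x. complex_of_real (coef c1 p q x) * (\<omega> 0 x * cnj (\<omega> 1 x)))"
    by (rule set_borel_integral_eq_integral(2)[OF L2_integrable[OF cl]])
  also have "\<dots> = integral {0..L0} (\<lambda>x. complex_of_real (coef c1 p q x) * (\<omega> 0 x * cnj (\<omega> 1 x)))"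
    by (rule integral_open_interval_real[symmetric])
  also have "\<dots> = complex_of_real c1 * ip p q (\<omega> 0) (\<omega> 1)"
    unfolding ip_def using coef_has_integral[OF wc, of p q c1] pq by (intro integral_unique) auto
  finally have "cross U = 2 * c1 * Re (ip p q (\<omega> 0) (\<omega> 1))" unfolding cross_def by simp
  then show ?thesis unfolding E_eq[OF U] S by simp
qed

end

context orbit begin

lemma inner_intervals: "{p..q} \<subseteq> {lft 0..rgt 0}" "{p..q} \<subseteq> {lft 1..rgt 1}"
  "{\<beta>1..\<beta>3} \<subseteq> {lft 2..rgt 2}" "{\<beta>1..\<beta>3} \<subseteq> {lft 3..rgt 3}" "{\<beta>2..\<beta>4} \<subseteq> {lft 2..rgt 2}" "{\<beta>2..\<beta>4} \<subseteq> {lft 3..rgt 3}"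
  using pq \<beta> by (auto simp: lft_def rgt_def)

text \<open>Integration by parts; the gradient need not be differentiable at the finitely many jumps.\<close>

lemma green_component:
  assumes k: "k < 4" and j: "j < 7" and i: "i < 8" and t: "0 \<le> t"
  shows "((\<lambda>x. (w k (Suc (Suc j)) x t - lo k j x t) * cnj (w k i x t) + complex_of_real (stiff k) * (r k j x t * cnj (r k i x t)))
    has_integral complex_of_real (stiff k) * (r k j (rgt k) t * cnj (w k i (rgt k) t)) - complex_of_real (stiff k) * (r k j (lft k) t * cnj (w k i (lft k) t)))
    {lft k..rgt k}"
proof (rule fundamental_theorem_of_calculus_interior_strong[OF finite_kinks])
  show "lft k \<le> rgt k" using lr(1)[of k] by simp
  show "continuous_on {lft k..rgt k} (\<lambda>x. complex_of_real (stiff k) * (r k j x t * cnj (w k i x t)))"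
    using j i by (intro continuous_intros r_cont w_cont k t) auto
  fix x assume x: "x \<in> {lft k<..<rgt k} - kinks"
  then have x': "x \<in> {lft k<..<rgt k}" by simp
  have c: "((\<lambda>x. cnj (w k i x t)) has_vector_derivative cnj (r k i x t)) (at x)"
    by (rule has_vector_derivative_cnj[OF w_space[OF k x' i t]])
  have "((\<lambda>x. r k j x t * cnj (w k i x t)) has_vector_derivative (r k j x t * cnj (r k i x t) + rx k j x t * cnj (w k i x t))) (at x)"
    by (rule has_vector_derivative_mult[OF r_space[OF k x j t] c])
  then have "((\<lambda>x. complex_of_real (stiff k) * (r k j x t * cnj (w k i x t))) has_vector_derivative
      complex_of_real (stiff k) * (r k j x t * cnj (r k i x t) + rx k j x t * cnj (w k i x t))) (at x)"
    by (rule has_vector_derivative_mult_right)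
  moreover have "complex_of_real (stiff k) * rx k j x t = w k (Suc (Suc j)) x t - lo k j x t"
    unfolding rx_def scaleR_conv_of_real using stiff_pos[of k] by simp
  then have "complex_of_real (stiff k) * (r k j x t * cnj (r k i x t) + rx k j x t * cnj (w k i x t))
      = (w k (Suc (Suc j)) x t - lo k j x t) * cnj (w k i x t) + complex_of_real (stiff k) * (r k j x t * cnj (r k i x t))"
    by (simp add: distrib_left mult.assoc[symmetric])
  ultimately show "((\<lambda>x. complex_of_real (stiff k) * (r k j x t * cnj (w k i x t))) has_vector_derivative
      (w k (Suc (Suc j)) x t - lo k j x t) * cnj (w k i x t) + complex_of_real (stiff k) * (r k j x t * cnj (r k i x t))) (at x)"
    by simp
qed

text \<open>In the sum over the components the boundary terms cancel, by the end conditions on the displacements and by the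
transmission conditions for displacements and fluxes at the interface.\<close>

lemma green:
  assumes j: "j < 7" and i: "i < 8" and t: "0 \<le> t"
  shows "(\<Sum>k<4. complex_of_real (stiff k) * ip (lft k) (rgt k) (\<lambda>x. r k j x t) (\<lambda>x. r k i x t))
    = - (\<Sum>k<4. ip (lft k) (rgt k) (\<lambda>x. w k (Suc (Suc j)) x t) (\<lambda>x. w k i x t))
      - complex_of_real c1 * (ip p q (\<lambda>x. w 1 j x t) (\<lambda>x. w 0 i x t) + ip p q (\<lambda>x. w 0 j x t) (\<lambda>x. w 1 i x t))
      - complex_of_real c2 * ip \<beta>1 \<beta>3 (\<lambda>x. w 3 (Suc j) x t) (\<lambda>x. w 2 i x t)
      + complex_of_real c2 * ip \<beta>1 \<beta>3 (\<lambda>x. w 2 (Suc j) x t) (\<lambda>x. w 3 i x t)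
      - complex_of_real d2 * ip \<beta>2 \<beta>4 (\<lambda>x. w 2 (Suc j) x t) (\<lambda>x. w 2 i x t)"
proof -
  define A where "A = (\<lambda>k. ip (lft k) (rgt k) (\<lambda>x. w k (Suc (Suc j)) x t) (\<lambda>x. w k i x t))"
  define B where "B = (\<lambda>k. complex_of_real (stiff k) * ip (lft k) (rgt k) (\<lambda>x. r k j x t) (\<lambda>x. r k i x t))"
  define bd where "bd = (\<lambda>k x. complex_of_real (stiff k) * (r k j x t * cnj (w k i x t)))"
  have wc: "continuous_on {lft k..rgt k} (\<lambda>x. w m n x t * cnj (w k i x t))" if "k < 4" "m < 4" "m < 2 \<longleftrightarrow> k < 2" "n \<le> 8" for k m n
  proof -
    have "lft m = lft k" "rgt m = rgt k" using that by (auto simp: lft_def rgt_def)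
    then have "continuous_on {lft k..rgt k} (\<lambda>x. w m n x t)" using w_cont[OF that(2,4) t] by simp
    then show ?thesis using i by (intro continuous_intros w_cont t that(1)) auto
  qed
  have step: "A k + B k - Z = bd k (rgt k) - bd k (lft k)"
    if k: "k < 4" and Z: "((\<lambda>x. lo k j x t * cnj (w k i x t)) has_integral Z) {lft k..rgt k}" for k Z
  proof -
    have "((\<lambda>x. w k (Suc (Suc j)) x t * cnj (w k i x t)) has_integral A k) {lft k..rgt k}"
      unfolding A_def ip_def by (intro integrable_integral integrable_continuous_interval wc k) (use j in auto)
    moreover have "((\<lambda>x. complex_of_real (stiff k) * (r k j x t * cnj (r k i x t))) has_integral B k) {lft k..rgt k}"
      unfolding B_def ip_def by (intro has_integral_mult_right integrable_integral integrable_continuous_interval continuous_intros r_cont k t) (use j i in auto)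
    ultimately have "((\<lambda>x. w k (Suc (Suc j)) x t * cnj (w k i x t) + complex_of_real (stiff k) * (r k j x t * cnj (r k i x t))
        - lo k j x t * cnj (w k i x t)) has_integral A k + B k - Z) {lft k..rgt k}"
      by (intro has_integral_diff has_integral_add Z)
    then have "((\<lambda>x. (w k (Suc (Suc j)) x t - lo k j x t) * cnj (w k i x t) + complex_of_real (stiff k) * (r k j x t * cnj (r k i x t)))
        has_integral A k + B k - Z) {lft k..rgt k}"
      by (rule has_integral_eq[rotated]) (simp add: algebra_simps)
    from has_integral_unique[OF this green_component[OF k j i t]] show ?thesis by (simp only: bd_def)
  qed
  have lrs: "lft 0 = 0" "lft 1 = 0" "rgt 0 = L0" "rgt 1 = L0" "lft 2 = L0" "lft 3 = L0" "rgt 2 = L" "rgt 3 = L"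
    by (auto simp: lft_def rgt_def)
  have z0: "((\<lambda>x. lo 0 j x t * cnj (w 0 i x t)) has_integral - (complex_of_real c1 * ip p q (\<lambda>x. w 1 j x t) (\<lambda>x. w 0 i x t))) {lft 0..rgt 0}"
  proof -
    have "((\<lambda>x. complex_of_real (coef c1 p q x) * (w 1 j x t * cnj (w 0 i x t))) has_integral complex_of_real c1 * ip p q (\<lambda>x. w 1 j x t) (\<lambda>x. w 0 i x t)) {lft 0..rgt 0}"
      unfolding ip_def by (rule coef_has_integral[OF wc]) (use j pq lrs in auto)
    from has_integral_neg[OF this] show ?thesis by (rule has_integral_eq[rotated]) (simp add: lo_def lower_def)
  qed
  have z1: "((\<lambda>x. lo 1 j x t * cnj (w 1 i x t)) has_integral - (complex_of_real c1 * ip p q (\<lambda>x. w 0 j x t) (\<lambda>x. w 1 i x t))) {lft 1..rgt 1}"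
  proof -
    have "((\<lambda>x. complex_of_real (coef c1 p q x) * (w 0 j x t * cnj (w 1 i x t))) has_integral complex_of_real c1 * ip p q (\<lambda>x. w 0 j x t) (\<lambda>x. w 1 i x t)) {lft 1..rgt 1}"
      unfolding ip_def by (rule coef_has_integral[OF wc]) (use j pq lrs in auto)
    from has_integral_neg[OF this] show ?thesis by (rule has_integral_eq[rotated]) (simp add: lo_def lower_def)
  qed
  have z2: "((\<lambda>x. lo 2 j x t * cnj (w 2 i x t)) has_integral - (complex_of_real c2 * ip \<beta>1 \<beta>3 (\<lambda>x. w 3 (Suc j) x t) (\<lambda>x. w 2 i x t)
      + complex_of_real d2 * ip \<beta>2 \<beta>4 (\<lambda>x. w 2 (Suc j) x t) (\<lambda>x. w 2 i x t))) {lft 2..rgt 2}"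
  proof -
    have "((\<lambda>x. complex_of_real (coef c2 \<beta>1 \<beta>3 x) * (w 3 (Suc j) x t * cnj (w 2 i x t))) has_integral complex_of_real c2 * ip \<beta>1 \<beta>3 (\<lambda>x. w 3 (Suc j) x t) (\<lambda>x. w 2 i x t)) {lft 2..rgt 2}"
      unfolding ip_def by (rule coef_has_integral[OF wc]) (use j \<beta> lrs in auto)
    moreover have "((\<lambda>x. complex_of_real (coef d2 \<beta>2 \<beta>4 x) * (w 2 (Suc j) x t * cnj (w 2 i x t))) has_integral complex_of_real d2 * ip \<beta>2 \<beta>4 (\<lambda>x. w 2 (Suc j) x t) (\<lambda>x. w 2 i x t)) {lft 2..rgt 2}"
      unfolding ip_def by (rule coef_has_integral[OF wc]) (use j \<beta> lrs in auto)
    ultimately have "((\<lambda>x. complex_of_real (coef c2 \<beta>1 \<beta>3 x) * (w 3 (Suc j) x t * cnj (w 2 i x t)) + complex_of_real (coef d2 \<beta>2 \<beta>4 x) * (w 2 (Suc j) x t * cnj (w 2 i x t)))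
        has_integral complex_of_real c2 * ip \<beta>1 \<beta>3 (\<lambda>x. w 3 (Suc j) x t) (\<lambda>x. w 2 i x t) + complex_of_real d2 * ip \<beta>2 \<beta>4 (\<lambda>x. w 2 (Suc j) x t) (\<lambda>x. w 2 i x t)) {lft 2..rgt 2}"
      by (rule has_integral_add)
    from has_integral_neg[OF this] show ?thesis by (rule has_integral_eq[rotated]) (simp add: lo_def lower_def algebra_simps)
  qed
  have z3: "((\<lambda>x. lo 3 j x t * cnj (w 3 i x t)) has_integral complex_of_real c2 * ip \<beta>1 \<beta>3 (\<lambda>x. w 2 (Suc j) x t) (\<lambda>x. w 3 i x t)) {lft 3..rgt 3}"
  proof -
    have "((\<lambda>x. complex_of_real (coef c2 \<beta>1 \<beta>3 x) * (w 2 (Suc j) x t * cnj (w 3 i x t))) has_integral complex_of_real c2 * ip \<beta>1 \<beta>3 (\<lambda>x. w 2 (Suc j) x t) (\<lambda>x. w 3 i x t)) {lft 3..rgt 3}"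
      unfolding ip_def by (rule coef_has_integral[OF wc]) (use j \<beta> lrs in auto)
    then show ?thesis by (rule has_integral_eq[rotated]) (simp add: lo_def lower_def)
  qed
  have bsum: "(bd 0 (rgt 0) - bd 0 (lft 0)) + (bd 1 (rgt 1) - bd 1 (lft 1)) + (bd 2 (rgt 2) - bd 2 (lft 2)) + (bd 3 (rgt 3) - bd 3 (lft 3)) = 0"
  proof -
    have j8: "j < 8" using j by simp
    note b = boundary[OF t i] and c = boundary(7,8)[OF t j8]
    have "bd 0 (lft 0) = 0" "bd 1 (lft 1) = 0" "bd 2 (rgt 2) = 0" "bd 3 (rgt 3) = 0"
      unfolding bd_def lrs b(1-4) by simp_all
    moreover have "bd 0 (rgt 0) = bd 2 (lft 2)"
    proof -
      have "bd 0 (rgt 0) = (complex_of_real a1 * r 0 j L0 t) * cnj (w 0 i L0 t)"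
        unfolding bd_def lrs by (simp add: stiff_def)
      also have "\<dots> = (complex_of_real a2 * r 2 j L0 t) * cnj (w 2 i L0 t)" unfolding b(5) c(1) ..
      also have "\<dots> = bd 2 (lft 2)" unfolding bd_def lrs by (simp add: stiff_def)
      finally show ?thesis .
    qed
    moreover have "bd 1 (rgt 1) = bd 3 (lft 3)"
      unfolding bd_def lrs b(6) c(2) by (simp add: stiff_def)
    ultimately show ?thesis by simp
  qed
  have sum: "A 0 + A 1 + A 2 + A 3 + (B 0 + B 1 + B 2 + B 3)
      = - (complex_of_real c1 * ip p q (\<lambda>x. w 1 j x t) (\<lambda>x. w 0 i x t)) + - (complex_of_real c1 * ip p q (\<lambda>x. w 0 j x t) (\<lambda>x. w 1 i x t))
      + - (complex_of_real c2 * ip \<beta>1 \<beta>3 (\<lambda>x. w 3 (Suc j) x t) (\<lambda>x. w 2 i x t) + complex_of_real d2 * ip \<beta>2 \<beta>4 (\<lambda>x. w 2 (Suc j) x t) (\<lambda>x. w 2 i x t))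
      + complex_of_real c2 * ip \<beta>1 \<beta>3 (\<lambda>x. w 2 (Suc j) x t) (\<lambda>x. w 3 i x t)"
    (is "_ = ?Z0 + ?Z1 + ?Z2 + ?Z3")
  proof -
    have s: "A 0 + B 0 - ?Z0 = bd 0 (rgt 0) - bd 0 (lft 0)" "A 1 + B 1 - ?Z1 = bd 1 (rgt 1) - bd 1 (lft 1)"
      "A 2 + B 2 - ?Z2 = bd 2 (rgt 2) - bd 2 (lft 2)" "A 3 + B 3 - ?Z3 = bd 3 (rgt 3) - bd 3 (lft 3)"
      by (rule step[OF _ z0], simp, rule step[OF _ z1], simp, rule step[OF _ z2], simp, rule step[OF _ z3], simp)
    have "(A 0 + B 0 - ?Z0) + (A 1 + B 1 - ?Z1) + (A 2 + B 2 - ?Z2) + (A 3 + B 3 - ?Z3) = 0"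
      unfolding s by (rule bsum)
    then show ?thesis by (simp add: algebra_simps)
  qed
  have "(\<Sum>k<4. B k) = - (\<Sum>k<4. A k) + (?Z0 + ?Z1 + ?Z2 + ?Z3)"
    unfolding sum_less_4 sum[symmetric] by simp
  then show ?thesis unfolding A_def B_def by (simp add: algebra_simps)
qed

lemma orbit_energy:
  assumes j: "j < 7" and t: "0 \<le> t"
  shows "E (S t (f j)) = (\<Sum>k<4. stiff k * Re (ip (lft k) (rgt k) (\<lambda>x. r k j x t) (\<lambda>x. r k j x t))
      + Re (ip (lft k) (rgt k) (\<lambda>x. w k (Suc j) x t) (\<lambda>x. w k (Suc j) x t))) + 2 * c1 * Re (ip p q (\<lambda>x. w 0 j x t) (\<lambda>x. w 1 j x t))"
  by (rule E_classical[OF orbit_H[OF t]]) (use j t in \<open>auto intro!: grad_ae vel_ae disp_ae r_cont w_cont\<close>)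

definition G :: "nat \<Rightarrow> real \<Rightarrow> real" where
  "G j t = integral {\<beta>2..\<beta>4} (\<lambda>x. (cmod (w 2 (Suc j) x t))\<^sup>2)"

lemma Re_ip_self:
  assumes "continuous_on {a..b} u"
  shows "Re (ip a b u u) = integral {a..b} (\<lambda>x. (cmod (u x))\<^sup>2)"
proof -
  have c: "continuous_on {a..b} (\<lambda>x. (cmod (u x))\<^sup>2)" using assms by (intro continuous_intros)
  have i: "set_integrable lborel {a..b} (\<lambda>x. (cmod (u x))\<^sup>2)"
    unfolding set_integrable_def using borel_integrable_compact[OF compact_Icc c] .
  show ?thesis unfolding sqint_ip[OF assms, symmetric] set_integral_open_closed by (rule set_borel_integral_eq_integral(2)[OF i])
qed

text \<open>Expanding the quadratic energy gives the derivative as a bilinear expression in two consecutive levels.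
Green's formula reduces it to lower-order terms: the displacement coupling is part of the energy, the velocity
coupling is skew-symmetric and drops out, and the damping remains.\<close>

lemma energy_derivative:
  assumes j: "j < 5" and t: "0 < t"
  shows "((\<lambda>t. (N (S t (f j)))\<^sup>2) has_real_derivative - (2 * d2 * G j t)) (at t)"
proof -
  have t0: "0 \<le> t" using t by simp
  define \<rho> where "\<rho> = (\<lambda>i k x. r k (j + i) x t)"
  define \<omega> where "\<omega> = (\<lambda>i k x. w k (j + i) x t)"
  define I where "I = (\<lambda>k u v. Re (ip (lft k) (rgt k) u v))"
  define b where "b = (\<Sum>k<4. stiff k * I k (\<rho> 0 k) (\<rho> 1 k) + I k (\<omega> 1 k) (\<omega> 2 k)) + c1 * Re (ip p q (\<omega> 0 0) (\<omega> 1 1) + ip p q (\<omega> 1 0) (\<omega> 0 1))"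
  have P: "S t (f j) \<in> H" "S t (f (Suc j)) \<in> H" using orbit_H[OF t0] j by auto
  have ae: "ae_eq (lft k) (rgt k) (grad k (S t (f (j + i)))) (\<rho> i k)" "ae_eq (lft k) (rgt k) (vel k (S t (f (j + i)))) (\<omega> (Suc i) k)"
    "ae_eq (lft k) (rgt k) (disp k (S t (f (j + i)))) (\<omega> i k)" if "k < 4" "i < 2" for k i
    unfolding \<rho>_def \<omega>_def add_Suc_right using that j t0 by (intro grad_ae vel_ae disp_ae; simp)+
  have cont: "continuous_on {lft k..rgt k} (\<rho> i k)" "continuous_on {lft k..rgt k} (\<omega> i k)" if "k < 4" "i < 3" for k i
    unfolding \<rho>_def \<omega>_def using that j t0 by (intro r_cont w_cont; simp)+
  have alg1: "s * (a + 2 * h * b + h\<^sup>2 * c) + (d + 2 * h * e + h\<^sup>2 * g) = (s * a + d) + 2 * h * (s * b + e) + h\<^sup>2 * (s * c + g)"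
    and alg2: "2 * s * (a + h * b + h\<^sup>2 * c) = 2 * s * a + 2 * h * (s * b) + h\<^sup>2 * (2 * s * c)"
    and alg3: "(a + 2 * h * b + h\<^sup>2 * c) + (d + 2 * h * e + h\<^sup>2 * g) = (a + d) + 2 * h * (b + e) + h\<^sup>2 * (c + g)"
    for s a b c d e g h :: real
    by (simp_all add: algebra_simps)
  have expand: "(N (S t (f j) + gen.rsc h (S t (f (Suc j)))))\<^sup>2 = (N (S t (f j)))\<^sup>2 + 2 * h * b + h\<^sup>2 * E (S t (f (Suc j)))" for h
  proof -
    let ?h = "complex_of_real h"
    let ?U = "S t (f j) + gen.rsc h (S t (f (Suc j)))"
    have V: "gen.rsc h (S t (f (Suc j))) \<in> H" using P by (intro H_scale)
    have U: "?U \<in> H" using P V by (intro H_add)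
    have a0: "ae_eq (lft k) (rgt k) (grad k (S t (f j))) (\<rho> 0 k)" "ae_eq (lft k) (rgt k) (grad k (S t (f (Suc j)))) (\<rho> 1 k)"
      "ae_eq (lft k) (rgt k) (vel k (S t (f j))) (\<omega> 1 k)" "ae_eq (lft k) (rgt k) (vel k (S t (f (Suc j)))) (\<omega> 2 k)"
      "ae_eq (lft k) (rgt k) (disp k (S t (f j))) (\<omega> 0 k)" "ae_eq (lft k) (rgt k) (disp k (S t (f (Suc j)))) (\<omega> 1 k)" if "k < 4" for k
      using ae[OF that, of 0] ae[OF that, of 1] by (simp_all add: numeral_2_eq_2)
    have EU: "E ?U = (\<Sum>k<4. stiff k * I k (\<lambda>x. \<rho> 0 k x + ?h * \<rho> 1 k x) (\<lambda>x. \<rho> 0 k x + ?h * \<rho> 1 k x)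
        + I k (\<lambda>x. \<omega> 1 k x + ?h * \<omega> 2 k x) (\<lambda>x. \<omega> 1 k x + ?h * \<omega> 2 k x))
        + 2 * c1 * Re (ip p q (\<lambda>x. \<omega> 0 0 x + ?h * \<omega> 1 0 x) (\<lambda>x. \<omega> 0 1 x + ?h * \<omega> 1 1 x))"
      unfolding I_def
    proof (rule E_classical[OF U, where \<rho> = "\<lambda>k x. \<rho> 0 k x + ?h * \<rho> 1 k x" and \<nu> = "\<lambda>k x. \<omega> 1 k x + ?h * \<omega> 2 k x" and \<omega> = "\<lambda>k x. \<omega> 0 k x + ?h * \<omega> 1 k x"])
      fix k :: nat assume k: "k < 4"
      show "ae_eq (lft k) (rgt k) (grad k ?U) (\<lambda>x. \<rho> 0 k x + ?h * \<rho> 1 k x)"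
      proof (rule ae_eq_trans[OF grad_add[OF P(1) V k]], rule ae_eq_binop[of _ _ _ _ _ _ "\<lambda>x y z. y + z", OF a0(1)[OF k]])
        show "ae_eq (lft k) (rgt k) (grad k (gen.rsc h (S t (f (Suc j))))) (\<lambda>x. ?h * \<rho> 1 k x)"
          by (rule ae_eq_trans[OF grad_scale[OF P(2) k] ae_eq_unop[of _ _ _ _ "\<lambda>x y. ?h * y", OF a0(2)[OF k]]])
      qed
      show "ae_eq (lft k) (rgt k) (vel k ?U) (\<lambda>x. \<omega> 1 k x + ?h * \<omega> 2 k x)"
        unfolding vel_add vel_scale by (rule ae_eq_binop[of _ _ _ _ _ _ "\<lambda>x y z. y + ?h * z", OF a0(3,4)[OF k]])
      show "ae_eq (lft k) (rgt k) (disp k ?U) (\<lambda>x. \<omega> 0 k x + ?h * \<omega> 1 k x)"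
        unfolding disp_add disp_scale by (rule ae_eq_binop[of _ _ _ _ _ _ "\<lambda>x y z. y + ?h * z", OF a0(5,6)[OF k]])
      show "continuous_on {lft k..rgt k} (\<lambda>x. \<rho> 0 k x + ?h * \<rho> 1 k x)" "continuous_on {lft k..rgt k} (\<lambda>x. \<omega> 1 k x + ?h * \<omega> 2 k x)"
        "continuous_on {lft k..rgt k} (\<lambda>x. \<omega> 0 k x + ?h * \<omega> 1 k x)"
        by (intro continuous_intros cont k; simp)+
    qed
    have E0: "E (S t (f j)) = (\<Sum>k<4. stiff k * I k (\<rho> 0 k) (\<rho> 0 k) + I k (\<omega> 1 k) (\<omega> 1 k)) + 2 * c1 * Re (ip p q (\<omega> 0 0) (\<omega> 0 1))"
      unfolding I_def by (rule E_classical[OF P(1)]) (use a0 cont in auto)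
    have E1: "E (S t (f (Suc j))) = (\<Sum>k<4. stiff k * I k (\<rho> 1 k) (\<rho> 1 k) + I k (\<omega> 2 k) (\<omega> 2 k)) + 2 * c1 * Re (ip p q (\<omega> 1 0) (\<omega> 1 1))"
      unfolding I_def by (rule E_classical[OF P(2)]) (use a0 cont in auto)
    have e1: "stiff k * I k (\<lambda>x. \<rho> 0 k x + ?h * \<rho> 1 k x) (\<lambda>x. \<rho> 0 k x + ?h * \<rho> 1 k x) + I k (\<lambda>x. \<omega> 1 k x + ?h * \<omega> 2 k x) (\<lambda>x. \<omega> 1 k x + ?h * \<omega> 2 k x)
        = (stiff k * I k (\<rho> 0 k) (\<rho> 0 k) + I k (\<omega> 1 k) (\<omega> 1 k)) + 2 * h * (stiff k * I k (\<rho> 0 k) (\<rho> 1 k) + I k (\<omega> 1 k) (\<omega> 2 k))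
          + h\<^sup>2 * (stiff k * I k (\<rho> 1 k) (\<rho> 1 k) + I k (\<omega> 2 k) (\<omega> 2 k))" if k: "k < 4" for k
    proof -
      have cc: "continuous_on {lft k..rgt k} (\<rho> 0 k)" "continuous_on {lft k..rgt k} (\<rho> 1 k)"
        "continuous_on {lft k..rgt k} (\<omega> 1 k)" "continuous_on {lft k..rgt k} (\<omega> 2 k)" using cont[OF k] by auto
      have "I k (\<lambda>x. \<rho> 0 k x + ?h * \<rho> 1 k x) (\<lambda>x. \<rho> 0 k x + ?h * \<rho> 1 k x) = I k (\<rho> 0 k) (\<rho> 0 k) + 2 * h * I k (\<rho> 0 k) (\<rho> 1 k) + h\<^sup>2 * I k (\<rho> 1 k) (\<rho> 1 k)"
        "I k (\<lambda>x. \<omega> 1 k x + ?h * \<omega> 2 k x) (\<lambda>x. \<omega> 1 k x + ?h * \<omega> 2 k x) = I k (\<omega> 1 k) (\<omega> 1 k) + 2 * h * I k (\<omega> 1 k) (\<omega> 2 k) + h\<^sup>2 * I k (\<omega> 2 k) (\<omega> 2 k)"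
        unfolding I_def by (rule Re_ip_expand[OF cc(1,2)], rule Re_ip_expand[OF cc(3,4)])
      then show ?thesis by (simp only: alg1)
    qed
    have es: "(\<Sum>k<4. stiff k * I k (\<lambda>x. \<rho> 0 k x + ?h * \<rho> 1 k x) (\<lambda>x. \<rho> 0 k x + ?h * \<rho> 1 k x) + I k (\<lambda>x. \<omega> 1 k x + ?h * \<omega> 2 k x) (\<lambda>x. \<omega> 1 k x + ?h * \<omega> 2 k x))
        = (\<Sum>k<4. stiff k * I k (\<rho> 0 k) (\<rho> 0 k) + I k (\<omega> 1 k) (\<omega> 1 k)) + 2 * h * (\<Sum>k<4. stiff k * I k (\<rho> 0 k) (\<rho> 1 k) + I k (\<omega> 1 k) (\<omega> 2 k))
          + h\<^sup>2 * (\<Sum>k<4. stiff k * I k (\<rho> 1 k) (\<rho> 1 k) + I k (\<omega> 2 k) (\<omega> 2 k))"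
    proof -
      have "(\<Sum>k<4. stiff k * I k (\<lambda>x. \<rho> 0 k x + ?h * \<rho> 1 k x) (\<lambda>x. \<rho> 0 k x + ?h * \<rho> 1 k x) + I k (\<lambda>x. \<omega> 1 k x + ?h * \<omega> 2 k x) (\<lambda>x. \<omega> 1 k x + ?h * \<omega> 2 k x))
          = (\<Sum>k<4. (stiff k * I k (\<rho> 0 k) (\<rho> 0 k) + I k (\<omega> 1 k) (\<omega> 1 k)) + 2 * h * (stiff k * I k (\<rho> 0 k) (\<rho> 1 k) + I k (\<omega> 1 k) (\<omega> 2 k))
          + h\<^sup>2 * (stiff k * I k (\<rho> 1 k) (\<rho> 1 k) + I k (\<omega> 2 k) (\<omega> 2 k)))"
        by (rule sum.cong[OF refl], rule e1) simp
      then show ?thesis unfolding sum_distrib_left sum.distrib[symmetric] .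
    qed
    have cpq: "continuous_on {p..q} (\<omega> i k)" if "k < 2" "i < 3" for i k
    proof (rule continuous_on_subset)
      show "continuous_on {lft k..rgt k} (\<omega> i k)" by (rule cont(2)) (use that in auto)
      show "{p..q} \<subseteq> {lft k..rgt k}" using that(1) pq by (auto simp: lft_def rgt_def)
    qed
    have e2: "2 * c1 * Re (ip p q (\<lambda>x. \<omega> 0 0 x + ?h * \<omega> 1 0 x) (\<lambda>x. \<omega> 0 1 x + ?h * \<omega> 1 1 x))
        = 2 * c1 * Re (ip p q (\<omega> 0 0) (\<omega> 0 1)) + 2 * h * (c1 * Re (ip p q (\<omega> 0 0) (\<omega> 1 1) + ip p q (\<omega> 1 0) (\<omega> 0 1))) + h\<^sup>2 * (2 * c1 * Re (ip p q (\<omega> 1 0) (\<omega> 1 1)))"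
    proof -
      have "Re (ip p q (\<lambda>x. \<omega> 0 0 x + ?h * \<omega> 1 0 x) (\<lambda>x. \<omega> 0 1 x + ?h * \<omega> 1 1 x))
          = Re (ip p q (\<omega> 0 0) (\<omega> 0 1)) + h * Re (ip p q (\<omega> 0 0) (\<omega> 1 1) + ip p q (\<omega> 1 0) (\<omega> 0 1)) + h\<^sup>2 * Re (ip p q (\<omega> 1 0) (\<omega> 1 1))"
        by (subst ip_expand) (auto intro!: cpq simp flip: of_real_power)
      then show ?thesis by (simp only: alg2)
    qed
    have "E ?U = E (S t (f j)) + 2 * h * b + h\<^sup>2 * E (S t (f (Suc j)))"
      unfolding EU E0 E1 b_def e2 es by (rule alg3)
    then show ?thesis unfolding N_sq[OF U] N_sq[OF P(1)] .
  qed
  have bG: "b = - (d2 * G j t)"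
  proof -
    have g: "(\<Sum>k<4. complex_of_real (stiff k) * ip (lft k) (rgt k) (\<rho> 0 k) (\<rho> 1 k))
      = - (\<Sum>k<4. ip (lft k) (rgt k) (\<omega> 2 k) (\<omega> 1 k))
      - complex_of_real c1 * (ip p q (\<omega> 0 1) (\<omega> 1 0) + ip p q (\<omega> 0 0) (\<omega> 1 1))
      - complex_of_real c2 * ip \<beta>1 \<beta>3 (\<omega> 1 3) (\<omega> 1 2)
      + complex_of_real c2 * ip \<beta>1 \<beta>3 (\<omega> 1 2) (\<omega> 1 3)
      - complex_of_real d2 * ip \<beta>2 \<beta>4 (\<omega> 1 2) (\<omega> 1 2)"
    proof -
      have n: "j + 0 = j" "j + 1 = Suc j" "j + 2 = Suc (Suc j)" by simp_all
      show ?thesis unfolding \<rho>_def \<omega>_def n by (rule green[OF _ _ t0]) (use j in auto)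
    qed
    have "(\<Sum>k<4. stiff k * I k (\<rho> 0 k) (\<rho> 1 k)) = Re (\<Sum>k<4. complex_of_real (stiff k) * ip (lft k) (rgt k) (\<rho> 0 k) (\<rho> 1 k))"
      by (simp add: I_def)
    also have "\<dots> = - (\<Sum>k<4. Re (ip (lft k) (rgt k) (\<omega> 2 k) (\<omega> 1 k)))
        - c1 * (Re (ip p q (\<omega> 0 1) (\<omega> 1 0)) + Re (ip p q (\<omega> 0 0) (\<omega> 1 1)))
        - c2 * Re (ip \<beta>1 \<beta>3 (\<omega> 1 3) (\<omega> 1 2)) + c2 * Re (ip \<beta>1 \<beta>3 (\<omega> 1 2) (\<omega> 1 3)) - d2 * Re (ip \<beta>2 \<beta>4 (\<omega> 1 2) (\<omega> 1 2))"
      unfolding g by simp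
    also have "(\<Sum>k<4. Re (ip (lft k) (rgt k) (\<omega> 2 k) (\<omega> 1 k))) = (\<Sum>k<4. I k (\<omega> 1 k) (\<omega> 2 k))"
      unfolding I_def by (rule sum.cong[OF refl], rule Re_ip_commute)
    also have "Re (ip p q (\<omega> 0 1) (\<omega> 1 0)) = Re (ip p q (\<omega> 1 0) (\<omega> 0 1))" by (rule Re_ip_commute)
    also have "Re (ip \<beta>1 \<beta>3 (\<omega> 1 3) (\<omega> 1 2)) = Re (ip \<beta>1 \<beta>3 (\<omega> 1 2) (\<omega> 1 3))" by (rule Re_ip_commute)
    finally have s: "(\<Sum>k<4. stiff k * I k (\<rho> 0 k) (\<rho> 1 k)) = - (\<Sum>k<4. I k (\<omega> 1 k) (\<omega> 2 k))
        - c1 * (Re (ip p q (\<omega> 1 0) (\<omega> 0 1)) + Re (ip p q (\<omega> 0 0) (\<omega> 1 1))) - d2 * Re (ip \<beta>2 \<beta>4 (\<omega> 1 2) (\<omega> 1 2))"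
      by simp
    have "b = - (d2 * Re (ip \<beta>2 \<beta>4 (\<omega> 1 2) (\<omega> 1 2)))"
      unfolding b_def sum.distrib s plus_complex.simps by (simp add: distrib_left)
    moreover have "Re (ip \<beta>2 \<beta>4 (\<omega> 1 2) (\<omega> 1 2)) = G j t"
    proof -
      have "continuous_on {\<beta>2..\<beta>4} (\<omega> 1 2)"
        by (rule continuous_on_subset[OF cont(2) inner_intervals(5)]) auto
      from Re_ip_self[OF this] show ?thesis by (simp add: G_def \<omega>_def)
    qed
    ultimately show ?thesis by simp
  qed
  have "((\<lambda>t. (N (S t (f j)))\<^sup>2) has_real_derivative 2 * b) (at t)"
    by (rule gen.norm_sq_derivative[OF _ _ _ t expand]) (use f_chain j in auto)
  then show ?thesis unfolding bG by (simp add: mult.assoc)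
qed

end

section \<open>Decay\<close>

text \<open>Pointwise decay of one factor suffices, by dominated convergence.\<close>

lemma ip_tendsto_zero:
  fixes u v :: "real \<Rightarrow> real \<Rightarrow> complex"
  assumes lim: "\<And>x. x \<in> {a..b} \<Longrightarrow> ((\<lambda>t. u x t) \<longlongrightarrow> 0) at_top"
    and bu: "\<And>x t. x \<in> {a..b} \<Longrightarrow> 0 \<le> t \<Longrightarrow> cmod (u x t) \<le> B" and bv: "\<And>x t. x \<in> {a..b} \<Longrightarrow> 0 \<le> t \<Longrightarrow> cmod (v x t) \<le> B"
    and cu: "\<And>t. 0 \<le> t \<Longrightarrow> continuous_on {a..b} (\<lambda>x. u x t)" and cv: "\<And>t. 0 \<le> t \<Longrightarrow> continuous_on {a..b} (\<lambda>x. v x t)"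
  shows "((\<lambda>t. ip a b (\<lambda>x. u x t) (\<lambda>x. v x t)) \<longlongrightarrow> 0) at_top"
proof -
  \<comment> \<open>Cutting off negative times lets the bounds hold along any sequence tending to infinity.\<close>
  let ?h = "\<lambda>t x. u x (max t 0) * cnj (v x (max t 0))"
  have "((\<lambda>t. integral {a..b} (?h t)) \<longlongrightarrow> 0) at_top"
  proof (rule tendsto_at_topI_sequentially)
    fix X :: "nat \<Rightarrow> real" assume X: "filterlim X at_top sequentially"
    have "(\<lambda>n. integral {a..b} (?h (X n))) \<longlonglongrightarrow> integral {a..b} (\<lambda>x. 0 :: complex)"
    proof (rule dominated_convergence(2)[where h="\<lambda>_. B * B"])
      show "?h (X n) integrable_on {a..b}" for n
        by (intro integrable_continuous_interval continuous_intros cu cv) auto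
      show "(\<lambda>_. B * B) integrable_on {a..b}" by (rule integrable_const_ivl)
      show "norm (?h (X n) x) \<le> B * B" if "x \<in> {a..b}" for n x
      proof -
        have "cmod (u x (max (X n) 0)) \<le> B" "cmod (v x (max (X n) 0)) \<le> B" using bu[OF that] bv[OF that] by auto
        then show ?thesis unfolding norm_mult complex_mod_cnj by (intro mult_mono order.trans[OF norm_ge_zero]) auto
      qed
      show "(\<lambda>n. ?h (X n) x) \<longlonglongrightarrow> 0" if x: "x \<in> {a..b}" for x
      proof -
        have "((\<lambda>t. u x (max t 0)) \<longlongrightarrow> 0) at_top"
          by (rule Lim_transform_eventually[OF lim[OF x]]) (auto simp: eventually_at_top_linorder intro!: exI[of _ 0])
        then have uX: "(\<lambda>n. u x (max (X n) 0)) \<longlonglongrightarrow> 0" using X by (rule filterlim_compose)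
        have "(\<lambda>n. cnj (v x (max (X n) 0)) * u x (max (X n) 0)) \<longlonglongrightarrow> 0"
        proof (rule Lim_null_comparison)
          have "(\<lambda>n. B * cmod (u x (max (X n) 0))) \<longlonglongrightarrow> B * 0"
            by (intro tendsto_intros tendsto_norm_zero uX)
          then show "(\<lambda>n. B * cmod (u x (max (X n) 0))) \<longlonglongrightarrow> 0" by simp
          show "\<forall>\<^sub>F n in sequentially. norm (cnj (v x (max (X n) 0)) * u x (max (X n) 0)) \<le> B * cmod (u x (max (X n) 0))"
            unfolding norm_mult complex_mod_cnj using bv[OF x] by (intro always_eventually allI mult_right_mono) auto
        qed
        then show ?thesis by (simp only: mult.commute)
      qed
    qed
    then show "(\<lambda>n. integral {a..b} (?h (X n))) \<longlonglongrightarrow> 0" by simp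
  qed
  moreover have "\<forall>\<^sub>F t in at_top. integral {a..b} (?h t) = ip a b (\<lambda>x. u x t) (\<lambda>x. v x t)"
    by (auto simp: eventually_at_top_linorder ip_def intro!: exI[of _ 0])
  ultimately show ?thesis by (rule Lim_transform_eventually)
qed

context orbit begin

lemma G_lipschitz:
  assumes j: "j < 5" and st: "0 < s" "0 < t"
  shows "\<bar>G j s - G j t\<bar> \<le> (2 * M * M2 * (\<beta>4 - \<beta>2)) * \<bar>s - t\<bar>"
proof -
  have c: "continuous_on {\<beta>2..\<beta>4} (\<lambda>x. w 2 (Suc j) x t)" if "0 \<le> t" for t
    by (rule continuous_on_subset[OF w_cont inner_intervals(5)]) (use j that in auto)
  have c2: "continuous_on {\<beta>2..\<beta>4} (\<lambda>x. (cmod (w 2 (Suc j) x t))\<^sup>2)" if "0 \<le> t" for t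
    by (intro continuous_intros c that)
  have "G j s - G j t = integral {\<beta>2..\<beta>4} (\<lambda>x. (cmod (w 2 (Suc j) x s))\<^sup>2 - (cmod (w 2 (Suc j) x t))\<^sup>2)"
    unfolding G_def using st by (intro integral_diff[symmetric] integrable_continuous_interval c2) auto
  also have "norm \<dots> \<le> (2 * M * M2 * \<bar>s - t\<bar>) * (\<beta>4 - \<beta>2)"
  proof (rule integral_bound)
    show "continuous_on {\<beta>2..\<beta>4} (\<lambda>x. (cmod (w 2 (Suc j) x s))\<^sup>2 - (cmod (w 2 (Suc j) x t))\<^sup>2)"
      using st by (intro continuous_on_diff c2) auto
    fix x assume "x \<in> {\<beta>2..\<beta>4}"
    then have x: "x \<in> {lft 2..rgt 2}" using inner_intervals(5) by blast
    define A B where "A = w 2 (Suc j) x s" and "B = w 2 (Suc j) x t"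
    have AB: "cmod A \<le> M" "cmod B \<le> M" unfolding A_def B_def using x st j by (auto intro!: M(2))
    have "cmod (A - B) \<le> M2 * \<bar>s - t\<bar>" unfolding A_def B_def using x st j by (intro w_lip_t) auto
    then have d: "\<bar>cmod A - cmod B\<bar> \<le> M2 * \<bar>s - t\<bar>" using norm_triangle_ineq3[of A B] by linarith
    have "(cmod A)\<^sup>2 - (cmod B)\<^sup>2 = (cmod A + cmod B) * (cmod A - cmod B)" by (simp add: power2_eq_square algebra_simps)
    then have "\<bar>(cmod A)\<^sup>2 - (cmod B)\<^sup>2\<bar> = (cmod A + cmod B) * \<bar>cmod A - cmod B\<bar>" by (simp add: abs_mult)
    also have "\<dots> \<le> (2 * M) * (M2 * \<bar>s - t\<bar>)" using AB d M(1) by (intro mult_mono) auto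
    finally show "norm ((cmod (w 2 (Suc j) x s))\<^sup>2 - (cmod (w 2 (Suc j) x t))\<^sup>2) \<le> 2 * M * M2 * \<bar>s - t\<bar>"
      unfolding A_def B_def by (simp add: mult.assoc)
  qed (use \<beta> in auto)
  finally show ?thesis by (simp add: mult_ac)
qed

text \<open>The decay of the dissipation rate is a decay in the mean square, which is pointwise for equi-Lipschitz
functions.\<close>

lemma damped_decay:
  assumes j: "j < 5" and x: "x \<in> {\<beta>2..\<beta>4}"
  shows "((\<lambda>t. w 2 (Suc j) x t) \<longlongrightarrow> 0) at_top"
proof -
  have "((\<lambda>t. 2 * d2 * G j t) \<longlongrightarrow> 0) at_top"
  proof (rule dissipation_rate_tendsto_zero)
    show "((\<lambda>t. (N (S t (f j)))\<^sup>2) has_real_derivative - (2 * d2 * G j t)) (at t)" if "0 < t" for t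
      by (rule energy_derivative[OF j that])
    show "0 \<le> 2 * d2 * G j t" if "0 < t" for t
    proof -
      have "0 \<le> G j t" unfolding G_def by (rule integral_nonneg)
          (use continuous_on_subset[OF w_cont inner_intervals(5)] j that in \<open>auto intro!: integrable_continuous_interval continuous_intros\<close>)
      then show ?thesis using d2 by simp
    qed
    show "\<bar>2 * d2 * G j s - 2 * d2 * G j t\<bar> \<le> (2 * d2 * (2 * M * M2 * (\<beta>4 - \<beta>2))) * \<bar>s - t\<bar>" if "0 < s" "0 < t" for s t
    proof -
      have "\<bar>2 * d2 * G j s - 2 * d2 * G j t\<bar> = 2 * d2 * \<bar>G j s - G j t\<bar>"
        unfolding right_diff_distrib[symmetric] using d2 by (simp add: abs_mult)
      also have "\<dots> \<le> 2 * d2 * ((2 * M * M2 * (\<beta>4 - \<beta>2)) * \<bar>s - t\<bar>)"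
        using G_lipschitz[OF j that] d2 by (intro mult_left_mono) auto
      finally show ?thesis by (simp only: mult.assoc)
    qed
  qed simp
  from tendsto_mult[OF tendsto_const[of "1 / (2 * d2)"] this] have G0: "(G j \<longlongrightarrow> 0) at_top" using d2 by simp
  show ?thesis
  proof (rule mean_square_tendsto_pointwise[OF _ _ _ x])
    show "\<beta>2 < \<beta>4" using \<beta> by simp
    show "cmod (w 2 (Suc j) x t - w 2 (Suc j) y t) \<le> M2 * \<bar>x - y\<bar>" if "x \<in> {\<beta>2..\<beta>4}" "y \<in> {\<beta>2..\<beta>4}" "0 < t" for x y t
      using that inner_intervals(5) j by (intro w_lip_x) auto
    show "((\<lambda>t. integral {\<beta>2..\<beta>4} (\<lambda>x. (cmod (w 2 (Suc j) x t))\<^sup>2)) \<longlongrightarrow> 0) at_top"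
      using G0 by (simp add: G_def[abs_def])
  qed
qed

lemma middle: "{\<beta>2<..<\<beta>3} \<subseteq> {lft 2<..<rgt 2} - kinks" "{\<beta>2<..<\<beta>3} \<subseteq> {lft 3<..<rgt 3} - kinks"
  using \<beta> pq by (auto simp: lft_def rgt_def kinks_def)

lemma middle_closed: "x \<in> {\<beta>2<..<\<beta>3} \<Longrightarrow> x \<in> {lft 2..rgt 2}" "x \<in> {\<beta>2<..<\<beta>3} \<Longrightarrow> x \<in> {lft 3..rgt 3}"
  using middle by fastforce+

lemma middle_flux_decay:
  assumes i: "1 \<le> i" "i < 6" and x: "x \<in> {\<beta>2<..<\<beta>3}"
  shows "((\<lambda>t. r 2 i x t) \<longlongrightarrow> 0) at_top"
proof (rule space_derivative_tendsto_zero[where f="w 2 i" and K=M2, OF _ _ _ x])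
  show "((\<lambda>x. w 2 i x t) has_vector_derivative r 2 i x t) (at x)" if "x \<in> {\<beta>2<..<\<beta>3}" "0 < t" for x t
    using that middle i by (intro w_space) auto
  show "cmod (r 2 i x t - r 2 i y t) \<le> M2 * \<bar>x - y\<bar>" if "x \<in> {\<beta>2<..<\<beta>3}" "y \<in> {\<beta>2<..<\<beta>3}" "0 < t" for x y t
    using that i by (intro r_lip_x middle_closed) auto
  show "((\<lambda>t. w 2 i x t) \<longlongrightarrow> 0) at_top" if "x \<in> {\<beta>2<..<\<beta>3}" for x
    using damped_decay[of "i - 1" x] i that \<beta> by auto
qed

lemma lo_middle: "x \<in> {\<beta>2<..<\<beta>3} \<Longrightarrow> lo 2 i x t = - complex_of_real c2 * w 3 (Suc i) x t - complex_of_real d2 * w 2 (Suc i) x t"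
proof -
  assume "x \<in> {\<beta>2<..<\<beta>3}"
  then have "x \<in> {\<beta>1<..<\<beta>3}" "x \<in> {\<beta>2<..<\<beta>4}" using \<beta> by auto
  then have c: "coef c2 \<beta>1 \<beta>3 x = c2" "coef d2 \<beta>2 \<beta>4 x = d2" by (simp_all only: coef_def if_True)
  have n: "((2::nat) = 0) = False" "((2::nat) = 1) = False" by simp_all
  show ?thesis unfolding lo_def lower_def c n if_False by (simp only: simp_thms if_True)
qed

text \<open>Where damping and coupling overlap, the first equation expresses the second velocity through
  derivatives of the damped component.\<close>

lemma middle_coupled_decay:
  assumes i: "1 \<le> i" "i \<le> 2" and x: "x \<in> {\<beta>2<..<\<beta>3}"
  shows "((\<lambda>t. w 3 (Suc i) x t) \<longlongrightarrow> 0) at_top"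
proof -
  have a2: "stiff 2 = a2" by (simp add: stiff_def)
  define K where "K = (1 / a2) * (M2 + (\<bar>c2\<bar> * M2 + d2 * M2))"
  have rx: "((\<lambda>t. rx 2 i x t) \<longlongrightarrow> 0) at_top"
  proof (rule space_derivative_tendsto_zero[where f="r 2 i" and K=K, OF _ _ _ x])
    show "((\<lambda>x. r 2 i x t) has_vector_derivative rx 2 i x t) (at x)" if "x \<in> {\<beta>2<..<\<beta>3}" "0 < t" for x t
      using that middle i by (intro r_space) auto
    show "((\<lambda>t. r 2 i x t) \<longlongrightarrow> 0) at_top" if "x \<in> {\<beta>2<..<\<beta>3}" for x
      using middle_flux_decay[of i x] i that by auto
    fix x y t :: real assume xy: "x \<in> {\<beta>2<..<\<beta>3}" "y \<in> {\<beta>2<..<\<beta>3}" and t: "0 < t"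
    have in2: "x \<in> {lft 2..rgt 2}" "y \<in> {lft 2..rgt 2}" "x \<in> {lft 3..rgt 3}" "y \<in> {lft 3..rgt 3}"
      by (rule middle_closed[OF xy(1)] middle_closed[OF xy(2)])+
    define A where "A = w 2 (Suc (Suc i)) x t - w 2 (Suc (Suc i)) y t"
    define B where "B = w 3 (Suc i) x t - w 3 (Suc i) y t"
    define C where "C = w 2 (Suc i) x t - w 2 (Suc i) y t"
    have b: "cmod A \<le> M2 * \<bar>x - y\<bar>" "cmod B \<le> M2 * \<bar>x - y\<bar>" "cmod C \<le> M2 * \<bar>x - y\<bar>"
    proof -
      have "Suc (Suc i) < 8" "Suc i < 8" "0 \<le> t" "2 < (4::nat)" "3 < (4::nat)" using t i by simp_all
      note n = this
      show "cmod A \<le> M2 * \<bar>x - y\<bar>" unfolding A_def by (rule w_lip_x[OF n(4,1) in2(1,2) n(3)])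
      show "cmod B \<le> M2 * \<bar>x - y\<bar>" unfolding B_def by (rule w_lip_x[OF n(5,2) in2(3,4) n(3)])
      show "cmod C \<le> M2 * \<bar>x - y\<bar>" unfolding C_def by (rule w_lip_x[OF n(4,2) in2(1,2) n(3)])
    qed
    have "rx 2 i x t - rx 2 i y t = (1 / a2) *\<^sub>R (A + (complex_of_real c2 * B + complex_of_real d2 * C))"
      unfolding rx_def a2 lo_middle[OF xy(1)] lo_middle[OF xy(2)] A_def B_def C_def by (simp add: algebra_simps scaleR_conv_of_real)
    then have "cmod (rx 2 i x t - rx 2 i y t) = (1 / a2) * cmod (A + (complex_of_real c2 * B + complex_of_real d2 * C))"
      using a by simp
    moreover have "cmod (A + (complex_of_real c2 * B + complex_of_real d2 * C))
        \<le> M2 * \<bar>x - y\<bar> + (\<bar>c2\<bar> * (M2 * \<bar>x - y\<bar>) + d2 * (M2 * \<bar>x - y\<bar>))"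
    proof -
      have "cmod (complex_of_real c2 * B) \<le> \<bar>c2\<bar> * (M2 * \<bar>x - y\<bar>)" "cmod (complex_of_real d2 * C) \<le> d2 * (M2 * \<bar>x - y\<bar>)"
        unfolding norm_mult norm_of_real using b d2 by (simp_all add: mult_left_mono)
      then show ?thesis
        using b(1) norm_triangle_ineq[of "complex_of_real c2 * B" "complex_of_real d2 * C"]
          norm_triangle_ineq[of A "complex_of_real c2 * B + complex_of_real d2 * C"] by linarith
    qed
    ultimately have "cmod (rx 2 i x t - rx 2 i y t) \<le> (1 / a2) * (M2 * \<bar>x - y\<bar> + (\<bar>c2\<bar> * (M2 * \<bar>x - y\<bar>) + d2 * (M2 * \<bar>x - y\<bar>)))"
      using mult_left_mono[of "cmod (A + (complex_of_real c2 * B + complex_of_real d2 * C))" _ "1 / a2"] a by simp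
    also have "\<dots> = K * \<bar>x - y\<bar>" unfolding K_def by (simp only: distrib_left distrib_right mult.assoc)
    finally show "cmod (rx 2 i x t - rx 2 i y t) \<le> K * \<bar>x - y\<bar>" .
  qed
  have xb: "x \<in> {\<beta>2..\<beta>4}" using x \<beta> by auto
  have eq: "w 3 (Suc i) x t = (1 / complex_of_real c2) * (complex_of_real a2 * rx 2 i x t - w 2 (Suc (Suc i)) x t - complex_of_real d2 * w 2 (Suc i) x t)" for t
    unfolding rx_def a2 lo_middle[OF x] scaleR_conv_of_real using c2 a by (simp add: field_simps)
  have "((\<lambda>t. (1 / complex_of_real c2) * (complex_of_real a2 * rx 2 i x t - w 2 (Suc (Suc i)) x t - complex_of_real d2 * w 2 (Suc i) x t))
      \<longlongrightarrow> (1 / complex_of_real c2) * (complex_of_real a2 * 0 - 0 - complex_of_real d2 * 0)) at_top"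
    by (intro tendsto_mult tendsto_diff tendsto_const rx damped_decay xb) (use i in auto)
  then show ?thesis unfolding eq[symmetric] by simp
qed

lemma middle_coupled_flux_decay:
  assumes x: "x \<in> {\<beta>2<..<\<beta>3}"
  shows "((\<lambda>t. r 3 2 x t) \<longlongrightarrow> 0) at_top"
proof (rule space_derivative_tendsto_zero[where f="w 3 2" and K=M2, OF _ _ _ x])
  show "((\<lambda>x. w 3 2 x t) has_vector_derivative r 3 2 x t) (at x)" if "x \<in> {\<beta>2<..<\<beta>3}" "0 < t" for x t
    using that middle by (intro w_space) auto
  show "cmod (r 3 2 x t - r 3 2 y t) \<le> M2 * \<bar>x - y\<bar>" if "x \<in> {\<beta>2<..<\<beta>3}" "y \<in> {\<beta>2<..<\<beta>3}" "0 < t" for x y t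
    using that by (intro r_lip_x middle_closed) auto
  show "((\<lambda>t. w 3 2 x t) \<longlongrightarrow> 0) at_top" if "x \<in> {\<beta>2<..<\<beta>3}" for x
    using middle_coupled_decay[of 1 x] that by (simp add: numeral_2_eq_2)
qed

text \<open>The second time derivatives satisfy the wave equations of the system, and their lower-order terms contain the
components on the same side of the interface only.\<close>

lemma waves:
  assumes k0: "k0 = 0 \<or> k0 = 2"
  shows "wave_family {k0, Suc k0} (lft k0) (rgt k0) kinks (\<lambda>k. sqrt (stiff k)) CC (1 / sqrt kap) ((1 + sqrt Kap) * M)
    (\<lambda>k. w k 2) (\<lambda>k. w k 3) (\<lambda>k. w k 4) (\<lambda>k. r k 2) (\<lambda>k. r k 3) (\<lambda>k. rx k 2) (\<lambda>k x t. - lo k 2 x t)"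
proof
  have I: "k < 4" "lft k = lft k0" "rgt k = rgt k0" "k < 2 \<longleftrightarrow> k0 < 2" if "k \<in> {k0, Suc k0}" for k
    using k0 that by (auto simp: lft_def rgt_def)
  show "finite {k0, Suc k0}" by simp
  show "finite kinks" by (rule finite_kinks)
  show "0 \<le> CC" by (rule CC)
  fix k assume kI: "k \<in> {k0, Suc k0}"
  note k = I[OF kI]
  show "0 < sqrt (stiff k)" using stiff_pos by simp
  show "1 / sqrt (stiff k) \<le> 1 / sqrt kap" using kap stiff_pos[of k] by (intro divide_left_mono) auto
  show "continuous_on ({lft k0..rgt k0} \<times> {0<..}) (\<lambda>(x, t). h x t)" if "h \<in> {w k 2, w k 3, r k 2, w k 4, r k 3}" for h
    using that w_joint[OF k(1)] r_joint[OF k(1)] unfolding k(2,3) by auto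
  fix x t :: real assume t: "0 < t"
  then have t0: "0 \<le> t" by simp
  have n: "Suc 2 = 3" "Suc 3 = 4" "Suc (Suc 2) = 4" by simp_all
  show "(w k 3 x has_vector_derivative w k 4 x t) (at t)" if "x \<in> {lft k0..rgt k0}"
    using pt_functional[OF k(1), of x 3 t] that t unfolding k(2,3) n by simp
  show "(r k 2 x has_vector_derivative r k 3 x t) (at t)" if "x \<in> {lft k0..rgt k0}"
    using fl_functional[OF k(1), of x 2 t] that t unfolding k(2,3) n by simp
  show "((\<lambda>x. w k 2 x t) has_vector_derivative r k 2 x t) (at x)" "((\<lambda>x. w k 3 x t) has_vector_derivative r k 3 x t) (at x)" if "x \<in> {lft k0<..<rgt k0}"
    using w_space[OF k(1) _ _ t0, of x] that unfolding k(2,3) by auto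
  show "((\<lambda>x. r k 2 x t) has_vector_derivative rx k 2 x t) (at x)" if "x \<in> {lft k0<..<rgt k0} - kinks"
    using r_space[OF k(1) _ _ t0, of x] that unfolding k(2,3) by auto
  show "(sqrt (stiff k))\<^sup>2 *\<^sub>R rx k 2 x t = w k 4 x t + - lo k 2 x t"
    using stiff_pos[of k] unfolding rx_def n by simp
  show "cmod (- lo k 2 x t) \<le> CC * B" if B: "\<And>j. j \<in> {k0, Suc k0} \<Longrightarrow> cmod (w j 2 x t) \<le> B \<and> cmod (w j 3 x t) \<le> B" for B
    unfolding norm_minus_cancel lo_def CC_def n
  proof (rule lower_bound[OF k(1)])
    fix m :: nat assume "m < 4" "m < 2 \<longleftrightarrow> k < 2"
    then have "m \<in> {k0, Suc k0}" using k0 kI by auto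
    then show "cmod (w m 2 x t) \<le> B \<and> cmod (w m 3 x t) \<le> B" by (rule B)
  qed
  show "cmod (w k 2 x t) \<le> (1 + sqrt Kap) * M \<and> cmod (w k 3 x t) \<le> (1 + sqrt Kap) * M \<and> cmod (sqrt (stiff k) *\<^sub>R r k 2 x t) \<le> (1 + sqrt Kap) * M"
    if x: "x \<in> {lft k0..rgt k0}"
  proof -
    have K: "0 \<le> sqrt Kap" "0 \<le> sqrt Kap * M" using kap(5) M(1) by auto
    have le: "M \<le> (1 + sqrt Kap) * M" using K by (simp add: distrib_right)
    have b: "cmod (w k 2 x t) \<le> M" "cmod (w k 3 x t) \<le> M" "cmod (r k 2 x t) \<le> M"
      using M(2)[OF k(1) _ _ t0, of _ x] M(3)[OF k(1) _ _ t0, of _ x] x unfolding k(2,3) by auto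
    have "cmod (sqrt (stiff k) *\<^sub>R r k 2 x t) \<le> sqrt Kap * M"
      unfolding norm_scaleR using b(3) kap(4)[of k] stiff_pos[of k] K by (intro mult_mono) auto
    also have "\<dots> \<le> (1 + sqrt Kap) * M" using M(1) by (simp add: distrib_right)
    finally show ?thesis using b le by auto
  qed
qed

definition fades :: "nat \<Rightarrow> real \<Rightarrow> bool" where
  "fades k x \<longleftrightarrow> ((\<lambda>t. w k 2 x t) \<longlongrightarrow> 0) at_top \<and> ((\<lambda>t. w k 3 x t) \<longlongrightarrow> 0) at_top \<and> ((\<lambda>t. r k 2 x t) \<longlongrightarrow> 0) at_top"

lemma fades_spread:
  assumes k0: "k0 = 0 \<or> k0 = 2" and x0: "x0 \<in> {lft k0..rgt k0}" and x: "x \<in> {lft k0..rgt k0}"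
    and f0: "fades k0 x0" "fades (Suc k0) x0" and k: "k \<in> {k0, Suc k0}"
  shows "fades k x"
proof -
  interpret W: wave_family "{k0, Suc k0}" "lft k0" "rgt k0" kinks "\<lambda>k. sqrt (stiff k)" CC "1 / sqrt kap" "(1 + sqrt Kap) * M"
    "\<lambda>k. w k 2" "\<lambda>k. w k 3" "\<lambda>k. w k 4" "\<lambda>k. r k 2" "\<lambda>k. r k 3" "\<lambda>k. rx k 2" "\<lambda>k x t. - lo k 2 x t"
    by (rule waves[OF k0])
  have "W.decays x0"
    unfolding W.decays_def
  proof (intro allI impI)
    fix e :: real assume e: "0 < e"
    have "\<forall>\<^sub>F t in at_top. cmod (w m 2 x0 t) \<le> e \<and> cmod (w m 3 x0 t) \<le> e \<and> cmod (sqrt (stiff m) *\<^sub>R r m 2 x0 t) \<le> e"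
      if "m \<in> {k0, Suc k0}" for m
    proof (intro eventually_conj)
      have fm: "fades m x0" using that f0 by auto
      show "\<forall>\<^sub>F t in at_top. cmod (w m 2 x0 t) \<le> e" "\<forall>\<^sub>F t in at_top. cmod (w m 3 x0 t) \<le> e"
        using fm e unfolding fades_def by (auto intro: tendsto_zero_cmodD)
      have "((\<lambda>t. sqrt (stiff m) *\<^sub>R r m 2 x0 t) \<longlongrightarrow> sqrt (stiff m) *\<^sub>R 0) at_top"
        using fm unfolding fades_def by (intro tendsto_intros) auto
      then show "\<forall>\<^sub>F t in at_top. cmod (sqrt (stiff m) *\<^sub>R r m 2 x0 t) \<le> e"
        using e by (intro tendsto_zero_cmodD) auto
    qed
    then have "\<forall>\<^sub>F t in at_top. \<forall>m\<in>{k0, Suc k0}. cmod (w m 2 x0 t) \<le> e \<and> cmod (w m 3 x0 t) \<le> e \<and> cmod (sqrt (stiff m) *\<^sub>R r m 2 x0 t) \<le> e"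
      by (intro eventually_ball_finite) auto
    then show "\<forall>\<^sub>F t in at_top. W.small e x0 t" unfolding W.small_def .
  qed
  then have dx: "W.decays x" by (rule W.decay_spreads[OF x0 _ x]) (use kap(1) in simp)
  have ev: "\<forall>\<^sub>F t in at_top. cmod (w k 2 x t) \<le> e \<and> cmod (w k 3 x t) \<le> e \<and> cmod (sqrt (stiff k) *\<^sub>R r k 2 x t) \<le> e" if e: "0 < e" for e
  proof -
    have "\<forall>\<^sub>F t in at_top. W.small e x t" using dx e unfolding W.decays_def by blast
    then show ?thesis by (rule eventually_mono) (use k in \<open>simp only: W.small_def; blast\<close>)
  qed
  have "((\<lambda>t. w k 2 x t) \<longlongrightarrow> 0) at_top" "((\<lambda>t. w k 3 x t) \<longlongrightarrow> 0) at_top"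
    by (rule tendsto_zero_cmodI, rule eventually_mono[OF ev]; blast)+
  moreover have "((\<lambda>t. sqrt (stiff k) *\<^sub>R r k 2 x t) \<longlongrightarrow> 0) at_top"
    by (rule tendsto_zero_cmodI, rule eventually_mono[OF ev]; blast)
  then have "((\<lambda>t. (1 / sqrt (stiff k)) *\<^sub>R (sqrt (stiff k) *\<^sub>R r k 2 x t)) \<longlongrightarrow> (1 / sqrt (stiff k)) *\<^sub>R 0) at_top"
    by (intro tendsto_scaleR tendsto_const)
  then have "((\<lambda>t. r k 2 x t) \<longlongrightarrow> 0) at_top" using stiff_pos[of k] by simp
  ultimately show ?thesis by (simp add: fades_def)
qed

text \<open>From the middle of \<open>(\<beta>2, \<beta>3)\<close> the decay spreads over \<open>[L0, L]\<close>, then crosses the interface by the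
transmission conditions and spreads over \<open>[0, L0]\<close>.\<close>

lemma all_fade:
  assumes k: "k < 4" and x: "x \<in> {lft k..rgt k}"
  shows "fades k x"
proof -
  define m where "m = (\<beta>2 + \<beta>3) / 2"
  have m: "m \<in> {\<beta>2<..<\<beta>3}" using \<beta> by (auto simp: m_def)
  have mb: "m \<in> {\<beta>2..\<beta>4}" using m \<beta> by auto
  have n: "Suc 1 = 2" "Suc 2 = 3" by simp_all
  have f2: "fades 2 m" unfolding fades_def
    using damped_decay[of 1 m] damped_decay[of 2 m] middle_flux_decay[of 2 m] m mb unfolding n by auto
  have f3: "fades 3 m" unfolding fades_def
    using middle_coupled_decay[of 1 m] middle_coupled_decay[of 2 m] middle_coupled_flux_decay[of m] m unfolding n by auto
  have lrs: "lft 0 = 0" "rgt 0 = L0" "lft 2 = L0" "rgt 2 = L" by (auto simp: lft_def rgt_def)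
  have right: "fades i y" if "i \<in> {2, 3}" "y \<in> {L0..L}" for i y
    using fades_spread[of 2 m y i] f2 f3 that m \<beta> unfolding lrs n by auto
  have L0in: "L0 \<in> {L0..L}" "L0 \<in> {0..L0}" using L0 by auto
  note R2 = right[of 2 L0] and R3 = right[of 3 L0]
  have ev: "\<forall>\<^sub>F t in at_top. (0::real) \<le> t" by (rule eventually_ge_at_top)
  have "fades 0 L0"
    unfolding fades_def
  proof (intro conjI)
    have b: "w 0 j L0 t = w 2 j L0 t" if "0 \<le> t" "j < 8" for j t by (rule boundary(5)[OF that])
    show "((\<lambda>t. w 0 2 L0 t) \<longlongrightarrow> 0) at_top"
      by (rule Lim_transform_eventually[of "w 2 2 L0"]) (use R2 L0in in \<open>auto simp: fades_def intro!: eventually_mono[OF ev] b[symmetric]\<close>)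
    show "((\<lambda>t. w 0 3 L0 t) \<longlongrightarrow> 0) at_top"
      by (rule Lim_transform_eventually[of "w 2 3 L0"]) (use R2 L0in in \<open>auto simp: fades_def intro!: eventually_mono[OF ev] b[symmetric]\<close>)
    have c: "(complex_of_real a2 / complex_of_real a1) * r 2 2 L0 t = r 0 2 L0 t" if "0 \<le> t" for t
      using boundary(7)[OF that, of 2] a by (simp add: field_simps)
    have "((\<lambda>t. (complex_of_real a2 / complex_of_real a1) * r 2 2 L0 t) \<longlongrightarrow> (complex_of_real a2 / complex_of_real a1) * 0) at_top"
      by (rule tendsto_mult_left) (use R2 L0in in \<open>auto simp: fades_def\<close>)
    then have "((\<lambda>t. (complex_of_real a2 / complex_of_real a1) * r 2 2 L0 t) \<longlongrightarrow> 0) at_top" by simp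
    then show "((\<lambda>t. r 0 2 L0 t) \<longlongrightarrow> 0) at_top"
      by (rule Lim_transform_eventually) (rule eventually_mono[OF ev], erule c)
  qed
  moreover have "fades 1 L0"
    unfolding fades_def
  proof (intro conjI)
    have b: "w 3 j L0 t = w 1 j L0 t" "r 3 j L0 t = r 1 j L0 t" if "0 \<le> t" "j < 8" for j t
      using boundary(6,8)[OF that] by simp_all
    have l: "((\<lambda>t. w 3 2 L0 t) \<longlongrightarrow> 0) at_top" "((\<lambda>t. w 3 3 L0 t) \<longlongrightarrow> 0) at_top" "((\<lambda>t. r 3 2 L0 t) \<longlongrightarrow> 0) at_top"
      using R3 L0in by (auto simp: fades_def)
    show "((\<lambda>t. w 1 2 L0 t) \<longlongrightarrow> 0) at_top"
      by (rule Lim_transform_eventually[OF l(1)], rule eventually_mono[OF ev], erule b) simp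
    show "((\<lambda>t. w 1 3 L0 t) \<longlongrightarrow> 0) at_top"
      by (rule Lim_transform_eventually[OF l(2)], rule eventually_mono[OF ev], erule b) simp
    show "((\<lambda>t. r 1 2 L0 t) \<longlongrightarrow> 0) at_top"
      by (rule Lim_transform_eventually[OF l(3)], rule eventually_mono[OF ev], erule b) simp
  qed
  ultimately have left: "fades i y" if "i \<in> {0, 1}" "y \<in> {0..L0}" for i y
    using fades_spread[of 0 L0 y i] that L0in unfolding lrs by auto
  show ?thesis
  proof (cases "k < 2")
    case True then have "k \<in> {0, 1}" by auto
    then show ?thesis using True left[of k x] x by (simp add: lft_def rgt_def)
  next
    case False then have "k \<in> {2, 3}" using k by auto
    then show ?thesis using False right[of k x] x by (simp add: lft_def rgt_def)
  qed
qed

text \<open>Green's formula tested with the displacement itself turns the elastic energy, coupling included, into integrals with an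
acceleration or a velocity as a factor.  These fade, and so does the kinetic energy.\<close>

theorem orbit_decay: "((\<lambda>t. N (S t (f 0))) \<longlongrightarrow> 0) at_top"
proof -
  have w2: "((\<lambda>t. w k 2 x t) \<longlongrightarrow> 0) at_top" if "k < 4" "x \<in> {lft k..rgt k}" for k x
    using all_fade[OF that] by (simp add: fades_def)
  have n: "Suc 0 = 1" "Suc 1 = 2" by simp_all
  have w1: "((\<lambda>t. w k 1 x t) \<longlongrightarrow> 0) at_top" if "k < 4" "x \<in> {lft k..rgt k}" for k x
  proof (rule time_derivative_tendsto_zero[where u="w k 0 x" and w="w k 2 x" and M=M])
    show "(w k 0 x has_vector_derivative w k 1 x t) (at t)" "(w k 1 x has_vector_derivative w k 2 x t) (at t)" if "0 < t" for t
      using pt_functional[OF \<open>k < 4\<close> \<open>x \<in> _\<close> _ that, of 0] pt_functional[OF \<open>k < 4\<close> \<open>x \<in> _\<close> _ that, of 1] unfolding n by auto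
  qed (use that M(2) w2 in auto)
  have ipz: "((\<lambda>t. ip u v (\<lambda>x. w k i x t) (\<lambda>x. w m j x t)) \<longlongrightarrow> 0) at_top"
    if "k < 4" "m < 4" "i = 1 \<or> i = 2" "j < 8" "{u..v} \<subseteq> {lft k..rgt k}" "{u..v} \<subseteq> {lft m..rgt m}" for u v k i m j
  proof (rule ip_tendsto_zero[where B=M])
    show "((\<lambda>t. w k i x t) \<longlongrightarrow> 0) at_top" if "x \<in> {u..v}" for x
      using that w1[of k x] w2[of k x] \<open>i = 1 \<or> i = 2\<close> \<open>k < 4\<close> \<open>{u..v} \<subseteq> {lft k..rgt k}\<close> by blast
    show "cmod (w k i x t) \<le> M" "cmod (w m j x t) \<le> M" if "x \<in> {u..v}" "0 \<le> t" for x t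
    proof -
      have "i < 8" using \<open>i = 1 \<or> i = 2\<close> by auto
      moreover have "x \<in> {lft k..rgt k}" "x \<in> {lft m..rgt m}"
        using \<open>x \<in> _\<close> \<open>{u..v} \<subseteq> {lft k..rgt k}\<close> \<open>{u..v} \<subseteq> {lft m..rgt m}\<close> by blast+
      ultimately show "cmod (w k i x t) \<le> M" "cmod (w m j x t) \<le> M" using M(2) \<open>k < 4\<close> \<open>m < 4\<close> \<open>j < 8\<close> \<open>0 \<le> t\<close> by blast+
    qed
    show "continuous_on {u..v} (\<lambda>x. w k i x t)" if "0 \<le> t" for t
      by (rule continuous_on_subset[OF w_cont[OF \<open>k < 4\<close> _ that] \<open>{u..v} \<subseteq> {lft k..rgt k}\<close>]) (use \<open>i = 1 \<or> i = 2\<close> in auto)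
    show "continuous_on {u..v} (\<lambda>x. w m j x t)" if "0 \<le> t" for t
      by (rule continuous_on_subset[OF w_cont[OF \<open>m < 4\<close> _ that] \<open>{u..v} \<subseteq> {lft m..rgt m}\<close>]) (use \<open>j < 8\<close> in auto)
  qed
  define R where "R = (\<lambda>t. (\<Sum>k<4. Re (ip (lft k) (rgt k) (\<lambda>x. w k 1 x t) (\<lambda>x. w k 1 x t)))
      - (\<Sum>k<4. Re (ip (lft k) (rgt k) (\<lambda>x. w k 2 x t) (\<lambda>x. w k 0 x t)))
      - c2 * Re (ip \<beta>1 \<beta>3 (\<lambda>x. w 3 1 x t) (\<lambda>x. w 2 0 x t))
      + c2 * Re (ip \<beta>1 \<beta>3 (\<lambda>x. w 2 1 x t) (\<lambda>x. w 3 0 x t))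
      - d2 * Re (ip \<beta>2 \<beta>4 (\<lambda>x. w 2 1 x t) (\<lambda>x. w 2 0 x t)))"
  have ER: "E (S t (f 0)) = R t" if t: "0 \<le> t" for t
  proof -
    have g: "(\<Sum>k<4. stiff k * Re (ip (lft k) (rgt k) (\<lambda>x. r k 0 x t) (\<lambda>x. r k 0 x t)))
        = - (\<Sum>k<4. Re (ip (lft k) (rgt k) (\<lambda>x. w k 2 x t) (\<lambda>x. w k 0 x t)))
        - c1 * (Re (ip p q (\<lambda>x. w 1 0 x t) (\<lambda>x. w 0 0 x t)) + Re (ip p q (\<lambda>x. w 0 0 x t) (\<lambda>x. w 1 0 x t)))
        - c2 * Re (ip \<beta>1 \<beta>3 (\<lambda>x. w 3 1 x t) (\<lambda>x. w 2 0 x t))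
        + c2 * Re (ip \<beta>1 \<beta>3 (\<lambda>x. w 2 1 x t) (\<lambda>x. w 3 0 x t))
        - d2 * Re (ip \<beta>2 \<beta>4 (\<lambda>x. w 2 1 x t) (\<lambda>x. w 2 0 x t))"
    proof -
      have "(\<Sum>k<4. stiff k * Re (ip (lft k) (rgt k) (\<lambda>x. r k 0 x t) (\<lambda>x. r k 0 x t)))
          = Re (\<Sum>k<4. complex_of_real (stiff k) * ip (lft k) (rgt k) (\<lambda>x. r k 0 x t) (\<lambda>x. r k 0 x t))" by simp
      also note green[of 0 0 t, unfolded n, OF _ _ t, simplified]
      finally show ?thesis by simp
    qed
    have c: "Re (ip p q (\<lambda>x. w 1 0 x t) (\<lambda>x. w 0 0 x t)) = Re (ip p q (\<lambda>x. w 0 0 x t) (\<lambda>x. w 1 0 x t))" by (rule Re_ip_commute)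
    show ?thesis
      unfolding orbit_energy[of 0 t, unfolded n, OF _ t, simplified] sum.distrib g c R_def by simp
  qed
  have "(R \<longlongrightarrow> (\<Sum>k<4::nat. 0) - (\<Sum>k<4::nat. 0) - c2 * 0 + c2 * 0 - d2 * 0) at_top"
  proof -
    have Re0: "((\<lambda>t. Re (ip u v (\<lambda>x. w k i x t) (\<lambda>x. w m j x t))) \<longlongrightarrow> 0) at_top"
      if "k < 4" "m < 4" "i = 1 \<or> i = 2" "j < 8" "{u..v} \<subseteq> {lft k..rgt k}" "{u..v} \<subseteq> {lft m..rgt m}" for u v k i m j
      using tendsto_Re[OF ipz[OF that]] by simp
    show ?thesis unfolding R_def
      by (intro tendsto_add tendsto_diff tendsto_sum tendsto_mult tendsto_const Re0 inner_intervals) auto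
  qed
  then have "(R \<longlongrightarrow> 0) at_top" by simp
  then have "((\<lambda>t. (N (S t (f 0)))\<^sup>2) \<longlongrightarrow> 0) at_top"
  proof (rule Lim_transform_eventually)
    show "\<forall>\<^sub>F t in at_top. R t = (N (S t (f 0)))\<^sup>2"
      using eventually_ge_at_top[of 0]
    proof (rule eventually_mono)
      fix t :: real assume t: "0 \<le> t"
      show "R t = (N (S t (f 0)))\<^sup>2" unfolding N_sq[OF orbit_H[OF t le0]] ER[OF t] ..
    qed
  qed
  from tendsto_real_sqrt[OF this] have l: "((\<lambda>t. \<bar>N (S t (f 0))\<bar>) \<longlongrightarrow> 0) at_top" by (simp only: real_sqrt_abs real_sqrt_zero)
  show ?thesis using l by (simp only: tendsto_rabs_zero_iff)
qed

end

context damped_transmission begin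

text \<open>Contractivity transfers the decay from the dense set of smooth initial states to all states.\<close>

theorem strongly_stable:
  assumes U: "U \<in> H"
  shows "((\<lambda>t. N (S t U)) \<longlongrightarrow> 0) at_top"
proof (rule tendstoI)
  fix e :: real assume e: "0 < e"
  then have "0 < e / 2" by simp
  then obtain f where f: "gen.chain 8 f" "N (f 0 - U) < e / 2" using gen.chain_dense[OF U, of "e / 2" 8] by blast
  interpret orbit L0 L a1 a2 c1 p q \<beta>1 \<beta>2 \<beta>3 \<beta>4 c2 d2 S f by unfold_locales (rule f(1))
  have f0: "f 0 \<in> H" by (rule f_chain(3)) simp
  have "\<forall>\<^sub>F t in at_top. dist (N (S t (f 0))) 0 < e / 2" by (rule tendstoD[OF orbit_decay \<open>0 < e / 2\<close>])
  then show "\<forall>\<^sub>F t in at_top. dist (N (S t U)) 0 < e"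
    using eventually_ge_at_top[of 0]
  proof eventually_elim
    case (elim t)
    have X: "S t U \<in> H" "S t (f 0) \<in> H" using U f0 elim by auto
    have "N (S t U) \<le> N (S t (f 0)) + N (S t U - S t (f 0))" by (rule gen.N_le_add_diff[OF X])
    also have "N (S t U - S t (f 0)) \<le> N (U - f 0)" using elim by (intro gen.S_diff_le U f0) auto
    also have "N (U - f 0) = N (f 0 - U)" by (rule gen.N_commute[OF U f0])
    finally have "N (S t U) < e" using elim(1) f(2) gen.N_ge_0[OF X(2)] by (simp add: dist_real_def)
    then show ?case using gen.N_ge_0[OF X(1)] by (simp add: dist_real_def)
  qed
qed

end

theorem theorem3p1:
  fixes \<alpha>1 \<alpha>2 \<alpha>3 \<alpha>4 \<beta>1 \<beta>2 \<beta>3 \<beta>4 L0 L a1 a2 c1 c2 d2 C0 :: real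
    and S :: "real \<Rightarrow> state \<Rightarrow> state"
  defines "c1f \<equiv> coef c1 \<alpha>1 \<alpha>3"
    and "c2f \<equiv> coef c2 \<beta>1 \<beta>3"
    and "d2f \<equiv> coef d2 \<beta>2 \<beta>4"
  assumes "0 < \<alpha>1" "\<alpha>1 < \<alpha>2" "\<alpha>2 < \<alpha>3" "\<alpha>3 < \<alpha>4" "\<alpha>4 < L0"
    and "L0 < \<beta>1" "\<beta>1 < \<beta>2" "\<beta>2 < \<beta>3" "\<beta>3 < \<beta>4" "\<beta>4 < L"
    and "0 < a1" "0 < a2" "0 < d2" "c1 \<noteq> 0" "c2 \<noteq> 0"
    and "is_poincare_constant L0 C0" "\<bar>c1\<bar> < 1 / C0"
    and "norm_on state_scale (energy_space L0 L) (null_states L0 L) (energy_norm a1 a2 c1f L0 L)"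
    and "C0_contraction_semigroup state_scale (energy_space L0 L) (energy_norm a1 a2 c1f L0 L) S"
    and "is_generator state_scale (energy_space L0 L) (energy_norm a1 a2 c1f L0 L) S
           (wave_dom a1 a2 L0 L) (wave_op a1 a2 c1f c2f d2f L0 L)"
  shows "\<forall>U0 \<in> energy_space L0 L. ((\<lambda>t. energy_norm a1 a2 c1f L0 L (S t U0)) \<longlongrightarrow> 0) at_top"
proof -
  interpret damped_transmission L0 L a1 a2 c1 \<alpha>1 \<alpha>3 \<beta>1 \<beta>2 \<beta>3 \<beta>4 c2 d2 S
    using assms(4-) unfolding c1f_def c2f_def d2f_def by unfold_locales auto
  show ?thesis unfolding c1f_def using strongly_stable by blast
qed

end
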